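(* Let $H$ be a cocommutative Hopf algebra and $V$ a cocommutative left $H$-module coalgebra with a (surjective) right $H$-module map $\omega:H^+\to V$. Then the super-Hopf algebra $\Omega(\widetilde H)=(S(V^* )\rtimes H)\ltimes\Lambda(V^*\oplus V)$ over $\widetilde H=S(V^* )\rtimes H$ is a (standard) strongly bicovariant differential graded algebra with super-derivation $d$ given by $$dh=h_{(1)}\otimes\omega\circ\pi(h_{(2)}),\qquad d\phi=1\otimes\phi,$$ $$d(\phi_1\cdots\phi_nh)=\sum_{p=0}^{n-1}\sum_{\sigma\in Sh(p,n-p)}(-1)^{n-p-1}\phi_{\sigma(1)}\cdots\phi_{\sigma(p)}h_{(1)}\otimes S(h_{(2)})\triangleright(\phi_{\sigma(p+1)}*\cdots*\phi_{\sigma(n)})+\phi_1\cdots\phi_nh_{(1)}\otimes\omega\circ\pi(h_{(2)}),$$ $$d(\phi_1\cdots\phi_nh\otimes f_1\wedge\cdots\wedge f_r\wedge e_1\wedge\cdots\wedge e_s)=\phi_1\cdots\phi_nh_{(1)}\otimes\omega\circ\pi(h_{(2)})\wedge f_1\wedge\cdots\wedge f_r\wedge e_1\wedge\cdots\wedge e_s$$ $$\qquad+\sum_{p=0}^{n-1}\sum_{\sigma\in Sh(p,n-p)}(-1)^{n-p-1}\phi_{\sigma(1)}\cdots\phi_{\sigma(p)}h_{(1)}\otimes S(h_{(2)})\triangleright(\phi_{\sigma(p+1)}*\cdots*\phi_{\sigma(n)})\wedge f_1\wedge\cdots\wedge f_r\wedge e_1\wedge\cdots\wedge e_s$$ for $\phi,\phi_i\in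 V^*$, $h\in H$, $f_i\in V^*$, $e_j\in V$. Here one has $$[\phi_1\cdots\phi_n,d(\psi_1\cdots\psi_m)]=\sum_{p=0}^{m-1}\sum_{q=0}^{n-1}\sum_{\substack{\sigma\in Sh(p,m-p)\\ \tau\in Sh(q,n-q)}}(-1)^{p+q}\psi_{\sigma(1)}\cdots\psi_{\sigma(p)}\phi_{\tau(1)}\cdots\phi_{\tau(q)}\otimes\phi_{\tau(q+1)}*\cdots*\phi_{\tau(n)}*\psi_{\sigma(p+1)}*\cdots*\psi_{\sigma(m)}$$ for any $\phi_i,\psi_j\in V^*$. In particular $[\phi,d\psi]=1\otimes\phi*\psi$.
   Context: $H$ has coproduct $\Delta h=h_{(1)}\otimes h_{(2)}$, counit $\epsilon$, antipode $S$; $H^+=\ker\epsilon$ and $\pi=\mathrm{id}-\epsilon$ (i.e. $\pi(h)=h-\epsilon(h)1$). $V$ is a cocommutative coalgebra and a left $H$-module with coproduct and counit being module maps; it is a right $H$-module by $v\triangleleft h=S(h)\triangleright v$. $V^*$ is a commutative algebra (product $*$ dual to the coproduct of $V$) and a left $H$-module algebra by $\langle h\triangleright\phi,v\rangle=\langle\phi,S(h)\triangleright v\rangle$. $S(V^* )$ is the symmetric algebra (product written by juxtaposition) with $V^*$ primitive, and $\widetilde H=S(V^* )\rtimes H$ is the cocommutative Hopf algebra with the tensor product coalgebra structure and cross relations $h\phi=(h_{(1)}\triangleright\phi)h_{(2)}$. $V^*\oplus V$ is a right $\widetilde H$-module via $(\psi+v)\triangleleft h=S(h)\triangleright\psi+S(h)\triangleright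 v$, $(\psi+v)\triangleleft\phi=-\phi*\psi$ ($\phi,\psi\in V^*$, $v\in V$, $h\in H$), with trivial right coaction. $\Lambda(V^*\oplus V)$ is the exterior algebra, a super-Hopf algebra with $V^*\oplus V$ primitive. $\Omega(\widetilde H)=\widetilde H\ltimes\Lambda(V^*\oplus V)$ is $\widetilde H\otimes\Lambda(V^*\oplus V)$ with the tensor product (super-)coalgebra structure and product determined by those of $\widetilde H$ and $\Lambda$ together with $\eta.a=a_{(1)}\otimes\eta\triangleleft a_{(2)}$ for $\eta\in V^*\oplus V$, $a\in\widetilde H$. $Sh(p,n-p)$ is the set of $(p,n-p)$-shuffles. $[a,\xi]=a\xi-\xi a$ denotes the commutator in $\Omega(\widetilde H)$ of $a\in\widetilde H$ and a 1-form $\xi$. A strongly bicovariant differential graded algebra over a Hopf algebra $A$ is an $\mathbb N_0$-graded super-Hopf algebra $\Omega=\oplus_{i\ge0}\Omega^i$ with $\Omega^0=A$ and a degree 1 map $d:\Omega\to\Omega$ with $d^2=0$ which is a super-derivation, $d(\xi\eta)=(d\xi)\eta+(-1)^{|\xi|}\xi\,d\eta$, and a super-coderivation, $\Delta(d\xi)=d\xi^{(1)}\otimes\xi^{(2)}+(-1)^{|\xi^{(1)}|}\xi^{(1)}\otimes d\xi^{(2)}$ where $\Delta\xi=\xi^{(1)}\otimes\xi^{(2)}$. It is standard if $\Omega$ is generated by $A$ and $dA$. The parentheses in the statement mean: for a right $H$-module map $\omega$ the result is a strongly bicovariant differential graded algebra, and it is standard when $\omega$ is surjective.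
   Formalization: The sign (-1)^{p+q} in the formula for [φ_1⋯φ_n, d(ψ_1⋯ψ_m)] is corrected to (-1)^{m+n+p+q}; the printed sign contradicts the stated formula for d when m+n is odd, e.g. H=V=k, x*x=x gives [x,d(x^2)]=(2x-1)dx, not (1-2x)dx. *)

theory Defs
  imports
    "HOL-Combinatorics.Combinatorics"
    "HOL-Library.Function_Algebras"
    "HOL-Library.Product_Plus"
begin

section \<open>Vector spaces with carriers\<close>

text \<open>A space is a linear subspace \<open>car A\<close> of an ambient type with scalar multiplication
  \<open>smul A\<close>; structure maps are only constrained on the carrier.\<close>

record ('k, 'a) kspace =
  car :: "'a set"
  smul :: "'k \<Rightarrow> 'a \<Rightarrow> 'a"

definition kspace :: "('k::field, 'a::ab_group_add, 'z) kspace_scheme \<Rightarrow> bool" where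
  "kspace A \<longleftrightarrow> vector_space (smul A) \<and> module.subspace (smul A) (car A)"

definition klinear ::
  "('k::field, 'a::ab_group_add, 'y) kspace_scheme \<Rightarrow> ('k, 'b::ab_group_add, 'z) kspace_scheme
     \<Rightarrow> ('a \<Rightarrow> 'b) \<Rightarrow> bool" where
  "klinear A B f \<longleftrightarrow>
     (\<forall>x\<in>car A. f x \<in> car B) \<and>
     (\<forall>x\<in>car A. \<forall>y\<in>car A. f (x + y) = f x + f y) \<and>
     (\<forall>c. \<forall>x\<in>car A. f (smul A c x) = smul B c (f x))"

definition kbilinear ::
  "('k::field, 'a::ab_group_add, 'x) kspace_scheme \<Rightarrow> ('k, 'b::ab_group_add, 'y) kspace_scheme
     \<Rightarrow> ('k, 'c::ab_group_add, 'z) kspace_scheme \<Rightarrow> ('a \<Rightarrow> 'b \<Rightarrow> 'c) \<Rightarrow> bool" where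
  "kbilinear A B C f \<longleftrightarrow>
     (\<forall>a\<in>car A. klinear B C (f a)) \<and> (\<forall>b\<in>car B. klinear A C (\<lambda>a. f a b))"

definition ground :: "('k::field, 'k) kspace" where
  "ground = \<lparr>car = UNIV, smul = (*)\<rparr>"

definition dsum ::
  "('k::field, 'a, 'y) kspace_scheme \<Rightarrow> ('k, 'b, 'z) kspace_scheme \<Rightarrow> ('k, 'a \<times> 'b) kspace" where
  "dsum A B = \<lparr>car = car A \<times> car B, smul = (\<lambda>c (a, b). (smul A c a, smul B c b))\<rparr>"


section \<open>Spaces given by generators and linear relations\<close>

text \<open>Let \<open>X\<close> be a set of generators and let \<open>R\<close> be the space of those functions
  \<open>F :: 'x \<Rightarrow> 'k\<close> that satisfy a prescribed set of linear relations. The free vector space on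
  \<open>X\<close> modulo the relations is realised as the span of the evaluation functionals
  \<open>F \<mapsto> F x\<close> (\<open>x \<in> X\<close>) in the dual of \<open>R\<close>. Over a field nothing is lost, because the
  linear functionals vanishing on the relations separate the points of the quotient; the
  universal property is \<open>gen_universal\<close> below.\<close>

type_synonym ('x, 'k) functional = "('x \<Rightarrow> 'k) \<Rightarrow> 'k"

definition pscale :: "'k::field \<Rightarrow> ('x \<Rightarrow> 'k) \<Rightarrow> ('x \<Rightarrow> 'k)" where
  "pscale c f = (\<lambda>x. c * f x)"

definition gen :: "('x \<Rightarrow> 'k::field) set \<Rightarrow> 'x \<Rightarrow> ('x, 'k) functional" where
  "gen R x = (\<lambda>F. if F \<in> R then F x else 0)"

definition gen_space :: "('x \<Rightarrow> 'k::field) set \<Rightarrow> 'x set \<Rightarrow> ('k, ('x, 'k) functional) kspace" where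
  "gen_space R X = \<lparr>car = module.span pscale (gen R ` X), smul = pscale\<rparr>"

text \<open>The linear map into \<open>C\<close> with prescribed values on generators.\<close>

definition lin_ext ::
  "('x \<Rightarrow> 'k::field) set \<Rightarrow> 'x set \<Rightarrow> ('k, 'c::ab_group_add, 'z) kspace_scheme \<Rightarrow> ('x \<Rightarrow> 'c)
     \<Rightarrow> ('x, 'k) functional \<Rightarrow> 'c" where
  "lin_ext R X C f =
     (SOME g. klinear (gen_space R X) C g \<and> (\<forall>x\<in>X. g (gen R x) = f x))"

lemma vector_space_pscale: "vector_space (pscale :: 'k::field \<Rightarrow> ('x \<Rightarrow> 'k) \<Rightarrow> ('x \<Rightarrow> 'k))"
  by standard (auto simp: pscale_def fun_eq_iff algebra_simps)

lemmas module_pscale = vector_space_pscale[folded module_iff_vector_space]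

lemma vector_space_mult: "vector_space ((*) :: 'k::field \<Rightarrow> 'k \<Rightarrow> 'k)"
  by standard (auto simp: algebra_simps)

lemma kspace_gen_space: "kspace (gen_space R X)"
  unfolding kspace_def gen_space_def
  by (simp add: vector_space_pscale module.subspace_span[OF module_pscale])

lemma functionals_separate:
  assumes s: "vector_space (s :: 'k::field \<Rightarrow> 'c::ab_group_add \<Rightarrow> 'c)"
    and eq: "\<And>l. Vector_Spaces.linear s (*) l \<Longrightarrow> l x = l y"
  shows "x = y"
proof (rule ccontr)
  interpret V: vector_space s by (rule s)
  interpret P: vector_space_pair s "(*) :: 'k \<Rightarrow> 'k \<Rightarrow> 'k"
    using s vector_space_mult by (simp add: vector_space_pair_def)
  assume "x \<noteq> y"
  then have ind: "V.independent {x - y}" by simp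
  let ?l = "P.construct {x - y} (\<lambda>_. 1 :: 'k)"
  have l: "Vector_Spaces.linear s (*) ?l" by (rule P.linear_construct[OF ind])
  have "?l (x - y) = 1" by (rule P.construct_basis[OF ind]) simp
  moreover have "?l (x - y) = ?l x - ?l y" by (rule P.linear_diff[OF l])
  ultimately show False using eq[OF l] by simp
qed

theorem gen_universal:
  fixes R :: "('x \<Rightarrow> 'k::field) set" and C :: "('k, 'c::ab_group_add, 'z) kspace_scheme"
  assumes C: "kspace C" and f: "\<And>x. x \<in> X \<Longrightarrow> f x \<in> car C"
    and rel: "\<And>l. klinear C ground l \<Longrightarrow> (\<lambda>x. l (f x)) \<in> R"
  shows "\<exists>g. klinear (gen_space R X) C g \<and> (\<forall>x\<in>X. g (gen R x) = f x)"
proof -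
  interpret U: vector_space "pscale :: 'k \<Rightarrow> ('x, 'k) functional \<Rightarrow> ('x, 'k) functional"
    by (rule vector_space_pscale)
  interpret V: vector_space "smul C" using C by (simp add: kspace_def)
  interpret P: vector_space_pair "pscale :: 'k \<Rightarrow> ('x, 'k) functional \<Rightarrow> _" "smul C" ..
  have subC: "V.subspace (car C)" using C by (simp add: kspace_def)
  obtain I where I: "I \<subseteq> gen R ` X" "U.independent I" "gen R ` X \<subseteq> U.span I"
    by (rule U.maximal_independent_subset)
  have "\<forall>u\<in>I. \<exists>x. x \<in> X \<and> gen R x = u" using I(1) by blast
  then obtain pick where pick: "pick u \<in> X \<and> gen R (pick u) = u" if "u \<in> I" for u
    by (metis (no_types))
  define g where "g = P.construct I (\<lambda>u. f (pick u))"
  have lin: "Vector_Spaces.linear pscale (smul C) g"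
    unfolding g_def by (rule P.linear_construct[OF I(2)])
  interpret g: Vector_Spaces.linear pscale "smul C" g by (rule lin)
  have gI: "g u = f (pick u)" if "u \<in> I" for u
    unfolding g_def by (rule P.construct_basis[OF I(2) that])
  have gX: "g (gen R x) = f x" if x: "x \<in> X" for x
  proof (rule functionals_separate)
    show "vector_space (smul C)" ..
    fix l assume l: "Vector_Spaces.linear (smul C) ((*) :: 'k \<Rightarrow> 'k \<Rightarrow> 'k) l"
    interpret l: Vector_Spaces.linear "smul C" "(*) :: 'k \<Rightarrow> 'k \<Rightarrow> 'k" l by (rule l)
    have R: "(\<lambda>x. l (f x)) \<in> R"
      by (rule rel) (simp add: klinear_def ground_def l.add l.scale)
    have "l (g u) = u (\<lambda>x. l (f x))" if "u \<in> U.span I" for u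
      using that
    proof (induction rule: U.span_induct_alt)
      case base
      have "l (g 0) = 0" by (simp only: g.zero l.zero)
      then show ?case by (simp add: zero_fun_def)
    next
      case (step c u v)
      have "u (\<lambda>x. l (f x)) = l (f (pick u))"
        using pick[OF step(1)] R by (metis gen_def)
      moreover have "l (g (pscale c u + v)) = c * l (g u) + l (g v)"
        by (simp only: g.add g.scale l.add l.scale)
      ultimately show ?case
        using step gI[OF step(1)] by (simp add: pscale_def plus_fun_def)
    qed
    then have "l (g (gen R x)) = gen R x (\<lambda>x. l (f x))" using I(3) x by auto
    then show "l (g (gen R x)) = l (f x)" using R by (simp add: gen_def)
  qed
  have "g u \<in> car C" if "u \<in> U.span (gen R ` X)" for u
    using that
  proof (induction rule: U.span_induct_alt)
    case base
    show ?case unfolding g.zero by (rule V.subspace_0[OF subC])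
  next
    case (step c u v)
    then have "g u \<in> car C" using gX f by auto
    then show ?case
      unfolding g.add g.scale using step subC by (blast intro: V.subspace_add V.subspace_scale)
  qed
  then show ?thesis
    using gX g.add g.scale unfolding klinear_def gen_space_def by (intro exI[of _ g]) simp
qed

lemma gen_unique:
  fixes R :: "('x \<Rightarrow> 'k::field) set" and C :: "('k, 'c::ab_group_add, 'z) kspace_scheme"
  assumes C: "kspace C" and g: "klinear (gen_space R X) C g" and h: "klinear (gen_space R X) C h"
    and eq: "\<And>x. x \<in> X \<Longrightarrow> g (gen R x) = h (gen R x)"
    and u: "u \<in> car (gen_space R X)"
  shows "g u = h u"
proof -
  interpret U: vector_space "pscale :: 'k \<Rightarrow> ('x, 'k) functional \<Rightarrow> ('x, 'k) functional"
    by (rule vector_space_pscale)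
  interpret V: vector_space "smul C" using C by (simp add: kspace_def)
  have zero: "k 0 = 0" if "klinear (gen_space R X) C k" for k
  proof -
    have "k (pscale 0 0) = smul C 0 (k 0)"
      using that U.span_zero unfolding klinear_def gen_space_def by fastforce
    then show ?thesis by simp
  qed
  have "u \<in> U.span (gen R ` X)" using u by (simp add: gen_space_def)
  then have "u \<in> U.span (gen R ` X) \<and> g u = h u"
  proof (induction rule: U.span_induct_alt)
    case base
    show ?case using zero[OF g] zero[OF h] U.span_zero by metis
  next
    case (step c a b)
    have a: "a \<in> U.span (gen R ` X)" by (rule U.span_base) (rule step)
    then have ca: "pscale c a \<in> U.span (gen R ` X)" by (rule U.span_scale)
    have b: "b \<in> U.span (gen R ` X)" and gb: "g b = h b" using step by auto
    have k: "k (pscale c a + b) = smul C c (k a) + k b" if "klinear (gen_space R X) C k" for k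
      using that a b ca unfolding klinear_def gen_space_def by simp
    have "g a = h a" using step(1) eq by auto
    then have "g (pscale c a + b) = h (pscale c a + b)" by (simp only: k[OF g] k[OF h] gb)
    then show ?case using U.span_add[OF ca b] by blast
  qed
  then show ?thesis ..
qed

lemma lin_ext:
  assumes "kspace C" and "\<And>x. x \<in> X \<Longrightarrow> f x \<in> car C"
    and "\<And>l. klinear C ground l \<Longrightarrow> (\<lambda>x. l (f x)) \<in> R"
  shows klinear_lin_ext: "klinear (gen_space R X) C (lin_ext R X C f)"
    and lin_ext_gen: "x \<in> X \<Longrightarrow> lin_ext R X C f (gen R x) = f x"
  using someI_ex[OF gen_universal[where f = f, OF assms]] unfolding lin_ext_def by auto


section \<open>Tensor products\<close>

type_synonym ('a, 'b, 'k) tensor = "('a \<times> 'b, 'k) functional"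

definition bilinear_forms ::
  "('k::field, 'a::ab_group_add, 'y) kspace_scheme \<Rightarrow> ('k, 'b::ab_group_add, 'z) kspace_scheme
     \<Rightarrow> ('a \<times> 'b \<Rightarrow> 'k) set" where
  "bilinear_forms A B = {F. kbilinear A B ground (\<lambda>a b. F (a, b))}"

definition tensor ::
  "('k::field, 'a::ab_group_add, 'y) kspace_scheme \<Rightarrow> ('k, 'b::ab_group_add, 'z) kspace_scheme
     \<Rightarrow> ('k, ('a, 'b, 'k) tensor) kspace" where
  "tensor A B = gen_space (bilinear_forms A B) (car A \<times> car B)"

definition tens ::
  "('k::field, 'a::ab_group_add, 'y) kspace_scheme \<Rightarrow> ('k, 'b::ab_group_add, 'z) kspace_scheme
     \<Rightarrow> 'a \<Rightarrow> 'b \<Rightarrow> ('a, 'b, 'k) tensor" where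
  "tens A B a b = gen (bilinear_forms A B) (a, b)"

text \<open>The linear map \<open>A \<otimes> B \<rightarrow> C\<close> induced by a bilinear map \<open>f\<close>. Applied to \<open>f\<close> and a
  coproduct it is a Sweedler sum: \<open>tlift A A C f (cop A a)\<close> is the sum of \<open>f a\<^sub>(\<^sub>1\<^sub>) a\<^sub>(\<^sub>2\<^sub>)\<close>.\<close>

definition tlift ::
  "('k::field, 'a::ab_group_add, 'x) kspace_scheme \<Rightarrow> ('k, 'b::ab_group_add, 'y) kspace_scheme
     \<Rightarrow> ('k, 'c::ab_group_add, 'z) kspace_scheme \<Rightarrow> ('a \<Rightarrow> 'b \<Rightarrow> 'c) \<Rightarrow> ('a, 'b, 'k) tensor \<Rightarrow> 'c" where
  "tlift A B C f = lin_ext (bilinear_forms A B) (car A \<times> car B) C (\<lambda>(a, b). f a b)"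

lemma tlift:
  assumes C: "kspace C" and f: "kbilinear A B C f"
  shows klinear_tlift: "klinear (tensor A B) C (tlift A B C f)"
    and tlift_tens: "a \<in> car A \<Longrightarrow> b \<in> car B \<Longrightarrow> tlift A B C f (tens A B a b) = f a b"
proof -
  have 1: "(\<lambda>(a, b). f a b) x \<in> car C" if "x \<in> car A \<times> car B" for x
    using f that by (auto simp: kbilinear_def klinear_def)
  have 2: "(\<lambda>x. l ((\<lambda>(a, b). f a b) x)) \<in> bilinear_forms A B" if "klinear C ground l" for l
    using f that by (auto simp: bilinear_forms_def kbilinear_def klinear_def)
  show "klinear (tensor A B) C (tlift A B C f)"
    unfolding tensor_def tlift_def by (rule klinear_lin_ext[where f = "\<lambda>(a, b). f a b", OF C 1 2])
  show "tlift A B C f (tens A B a b) = f a b" if "a \<in> car A" "b \<in> car B"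
    unfolding tens_def tlift_def using that by (subst lin_ext_gen[where f = "\<lambda>(a, b). f a b", OF C 1 2]) auto
qed

definition tmap ::
  "('k::field, 'a::ab_group_add, 'w) kspace_scheme \<Rightarrow> ('k, 'b::ab_group_add, 'x) kspace_scheme
     \<Rightarrow> ('k, 'c::ab_group_add, 'y) kspace_scheme \<Rightarrow> ('k, 'd::ab_group_add, 'z) kspace_scheme
     \<Rightarrow> ('a \<Rightarrow> 'c) \<Rightarrow> ('b \<Rightarrow> 'd) \<Rightarrow> ('a, 'b, 'k) tensor \<Rightarrow> ('c, 'd, 'k) tensor" where
  "tmap A B C D f g = tlift A B (tensor C D) (\<lambda>a b. tens C D (f a) (g b))"

definition tflip ::
  "('k::field, 'a::ab_group_add, 'y) kspace_scheme \<Rightarrow> ('k, 'b::ab_group_add, 'z) kspace_scheme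
     \<Rightarrow> ('a, 'b, 'k) tensor \<Rightarrow> ('b, 'a, 'k) tensor" where
  "tflip A B = tlift A B (tensor B A) (\<lambda>a b. tens B A b a)"

definition tassoc ::
  "('k::field, 'a::ab_group_add, 'x) kspace_scheme \<Rightarrow> ('k, 'b::ab_group_add, 'y) kspace_scheme
     \<Rightarrow> ('k, 'c::ab_group_add, 'z) kspace_scheme
     \<Rightarrow> (('a, 'b, 'k) tensor, 'c, 'k) tensor \<Rightarrow> ('a, ('b, 'c, 'k) tensor, 'k) tensor" where
  "tassoc A B C = tlift (tensor A B) C (tensor A (tensor B C))
     (\<lambda>t c. tlift A B (tensor A (tensor B C)) (\<lambda>a b. tens A (tensor B C) a (tens B C b c)) t)"


section \<open>Coalgebras and Hopf algebras\<close>

record ('k, 'a) kcoalg = "('k, 'a) kspace" +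
  cop :: "'a \<Rightarrow> ('a, 'a, 'k) tensor"
  cou :: "'a \<Rightarrow> 'k"

record ('k, 'a) kbialg = "('k, 'a) kcoalg" +
  mul :: "'a \<Rightarrow> 'a \<Rightarrow> 'a"
  unit :: "'a"

record ('k, 'a) kgbialg = "('k, 'a) kbialg" +
  gr :: "nat \<Rightarrow> 'a set"

definition coalgebra :: "('k::field, 'a::ab_group_add, 'z) kcoalg_scheme \<Rightarrow> bool" where
  "coalgebra C \<longleftrightarrow>
     kspace C \<and> klinear C (tensor C C) (cop C) \<and> klinear C ground (cou C) \<and>
     (\<forall>c\<in>car C.
        tassoc C C C (tmap C C (tensor C C) C (cop C) id (cop C c))
          = tmap C C C (tensor C C) id (cop C) (cop C c) \<and>
        tlift C C C (\<lambda>a b. smul C (cou C a) b) (cop C c) = c \<and>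
        tlift C C C (\<lambda>a b. smul C (cou C b) a) (cop C c) = c)"

definition cocommutative :: "('k::field, 'a::ab_group_add, 'z) kcoalg_scheme \<Rightarrow> bool" where
  "cocommutative C \<longleftrightarrow> (\<forall>c\<in>car C. tflip C C (cop C c) = cop C c)"

definition assoc_algebra :: "('k::field, 'a::ab_group_add, 'z) kbialg_scheme \<Rightarrow> bool" where
  "assoc_algebra A \<longleftrightarrow>
     kspace A \<and> kbilinear A A A (mul A) \<and> unit A \<in> car A \<and>
     (\<forall>a\<in>car A. \<forall>b\<in>car A. \<forall>c\<in>car A. mul A (mul A a b) c = mul A a (mul A b c)) \<and>
     (\<forall>a\<in>car A. mul A (unit A) a = a \<and> mul A a (unit A) = a)"

text \<open>The product of \<open>A \<otimes> A\<close>; the multiplication \<open>m\<close> of \<open>A\<close> is a separate argument so that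
  coproducts can be defined as algebra maps before the record \<open>A\<close> is complete.\<close>

definition tens_mul ::
  "('k::field, 'a::ab_group_add, 'z) kspace_scheme \<Rightarrow> ('a \<Rightarrow> 'a \<Rightarrow> 'a)
     \<Rightarrow> ('a, 'a, 'k) tensor \<Rightarrow> ('a, 'a, 'k) tensor \<Rightarrow> ('a, 'a, 'k) tensor" where
  "tens_mul A m u v =
     tlift A A (tensor A A) (\<lambda>a b.
       tlift A A (tensor A A) (\<lambda>a' b'. tens A A (m a a') (m b b')) v) u"

definition bialgebra :: "('k::field, 'a::ab_group_add, 'z) kbialg_scheme \<Rightarrow> bool" where
  "bialgebra A \<longleftrightarrow>
     assoc_algebra A \<and> coalgebra A \<and>
     (\<forall>a\<in>car A. \<forall>b\<in>car A.
        cop A (mul A a b) = tens_mul A (mul A) (cop A a) (cop A b) \<and>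
        cou A (mul A a b) = cou A a * cou A b) \<and>
     cop A (unit A) = tens A A (unit A) (unit A) \<and> cou A (unit A) = 1"

definition is_antipode :: "('k::field, 'a::ab_group_add, 'z) kbialg_scheme \<Rightarrow> ('a \<Rightarrow> 'a) \<Rightarrow> bool" where
  "is_antipode A S \<longleftrightarrow>
     klinear A A S \<and>
     (\<forall>a\<in>car A.
        tlift A A A (\<lambda>b c. mul A (S b) c) (cop A a) = smul A (cou A a) (unit A) \<and>
        tlift A A A (\<lambda>b c. mul A b (S c)) (cop A a) = smul A (cou A a) (unit A))"

definition hopf_algebra :: "('k::field, 'a::ab_group_add, 'z) kbialg_scheme \<Rightarrow> bool" where
  "hopf_algebra A \<longleftrightarrow> bialgebra A \<and> (\<exists>S. is_antipode A S)"

text \<open>Antipodes are unique on the carrier.\<close>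

definition antipode :: "('k::field, 'a::ab_group_add, 'z) kbialg_scheme \<Rightarrow> 'a \<Rightarrow> 'a" where
  "antipode A = (SOME S. is_antipode A S)"

definition aug_ideal :: "('k::field, 'a::ab_group_add, 'z) kbialg_scheme \<Rightarrow> ('k, 'a) kspace" where
  "aug_ideal A = \<lparr>car = {a \<in> car A. cou A a = 0}, smul = smul A\<rparr>"

definition aug_proj :: "('k::field, 'a::ab_group_add, 'z) kbialg_scheme \<Rightarrow> 'a \<Rightarrow> 'a" where
  "aug_proj A a = a - smul A (cou A a) (unit A)"

text \<open>Tensor product coalgebra. No sign occurs in the super setting either as long as \<open>A\<close> is
  concentrated in even degree.\<close>

definition tens_cop ::
  "('k::field, 'a::ab_group_add, 'y) kcoalg_scheme \<Rightarrow> ('k, 'b::ab_group_add, 'z) kcoalg_scheme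
     \<Rightarrow> ('a, 'b, 'k) tensor \<Rightarrow> (('a, 'b, 'k) tensor, ('a, 'b, 'k) tensor, 'k) tensor" where
  "tens_cop A B =
     (let T = tensor A B; TT = tensor T T in
      tlift A B TT (\<lambda>a b.
        tlift A A TT (\<lambda>a1 a2.
          tlift B B TT (\<lambda>b1 b2. tens T T (tens A B a1 b1) (tens A B a2 b2)) (cop B b)) (cop A a)))"

definition tens_cou ::
  "('k::field, 'a::ab_group_add, 'y) kcoalg_scheme \<Rightarrow> ('k, 'b::ab_group_add, 'z) kcoalg_scheme
     \<Rightarrow> ('a, 'b, 'k) tensor \<Rightarrow> 'k" where
  "tens_cou A B = tlift A B ground (\<lambda>a b. cou A a * cou B b)"


section \<open>Graded super-Hopf algebras and differential structures\<close>

definition decomposition :: "(nat \<Rightarrow> 'a::ab_group_add set) \<Rightarrow> 'a \<Rightarrow> (nat \<Rightarrow> 'a) \<Rightarrow> bool" where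
  "decomposition G x f \<longleftrightarrow>
     (\<forall>i. f i \<in> G i) \<and> finite {i. f i \<noteq> 0} \<and> x = (\<Sum>i | f i \<noteq> 0. f i)"

definition component :: "(nat \<Rightarrow> 'a::ab_group_add set) \<Rightarrow> 'a \<Rightarrow> nat \<Rightarrow> 'a" where
  "component G x = (THE f. decomposition G x f)"

definition sign_inv ::
  "('k::field, 'a::ab_group_add, 'z) kspace_scheme \<Rightarrow> (nat \<Rightarrow> 'a set) \<Rightarrow> 'a \<Rightarrow> 'a" where
  "sign_inv A G x = (\<Sum>i | component G x i \<noteq> 0. smul A ((- 1) ^ i) (component G x i))"

text \<open>Super tensor product of algebras: \<open>(a \<otimes> b)(a' \<otimes> b') = (-1)\<^bsup>|b||a'|\<^esup> a a' \<otimes> b b'\<close> for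
  homogeneous \<open>b\<close>, \<open>a'\<close>.\<close>

definition stens_mul ::
  "('k::field, 'a::ab_group_add, 'z) kspace_scheme \<Rightarrow> (nat \<Rightarrow> 'a set) \<Rightarrow> ('a \<Rightarrow> 'a \<Rightarrow> 'a)
     \<Rightarrow> ('a, 'a, 'k) tensor \<Rightarrow> ('a, 'a, 'k) tensor \<Rightarrow> ('a, 'a, 'k) tensor" where
  "stens_mul A G m u v =
     tlift A A (tensor A A) (\<lambda>a b.
       tlift A A (tensor A A) (\<lambda>a' b'.
         \<Sum>i | component G b i \<noteq> 0. \<Sum>j | component G a' j \<noteq> 0.
           pscale ((- 1) ^ (i * j)) (tens A A (m a (component G a' j)) (m (component G b i) b')))
       v) u"

definition graded_space :: "('k::field, 'a::ab_group_add, 'z) kspace_scheme \<Rightarrow> (nat \<Rightarrow> 'a set) \<Rightarrow> bool" where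
  "graded_space A G \<longleftrightarrow>
     kspace A \<and>
     (\<forall>i. G i \<subseteq> car A \<and> module.subspace (smul A) (G i)) \<and>
     (\<forall>x\<in>car A. \<exists>!f. decomposition G x f)"

definition super_hopf_algebra :: "('k::field, 'a::ab_group_add, 'z) kgbialg_scheme \<Rightarrow> bool" where
  "super_hopf_algebra A \<longleftrightarrow>
     assoc_algebra A \<and> coalgebra A \<and> graded_space A (gr A) \<and>
     unit A \<in> gr A 0 \<and>
     (\<forall>i j. \<forall>a\<in>gr A i. \<forall>b\<in>gr A j. mul A a b \<in> gr A (i + j)) \<and>
     (\<forall>n. \<forall>a\<in>gr A n. cop A a \<in>
        module.span pscale {tens A A b c |b c i j. b \<in> gr A i \<and> c \<in> gr A j \<and> i + j = n}) \<and>
     (\<forall>n>0. \<forall>a\<in>gr A n. cou A a = 0) \<and>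
     (\<forall>a\<in>car A. \<forall>b\<in>car A.
        cop A (mul A a b) = stens_mul A (gr A) (mul A) (cop A a) (cop A b) \<and>
        cou A (mul A a b) = cou A a * cou A b) \<and>
     cop A (unit A) = tens A A (unit A) (unit A) \<and> cou A (unit A) = 1 \<and>
     (\<exists>S. is_antipode A S \<and> (\<forall>n. \<forall>a\<in>gr A n. S a \<in> gr A n))"

text \<open>The degree zero part of \<open>\<Omega>\<close> is identified with \<open>A\<close> by the isomorphism \<open>j\<close>.\<close>

definition strongly_bicovariant_dga ::
  "('k::field, 'a::ab_group_add, 'y) kbialg_scheme \<Rightarrow> ('a \<Rightarrow> 'o)
     \<Rightarrow> ('k, 'o::ab_group_add, 'z) kgbialg_scheme \<Rightarrow> ('o \<Rightarrow> 'o) \<Rightarrow> bool" where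
  "strongly_bicovariant_dga A j \<Omega> d \<longleftrightarrow>
     hopf_algebra A \<and> super_hopf_algebra \<Omega> \<and>
     klinear A \<Omega> j \<and> bij_betw j (car A) (gr \<Omega> 0) \<and>
     (\<forall>a\<in>car A. \<forall>b\<in>car A. j (mul A a b) = mul \<Omega> (j a) (j b)) \<and> j (unit A) = unit \<Omega> \<and>
     (\<forall>a\<in>car A. cop \<Omega> (j a) = tmap A A \<Omega> \<Omega> j j (cop A a) \<and> cou \<Omega> (j a) = cou A a) \<and>
     klinear \<Omega> \<Omega> d \<and>
     (\<forall>i. \<forall>\<xi>\<in>gr \<Omega> i. d \<xi> \<in> gr \<Omega> (i + 1)) \<and>
     (\<forall>\<xi>\<in>car \<Omega>. d (d \<xi>) = 0) \<and>
     (\<forall>i. \<forall>\<xi>\<in>gr \<Omega> i. \<forall>\<eta>\<in>car \<Omega>.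
        d (mul \<Omega> \<xi> \<eta>) = mul \<Omega> (d \<xi>) \<eta> + smul \<Omega> ((- 1) ^ i) (mul \<Omega> \<xi> (d \<eta>))) \<and>
     (\<forall>\<xi>\<in>car \<Omega>.
        cop \<Omega> (d \<xi>) =
          tlift \<Omega> \<Omega> (tensor \<Omega> \<Omega>)
            (\<lambda>\<xi>1 \<xi>2. tens \<Omega> \<Omega> (d \<xi>1) \<xi>2 + tens \<Omega> \<Omega> (sign_inv \<Omega> (gr \<Omega>) \<xi>1) (d \<xi>2)) (cop \<Omega> \<xi>))"

definition generated_by :: "('k::field, 'a::ab_group_add, 'z) kbialg_scheme \<Rightarrow> 'a set \<Rightarrow> bool" where
  "generated_by A X \<longleftrightarrow>
     (\<forall>B. module.subspace (smul A) B \<and> unit A \<in> B \<and> (\<forall>a\<in>B. \<forall>b\<in>B. mul A a b \<in> B) \<and> X \<subseteq> B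
        \<longrightarrow> car A \<subseteq> B)"

definition standard_dga ::
  "('k::field, 'a, 'y) kbialg_scheme \<Rightarrow> ('a \<Rightarrow> 'o)
     \<Rightarrow> ('k, 'o::ab_group_add, 'z) kgbialg_scheme \<Rightarrow> ('o \<Rightarrow> 'o) \<Rightarrow> bool" where
  "standard_dga A j \<Omega> d \<longleftrightarrow> generated_by \<Omega> (j ` car A \<union> d ` j ` car A)"


section \<open>Symmetric and exterior algebras\<close>

definition multilinear_forms ::
  "('k::field, 'w::ab_group_add, 'z) kspace_scheme \<Rightarrow> ('w list \<Rightarrow> 'k) set" where
  "multilinear_forms W =
     {F. \<forall>us\<in>lists (car W). \<forall>vs\<in>lists (car W). klinear W ground (\<lambda>w. F (us @ w # vs))}"

definition symmetric_forms ::
  "('k::field, 'w::ab_group_add, 'z) kspace_scheme \<Rightarrow> ('w list \<Rightarrow> 'k) set" where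
  "symmetric_forms W =
     {F \<in> multilinear_forms W.
        \<forall>us\<in>lists (car W). \<forall>vs\<in>lists (car W). \<forall>x\<in>car W. \<forall>y\<in>car W.
          F (us @ x # y # vs) = F (us @ y # x # vs)}"

definition alternating_forms ::
  "('k::field, 'w::ab_group_add, 'z) kspace_scheme \<Rightarrow> ('w list \<Rightarrow> 'k) set" where
  "alternating_forms W =
     {F \<in> multilinear_forms W.
        \<forall>us\<in>lists (car W). \<forall>vs\<in>lists (car W). \<forall>x\<in>car W. F (us @ x # x # vs) = 0}"

text \<open>For \<open>R\<close> one of these sets of forms, \<open>gen R [w\<^sub>1, \<dots>, w\<^sub>n]\<close> is the product of
  \<open>w\<^sub>1, \<dots>, w\<^sub>n\<close> in the corresponding quotient of the tensor algebra.\<close>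

definition word_space ::
  "('w list \<Rightarrow> 'k) set \<Rightarrow> ('k::field, 'w, 'z) kspace_scheme
     \<Rightarrow> ('k, ('w list, 'k) functional) kspace" where
  "word_space R W = gen_space R (lists (car W))"

definition word_mul ::
  "('w list \<Rightarrow> 'k) set \<Rightarrow> ('k::field, 'w, 'z) kspace_scheme
     \<Rightarrow> ('w list, 'k) functional \<Rightarrow> ('w list, 'k) functional \<Rightarrow> ('w list, 'k) functional" where
  "word_mul R W x y =
     lin_ext R (lists (car W)) (word_space R W) (\<lambda>us.
       lin_ext R (lists (car W)) (word_space R W) (\<lambda>vs. gen R (us @ vs)) y) x"

definition word_grade ::
  "('w list \<Rightarrow> 'k) set \<Rightarrow> ('k::field, 'w, 'z) kspace_scheme \<Rightarrow> nat \<Rightarrow> ('w list, 'k) functional set" where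
  "word_grade R W n = module.span pscale (gen R ` {ws \<in> lists (car W). length ws = n})"

definition word_cou ::
  "('w list \<Rightarrow> 'k) set \<Rightarrow> ('k::field, 'w, 'z) kspace_scheme \<Rightarrow> ('w list, 'k) functional \<Rightarrow> 'k" where
  "word_cou R W = lin_ext R (lists (car W)) ground (\<lambda>ws. if ws = [] then 1 else 0)"

text \<open>The algebra map into the square of the word algebra, multiplied by \<open>M\<close>, that makes the
  elements of \<open>W\<close> primitive.\<close>

definition word_cop ::
  "('w list \<Rightarrow> 'k) set \<Rightarrow> ('k::field, 'w, 'z) kspace_scheme
     \<Rightarrow> ((('w list, 'k) functional, ('w list, 'k) functional, 'k) tensor
          \<Rightarrow> (('w list, 'k) functional, ('w list, 'k) functional, 'k) tensor
          \<Rightarrow> (('w list, 'k) functional, ('w list, 'k) functional, 'k) tensor)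
     \<Rightarrow> ('w list, 'k) functional
     \<Rightarrow> (('w list, 'k) functional, ('w list, 'k) functional, 'k) tensor" where
  "word_cop R W M =
     (let A = word_space R W in
      lin_ext R (lists (car W)) (tensor A A) (\<lambda>ws.
        foldr (\<lambda>w. M (tens A A (gen R [w]) (gen R []) + tens A A (gen R []) (gen R [w])))
          ws (tens A A (gen R []) (gen R []))))"

definition sym_alg ::
  "('k::field, 'w::ab_group_add, 'z) kspace_scheme \<Rightarrow> ('k, ('w list, 'k) functional) kbialg" where
  "sym_alg W =
     (let R = symmetric_forms W; A = word_space R W; m = word_mul R W in
      \<lparr>car = car A, smul = smul A,
       cop = word_cop R W (tens_mul A m), cou = word_cou R W,
       mul = m, unit = gen R []\<rparr>)"

definition ext_alg ::
  "('k::field, 'w::ab_group_add, 'z) kspace_scheme \<Rightarrow> ('k, ('w list, 'k) functional) kgbialg" where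
  "ext_alg W =
     (let R = alternating_forms W; A = word_space R W; G = word_grade R W; m = word_mul R W in
      \<lparr>car = car A, smul = smul A,
       cop = word_cop R W (stens_mul A G m), cou = word_cou R W,
       mul = m, unit = gen R [], gr = G\<rparr>)"

definition sym_word ::
  "('k::field, 'w::ab_group_add, 'z) kspace_scheme \<Rightarrow> 'w list \<Rightarrow> ('w list, 'k) functional" where
  "sym_word W ws = gen (symmetric_forms W) ws"

definition ext_word ::
  "('k::field, 'w::ab_group_add, 'z) kspace_scheme \<Rightarrow> 'w list \<Rightarrow> ('w list, 'k) functional" where
  "ext_word W ws = gen (alternating_forms W) ws"


section \<open>Module structures and cross products\<close>

definition left_module_coalgebra ::
  "('k::field, 'h::ab_group_add, 'y) kbialg_scheme \<Rightarrow> ('k, 'v::ab_group_add, 'z) kcoalg_scheme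
     \<Rightarrow> ('h \<Rightarrow> 'v \<Rightarrow> 'v) \<Rightarrow> bool" where
  "left_module_coalgebra H V act \<longleftrightarrow>
     coalgebra V \<and> kbilinear H V V act \<and>
     (\<forall>v\<in>car V. act (unit H) v = v) \<and>
     (\<forall>h\<in>car H. \<forall>g\<in>car H. \<forall>v\<in>car V. act (mul H h g) v = act h (act g v)) \<and>
     (\<forall>h\<in>car H. \<forall>v\<in>car V.
        cop V (act h v) =
          tlift H H (tensor V V) (\<lambda>h1 h2.
            tlift V V (tensor V V) (\<lambda>v1 v2. tens V V (act h1 v1) (act h2 v2)) (cop V v)) (cop H h) \<and>
        cou V (act h v) = cou H h * cou V v)"

definition right_module_map ::
  "('k::field, 'h::ab_group_add, 'y) kbialg_scheme \<Rightarrow> ('k, 'v::ab_group_add, 'z) kcoalg_scheme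
     \<Rightarrow> ('h \<Rightarrow> 'v \<Rightarrow> 'v) \<Rightarrow> ('h \<Rightarrow> 'v) \<Rightarrow> bool" where
  "right_module_map H V act \<omega> \<longleftrightarrow>
     klinear (aug_ideal H) V \<omega> \<and>
     (\<forall>x\<in>car (aug_ideal H). \<forall>h\<in>car H. \<omega> (mul H x h) = act (antipode H h) (\<omega> x))"

text \<open>The action of \<open>H\<close> on \<open>S(W)\<close> extending an action on \<open>W\<close> so that \<open>S(W)\<close> becomes a
  left \<open>H\<close>-module algebra.\<close>

primrec sym_act_word ::
  "('k::field, 'h::ab_group_add, 'y) kbialg_scheme \<Rightarrow> ('k, 'w::ab_group_add, 'z) kspace_scheme
     \<Rightarrow> ('h \<Rightarrow> 'w \<Rightarrow> 'w) \<Rightarrow> 'w list \<Rightarrow> 'h \<Rightarrow> ('w list, 'k) functional" where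
  "sym_act_word H W la [] = (\<lambda>h. pscale (cou H h) (sym_word W []))"
| "sym_act_word H W la (w # ws) = (\<lambda>h.
     tlift H H (sym_alg W)
       (\<lambda>h1 h2. mul (sym_alg W) (sym_word W [la h1 w]) (sym_act_word H W la ws h2)) (cop H h))"

definition sym_act ::
  "('k::field, 'h::ab_group_add, 'y) kbialg_scheme \<Rightarrow> ('k, 'w::ab_group_add, 'z) kspace_scheme
     \<Rightarrow> ('h \<Rightarrow> 'w \<Rightarrow> 'w) \<Rightarrow> 'h \<Rightarrow> ('w list, 'k) functional \<Rightarrow> ('w list, 'k) functional" where
  "sym_act H W la h =
     lin_ext (symmetric_forms W) (lists (car W)) (sym_alg W) (\<lambda>ws. sym_act_word H W la ws h)"

text \<open>\<open>A \<rtimes> H\<close> for a left action \<open>la\<close>: \<open>(x \<otimes> h)(y \<otimes> g) = x (h\<^sub>(\<^sub>1\<^sub>) \<rhd> y) \<otimes> h\<^sub>(\<^sub>2\<^sub>) g\<close>.\<close>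

definition left_cross_product ::
  "('k::field, 'a::ab_group_add, 'y) kbialg_scheme \<Rightarrow> ('k, 'h::ab_group_add, 'z) kbialg_scheme
     \<Rightarrow> ('h \<Rightarrow> 'a \<Rightarrow> 'a) \<Rightarrow> ('k, ('a, 'h, 'k) tensor) kbialg" where
  "left_cross_product A H la =
     (let T = tensor A H in
      \<lparr>car = car T, smul = smul T, cop = tens_cop A H, cou = tens_cou A H,
       mul = (\<lambda>u v.
         tlift A H T (\<lambda>x h.
           tlift A H T (\<lambda>y g.
             tlift H H T (\<lambda>h1 h2. tens A H (mul A x (la h1 y)) (mul H h2 g)) (cop H h)) v) u),
       unit = tens A H (unit A) (unit H)\<rparr>)"

text \<open>Likewise for a right action of \<open>A\<close> on \<open>W\<close>, extended to \<open>\<Lambda>(W)\<close> as a right module algebra.\<close>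

primrec ext_act_word ::
  "('k::field, 'a::ab_group_add, 'y) kbialg_scheme \<Rightarrow> ('k, 'w::ab_group_add, 'z) kspace_scheme
     \<Rightarrow> ('w \<Rightarrow> 'a \<Rightarrow> 'w) \<Rightarrow> 'w list \<Rightarrow> 'a \<Rightarrow> ('w list, 'k) functional" where
  "ext_act_word A W ra [] = (\<lambda>a. pscale (cou A a) (ext_word W []))"
| "ext_act_word A W ra (w # ws) = (\<lambda>a.
     tlift A A (ext_alg W)
       (\<lambda>a1 a2. mul (ext_alg W) (ext_word W [ra w a1]) (ext_act_word A W ra ws a2)) (cop A a))"

definition ext_act ::
  "('k::field, 'a::ab_group_add, 'y) kbialg_scheme \<Rightarrow> ('k, 'w::ab_group_add, 'z) kspace_scheme
     \<Rightarrow> ('w \<Rightarrow> 'a \<Rightarrow> 'w) \<Rightarrow> ('w list, 'k) functional \<Rightarrow> 'a \<Rightarrow> ('w list, 'k) functional" where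
  "ext_act A W ra x a =
     lin_ext (alternating_forms W) (lists (car W)) (ext_alg W) (\<lambda>ws. ext_act_word A W ra ws a) x"

text \<open>\<open>A \<ltimes> \<Lambda>(W)\<close>: \<open>(a \<otimes> x)(b \<otimes> y) = a b\<^sub>(\<^sub>1\<^sub>) \<otimes> (x \<lhd> b\<^sub>(\<^sub>2\<^sub>)) \<and> y\<close>, graded by the degree in
  \<open>\<Lambda>(W)\<close>.\<close>

definition ext_cross_product ::
  "('k::field, 'a::ab_group_add, 'y) kbialg_scheme \<Rightarrow> ('k, 'w::ab_group_add, 'z) kspace_scheme
     \<Rightarrow> ('w \<Rightarrow> 'a \<Rightarrow> 'w) \<Rightarrow> ('k, ('a, ('w list, 'k) functional, 'k) tensor) kgbialg" where
  "ext_cross_product A W ra =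
     (let L = ext_alg W; T = tensor A L in
      \<lparr>car = car T, smul = smul T, cop = tens_cop A L, cou = tens_cou A L,
       mul = (\<lambda>u v.
         tlift A L T (\<lambda>a x.
           tlift A L T (\<lambda>b y.
             tlift A A T (\<lambda>b1 b2. tens A L (mul A a b1) (mul L (ext_act A W ra x b2) y)) (cop A b))
           v) u),
       unit = tens A L (unit A) (unit L),
       gr = (\<lambda>n. module.span pscale {tens A L a x |a x. a \<in> car A \<and> x \<in> gr L n})\<rparr>)"


section \<open>The dual of a module coalgebra\<close>

text \<open>Functionals on the carrier are extended by zero to the ambient type.\<close>

definition dual ::
  "('k::field, 'v::ab_group_add, 'z) kspace_scheme \<Rightarrow> ('k, 'v \<Rightarrow> 'k) kspace" where
  "dual V = \<lparr>car = {\<phi>. klinear V ground \<phi> \<and> (\<forall>v. v \<notin> car V \<longrightarrow> \<phi> v = 0)}, smul = pscale\<rparr>"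

definition conv ::
  "('k::field, 'v::ab_group_add, 'z) kcoalg_scheme \<Rightarrow> ('v \<Rightarrow> 'k) \<Rightarrow> ('v \<Rightarrow> 'k) \<Rightarrow> ('v \<Rightarrow> 'k)" where
  "conv V \<phi> \<psi> =
     (\<lambda>v. if v \<in> car V then tlift V V ground (\<lambda>v1 v2. \<phi> v1 * \<psi> v2) (cop V v) else 0)"

text \<open>The product \<open>\<phi>\<^sub>1 * \<dots> * \<phi>\<^sub>n\<close> of a nonempty list.\<close>

definition conv_list ::
  "('k::field, 'v::ab_group_add, 'z) kcoalg_scheme \<Rightarrow> ('v \<Rightarrow> 'k) list \<Rightarrow> ('v \<Rightarrow> 'k)" where
  "conv_list V \<phi>s = foldr (conv V) (butlast \<phi>s) (last \<phi>s)"

definition dual_act ::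
  "('k::field, 'h::ab_group_add, 'y) kbialg_scheme \<Rightarrow> ('k, 'v::ab_group_add, 'z) kcoalg_scheme
     \<Rightarrow> ('h \<Rightarrow> 'v \<Rightarrow> 'v) \<Rightarrow> 'h \<Rightarrow> ('v \<Rightarrow> 'k) \<Rightarrow> ('v \<Rightarrow> 'k)" where
  "dual_act H V act h \<phi> = (\<lambda>v. if v \<in> car V then \<phi> (act (antipode H h) v) else 0)"


section \<open>The Hopf algebra \<open>S(V*) \<rtimes> H\<close> and its exterior algebra\<close>

type_synonym ('k, 'h, 'v) htilde = "((('v \<Rightarrow> 'k) list, 'k) functional, 'h, 'k) tensor"
type_synonym ('k, 'h, 'v) omega =
  "(('k, 'h, 'v) htilde, ((('v \<Rightarrow> 'k) \<times> 'v) list, 'k) functional, 'k) tensor"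

definition Htilde ::
  "('k::field, 'h::ab_group_add, 'y) kbialg_scheme \<Rightarrow> ('k, 'v::ab_group_add, 'z) kcoalg_scheme
     \<Rightarrow> ('h \<Rightarrow> 'v \<Rightarrow> 'v) \<Rightarrow> ('k, ('k, 'h, 'v) htilde) kbialg" where
  "Htilde H V act =
     left_cross_product (sym_alg (dual V)) H (sym_act H (dual V) (dual_act H V act))"

abbreviation one_forms ::
  "('k::field, 'v::ab_group_add, 'z) kcoalg_scheme \<Rightarrow> ('k, ('v \<Rightarrow> 'k) \<times> 'v) kspace" where
  "one_forms V \<equiv> dsum (dual V) V"

text \<open>The right action \<open>\<eta> \<lhd> (\<phi>\<^sub>1 \<cdots> \<phi>\<^sub>n h) = (\<dots>(\<eta> \<lhd> \<phi>\<^sub>1) \<dots> \<lhd> \<phi>\<^sub>n) \<lhd> h\<close> on \<open>V* \<oplus> V\<close>.\<close>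

definition ract_H ::
  "('k::field, 'h::ab_group_add, 'y) kbialg_scheme \<Rightarrow> ('k, 'v::ab_group_add, 'z) kcoalg_scheme
     \<Rightarrow> ('h \<Rightarrow> 'v \<Rightarrow> 'v) \<Rightarrow> ('v \<Rightarrow> 'k) \<times> 'v \<Rightarrow> 'h \<Rightarrow> ('v \<Rightarrow> 'k) \<times> 'v" where
  "ract_H H V act \<eta> h =
     (dual_act H V act (antipode H h) (fst \<eta>), act (antipode H h) (snd \<eta>))"

definition ract_dual ::
  "('k::field, 'v::ab_group_add, 'z) kcoalg_scheme
     \<Rightarrow> ('v \<Rightarrow> 'k) \<times> 'v \<Rightarrow> ('v \<Rightarrow> 'k) \<Rightarrow> ('v \<Rightarrow> 'k) \<times> 'v" where
  "ract_dual V \<eta> \<phi> = (- conv V \<phi> (fst \<eta>), 0)"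

definition ract ::
  "('k::field, 'h::ab_group_add, 'y) kbialg_scheme \<Rightarrow> ('k, 'v::ab_group_add, 'z) kcoalg_scheme
     \<Rightarrow> ('h \<Rightarrow> 'v \<Rightarrow> 'v) \<Rightarrow> ('v \<Rightarrow> 'k) \<times> 'v \<Rightarrow> ('k, 'h, 'v) htilde \<Rightarrow> ('v \<Rightarrow> 'k) \<times> 'v" where
  "ract H V act \<eta> =
     tlift (sym_alg (dual V)) H (one_forms V) (\<lambda>x h.
       ract_H H V act
         (lin_ext (symmetric_forms (dual V)) (lists (car (dual V))) (one_forms V)
            (\<lambda>\<phi>s. foldl (ract_dual V) \<eta> \<phi>s) x) h)"

definition Omega ::
  "('k::field, 'h::ab_group_add, 'y) kbialg_scheme \<Rightarrow> ('k, 'v::ab_group_add, 'z) kcoalg_scheme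
     \<Rightarrow> ('h \<Rightarrow> 'v \<Rightarrow> 'v) \<Rightarrow> ('k, ('k, 'h, 'v) omega) kgbialg" where
  "Omega H V act = ext_cross_product (Htilde H V act) (one_forms V) (ract H V act)"

definition degree_zero ::
  "('k::field, 'h::ab_group_add, 'y) kbialg_scheme \<Rightarrow> ('k, 'v::ab_group_add, 'z) kcoalg_scheme
     \<Rightarrow> ('h \<Rightarrow> 'v \<Rightarrow> 'v) \<Rightarrow> ('k, 'h, 'v) htilde \<Rightarrow> ('k, 'h, 'v) omega" where
  "degree_zero H V act a =
     tens (Htilde H V act) (ext_alg (one_forms V)) a (unit (ext_alg (one_forms V)))"

text \<open>\<open>wedge_mono H V act [\<phi>\<^sub>1, \<dots>, \<phi>\<^sub>n] h [\<eta>\<^sub>1, \<dots>, \<eta>\<^sub>r]\<close> is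
  \<open>\<phi>\<^sub>1 \<cdots> \<phi>\<^sub>n h \<otimes> \<eta>\<^sub>1 \<and> \<dots> \<and> \<eta>\<^sub>r\<close>.\<close>

definition wedge_mono ::
  "('k::field, 'h::ab_group_add, 'y) kbialg_scheme \<Rightarrow> ('k, 'v::ab_group_add, 'z) kcoalg_scheme
     \<Rightarrow> ('h \<Rightarrow> 'v \<Rightarrow> 'v) \<Rightarrow> ('v \<Rightarrow> 'k) list \<Rightarrow> 'h \<Rightarrow> (('v \<Rightarrow> 'k) \<times> 'v) list \<Rightarrow> ('k, 'h, 'v) omega" where
  "wedge_mono H V act \<phi>s h \<eta>s =
     tens (Htilde H V act) (ext_alg (one_forms V))
       (tens (sym_alg (dual V)) H (sym_word (dual V) \<phi>s) h) (ext_word (one_forms V) \<eta>s)"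

text \<open>\<open>Sh p q\<close> consists of the \<open>(p, q)\<close>-shuffles, with indices counted from 0;
  \<open>entries xs \<sigma> i j\<close> is \<open>[xs ! \<sigma> i, \<dots>, xs ! \<sigma> (j - 1)]\<close>.\<close>

definition Sh :: "nat \<Rightarrow> nat \<Rightarrow> (nat \<Rightarrow> nat) set" where
  "Sh p q =
     {\<sigma>. \<sigma> permutes {..<p + q} \<and> strict_mono_on {..<p} \<sigma> \<and> strict_mono_on {p..<p + q} \<sigma>}"

definition entries :: "'a list \<Rightarrow> (nat \<Rightarrow> nat) \<Rightarrow> nat \<Rightarrow> nat \<Rightarrow> 'a list" where
  "entries xs \<sigma> i j = map (\<lambda>k. xs ! \<sigma> k) [i..<j]"

end

theory Submission
  imports Defs
begin

text \<open>Write D for the dual of V, A for the cocommutative Hopf algebra S(D) \<rtimes> H and W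
  for the right A-module D \<oplus> V. The whole calculus comes from a one-cocycle, its
  Maurer-Cartan form: a linear map \<zeta> from A to W with \<zeta>(ab) = \<zeta>(a) \<lhd> b +
  \<epsilon>(a) \<zeta>(b). Any such map gives a differential on A \<ltimes> \<Lambda>(W) by the
  single formula d(a \<otimes> x) = a1 \<otimes> \<zeta>(a2) \<and> x. The Leibniz rule is the
  cocycle identity (\<open>d_mul\<close>). The square of d vanishes because \<zeta>(a1) \<and>
  \<zeta>(a2) evaluates an alternating bilinear map on a symmetric tensor, A being cocommutative
  (\<open>d_d\<close>, \<open>sw_alternating\<close>). The coderivation property expresses that
  one-forms are primitive in \<Lambda>(W), again with cocommutativity (\<open>cop_d\<close>). Since
  the sum of S(a1) d(a2) is 1 \<otimes> \<zeta>(a), the calculus is standard as soon as \<zeta> is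
  onto. All this is the locale \<open>cocycle_calculus\<close>.

  The cocycle is glued from two pieces. On H it is \<omega> composed with the projection \<pi>; the
  cocycle identity follows from \<pi>(gh) = \<pi>(g)h + \<epsilon>(g)\<pi>(h) and the module map
  property (\<open>omega_proj_mul\<close>). On S(D) it is the map \<open>N\<close>, which reads the
  first letter of a word as a one-form and lets the remaining letters act on it. Because a letter
  acts by minus convolution, N(\<phi>1 ... \<phi>n) is (-1)^(n-1) times the convolution product of
  the letters, and it is well defined because cocommutativity of V makes convolution commutative.
  The value at x h is then N(x) \<lhd> h + \<epsilon>(x) \<omega>(\<pi>(h)). That this respects the
  cross relations, so that it is a cocycle on all of A (\<open>zeta_mul\<close>), rests on
  \<open>R_sem\<close> and \<open>N_sem\<close>; both cancel an S(h2) against an h1 and use that the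
  antipode of a cocommutative Hopf algebra is a coalgebra map (\<open>sw_antipode\<close>).

  The Hopf structures are obtained uniformly. S(W) and \<Lambda>(W) are treated together as words
  with a sign q = 1 or q = -1 (\<open>word_bialgebra\<close>), and the actions on both as
  \<open>word_action\<close>. Both cross products are instances of a twisted tensor product,
  governed by an exchange map that is compatible with products and coproducts
  (\<open>super_hopf_T\<close>).

  For the explicit formulas, the coproduct of a word is a sum over the subsets of its positions
  (\<open>sw_gw\<close>). The full subset yields the term with \<omega>; the proper subsets, sorted
  by cardinality, are the shuffles (\<open>sum_proper_Sh\<close>) and yield the convolution terms
  (\<open>d_formula\<close>). In the commutator the leading term of one product is the other
  product, so only proper subsets survive (\<open>commutator_formula\<close>). Its sign collects
  (-1)^(m-p-1) from d, one factor -1 for each of the n-q letters that act and one more from the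
  commutator, in all (-1)^(m+n+p+q); this agrees with (-1)^(p+q) when m+n is even.\<close>

section \<open>Linear maps between spaces with carriers\<close>

text \<open>Closure and linearity rules in introduction form. Applied repeatedly together with
  \<open>assumption\<close> they discharge nearly all membership and multilinearity conditions,
  which leaves the Sweedler computations as the visible part of the proofs.\<close>

named_theorems lin

lemma kspace_vector_space: "kspace A ==> vector_space (smul A)" by(simp add: kspace_def)

lemma ksp_module: "kspace A ==> module (smul A)" by(simp add: kspace_def module_iff_vector_space)

lemma ksp_subspace: "kspace A ==> module.subspace (smul A) (car A)" by(simp add: kspace_def)

abbreviation (input) elem (infix ".:" 50) where "x .: A == x : car A"

lemma ksp_zero [lin]: "kspace A ==> 0 .: A" by(rule module.subspace_0[OF ksp_module ksp_subspace])

lemma ksp_add [lin]: "kspace A ==> x .: A ==> y .: A ==> x + y .: A"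
 by(rule module.subspace_add[OF ksp_module ksp_subspace])

lemma ksp_scale [lin]: "kspace A ==> x .: A ==> smul A c x .: A"
 by(rule module.subspace_scale[OF ksp_module ksp_subspace])

lemma ksp_neg [lin]: "kspace A ==> x .: A ==> - x .: A"
 by(rule module.subspace_neg[OF ksp_module ksp_subspace])

lemma ksp_diff [lin]: "kspace A ==> x .: A ==> y .: A ==> x - y .: A"
 by(rule module.subspace_diff[OF ksp_module ksp_subspace])

lemma ksp_sum [lin]: "kspace A ==> (!!i. i : I ==> f i .: A) ==> sum f I .: A"
 by(rule module.subspace_sum[OF ksp_module ksp_subspace])

lemma ksp_sum_list [lin]:
 assumes "kspace A" and "!!x. x : set xs ==> f x .: A"
 shows "(\<Sum>x\<leftarrow>xs. f x) .: A" using assms(2) by(induction xs) (auto intro: ksp_zero ksp_add assms(1))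

lemma ksp_pscale [lin]:
 "kspace A ==> smul A = pscale ==> x .: A ==> pscale c x .: A" by(metis ksp_scale)

lemma smul_add_right: "kspace A ==> smul A c (x + y) = smul A c x + smul A c y"
 by(rule module.scale_right_distrib[OF ksp_module])

lemma smul_add_left: "kspace A ==> smul A (c + d) x = smul A c x + smul A d x"
 by(rule module.scale_left_distrib[OF ksp_module])

lemma smul_smul: "kspace A ==> smul A c (smul A d x) = smul A (c * d) x" by(rule module.scale_scale[OF ksp_module])

lemma smul_one: "kspace A ==> smul A 1 x = x" by(rule module.scale_one[OF ksp_module])

lemma smul_zero_left: "kspace A ==> smul A 0 x = 0" by(rule module.scale_zero_left[OF ksp_module])

lemma smul_zero_right: "kspace A ==> smul A c 0 = 0" by(rule module.scale_zero_right[OF ksp_module])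

lemma smul_minus_left: "kspace A ==> smul A (- c) x = - smul A c x" by(rule module.scale_minus_left[OF ksp_module])

lemma smul_minus_right: "kspace A ==> smul A c (- x) = - smul A c x" by(rule module.scale_minus_right[OF ksp_module])

lemma pscale_simps [simp]:
 "pscale 1 x = x" "pscale 0 x = 0" "pscale c 0 = 0" "pscale c (pscale d x) = pscale (c * d) x"
 "pscale (- c) x = - pscale c x" "pscale c (- x) = - pscale c x" by(auto simp: pscale_def fun_eq_iff)

lemma pscale_add: "pscale c (x + y) = pscale c x + pscale c y" by(auto simp: pscale_def fun_eq_iff algebra_simps)

lemma klin_mem: "klinear A B f ==> x .: A ==> f x .: B" by(simp add: klinear_def)

lemma klin_add: "klinear A B f ==> x .: A ==> y .: A ==> f (x + y) = f x + f y" by(simp add: klinear_def)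

lemma klin_scale: "klinear A B f ==> x .: A ==> f (smul A c x) = smul B c (f x)" by(simp add: klinear_def)

lemma klinearI:
 assumes "!!x. x .: A ==> f x .: B"
  and "!!x y. x .: A ==> y .: A ==> f (x + y) = f x + f y"
  and "!!c x. x .: A ==> f (smul A c x) = smul B c (f x)"
 shows "klinear A B f" using assms by(simp add: klinear_def)

lemma klin_0:
 assumes "kspace A" "kspace B" "klinear A B f"
 shows "f 0 = 0" using klin_scale[OF assms(3) ksp_zero[OF assms(1)], of 0] assms by(simp add: smul_zero_left)

lemma klin_neg:
 assumes "kspace A" "kspace B" "klinear A B f" "x .: A"
 shows "f (- x) = - f x" using klin_scale[OF assms(3,4), of "-1"] assms by(simp add: smul_minus_left smul_one)

lemma klin_diff:
 assumes "kspace A" "kspace B" "klinear A B f" "x .: A" "y .: A"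
 shows "f (x - y) = f x - f y" using klin_add[OF assms(3,4), of "- y"] klin_neg[OF assms(1-3,5)] assms
 by(simp add: ksp_neg)

lemma klin_sum_list:
 assumes "kspace A" "kspace B" "klinear A B f" "!!i. i : set xs ==> g i .: A"
 shows "f (\<Sum>i\<leftarrow>xs. g i) = (\<Sum>i\<leftarrow>xs. f (g i))" using assms(4)
 by(induction xs) (auto simp: klin_0[OF assms(1-3)] klin_add[OF assms(3)] ksp_sum_list[OF assms(1)])

lemma klin_sum:
 assumes "kspace A" "kspace B" "klinear A B f" "!!i. i : I ==> g i .: A"
 shows "f (\<Sum>i\<in>I. g i) = (\<Sum>i\<in>I. f (g i))" using assms(4) by(induction I rule: infinite_finite_induct)
  (auto simp: klin_0[OF assms(1-3)] klin_add[OF assms(3)] ksp_sum[OF assms(1)])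

text \<open>Structure maps are controlled on carriers only. A map given by \<open>tlift\<close> is
  shown to be linear by comparing it there with a Sweedler sum that is linear by the rules
  \<open>lin\<close>.\<close>

lemma klin_cong:
 assumes "kspace A" "klinear A B g" "!!x. x .: A ==> f x = g x"
 shows "klinear A B f" using assms by(simp add: klinear_def ksp_add ksp_scale)

lemma klin_comp: "klinear B C g ==> klinear A B f ==> klinear A C (%x. g (f x))" by(simp add: klinear_def)

lemma klin_id [lin]: "klinear A A (%x. x)" by(simp add: klinear_def)

lemma klin_const_0 [lin]: "kspace B ==> klinear A B (%x. 0)" by(simp add: klinear_def ksp_zero smul_zero_right)

lemma klin_plus [lin]:
 "kspace B ==> klinear A B f ==> klinear A B g ==> klinear A B (%x. f x + g x)"
 by(simp add: klinear_def ksp_add smul_add_right add_ac)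

lemma klin_uminus [lin]:
 "kspace B ==> klinear A B f ==> klinear A B (%x. - f x)" by(simp add: klinear_def ksp_neg smul_minus_right)

lemma klin_minus [lin]:
 "kspace B ==> klinear A B f ==> klinear A B g ==> klinear A B (%x. f x - g x)"
 using klin_plus[of B A f "%x. - g x"] klin_uminus[of B A g] by simp

lemma klin_smul [lin]:
 "kspace B ==> klinear A B f ==> klinear A B (%x. smul B c (f x))"
 by(simp add: klinear_def ksp_scale smul_add_right smul_smul mult.commute)

lemma klin_pscale [lin]:
 "kspace B ==> smul B = pscale ==> klinear A B f ==> klinear A B (%x. pscale c (f x))" by(metis klin_smul)

lemma klin_smul_left [lin]:
 "kspace B ==> d .: B ==> klinear A ground f ==> klinear A B (%x. smul B (f x) d)"
 by(simp add: klinear_def ground_def ksp_scale smul_add_left smul_smul)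

lemma klin_pscale_left [lin]:
 "kspace B ==> smul B = pscale ==> d .: B ==> klinear A ground f ==> klinear A B (%x. pscale (f x) d)"
 by(metis klin_smul_left)

lemma klin_sum_fun [lin]:
 assumes "kspace B" "!!i. i : I ==> klinear A B (%x. f x i)"
 shows "klinear A B (%x. \<Sum>i\<in>I. f x i)" using assms(2)
 by(induction I rule: infinite_finite_induct) (auto intro!: lin assms(1))

lemma klin_sum_list_fun [lin]:
 assumes "kspace B" "!!i. i : set I ==> klinear A B (%x. f x i)"
 shows "klinear A B (%x. \<Sum>i\<leftarrow>I. f x i)" using assms(2) by(induction I) (auto intro!: lin assms(1))

lemma ground_simps [simp]: "car ground = UNIV" "smul ground = (*)" by(simp_all add: ground_def)

lemma ksp_ground [lin, simp]: "kspace (ground :: ('k::field, 'k) kspace)"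
 by(auto simp: kspace_def vector_space_mult module.subspace_def[OF vector_space_mult[folded module_iff_vector_space]])

lemma klin_times_left [lin]: "klinear A ground f ==> klinear A ground (%x. c * f x)" by(simp add: klinear_def algebra_simps)

lemma klin_times_right [lin]: "klinear A ground f ==> klinear A ground (%x. f x * c)" by(simp add: klinear_def algebra_simps)

lemma kbilinearI [lin]:
 assumes "!!a. a .: A ==> klinear B C (%b. f a b)"
  and "!!b. b .: B ==> klinear A C (%a. f a b)"
 shows "kbilinear A B C f" using assms by(simp add: kbilinear_def)

lemma kbil_mem: "kbilinear A B C f ==> a .: A ==> b .: B ==> f a b .: C"
 by(simp add: kbilinear_def klinear_def)

lemma kbil_right:
 "kbilinear A B C f ==> a .: A ==> klinear D B g ==> klinear D C (%x. f a (g x))"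
 by(auto simp: kbilinear_def intro: klin_comp)

lemma kbil_left:
 "kbilinear A B C f ==> b .: B ==> klinear D A g ==> klinear D C (%x. f (g x) b)"
 by(auto simp: kbilinear_def intro: klin_comp[of A C "%a. f a b"])

lemmas kbilin = kbil_mem kbil_right kbil_left

definition ktrilinear where
 "ktrilinear A B C D f \<longleftrightarrow>
   (\<forall>a\<in>car A. kbilinear B C D (f a)) & (\<forall>b\<in>car B. \<forall>c\<in>car C. klinear A D (%a. f a b c))"

lemma ktrilinearI [lin]:
 assumes "!!a b. a .: A ==> b .: B ==> klinear C D (%c. f a b c)"
  and "!!a c. a .: A ==> c .: C ==> klinear B D (%b. f a b c)"
  and "!!b c. b .: B ==> c .: C ==> klinear A D (%a. f a b c)"
 shows "ktrilinear A B C D f" using assms by(simp add: ktrilinear_def kbilinear_def)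

lemma ktrilin:
 assumes "ktrilinear A B C D f"
 shows ktrilinear_mem: "a .: A ==> b .: B ==> c .: C ==> f a b c .: D"
  and ktrilinear_3: "a .: A ==> b .: B ==> klinear E C g ==> klinear E D (%x. f a b (g x))"
  and ktrilinear_2: "a .: A ==> c .: C ==> klinear E B g ==> klinear E D (%x. f a (g x) c)"
  and ktrilinear_1: "b .: B ==> c .: C ==> klinear E A g ==> klinear E D (%x. f (g x) b c)"
proof -
 show "a .: A ==> b .: B ==> c .: C ==> f a b c .: D"
  using assms by(simp add: ktrilinear_def kbilinear_def klinear_def)
 show "a .: A ==> b .: B ==> klinear E C g ==> klinear E D (%x. f a b (g x))"
  using assms by(auto simp: ktrilinear_def intro: kbil_right)
 show "a .: A ==> c .: C ==> klinear E B g ==> klinear E D (%x. f a (g x) c)"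
  using assms by(auto simp: ktrilinear_def intro: kbil_left)
 show "b .: B ==> c .: C ==> klinear E A g ==> klinear E D (%x. f (g x) b c)"
  using assms by(auto simp: ktrilinear_def intro: klin_comp[of A D "%a. f a b c"])
qed

section \<open>Elements of tensor products as finite sums of pure tensors\<close>

section \<open>Summation over representations of tensors\<close>

lemma ksp_tens [lin, simp]: "kspace (tensor A B)" by(simp add: tensor_def kspace_gen_space)

lemma smul_tensor [lin, simp]: "smul (tensor A B) = pscale" by(simp add: tensor_def gen_space_def)

lemma kbil_tens: "kbilinear A B (tensor A B) (tens A B)"
proof -
 have mem: "tens A B a b .: (tensor A B)" if "a .: A" "b .: B" for a b
  using that by(auto simp: tensor_def tens_def gen_space_def intro!: module.span_base[OF module_pscale])
 show ?thesis unfolding kbilinear_def klinear_def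
  by(auto simp: mem) (auto simp: tens_def gen_def bilinear_forms_def kbilinear_def klinear_def pscale_def fun_eq_iff)
qed

lemmas tens_lin [lin] = kbilin[OF kbil_tens]

lemma tens_scale_left: "a .: A ==> b .: B ==> tens A B (smul A c a) b = pscale c (tens A B a b)"
 using kbil_tens[of A B] by(auto simp: kbilinear_def klinear_def)

lemma tens_scale_right: "a .: A ==> b .: B ==> tens A B a (smul B c b) = pscale c (tens A B a b)"
 using kbil_tens[of A B] by(auto simp: kbilinear_def klinear_def)

text \<open>The scalars of a linear combination are absorbed into the left factors, so a list of
  pairs suffices.\<close>

lemma tensor_representation:
 assumes A: "kspace A" and t: "t .: (tensor A B)"
 shows "\<exists>xs. set xs \<subseteq> car A \<times> car B & t = (\<Sum>(a, b)\<leftarrow>xs. tens A B a b)"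
proof -
 have "t : module.span pscale (case_prod (tens A B) ` (car A \<times> car B))"
  using t by(simp add: tensor_def gen_space_def tens_def case_prod_unfold)
 then show ?thesis
 proof (induction rule: module.span_induct_alt[OF module_pscale, consumes 1, case_names base step])
  case base
  show ?case by(rule exI[of _ "[]"]) simp
 next
  case (step c u v)
  then obtain a b xs where *: "a .: A" "b .: B" "u = tens A B a b"
   "set xs \<subseteq> car A \<times> car B" "v = (\<Sum>(a, b)\<leftarrow>xs. tens A B a b)" by auto
  then show ?case by(intro exI[of _ "(smul A c a, b) # xs"]) (simp add: tens_scale_left ksp_scale[OF A])
 qed
qed

text \<open>One representation is fixed for each tensor. Outside the tensor product the list is
  empty, so that its entries lie in the carriers without any condition on \<open>t\<close>.\<close>

definition trep ::
 "('k::field, 'a::ab_group_add, 'y) kspace_scheme => ('k, 'b::ab_group_add, 'z) kspace_scheme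
   => ('a, 'b, 'k) tensor => ('a \<times> 'b) list" where
 "trep A B t =
   (let P = (%xs. set xs \<subseteq> car A \<times> car B & t = (\<Sum>(a, b)\<leftarrow>xs. tens A B a b))
   in if \<exists>xs. P xs then SOME xs. P xs else [])"

text \<open>Sweedler sums: \<open>tsum A B t f\<close> is the sum of \<open>f a b\<close> over one fixed representation
 \<open>t = \<Sum> a \<otimes> b\<close>. In contrast to \<open>tlift\<close> it needs no target space, and rearranging nested sums
 needs no linearity.\<close>

definition tsum ::
 "('k::field, 'a::ab_group_add, 'y) kspace_scheme => ('k, 'b::ab_group_add, 'z) kspace_scheme
   => ('a, 'b, 'k) tensor => ('a => 'b => 'c::ab_group_add) => 'c" where
 "tsum A B t f = (\<Sum>(a, b)\<leftarrow>trep A B t. f a b)"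

lemma trep_subset: "set (trep A B t) \<subseteq> car A \<times> car B" unfolding trep_def Let_def by(auto dest!: someI_ex)

lemma trep_sum:
 assumes "kspace A" "t .: (tensor A B)"
 shows "(\<Sum>(a, b)\<leftarrow>trep A B t. tens A B a b) = t" using tensor_representation[OF assms] unfolding trep_def Let_def
 by(auto dest!: someI_ex)

lemma trep_mem: "p : set (trep A B t) ==> fst p .: A & snd p .: B" using trep_subset[of A B t] by auto

text \<open>As a congruence rule it tells the simplifier that the bound Sweedler factors lie in the
  carriers, which is what most equations about structure maps require.\<close>

lemma tsum_cong [cong]:
 assumes "t = u" "!!a b. a .: A ==> b .: B ==> f a b = g a b"
 shows "tsum A B t f = tsum A B u g" unfolding tsum_def assms(1)
 by(rule arg_cong[of _ _ sum_list], rule map_cong) (auto simp: assms(2) dest: trep_mem)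

lemmas tsum_eq = tsum_cong[OF refl]

lemma tsum_add: "tsum A B t (%a b. f a b + g a b) = tsum A B t f + tsum A B t g"
 unfolding tsum_def by(simp add: case_prod_unfold sum_list_addf)

lemma tsum_0 [simp]: "tsum A B t (%a b. 0) = 0" unfolding tsum_def by(simp add: case_prod_unfold)

lemma tsum_neg: "tsum A B t (%a b. - f a b) = - tsum A B t f"
 using tsum_add[of A B t f "%a b. - f a b"] by(simp add: eq_neg_iff_add_eq_0 add.commute)

lemma tsum_diff: "tsum A B t (%a b. f a b - g a b) = tsum A B t f - tsum A B t g"
 using tsum_add[of A B t f "%a b. - g a b"] by(simp add: tsum_neg)

lemma sum_list_swap:
 fixes f :: "'a => 'b => 'c::comm_monoid_add"
 shows "(\<Sum>x\<leftarrow>xs. \<Sum>y\<leftarrow>ys. f x y) = (\<Sum>y\<leftarrow>ys. \<Sum>x\<leftarrow>xs. f x y)"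
 by(induction xs) (simp_all add: sum_list_addf)

lemma tsum_swap:
 "tsum A B t (%a b. tsum C D u (%c d. f a b c d)) = tsum C D u (%c d. tsum A B t (%a b. f a b c d))"
 unfolding tsum_def case_prod_unfold by(rule sum_list_swap)

lemma tsum_sum: "tsum A B t (%a b. \<Sum>i\<in>I. f a b i) = (\<Sum>i\<in>I. tsum A B t (%a b. f a b i))"
 by(induction I rule: infinite_finite_induct) (simp_all add: tsum_add)

lemma tsum_mem [lin]:
 "kspace D ==> (!!a b. a .: A ==> b .: B ==> f a b .: D) ==> tsum A B t f .: D"
 unfolding tsum_def by(rule ksp_sum_list) (auto dest: trep_mem)

lemma klin_tsum:
 assumes "kspace C" "kspace D" "klinear C D g" "!!a b. a .: A ==> b .: B ==> f a b .: C"
 shows "g (tsum A B t f) = tsum A B t (%a b. g (f a b))" unfolding tsum_def case_prod_unfold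
 by(rule klin_sum_list[OF assms(1-3)]) (auto dest: trep_mem intro: assms(4))

lemma smul_sum_list: "kspace D ==> smul D c (\<Sum>i\<leftarrow>xs. f i) = (\<Sum>i\<leftarrow>xs. smul D c (f i))"
 by(induction xs) (simp_all add: smul_zero_right smul_add_right)

lemma smul_tsum: "kspace D ==> smul D c (tsum A B t f) = tsum A B t (%a b. smul D c (f a b))"
 unfolding tsum_def by(simp add: case_prod_unfold smul_sum_list)

text \<open>The bridge from the \<open>tlift\<close> of the definitions to Sweedler sums: the
  induced linear map is evaluated on the chosen representation.\<close>

lemma tlift_eq_tsum:
 assumes "kspace A" "kspace C" "kbilinear A B C f" "t .: (tensor A B)"
 shows "tlift A B C f t = tsum A B t f"
proof -
 have "tlift A B C f t = tlift A B C f (\<Sum>(a, b)\<leftarrow>trep A B t. tens A B a b)"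
  by(simp only: trep_sum[OF assms(1,4)])
 also have "... = tsum A B t (%a b. tlift A B C f (tens A B a b))" unfolding tsum_def case_prod_unfold
  by(rule klin_sum_list[OF ksp_tens assms(2) klinear_tlift[OF assms(2,3)]])
   (auto dest: trep_mem intro: tens_lin)
 also have "... = tsum A B t f" by(rule tsum_cong) (auto simp: tlift_tens[OF assms(2,3)])
 finally show ?thesis .
qed

lemma tsum_tens:
 assumes "kspace A" "kspace C" "kbilinear A B C f" "a .: A" "b .: B"
 shows "tsum A B (tens A B a b) f = f a b"
 using tlift_eq_tsum[OF assms(1-3), of "tens A B a b"] tlift_tens[OF assms(2-5)] assms(4,5) by(simp add: tens_lin)

text \<open>Independence of the chosen representation enters here. The sum is additive in the tensor
  because, for a bilinear \<open>f\<close>, it agrees with the canonical map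
  \<open>tlift\<close>.\<close>

lemma klin_tsum_out:
 assumes "kspace A" "kspace C" "kbilinear A B C f"
 shows "klinear (tensor A B) C (%t. tsum A B t f)" by(rule klin_cong[OF ksp_tens klinear_tlift[OF assms(2,3)]])
  (simp add: tlift_eq_tsum[OF assms])

lemma klin_tsum_arg [lin]:
 assumes "kspace A" "kspace C" "klinear E (tensor A B) g" "kbilinear A B C f"
 shows "klinear E C (%x. tsum A B (g x) f)" by(rule klin_comp[OF klin_tsum_out[OF assms(1,2,4)] assms(3)])

lemma klin_tsum_fun [lin]:
 assumes "kspace D" "!!a b. a .: A ==> b .: B ==> klinear E D (%x. f x a b)"
 shows "klinear E D (%x. tsum A B t (f x))"
proof -
 have "klinear E D (%x. \<Sum>p\<leftarrow>trep A B t. f x (fst p) (snd p))"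
  by(rule klin_sum_list_fun[OF assms(1)]) (auto dest: trep_mem intro: assms(2))
 then show ?thesis by(simp add: tsum_def case_prod_unfold)
qed

lemma tsum_tsum:
 assumes "kspace C" "kspace E" "kbilinear C D E F"
  and "!!a b. a .: A ==> b .: B ==> f a b .: (tensor C D)"
 shows "tsum C D (tsum A B t f) F = tsum A B t (%a b. tsum C D (f a b) F)"
 by(rule klin_tsum[where g = "%t. tsum C D t F", OF ksp_tens assms(2) klin_tsum_out[OF assms(1-3)] assms(4)])

lemma tsum_tens_id: "kspace A ==> t .: (tensor A B) ==> tsum A B t (tens A B) = t" unfolding tsum_def by(rule trep_sum)

lemma tensor_eqI:
 assumes "kspace A" "kspace C" "klinear (tensor A B) C f" "klinear (tensor A B) C g"
  and "!!a b. a .: A ==> b .: B ==> f (tens A B a b) = g (tens A B a b)"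
  and t: "t .: (tensor A B)"
 shows "f t = g t"
proof -
 have "h t = tsum A B t (%a b. h (tens A B a b))" if "klinear (tensor A B) C h" for h
  using klin_tsum[OF ksp_tens assms(2) that, of A B "tens A B" t] tsum_tens_id[OF assms(1) t] by(simp add: tens_lin)
 from this[OF assms(3)] this[OF assms(4)] show ?thesis by(simp add: assms(5))
qed

section \<open>Coalgebra and bialgebra axioms as identities of iterated Sweedler sums\<close>

section \<open>Coalgebras and bialgebras in Sweedler notation\<close>

abbreviation sw ::
 "('k::field, 'a::ab_group_add, 'z) kcoalg_scheme => 'a => ('a => 'a => 'c::ab_group_add) => 'c" where
 "sw C c f \<equiv> tsum C C (cop C c) f"

lemma coalgebra_kspace [lin]: "coalgebra C ==> kspace C" by(simp add: coalgebra_def)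

lemma klin_cop: "coalgebra C ==> klinear C (tensor C C) (cop C)" by(simp add: coalgebra_def)

lemma klin_cou: "coalgebra C ==> klinear C ground (cou C)" by(simp add: coalgebra_def)

lemma cop_mem [lin]: "coalgebra C ==> c .: C ==> cop C c .: (tensor C C)" by(rule klin_mem[OF klin_cop])

lemma cop_lin [lin]: "coalgebra C ==> klinear E C g ==> klinear E (tensor C C) (%x. cop C (g x))"
 by(rule klin_comp[OF klin_cop])

lemma cou_lin [lin]: "coalgebra C ==> klinear E C g ==> klinear E ground (%x. cou C (g x))" by(rule klin_comp[OF klin_cou])

lemma tmap_eq_tsum:
 assumes "kspace A" "klinear A C f" "klinear B D g" "t .: (tensor A B)"
 shows "tmap A B C D f g t = tsum A B t (%a b. tens C D (f a) (g b))" unfolding tmap_def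
 by(rule tlift_eq_tsum[OF assms(1) ksp_tens _ assms(4)])
  (rule lin klin_mem[OF assms(2)] klin_mem[OF assms(3)] assms(2,3) |assumption)+

lemma tassoc_tens:
 assumes "kspace A" "kspace B" "kspace C" "t .: (tensor A B)" "c .: C"
 shows "tassoc A B C (tens (tensor A B) C t c) = tsum A B t (%a b. tens A (tensor B C) a (tens B C b c))"
proof -
 have *: "kbilinear A B (tensor A (tensor B C)) (%a b. tens A (tensor B C) a (tens B C b c))"
  if "c .: C" for c by(rule lin that |assumption)+
 have 1: "kbilinear (tensor A B) C (tensor A (tensor B C)) (%t c. tsum A B t (%a b. tens A (tensor B C) a (tens B C b c)))"
  by(rule lin assms |assumption)+
 have "kbilinear (tensor A B) C (tensor A (tensor B C))
   (%t c. tlift A B (tensor A (tensor B C)) (%a b. tens A (tensor B C) a (tens B C b c)) t)" apply(rule kbilinearI)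
   apply(rule klin_cong[OF assms(3) kbil_right[OF 1 _ klin_id]], assumption)
   apply(rule tlift_eq_tsum[OF assms(1) ksp_tens *]; assumption)
  apply(rule klin_cong[OF ksp_tens kbil_left[OF 1 _ klin_id]], assumption)
  apply(rule tlift_eq_tsum[OF assms(1) ksp_tens *]; assumption) done
 from tlift_tens[OF ksp_tens this assms(4,5)] show ?thesis
  unfolding tassoc_def by(simp add: tlift_eq_tsum[OF assms(1) ksp_tens *[OF assms(5)] assms(4)])
qed

lemma klin_tassoc:
 assumes "kspace A" "kspace B" "kspace C"
 shows "klinear (tensor (tensor A B) C) (tensor A (tensor B C)) (tassoc A B C)"
proof -
 have 1: "kbilinear (tensor A B) C (tensor A (tensor B C)) (%t c. tsum A B t (%a b. tens A (tensor B C) a (tens B C b c)))"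
  by(rule lin assms |assumption)+
 have *: "kbilinear A B (tensor A (tensor B C)) (%a b. tens A (tensor B C) a (tens B C b c))"
  if "c .: C" for c by(rule lin that |assumption)+
 show ?thesis unfolding tassoc_def apply(rule klinear_tlift[OF ksp_tens]) apply(rule kbilinearI)
   apply(rule klin_cong[OF assms(3) kbil_right[OF 1 _ klin_id]], assumption)
   apply(rule tlift_eq_tsum[OF assms(1) ksp_tens *]; assumption)
  apply(rule klin_cong[OF ksp_tens kbil_left[OF 1 _ klin_id]], assumption)
  apply(rule tlift_eq_tsum[OF assms(1) ksp_tens *]; assumption) done
qed

text \<open>Translates the two sides of the coassociativity axiom, which is phrased with
  \<open>tmap\<close> and \<open>tassoc\<close>, into nested Sweedler sums of pure tensors.\<close>

lemma tassoc_coproduct: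
 assumes C: "kspace C" and cop: "klinear C (tensor C C) (cop C)" and c: "c .: C"
 shows "tassoc C C C (tmap C C (tensor C C) C (cop C) id (cop C c)) =
      sw C c (%a b. sw C a (%a1 a2. tens C (tensor C C) a1 (tens C C a2 b)))"
  and "tmap C C C (tensor C C) id (cop C) (cop C c) =
      sw C c (%a b. sw C b (%b1 b2. tens C (tensor C C) a (tens C C b1 b2)))"
proof -
 note m = klin_mem[OF cop]
 have id: "klinear C C id" by(simp add: klinear_def)
 have "tassoc C C C (tmap C C (tensor C C) C (cop C) id (cop C c)) =
  tassoc C C C (sw C c (%a b. tens (tensor C C) C (cop C a) b))" by(simp add: tmap_eq_tsum[OF C cop id m[OF c]])
 also have "... = sw C c (%a b. tassoc C C C (tens (tensor C C) C (cop C a) b))"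
  by(rule klin_tsum[OF ksp_tens ksp_tens klin_tassoc[OF C C C]]) (rule lin m |assumption)+
 also have "... = sw C c (%a b. sw C a (%a1 a2. tens C (tensor C C) a1 (tens C C a2 b)))"
  by(rule tsum_eq) (simp add: tassoc_tens[OF C C C m])
 finally show "tassoc C C C (tmap C C (tensor C C) C (cop C) id (cop C c)) =
      sw C c (%a b. sw C a (%a1 a2. tens C (tensor C C) a1 (tens C C a2 b)))" .
 have "tmap C C C (tensor C C) id (cop C) (cop C c) = sw C c (%a b. tens C (tensor C C) a (cop C b))"
  by(simp add: tmap_eq_tsum[OF C id cop m[OF c]])
 also have "... = sw C c (%a b. sw C b (%b1 b2. tens C (tensor C C) a (tens C C b1 b2)))"
 proof (rule tsum_eq)
  fix a b assume a: "a .: C" and b: "b .: C"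
  have "tens C (tensor C C) a (sw C b (tens C C)) = sw C b (%b1 b2. tens C (tensor C C) a (tens C C b1 b2))"
   by(rule klin_tsum[OF ksp_tens ksp_tens]) (rule lin a |assumption)+
  then show "tens C (tensor C C) a (cop C b) = sw C b (%b1 b2. tens C (tensor C C) a (tens C C b1 b2))"
   by(simp add: tsum_tens_id[OF C m[OF b]])
 qed
 finally show "tmap C C C (tensor C C) id (cop C) (cop C c) =
      sw C c (%a b. sw C b (%b1 b2. tens C (tensor C C) a (tens C C b1 b2)))" .
qed

lemma coalgebraI:
 assumes C: "kspace C" and cop: "klinear C (tensor C C) (cop C)" and cou: "klinear C ground (cou C)"
  and "!!c. c .: C ==>
   sw C c (%a b. sw C a (%a1 a2. tens C (tensor C C) a1 (tens C C a2 b))) =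
   sw C c (%a b. sw C b (%b1 b2. tens C (tensor C C) a (tens C C b1 b2)))"
  and "!!c. c .: C ==> sw C c (%a b. smul C (cou C a) b) = c"
  and "!!c. c .: C ==> sw C c (%a b. smul C (cou C b) a) = c"
 shows "coalgebra C"
proof -
 have m: "cop C c .: (tensor C C)" if "c .: C" for c using klin_mem[OF cop that] .
 have "kbilinear C C C (%a b. smul C (cou C a) b)" "kbilinear C C C (%a b. smul C (cou C b) a)" by(rule lin cou C |assumption)+
 then show ?thesis unfolding coalgebra_def using assms by(simp add: tassoc_coproduct[OF C cop] tlift_eq_tsum[OF C C _ m])
qed

text \<open>A trilinear \<open>F\<close> factors through the triple tensor product as the linear map
  \<open>?G\<close>. Applying \<open>?G\<close> to the coassociativity identity gives the identity
  for \<open>F\<close>.\<close>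

lemma sw_coassoc:
 assumes "kspace D" "coalgebra C" "c .: C" and F: "ktrilinear C C C D F"
 shows "sw C c (%a b. sw C a (%a1 a2. F a1 a2 b)) = sw C c (%a b. sw C b (%b1 b2. F a b1 b2))"
proof -
 note C = coalgebra_kspace[OF assms(2)]
 let ?T = "tensor C C" and ?TT = "tensor C (tensor C C)"
 let ?G = "%u. tsum C ?T u (%a t. tsum C C t (F a))"
 have bF: "kbilinear C C D (F a)" if "a .: C" for a using F that by(simp add: ktrilinear_def)
 have bG: "kbilinear C ?T D (%a t. tsum C C t (F a))" by(rule lin C bF assms ktrilin[OF F] |assumption)+
 have lG: "klinear ?TT D ?G" by(rule klin_tsum_out[OF C assms(1) bG])
 have G: "?G (tens C ?T a (tens C C b c)) = F a b c" if "a .: C" "b .: C" "c .: C" for a b c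
  using that by(simp add: tsum_tens[OF C assms(1) bG] tsum_tens[OF C assms(1) bF] tens_lin)
 have "sw C c (%a b. sw C a (%a1 a2. tens C ?T a1 (tens C C a2 b))) =
  sw C c (%a b. sw C b (%b1 b2. tens C ?T a (tens C C b1 b2)))"
  using tassoc_coproduct[OF C klin_cop[OF assms(2)] assms(3)] assms(2,3) by(simp add: coalgebra_def)
 then have "?G (sw C c (%a b. sw C a (%a1 a2. tens C ?T a1 (tens C C a2 b)))) =
  ?G (sw C c (%a b. sw C b (%b1 b2. tens C ?T a (tens C C b1 b2))))" by simp
 moreover have "?G (sw C c (%a b. sw C a (%a1 a2. tens C ?T a1 (tens C C a2 b)))) =
  sw C c (%a b. sw C a (%a1 a2. F a1 a2 b))" apply(subst klin_tsum[OF ksp_tens assms(1) lG])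
   apply(rule lin |assumption)+ apply(rule tsum_eq) apply(subst klin_tsum[OF ksp_tens assms(1) lG])
   apply(rule lin |assumption)+ apply(rule tsum_eq) apply(rule G; assumption) done
 moreover have "?G (sw C c (%a b. sw C b (%b1 b2. tens C ?T a (tens C C b1 b2)))) =
  sw C c (%a b. sw C b (%b1 b2. F a b1 b2))" apply(subst klin_tsum[OF ksp_tens assms(1) lG])
   apply(rule lin |assumption)+ apply(rule tsum_eq) apply(subst klin_tsum[OF ksp_tens assms(1) lG])
   apply(rule lin |assumption)+ apply(rule tsum_eq) apply(rule G; assumption) done
 ultimately show ?thesis by simp
qed

lemma sw_counit:
 assumes "kspace D" "coalgebra C" "c .: C" "klinear C D f"
 shows sw_counit_left: "sw C c (%a b. smul D (cou C a) (f b)) = f c"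
  and sw_counit_right: "sw C c (%a b. smul D (cou C b) (f a)) = f c"
proof -
 note C = coalgebra_kspace[OF assms(2)]
 have b: "kbilinear C C C (%a b. smul C (cou C a) b)" "kbilinear C C C (%a b. smul C (cou C b) a)"
  by(rule lin C assms |assumption)+
 note eq = tlift_eq_tsum[OF C C _ cop_mem[OF assms(2,3)]]
 have *: "sw C c (%a b. smul C (cou C a) b) = c" "sw C c (%a b. smul C (cou C b) a) = c"
  using assms(2,3) by(simp_all add: coalgebra_def eq[OF b(1), symmetric] eq[OF b(2), symmetric])
 have "f (sw C c (%a b. smul C (cou C a) b)) = sw C c (%a b. smul D (cou C a) (f b))"
  by(subst klin_tsum[OF C assms(1,4)]) (auto intro: ksp_scale[OF C] simp: klin_scale[OF assms(4)])
 then show "sw C c (%a b. smul D (cou C a) (f b)) = f c" by(simp add: *)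
 have "f (sw C c (%a b. smul C (cou C b) a)) = sw C c (%a b. smul D (cou C b) (f a))"
  by(subst klin_tsum[OF C assms(1,4)]) (auto intro: ksp_scale[OF C] simp: klin_scale[OF assms(4)])
 then show "sw C c (%a b. smul D (cou C b) (f a)) = f c" by(simp add: *)
qed

lemma tflip_eq_tsum:
 "kspace A ==> t .: (tensor A B) ==> tflip A B t = tsum A B t (%a b. tens B A b a)"
 unfolding tflip_def by(rule tlift_eq_tsum) (rule lin |assumption)+

lemma sw_cocomm:
 assumes "kspace D" "coalgebra C" "cocommutative C" "c .: C" "kbilinear C C D F"
 shows "sw C c F = sw C c (%a b. F b a)"
proof -
 note C = coalgebra_kspace[OF assms(2)]
 have "cop C c = sw C c (%a b. tens C C b a)"
  using assms(3,4) by(simp add: cocommutative_def tflip_eq_tsum[OF C cop_mem[OF assms(2,4)], symmetric])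
 then have "sw C c F = tsum C C (sw C c (%a b. tens C C b a)) F" by simp
 also have "... = sw C c (%a b. tsum C C (tens C C b a) F)" by(rule tsum_tsum[OF C assms(1,5)]) (rule lin |assumption)+
 also have "... = sw C c (%a b. F b a)" by(rule tsum_eq) (rule tsum_tens[OF C assms(1,5)])
 finally show ?thesis .
qed

lemma cocommutativeI:
 assumes "coalgebra C" "!!c. c .: C ==> sw C c (%a b. tens C C b a) = sw C c (tens C C)"
 shows "cocommutative C" using assms(2) unfolding cocommutative_def
 by(simp add: tflip_eq_tsum[OF coalgebra_kspace[OF assms(1)] cop_mem[OF assms(1)]]
   tsum_tens_id[OF coalgebra_kspace[OF assms(1)] cop_mem[OF assms(1)]])

declare coalgebra_kspace [lin del]

lemma assoc_algebra_kspace: "assoc_algebra A ==> kspace A" by(simp add: assoc_algebra_def)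

lemma kbil_mul: "assoc_algebra A ==> kbilinear A A A (mul A)" by(simp add: assoc_algebra_def)

lemma unit_mem [lin]: "assoc_algebra A ==> unit A .: A" by(simp add: assoc_algebra_def)

lemma mul_mem [lin]: "assoc_algebra A ==> a .: A ==> b .: A ==> mul A a b .: A"
 by(rule kbilin(1)[OF kbil_mul])

lemma mul_right [lin]:
 "assoc_algebra A ==> a .: A ==> klinear D A g ==> klinear D A (%x. mul A a (g x))" by(rule kbilin(2)[OF kbil_mul])

lemma mul_left [lin]:
 "assoc_algebra A ==> b .: A ==> klinear D A g ==> klinear D A (%x. mul A (g x) b)" by(rule kbilin(3)[OF kbil_mul])

lemma mul_assoc:
 "assoc_algebra A ==> a .: A ==> b .: A ==> c .: A ==> mul A (mul A a b) c = mul A a (mul A b c)"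
 by(simp add: assoc_algebra_def)

lemma mul_unit:
 "assoc_algebra A ==> a .: A ==> mul A (unit A) a = a"
 "assoc_algebra A ==> a .: A ==> mul A a (unit A) = a" by(simp_all add: assoc_algebra_def)

lemma mul_smul:
 assumes "assoc_algebra A" "a .: A" "b .: A"
 shows "mul A (smul A c a) b = smul A c (mul A a b)" "mul A a (smul A c b) = smul A c (mul A a b)"
 using kbil_mul[OF assms(1)] assms(2,3) by(auto simp: kbilinear_def klinear_def)

lemma mul_tsum_left:
 assumes "assoc_algebra A" "b .: A" "!!x y. x .: X ==> y .: Y ==> f x y .: A"
 shows "mul A (tsum X Y t f) b = tsum X Y t (%x y. mul A (f x y) b)"
 by(rule klin_tsum[where g = "%a. mul A a b", OF assoc_algebra_kspace assoc_algebra_kspace])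
  (rule assms lin |assumption)+

lemma mul_tsum_right:
 assumes "assoc_algebra A" "b .: A" "!!x y. x .: X ==> y .: Y ==> f x y .: A"
 shows "mul A b (tsum X Y t f) = tsum X Y t (%x y. mul A b (f x y))"
 by(rule klin_tsum[where g = "%a. mul A b a", OF assoc_algebra_kspace assoc_algebra_kspace])
  (rule assms lin |assumption)+

lemma tens_mul_eq_tsum:
 assumes A: "kspace A" and m: "kbilinear A A A m" and u: "u .: (tensor A A)" and v: "v .: (tensor A A)"
 shows "tens_mul A m u v =
  tsum A A u (%a b. tsum A A v (%a' b'. tens A A (m a a') (m b b')))"
proof -
 note [lin] = A kbilin[OF m]
 have 1: "tlift A A (tensor A A) (%a' b'. tens A A (m a a') (m b b')) v =
   tsum A A v (%a' b'. tens A A (m a a') (m b b'))" if "a .: A" "b .: A" for a b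
  by(rule tlift_eq_tsum[OF A ksp_tens _ v]) (rule lin that |assumption)+
 have 2: "kbilinear A A (tensor A A) (%a b. tsum A A v (%a' b'. tens A A (m a a') (m b b')))" by(rule lin |assumption)+
 have "kbilinear A A (tensor A A)
   (%a b. tlift A A (tensor A A) (%a' b'. tens A A (m a a') (m b b')) v)" apply(rule kbilinearI)
   apply(rule klin_cong[OF A kbil_right[OF 2 _ klin_id]], assumption) apply(rule 1; assumption)
  apply(rule klin_cong[OF A kbil_left[OF 2 _ klin_id]], assumption) apply(rule 1; assumption) done
 from tlift_eq_tsum[OF A ksp_tens this u] show ?thesis unfolding tens_mul_def by(simp add: 1)
qed

lemma bialgebra_algebra: "bialgebra A ==> assoc_algebra A" by(simp add: bialgebra_def)

lemma bialgebra_coalgebra: "bialgebra A ==> coalgebra A" by(simp add: bialgebra_def)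

lemma bialgebra_cou:
 "bialgebra A ==> a .: A ==> b .: A ==> cou A (mul A a b) = cou A a * cou A b"
 "bialgebra A ==> cou A (unit A) = 1" by(simp_all add: bialgebra_def)

lemma bialgebra_cop_mul:
 assumes "bialgebra A" "a .: A" "b .: A"
 shows "cop A (mul A a b) =
  sw A a (%a1 a2. sw A b (%b1 b2. tens A A (mul A a1 b1) (mul A a2 b2)))" using assms
 by(simp add: bialgebra_def tens_mul_eq_tsum[OF assoc_algebra_kspace kbil_mul cop_mem cop_mem])

lemma sw_mul:
 assumes "kspace D" "bialgebra A" "a .: A" "b .: A" "kbilinear A A D F"
 shows "sw A (mul A a b) F = sw A a (%a1 a2. sw A b (%b1 b2. F (mul A a1 b1) (mul A a2 b2)))"
proof -
 note alg = bialgebra_algebra[OF assms(2)]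
 note A = assoc_algebra_kspace[OF alg]
 show ?thesis unfolding bialgebra_cop_mul[OF assms(2-4)] apply(subst tsum_tsum[OF A assms(1,5)])
   apply(rule lin alg |assumption)+ apply(rule tsum_eq) apply(subst tsum_tsum[OF A assms(1,5)])
   apply(rule lin alg |assumption)+ apply(rule tsum_eq) apply(rule tsum_tens[OF A assms(1,5)])
   apply(rule lin alg |assumption)+ done
qed

lemma sw_unit:
 assumes "kspace D" "bialgebra A" "kbilinear A A D F"
 shows "sw A (unit A) F = F (unit A) (unit A)"
 using tsum_tens[OF assoc_algebra_kspace[OF bialgebra_algebra[OF assms(2)]] assms(1,3)]
  unit_mem[OF bialgebra_algebra[OF assms(2)]] assms(2) by(simp add: bialgebra_def)

definition kquadrilinear where
 "kquadrilinear A B C D E f \<longleftrightarrow>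
   (\<forall>a\<in>car A. ktrilinear B C D E (f a)) &
   (\<forall>b\<in>car B. \<forall>c\<in>car C. \<forall>d\<in>car D. klinear A E (%a. f a b c d))"

lemma kquadrilinearI [lin]:
 assumes "!!a b c. a .: A ==> b .: B ==> c .: C ==> klinear D E (%d. f a b c d)"
  and "!!a b d. a .: A ==> b .: B ==> d .: D ==> klinear C E (%c. f a b c d)"
  and "!!a c d. a .: A ==> c .: C ==> d .: D ==> klinear B E (%b. f a b c d)"
  and "!!b c d. b .: B ==> c .: C ==> d .: D ==> klinear A E (%a. f a b c d)"
 shows "kquadrilinear A B C D E f" using assms by(simp add: kquadrilinear_def ktrilinear_def kbilinear_def)

lemma kquadrilin:
 assumes "kquadrilinear A B C D E f"
 shows "a .: A ==> b .: B ==> c .: C ==> klinear X D g ==> klinear X E (%x. f a b c (g x))"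
  and "a .: A ==> b .: B ==> d .: D ==> klinear X C g ==> klinear X E (%x. f a b (g x) d)"
  and "a .: A ==> c .: C ==> d .: D ==> klinear X B g ==> klinear X E (%x. f a (g x) c d)"
  and "b .: B ==> c .: C ==> d .: D ==> klinear X A g ==> klinear X E (%x. f (g x) b c d)"
proof -
 have t: "ktrilinear B C D E (f a)" if "a .: A" for a using assms that by(simp add: kquadrilinear_def)
 show "a .: A ==> b .: B ==> c .: C ==> klinear X D g ==> klinear X E (%x. f a b c (g x))"
  by(rule ktrilinear_3[OF t])
 show "a .: A ==> b .: B ==> d .: D ==> klinear X C g ==> klinear X E (%x. f a b (g x) d)"
  by(rule ktrilinear_2[OF t])
 show "a .: A ==> c .: C ==> d .: D ==> klinear X B g ==> klinear X E (%x. f a (g x) c d)"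
  by(rule ktrilinear_1[OF t])
 show "b .: B ==> c .: C ==> d .: D ==> klinear X A g ==> klinear X E (%x. f (g x) b c d)"
  using assms by(auto simp: kquadrilinear_def intro: klin_comp[of A E "%a. f a b c d"])
qed

text \<open>Exchanging the middle two of four Sweedler factors.\<close>

lemma sw_exchange:
 assumes D: "kspace D" and C: "coalgebra C" and co: "cocommutative C" and c: "c .: C"
  and F: "kquadrilinear C C C C D F"
 shows "sw C c (%a b. sw C a (%p q. sw C b (%x y. F p q x y))) =
     sw C c (%a b. sw C a (%p q. sw C b (%x y. F p x q y)))"
proof -
 note [lin] = D C coalgebra_kspace[OF C]
 \<comment> \<open>Coassociativity brings four factors into the form in which the two middle ones
   come from a single coproduct. There cocommutativity exchanges them.\<close>
 have normal: "sw C c (%a b. sw C a (%p q. sw C b (%x y. G p q x y))) =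
   sw C c (%p r. sw C r (%e y. sw C e (%q x. G p q x y)))"
  if G: "kquadrilinear C C C C D G" for G
 proof -
  have "sw C c (%a b. sw C a (%p q. sw C b (%x y. G p q x y))) =
    sw C c (%p r. sw C r (%q b. sw C b (%x y. G p q x y)))"
   by(rule sw_coassoc[OF D C c]) (rule lin kquadrilin[OF G] |assumption)+
  also have "... = sw C c (%p r. sw C r (%e y. sw C e (%q x. G p q x y)))"
   by(rule tsum_eq, rule sw_coassoc[OF D C, symmetric], assumption) (rule lin kquadrilin[OF G] |assumption)+
  finally show ?thesis .
 qed
 have F': "kquadrilinear C C C C D (%p q x y. F p x q y)" by(rule lin kquadrilin[OF F] |assumption)+
 have "sw C c (%p r. sw C r (%e y. sw C e (%q x. F p q x y))) =
   sw C c (%p r. sw C r (%e y. sw C e (%q x. F p x q y)))"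
  by(rule tsum_eq, rule tsum_eq, rule sw_cocomm[OF D C co], assumption) (rule lin kquadrilin[OF F] |assumption)+
 then show ?thesis by(simp only: normal[OF F] normal[OF F'])
qed

section \<open>The antipode reverses products and, in the cocommutative case, is a coalgebra
  map\<close>

section \<open>Antipodes\<close>

locale hopf =
 fixes H :: "('k::field, 'h::ab_group_add, 'z) kbialg_scheme"
 assumes hopf: "hopf_algebra H"
begin

lemma bialg [lin]: "bialgebra H" using hopf by(simp add: hopf_algebra_def)

lemma alg [lin]: "assoc_algebra H" by(rule bialgebra_algebra[OF bialg])
lemma coalg [lin]: "coalgebra H" by(rule bialgebra_coalgebra[OF bialg])
lemma ksp [lin]: "kspace H" by(rule coalgebra_kspace[OF coalg])

abbreviation mult (infixl "\<cdot>" 70) where "a \<cdot> b \<equiv> mul H a b"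
abbreviation S where "S \<equiv> antipode H"
abbreviation one where "one \<equiv> unit H"
abbreviation eps where "eps \<equiv> cou H"

lemma is_antipode: "is_antipode H S"
proof -
 have "\<exists>S. is_antipode H S" using hopf by(simp add: hopf_algebra_def)
 then show ?thesis unfolding antipode_def by(rule someI_ex)
qed

lemma klin_S: "klinear H H S" using is_antipode by(simp add: is_antipode_def)

lemma S_mem [lin]: "h .: H ==> S h .: H" by(rule klin_mem[OF klin_S])
lemma S_lin [lin]: "klinear E H g ==> klinear E H (%x. S (g x))" by(rule klin_comp[OF klin_S])

lemma antipode_eq:
 assumes D: "kspace D" and g: "klinear H D g" and h: "h .: H"
 shows antipode_left: "sw H h (%a b. g (S a \<cdot> b)) = smul D (eps h) (g one)"
  and antipode_right: "sw H h (%a b. g (a \<cdot> S b)) = smul D (eps h) (g one)"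
proof -
 have b: "kbilinear H H H (%b c. mul H (S b) c)" "kbilinear H H H (%b c. mul H b (S c))" by(rule lin |assumption)+
 note eq = tlift_eq_tsum[OF ksp ksp _ cop_mem[OF coalg h]]
 have 1: "sw H h (%b c. mul H (S b) c) = smul H (eps h) one" "sw H h (%b c. mul H b (S c)) = smul H (eps h) one"
  using is_antipode h by(simp_all add: is_antipode_def eq[OF b(1), symmetric] eq[OF b(2), symmetric])
 have "g (sw H h (%b c. mul H (S b) c)) = sw H h (%a b. g (S a \<cdot> b))"
  by(rule klin_tsum[OF ksp D g]) (rule lin |assumption)+
 then show "sw H h (%a b. g (S a \<cdot> b)) = smul D (eps h) (g one)" by(simp add: 1 klin_scale[OF g] unit_mem[OF alg])
 have "g (sw H h (%b c. mul H b (S c))) = sw H h (%a b. g (a \<cdot> S b))"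
  by(rule klin_tsum[OF ksp D g]) (rule lin |assumption)+
 then show "sw H h (%a b. g (a \<cdot> S b)) = smul D (eps h) (g one)" by(simp add: 1 klin_scale[OF g] unit_mem[OF alg])
qed

lemma antipode_one: "S one = one"
proof -
 have "sw H one (%a b. S a \<cdot> b) = S one \<cdot> one" by(rule sw_unit[OF ksp bialg]) (rule lin |assumption)+
 moreover have "sw H one (%a b. S a \<cdot> b) = smul H (eps one) one" by(rule antipode_left[OF ksp klin_id]) (rule lin)+
 ultimately show ?thesis by(simp add: bialgebra_cou[OF bialg] smul_one[OF ksp] mul_unit[OF alg] S_mem unit_mem[OF alg])
qed

text \<open>Both sides are convolution inverse to the multiplication map on H \<otimes> H.
  Concretely, the sum \<open>?X\<close> of S(h1 g1) (h2 g2) (S(g3) S(h3)) reduces to either side,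
  depending on whether the left or the right part is contracted first.\<close>

lemma antipode_mul:
 assumes h: "h .: H" and g: "g .: H"
 shows "S (h \<cdot> g) = S g \<cdot> S h"
proof -
 let ?X = "sw H h (%a h3. sw H a (%h1 h2. sw H g (%b g3. sw H b (%g1 g2.
   (S (h1 \<cdot> g1) \<cdot> (h2 \<cdot> g2)) \<cdot> (S g3 \<cdot> S h3)))))"
 \<comment> \<open>Contraction on the left: the antipode identity for the product
   \<open>a \<cdot> b\<close>.\<close>
 have *: "sw H a (%h1 h2. sw H b (%g1 g2. (S (h1 \<cdot> g1) \<cdot> (h2 \<cdot> g2)) \<cdot> c)) = smul H (eps a) (smul H (eps b) c)"
  if "a .: H" "b .: H" "c .: H" for a b c
 proof -
  have "sw H (a \<cdot> b) (%x y. (S x \<cdot> y) \<cdot> c) = sw H a (%h1 h2. sw H b (%g1 g2. (S (h1 \<cdot> g1) \<cdot> (h2 \<cdot> g2)) \<cdot> c))"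
   by(rule sw_mul[OF ksp bialg that(1,2)]) (rule lin that |assumption)+
  moreover have "sw H (a \<cdot> b) (%x y. (S x \<cdot> y) \<cdot> c) = smul H (eps (a \<cdot> b)) (one \<cdot> c)"
   by(rule antipode_left[OF ksp, where g = "%x. x \<cdot> c"]) (rule lin that |assumption)+
  ultimately show ?thesis using that by(simp add: bialgebra_cou[OF bialg] mul_unit[OF alg] smul_smul[OF ksp])
 qed
 have "?X = sw H h (%a h3. sw H g (%b g3. sw H a (%h1 h2. sw H b (%g1 g2.
   (S (h1 \<cdot> g1) \<cdot> (h2 \<cdot> g2)) \<cdot> (S g3 \<cdot> S h3)))))" by(rule tsum_eq, rule tsum_swap)
 also have "... = sw H h (%a h3. sw H g (%b g3. smul H (eps a) (smul H (eps b) (S g3 \<cdot> S h3))))"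
  by(simp add: * mul_mem[OF alg] S_mem)
 also have "... = sw H h (%a h3. smul H (eps a) (S g \<cdot> S h3))" apply(rule tsum_eq)
  apply(subst smul_tsum[OF ksp, symmetric]) apply(rule arg_cong[of _ _ "smul H _"])
  apply(rule sw_counit_left[OF ksp coalg g, where f = "%g3. S g3 \<cdot> S _"]) apply(rule lin |assumption)+ done
 also have "... = S g \<cdot> S h" by(rule sw_counit_left[OF ksp coalg h]) (rule lin g |assumption)+
 finally have 1: "?X = S g \<cdot> S h" .
 \<comment> \<open>Contraction on the right, from the inside out: first g2 S(g3), then h2
   S(h3).\<close>
 have **: "sw H c (%h2 h3. sw H d (%g2 g3. (u \<cdot> (h2 \<cdot> g2)) \<cdot> (S g3 \<cdot> S h3))) = smul H (eps c) (smul H (eps d) u)"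
  if "c .: H" "d .: H" "u .: H" for c d u
 proof -
  have "sw H c (%h2 h3. sw H d (%g2 g3. (u \<cdot> (h2 \<cdot> g2)) \<cdot> (S g3 \<cdot> S h3))) =
   sw H c (%h2 h3. sw H d (%g2 g3. u \<cdot> (h2 \<cdot> ((g2 \<cdot> S g3) \<cdot> S h3))))"
   using that by(simp add: mul_assoc[OF alg] mul_mem[OF alg] S_mem)
  also have "... = sw H c (%h2 h3. smul H (eps d) (u \<cdot> (h2 \<cdot> (one \<cdot> S h3))))" apply(rule tsum_eq)
   apply(rule antipode_right[OF ksp, where g = "%x. u \<cdot> (_ \<cdot> (x \<cdot> S _))"])
   apply(rule lin that |assumption)+ done
  also have "... = sw H c (%h2 h3. smul H (eps d) (u \<cdot> (h2 \<cdot> S h3)))" by(simp add: mul_unit[OF alg] S_mem)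
  also have "... = smul H (eps c) (smul H (eps d) (u \<cdot> one))"
   by(rule antipode_right[OF ksp, where g = "%x. smul H (eps d) (u \<cdot> x)"]) (rule lin that |assumption)+
  finally show ?thesis using that by(simp add: mul_unit[OF alg])
 qed
 have "?X = sw H h (%h1 c. sw H c (%h2 h3. sw H g (%b g3. sw H b (%g1 g2.
   (S (h1 \<cdot> g1) \<cdot> (h2 \<cdot> g2)) \<cdot> (S g3 \<cdot> S h3)))))"
  by(rule sw_coassoc[OF ksp coalg h]) (rule lin g |assumption)+
 also have "... = sw H h (%h1 c. sw H c (%h2 h3. sw H g (%g1 d. sw H d (%g2 g3.
   (S (h1 \<cdot> g1) \<cdot> (h2 \<cdot> g2)) \<cdot> (S g3 \<cdot> S h3)))))"
  by(rule tsum_eq, rule tsum_eq, rule sw_coassoc[OF ksp coalg g]) (rule lin |assumption)+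
 also have "... = sw H h (%h1 c. sw H g (%g1 d. sw H c (%h2 h3. sw H d (%g2 g3.
   (S (h1 \<cdot> g1) \<cdot> (h2 \<cdot> g2)) \<cdot> (S g3 \<cdot> S h3)))))" by(rule tsum_eq, rule tsum_swap)
 also have "... = sw H h (%h1 c. sw H g (%g1 d. smul H (eps c) (smul H (eps d) (S (h1 \<cdot> g1)))))"
  by(simp add: ** mul_mem[OF alg] S_mem)
 also have "... = sw H h (%h1 c. smul H (eps c) (S (h1 \<cdot> g)))" apply(rule tsum_eq)
  apply(subst smul_tsum[OF ksp, symmetric]) apply(rule arg_cong[of _ _ "smul H _"])
  apply(rule sw_counit_right[OF ksp coalg g, where f = "%g1. S (_ \<cdot> g1)"]) apply(rule lin |assumption)+ done
 also have "... = S (h \<cdot> g)" by(rule sw_counit_right[OF ksp coalg h]) (rule lin g |assumption)+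
 finally have 2: "?X = S (h \<cdot> g)" .
 from 2[symmetric] 1 show ?thesis by(rule trans)
qed

end

locale cocomm_hopf = hopf H
 for H :: "('k::field, 'h::ab_group_add, 'z) kbialg_scheme" +
 assumes cocomm: "cocommutative H"
begin

text \<open>\<open>E u c\<close> stands for \<open>\<Delta>(u) (S \<otimes> S)(\<Delta>(c))\<close>; the two ways to reduce the sum of \<open>E (S h\<^sub>1 h\<^sub>2) h\<^sub>3\<close>
 are compared.\<close>

lemma sw_antipode:
 assumes D: "kspace D" and F: "kbilinear H H D F" and h: "h .: H"
 shows "sw H (S h) F = sw H h (%a b. F (S a) (S b))"
proof -
 note [lin] = D kbilin[OF F]
 define E where "E u c = sw H u (%p q. sw H c (%x y. F (p \<cdot> S x) (q \<cdot> S y)))" for u c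
 have E: "kbilinear H H D E" unfolding E_def by(rule lin |assumption)+
 note [lin] = kbilin[OF E]
 have one: "one .: H" by(rule unit_mem[OF alg])
 have E_one: "E one c = sw H c (%x y. F (S x) (S y))" if c: "c .: H" for c
 proof -
  have "E one c = sw H c (%x y. F (one \<cdot> S x) (one \<cdot> S y))"
   unfolding E_def by(rule sw_unit[OF D bialg]) (rule c lin |assumption)+
  then show ?thesis by(simp add: mul_unit[OF alg] S_mem)
 qed
 have E_right: "sw H b (%b1 b2. E (u \<cdot> b1) b2) = smul D (eps b) (sw H u F)" if u: "u .: H" and b: "b .: H" for u b
 proof -
  have "sw H b (%b1 b2. E (u \<cdot> b1) b2) =
    sw H b (%b1 b2. sw H u (%p q. sw H b1 (%r s. sw H b2 (%x y. F (p \<cdot> r \<cdot> S x) (q \<cdot> s \<cdot> S y)))))"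
   unfolding E_def by(rule tsum_eq, rule sw_mul[OF D bialg u]) (rule lin |assumption)+
  also have "... = sw H u (%p q. sw H b (%b1 b2. sw H b1 (%r s. sw H b2 (%x y. F (p \<cdot> r \<cdot> S x) (q \<cdot> s \<cdot> S y)))))"
   by(rule tsum_swap)
  \<comment> \<open>After exchanging the middle factors each of the two inner coproducts contributes
    an element times the antipode of its partner, so both collapse to counits.\<close>
  also have "... = sw H u (%p q. sw H b (%b1 b2. sw H b1 (%r x. sw H b2 (%s y. F (p \<cdot> r \<cdot> S x) (q \<cdot> s \<cdot> S y)))))"
   by(rule tsum_eq, rule sw_exchange[OF D coalg cocomm b]) (rule lin |assumption)+
  also have "... = sw H u (%p q. smul D (eps b) (F p q))"
  proof (rule tsum_eq)
   fix p q assume c: "p .: H" "q .: H"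
   have red: "sw H v (%s y. g (z \<cdot> s \<cdot> S y)) = smul D (eps v) (g z)"
    if v: "v .: H" and z: "z .: H" and g: "klinear H D g" for v z g
   proof -
    have "sw H v (%s y. g (z \<cdot> s \<cdot> S y)) = sw H v (%s y. g (z \<cdot> (s \<cdot> S y)))"
     by(rule tsum_eq) (simp only: mul_assoc[OF alg z] S_mem)
    also have "... = smul D (eps v) (g (z \<cdot> one))"
     by(rule antipode_right[where g = "%w. g (z \<cdot> w)", OF D klin_comp[OF g mul_right[OF alg z klin_id]] v])
    finally show ?thesis by(simp only: mul_unit(2)[OF alg z])
   qed
   have "sw H b (%b1 b2. sw H b1 (%r x. sw H b2 (%s y. F (p \<cdot> r \<cdot> S x) (q \<cdot> s \<cdot> S y)))) =
     sw H b (%b1 b2. smul D (eps b2) (sw H b1 (%r x. F (p \<cdot> r \<cdot> S x) q)))" unfolding smul_tsum[OF D]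
    by(rule tsum_eq, rule tsum_eq, rule red) (rule c lin |assumption)+
   also have "... = sw H b (%r x. F (p \<cdot> r \<cdot> S x) q)"
    by(rule sw_counit_right[OF D coalg b]) (rule c lin |assumption)+
   also have "... = smul D (eps b) (F p q)" by(rule red[OF b c(1) kbilin(3)[OF F c(2) klin_id]])
   finally show "sw H b (%b1 b2. sw H b1 (%r x. sw H b2 (%s y. F (p \<cdot> r \<cdot> S x) (q \<cdot> s \<cdot> S y)))) = smul D (eps b) (F p q)" .
  qed
  finally show ?thesis by(simp only: smul_tsum[OF D])
 qed
 have "sw H h (%a b. F (S a) (S b)) = sw H h (%a c. smul D (eps a) (E one c))" unfolding E_one[OF h, symmetric]
  by(rule sw_counit_left[OF D coalg h, symmetric]) (rule one lin)+
 also have "... = sw H h (%r c. sw H r (%a b. E (S a \<cdot> b) c))"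
  by(rule tsum_eq, rule antipode_left[OF D, symmetric]) (rule lin |assumption)+
 also have "... = sw H h (%a r. sw H r (%b c. E (S a \<cdot> b) c))" by(rule sw_coassoc[OF D coalg h]) (rule lin |assumption)+
 also have "... = sw H h (%a r. smul D (eps r) (sw H (S a) F))" by(rule tsum_eq) (simp only: E_right S_mem)
 also have "... = sw H (S h) F" by(rule sw_counit_right[OF D coalg h]) (rule lin |assumption)+
 finally show ?thesis by(rule sym)
qed

end

section \<open>Alternating bilinear maps vanish on cocommutative coproducts, in every
  characteristic\<close>

section \<open>Alternating forms on symmetric tensors\<close>

text \<open>Relative to a well-ordered basis the matrix of an alternating form is skew with zero
  diagonal, so it is its strictly upper triangular part minus the transpose of that part. No
  division by two occurs.\<close>

lemma alternating_bilinear_split: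
 assumes A: "kspace A" and F: "kbilinear A A ground F" and alt: "!!x. x .: A ==> F x x = 0"
 shows "\<exists>G. kbilinear A A ground G & (\<forall>x\<in>car A. \<forall>y\<in>car A. F x y = G x y - G y x)"
proof -
 interpret V: vector_space "smul A" using A by(rule kspace_vector_space)
 interpret P: vector_space_pair "smul A" "(*) :: 'a => 'a => 'a"
  using vector_space_mult by(simp add: vector_space_pair_def V.vector_space_axioms)
 obtain B where B: "B \<subseteq> car A" "V.independent B" "car A \<subseteq> V.span B" by(rule V.maximal_independent_subset)
 obtain r where "well_order_on B r" using well_order_on by blast
 then have tot: "total_on B r" and anti: "antisym r" by(auto simp: well_order_on_def linear_order_on_def partial_order_on_def)
 \<comment> \<open>The strictly upper triangular part of the matrix of \<open>F\<close>.\<close>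
 define g where "g i j = (if (i, j) : r & i ~= j then F i j else 0)" for i j
 define G where "G x y = P.construct B (%i. P.construct B (g i) y) x" for x y
 have lg: "klinear A ground f" if "Vector_Spaces.linear (smul A) (*) f" for f
 proof -
  interpret f: Vector_Spaces.linear "smul A" "(*) :: 'a => 'a => 'a" f by(rule that)
  show ?thesis by(rule klinearI) (simp_all add: f.add f.scale)
 qed
 have G: "kbilinear A A ground G"
 proof (rule kbilinearI)
  fix x assume "x .: A"
  have 1: "P.construct B (g i) (y + z) = P.construct B (g i) y + P.construct B (g i) z"
   "P.construct B (g i) (smul A c y) = c * P.construct B (g i) y" for i c y z using P.linear_construct[OF B(2), of "g i"]
   by(auto simp: Vector_Spaces.linear_iff)
  show "klinear A ground (%y. G x y)"
   by(rule klinearI) (simp_all add: G_def 1 P.construct_add[OF B(2)] P.construct_scale[OF B(2)])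
 next
  fix y
  show "klinear A ground (%x. G x y)" unfolding G_def by(rule lg[OF P.linear_construct[OF B(2)]])
 qed
 have G_basis: "G i j = g i j" if "i : B" "j : B" for i j using that by(simp add: G_def P.construct_basis[OF B(2)])
 define D where "D x y = F x y - (G x y - G y x)" for x y
 have D: "kbilinear A A ground D" unfolding D_def by(rule lin kbilin[OF F] kbilin[OF G] |assumption)+
 have add: "F (x + y) (x + y) = F x x + F x y + (F y x + F y y)" if "x .: A" "y .: A" for x y
  using that F by(simp add: kbilinear_def klinear_def ksp_add[OF A])
 have skew: "F j i = - F i j" if "i .: A" "j .: A" for i j
 proof -
  have "F i j + F j i = 0" using add[OF that] that by(simp add: alt ksp_add[OF A])
  then show ?thesis by(rule add.inverse_unique[symmetric])
 qed
 have na: "(j, i) \<notin> r" if "i ~= j" "(i, j) : r" for i j using antisymD[OF anti, of i j] that by blast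
 have D_basis: "D i j = 0" if "i : B" "j : B" for i j
 proof -
  have c: "i .: A" "j .: A" using that B(1) by auto
  have "i = j \<or> (i, j) : r \<or> (j, i) : r" using tot that unfolding total_on_def by blast
  then consider "i = j" | "i ~= j" "(i, j) : r" | "i ~= j" "(j, i) : r" by blast
  then show ?thesis
  proof cases
   case 1
   then show ?thesis by(simp add: D_def alt c)
  next
   case 2
   then show ?thesis using na[OF 2] by(simp add: D_def G_basis that g_def)
  next
   case 3
   then have "(i, j) \<notin> r" using na[of j i] by blast
   then show ?thesis using 3 by(simp add: D_def G_basis that g_def skew[OF c])
  qed
 qed
 have span_sub: "V.span B \<subseteq> car A" by(rule V.span_minimal[OF B(1) ksp_subspace[OF A]])
 have z: "f 0 = 0" if "klinear A ground f" for f by(rule klin_0[OF A ksp_ground that])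
 have step: "f y = 0" if f: "klinear A ground f" and fB: "!!j. j : B ==> f j = 0" and y: "y .: A" for f y
 proof -
  have "y : V.span B" using y B(3) by auto
  then have "y .: A & f y = 0"
  proof (induction rule: V.span_induct_alt)
   case base then show ?case using z[OF f] ksp_zero[OF A] by simp
  next
   case (step c u v)
   then have "u .: A" using B(1) by auto
   then show ?case using step fB f by(auto simp: klinear_def ksp_add[OF A] ksp_scale[OF A])
  qed
  then show ?thesis by simp
 qed
 have "D x y = 0" if "x .: A" "y .: A" for x y
 proof (rule step[where f = "%x. D x y"])
  show "klinear A ground (%x. D x y)" by(rule kbilin(3)[OF D that(2) klin_id])
  show "x .: A" by fact
  fix i assume i: "i : B"
  show "D i y = 0"
  proof (rule step[where f = "D i"])
   show "klinear A ground (D i)" using D i B(1) by(auto simp: kbilinear_def)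
  qed (use i D_basis that in auto)
 qed
 then show ?thesis using G by(intro exI[of _ G]) (auto simp: D_def)
qed

text \<open>Symmetric tensors are spanned by the \<open>x \<otimes> x\<close> and the \<open>x \<otimes> y + y \<otimes> x\<close>, so this holds in
 every characteristic.\<close>

lemma sw_alternating:
 assumes D: "kspace D" and C: "coalgebra C" and co: "cocommutative C" and c: "c .: C"
  and F: "kbilinear C C D F" and alt: "!!x. x .: C ==> F x x = 0"
 shows "sw C c F = 0"
proof (rule functionals_separate[OF kspace_vector_space[OF D]])
 \<comment> \<open>Linear functionals separate points, so \<open>F\<close> may be taken scalar
   valued and then split as above. The two halves have equal sums by cocommutativity.\<close>
 fix l assume l: "Vector_Spaces.linear (smul D) (*) l"
 interpret l: Vector_Spaces.linear "smul D" "(*) :: 'a => 'a => 'a" l by(rule l)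
 have lD: "klinear D ground l" by(rule klinearI) (simp_all add: l.add l.scale)
 note ksp = coalgebra_kspace[OF C]
 have lF: "kbilinear C C ground (%x y. l (F x y))"
  by(rule kbilinearI) (rule klin_comp[OF lD] kbilin[OF F] klin_id |assumption)+
 have "l (F x x) = 0" if "x .: C" for x using alt[OF that] by(simp add: l.zero)
 from alternating_bilinear_split[OF ksp lF this] obtain G where
  G: "kbilinear C C ground G" "!!x y. x .: C ==> y .: C ==> l (F x y) = G x y - G y x" by blast
 have "l (sw C c F) = sw C c (%x y. l (F x y))" by(rule klin_tsum[OF D ksp_ground lD]) (rule kbilin[OF F] |assumption)+
 also have "... = sw C c (%x y. G x y - G y x)" by(rule tsum_eq[OF G(2)])
 also have "... = sw C c G - sw C c (%x y. G y x)" by(rule tsum_diff)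
 also have "sw C c (%x y. G y x) = sw C c G" by(rule sw_cocomm[OF ksp_ground C co c G(1), symmetric])
 finally show "l (sw C c F) = l 0" by(simp add: l.zero)
qed

section \<open>Graded spaces, homogeneous components and sums over them\<close>

section \<open>Graded spaces\<close>

text \<open>Linear projections onto the pieces force uniqueness: applied to any decomposition of
  \<open>x\<close>, the projection \<open>p j\<close> picks out its term of degree
  \<open>j\<close>.\<close>

lemma graded_spaceI:
 assumes A: "kspace A" and G: "!!i. G i \<subseteq> car A" "!!i. module.subspace (smul A) (G i)"
  and p: "!!i. klinear A A (p i)" "!!i x. x .: A ==> p i x : G i"
   "!!i x. x : G i ==> p i x = x" "!!i j x. x : G i ==> i ~= j ==> p j x = 0"
  and fin: "!!x. x .: A ==> finite {i. p i x ~= 0}"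
  and sum: "!!x. x .: A ==> x = (\<Sum>i | p i x ~= 0. p i x)"
 shows "graded_space A G"
proof -
 have "f = (%i. p i x)" if x: "x .: A" and f: "decomposition G x f" for x f
 proof
  fix j
  have fin: "finite {i. f i ~= 0}" and fG: "!!i. f i : G i" and xs: "x = (\<Sum>i | f i ~= 0. f i)"
   using f by(auto simp: decomposition_def)
  have "p j x = (\<Sum>i | f i ~= 0. p j (f i))" by(subst xs, rule klin_sum[OF A A p(1)]) (use fG G(1) in blast)
  also have "... = (\<Sum>i | f i ~= 0. if i = j then f j else 0)" by(rule sum.cong) (auto simp: p(3,4)[OF fG])
  also have "... = f j" using fin by(simp add: sum.delta)
  finally show "f j = p j x" by simp
 qed
 moreover have "decomposition G x (%i. p i x)" if "x .: A" for x using that p(2) fin sum by(auto simp: decomposition_def)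
 ultimately show ?thesis unfolding graded_space_def using A G by blast
qed

lemma graded_space_kspace: "graded_space A G ==> kspace A" by(simp add: graded_space_def)

lemma graded_subset: "graded_space A G ==> x : G i ==> x .: A" by(auto simp: graded_space_def)

lemma graded_closed:
 assumes "graded_space A G"
 shows "0 : G i" "x : G i ==> y : G i ==> x + y : G i" "x : G i ==> smul A c x : G i"
proof -
 have m: "module (smul A)" by(rule ksp_module[OF graded_space_kspace[OF assms]])
 have s: "module.subspace (smul A) (G i)" using assms by(simp add: graded_space_def)
 show "0 : G i" "x : G i ==> y : G i ==> x + y : G i" "x : G i ==> smul A c x : G i"
  using s by(simp_all add: module.subspace_def[OF m])
qed

lemma component_decomposition:
 assumes "graded_space A G" "x .: A"
 shows "decomposition G x (component G x)"
proof -
 have "\<exists>!f. decomposition G x f" using assms by(auto simp: graded_space_def)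
 then show ?thesis unfolding component_def by(rule theI')
qed

lemma component_unique:
 assumes "graded_space A G" "x .: A" "decomposition G x f"
 shows "component G x = f"
proof -
 have "\<exists>!f. decomposition G x f" using assms by(auto simp: graded_space_def)
 then show ?thesis using component_decomposition[OF assms(1,2)] assms(3) by auto
qed

lemma component_grade: "graded_space A G ==> x .: A ==> component G x i : G i"
 using component_decomposition[of A G x] by(simp add: decomposition_def)

lemma component_mem: "graded_space A G ==> x .: A ==> component G x i .: A"
 by(rule graded_subset[OF _ component_grade])

lemma component_finite: "graded_space A G ==> x .: A ==> finite {i. component G x i ~= 0}"
 using component_decomposition[of A G x] by(simp add: decomposition_def)

lemma component_sum: "graded_space A G ==> x .: A ==> x = (\<Sum>i | component G x i ~= 0. component G x i)"
 using component_decomposition[of A G x] by(simp add: decomposition_def)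

lemma component_homogeneous:
 assumes "graded_space A G" "x : G n"
 shows "component G x = (%i. if i = n then x else 0)"
proof (rule component_unique[OF assms(1) graded_subset[OF assms]])
 have "{i. i = n & x ~= 0} = (if x = 0 then {} else {n})" by auto
 then show "decomposition G x (%i. if i = n then x else 0)"
  using assms(2) by(auto simp: decomposition_def graded_closed[OF assms(1)])
qed

text \<open>Sums over components run over the indices of nonzero components, a set that depends on
  the element. Widening it to a common finite set makes sums for different elements
  comparable.\<close>

lemma sum_nonzero_superset:
 assumes "finite I" "{i. f i ~= 0} \<subseteq> I" "!!i. f i = 0 ==> g i = 0"
 shows "(\<Sum>i | f i ~= 0. g i) = (\<Sum>i\<in>I. g i)" by(rule sum.mono_neutral_left) (use assms in auto)

lemma component_add:
 assumes "graded_space A G" "x .: A" "y .: A"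
 shows "component G (x + y) = (%i. component G x i + component G y i)"
proof (rule component_unique[OF assms(1)])
 note A = graded_space_kspace[OF assms(1)]
 show "x + y .: A" by(rule ksp_add[OF A assms(2,3)])
 let ?I = "{i. component G x i ~= 0} \<union> {i. component G y i ~= 0}"
 have fin: "finite ?I" using component_finite[OF assms(1)] assms(2,3) by simp
 have "x + y = (\<Sum>i\<in>?I. component G x i) + (\<Sum>i\<in>?I. component G y i)"
  using component_sum[OF assms(1,2)] component_sum[OF assms(1,3)]
  by(simp add: sum_nonzero_superset[OF fin, of "component G x"] sum_nonzero_superset[OF fin, of "component G y"])
 also have "... = (\<Sum>i\<in>?I. component G x i + component G y i)" by(simp add: sum.distrib)
 also have "... = (\<Sum>i | component G x i + component G y i ~= 0. component G x i + component G y i)"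
  by(rule sum_nonzero_superset[OF fin, symmetric]) auto
 finally have "x + y = ..." .
 moreover have "finite {i. component G x i + component G y i ~= 0}" by(rule finite_subset[OF _ fin]) auto
 ultimately show "decomposition G (x + y) (%i. component G x i + component G y i)" unfolding decomposition_def
  using graded_closed(2)[OF assms(1)] component_grade[OF assms(1)] assms(2,3) by simp
qed

lemma component_scale:
 assumes "graded_space A G" "x .: A"
 shows "component G (smul A c x) = (%i. smul A c (component G x i))"
proof (rule component_unique[OF assms(1)])
 note A = graded_space_kspace[OF assms(1)]
 show "smul A c x .: A" by(rule ksp_scale[OF A assms(2)])
 let ?I = "{i. component G x i ~= 0}"
 have fin: "finite ?I" using component_finite[OF assms(1)] assms(2) by simp
 have l: "klinear A A (smul A c)" using klin_smul[OF A klin_id] .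
 have "smul A c x = smul A c (\<Sum>i\<in>?I. component G x i)" using component_sum[OF assms] by simp
 also have "... = (\<Sum>i\<in>?I. smul A c (component G x i))" by(rule klin_sum[OF A A l]) (rule component_mem[OF assms])
 also have "... = (\<Sum>i | smul A c (component G x i) ~= 0. smul A c (component G x i))"
  by(rule sum_nonzero_superset[OF fin, symmetric]) (auto simp: smul_zero_right[OF A])
 finally have "smul A c x = ..." .
 moreover have "finite {i. smul A c (component G x i) ~= 0}"
  by(rule finite_subset[OF _ fin]) (auto simp: smul_zero_right[OF A])
 ultimately show "decomposition G (smul A c x) (%i. smul A c (component G x i))" unfolding decomposition_def
  using graded_closed(3)[OF assms(1)] component_grade[OF assms(1)] assms(2) by simp
qed

text \<open>Summation over the homogeneous components, in analogy with \<open>tsum\<close>.\<close>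

definition hsum :: "(nat => 'a::ab_group_add set) => 'a => (nat => 'a => 'c::ab_group_add) => 'c" where
 "hsum G x g = (\<Sum>i | component G x i ~= 0. g i (component G x i))"

lemma hsum_mem [lin]:
 "graded_space A G ==> x .: A ==> kspace D ==> (!!i y. y .: A ==> g i y .: D) ==> hsum G x g .: D"
 unfolding hsum_def by(rule ksp_sum) (auto intro: component_mem)

lemma hsum_cong:
 "graded_space A G ==> x .: A ==> (!!i y. y .: A ==> f i y = g i y) ==> hsum G x f = hsum G x g"
 unfolding hsum_def by(rule sum.cong) (auto intro: component_mem)

lemma klin_hsum:
 assumes A: "graded_space A G" and D: "kspace D" and g: "!!i. klinear A D (g i)"
 shows "klinear A D (%x. hsum G x g)"
proof (rule klinearI)
 note kA = graded_space_kspace[OF A]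
 have z: "g i 0 = 0" for i by(rule klin_0[OF kA D g])
 note fin = component_finite[OF A]
 show "hsum G x g .: D" if "x .: A" for x by(rule hsum_mem[OF A that D]) (rule klin_mem[OF g])
 show "hsum G (x + y) g = hsum G x g + hsum G y g" if "x .: A" "y .: A" for x y
 proof -
  let ?I = "{i. component G x i ~= 0} \<union> {i. component G y i ~= 0}"
  have f: "finite ?I" using fin that by simp
  have "hsum G (x + y) g = (\<Sum>i\<in>?I. g i (component G x i + component G y i))"
   unfolding hsum_def component_add[OF A that] by(rule sum_nonzero_superset[OF f]) (auto simp: z)
  also have "... = (\<Sum>i\<in>?I. g i (component G x i)) + (\<Sum>i\<in>?I. g i (component G y i))"
   using that by(simp add: klin_add[OF g] component_mem[OF A] sum.distrib)
  also have "... = hsum G x g + hsum G y g" unfolding hsum_def by(subst (1 2) sum_nonzero_superset[OF f]) (auto simp: z)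
  finally show ?thesis .
 qed
 show "hsum G (smul A c x) g = smul D c (hsum G x g)" if "x .: A" for c x
 proof -
  have "hsum G (smul A c x) g = (\<Sum>i | component G x i ~= 0. g i (smul A c (component G x i)))"
   unfolding hsum_def component_scale[OF A that]
   by(rule sum_nonzero_superset[OF fin[OF that]]) (auto simp: z smul_zero_right[OF kA])
  also have "... = (\<Sum>i | component G x i ~= 0. smul D c (g i (component G x i)))"
   using that by(simp add: klin_scale[OF g] component_mem[OF A])
  also have "... = smul D c (hsum G x g)" unfolding hsum_def by(rule module.scale_sum_right[OF ksp_module[OF D], symmetric])
  finally show ?thesis .
 qed
qed

lemma klin_hsum_arg [lin]:
 "graded_space A G ==> kspace D ==> klinear E A h ==> (!!i. klinear A D (g i)) ==> klinear E D (%x. hsum G (h x) g)"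
 by(rule klin_comp[OF klin_hsum])

lemma klin_hsum_fun [lin]:
 "graded_space A G ==> a .: A ==> kspace D ==> (!!i y. y .: A ==> klinear E D (%x. g x i y)) ==>
  klinear E D (%x. hsum G a (g x))" unfolding hsum_def by(rule klin_sum_fun) (auto intro: component_mem)

lemma klin_hsum_apply:
 assumes "graded_space A G" "x .: A" "kspace C" "kspace D" "klinear C D f" "!!i y. y .: A ==> g i y .: C"
 shows "f (hsum G x g) = hsum G x (%i y. f (g i y))"
 unfolding hsum_def by(rule klin_sum[OF assms(3-5)]) (auto intro: assms(6) component_mem[OF assms(1,2)])

lemma hsum_homogeneous:
 assumes "graded_space A G" "x : G n" "g n 0 = 0"
 shows "hsum G x g = g n x"
proof (cases "x = 0")
 \<comment> \<open>For \<open>x = 0\<close> the index set is empty and the sum is zero, which is why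
   \<open>g n 0 = 0\<close> is assumed.\<close>
 case True
 have "component G x = (%i. 0)" by(rule trans[OF component_homogeneous[OF assms(1,2)]]) (auto simp: True)
 then show ?thesis using True assms(3) by(simp add: hsum_def)
next
 case False
 then have "{i. component G x i ~= 0} = {n}" by(auto simp: component_homogeneous[OF assms(1,2)])
 then show ?thesis by(simp add: hsum_def component_homogeneous[OF assms(1,2)])
qed

lemma hsum_tsum: "hsum G x (%i y. tsum A B t (%a b. f i y a b)) = tsum A B t (%a b. hsum G x (%i y. f i y a b))"
 unfolding hsum_def by(rule tsum_sum[symmetric])

lemma graded_eqI:
 assumes A: "graded_space A G" and D: "kspace D" and f: "klinear A D f" and g: "klinear A D g"
  and eq: "!!n x. x : G n ==> f x = g x" and x: "x .: A"
 shows "f x = g x"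
proof -
 note kA = graded_space_kspace[OF A]
 have "h x = (\<Sum>i | component G x i ~= 0. h (component G x i))" if "klinear A D h" for h
  by(subst component_sum[OF A x], rule klin_sum[OF kA D that]) (rule component_mem[OF A x])
 from this[OF f] this[OF g] show ?thesis by(simp add: eq[OF component_grade[OF A x]])
qed

lemma sign_inv_eq_hsum: "sign_inv A G x = hsum G x (%i y. smul A ((- 1) ^ i) y)" by(simp add: sign_inv_def hsum_def)

lemma stens_mul_eq:
 assumes G: "graded_space A G" and m: "kbilinear A A A m" and u: "u .: (tensor A A)" and v: "v .: (tensor A A)"
 shows "stens_mul A G m u v = tsum A A u (%a b. tsum A A v (%a' b'.
  hsum G b (%i b. hsum G a' (%j a'. pscale ((- 1) ^ (i * j)) (tens A A (m a a') (m b b'))))))"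
proof -
 let ?f = "%a b a' b'. hsum G b (%i b. hsum G a' (%j a'. pscale ((- 1) ^ (i * j)) (tens A A (m a a') (m b b'))))"
 note A = graded_space_kspace[OF G]
 note [lin] = G A kbilin[OF m]
 have f: "kbilinear A A (tensor A A) (?f a b)" if "a .: A" "b .: A" for a b by(rule lin that |assumption)+
 have 1: "tlift A A (tensor A A) (?f a b) v = tsum A A v (?f a b)" if "a .: A" "b .: A" for a b
  by(rule tlift_eq_tsum[OF A ksp_tens f[OF that] v])
 have 2: "kbilinear A A (tensor A A) (%a b. tsum A A v (?f a b))" by(rule lin |assumption)+
 have "kbilinear A A (tensor A A) (%a b. tlift A A (tensor A A) (?f a b) v)" apply(rule kbilinearI)
   apply(rule klin_cong[OF A kbil_right[OF 2 _ klin_id]], assumption) apply(rule 1; assumption)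
  apply(rule klin_cong[OF A kbil_left[OF 2 _ klin_id]], assumption) apply(rule 1; assumption) done
 from tlift_eq_tsum[OF A ksp_tens this u]
 have "tlift A A (tensor A A) (%a b. tlift A A (tensor A A) (?f a b) v) u = tsum A A u (%a b. tsum A A v (?f a b))"
  by(simp add: 1)
 then show ?thesis unfolding stens_mul_def hsum_def .
qed

section \<open>Tensor constructions see only the carrier and the scalar multiplication\<close>

section \<open>Dependence on the underlying spaces\<close>

text \<open>The same vector space occurs in records with different further fields. The tensor
  spaces, pure tensors and Sweedler sums formed from such records are literally equal, so facts can
  be moved between them.\<close>

context
 fixes A :: "('k::field, 'a::ab_group_add, 'x) kspace_scheme" and A' :: "('k, 'a, 'xx) kspace_scheme"
  and B :: "('k, 'b::ab_group_add, 'y) kspace_scheme" and B' :: "('k, 'b, 'yy) kspace_scheme"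
 assumes A: "car A = car A'" "smul A = smul A'" and B: "car B = car B'" "smul B = smul B'"
begin

lemma kspace_cong: "kspace A = kspace A'" by(simp add: kspace_def A)

lemma bilinear_forms_cong: "bilinear_forms A B = bilinear_forms A' B'"
 by(simp add: bilinear_forms_def kbilinear_def klinear_def A B)

lemma tensor_cong: "tensor A B = tensor A' B'" by(simp add: tensor_def bilinear_forms_cong A B)

lemma tens_cong: "tens A B = tens A' B'" by(intro ext) (simp add: tens_def bilinear_forms_cong)

lemma tsum_cong_spaces: "tsum A B = (tsum A' B' :: _ => _ => 'c::ab_group_add)"
 by(intro ext) (simp add: tsum_def trep_def tens_cong A B)

end

lemma kbil_tsum_left:
 assumes "kbilinear A B C f" "kspace A" "kspace C" "b .: B" "!!x y. x .: X ==> y .: Y ==> g x y .: A"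
 shows "f (tsum X Y t g) b = tsum X Y t (%x y. f (g x y) b)"
 by(rule klin_tsum[where g = "%a. f a b", OF assms(2,3) _ assms(5)])
  (rule kbilin(3)[OF assms(1,4) klin_id])

lemma kbil_tsum_right:
 assumes "kbilinear A B C f" "kspace B" "kspace C" "a .: A" "!!x y. x .: X ==> y .: Y ==> g x y .: B"
 shows "f a (tsum X Y t g) = tsum X Y t (%x y. f a (g x y))"
 by(rule klin_tsum[where g = "%b. f a b", OF assms(2,3) _ assms(5)])
  (rule kbilin(2)[OF assms(1,4) klin_id])

section \<open>The tensor product coalgebra\<close>

section \<open>Tensor products of coalgebras\<close>

text \<open>\<open>T\<close> may carry further structure: only its underlying space and its
  coalgebra maps are prescribed. Both cross products, with their different products, become
  instances.\<close>

locale tens_coalg =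
 fixes A :: "('k::field, 'a::ab_group_add, 'x) kcoalg_scheme"
  and B :: "('k, 'b::ab_group_add, 'y) kcoalg_scheme"
  and T :: "('k, ('a, 'b, 'k) tensor, 'z) kcoalg_scheme"
 assumes coalgA [lin]: "coalgebra A" and coalgB [lin]: "coalgebra B"
  and carT: "car T = car (tensor A B)" and smulT [lin, simp]: "smul T = pscale"
  and copT: "!!u. u .: T ==> cop T u = tens_cop A B u"
  and couT: "!!u. u .: T ==> cou T u = tens_cou A B u"
begin

abbreviation tn (infixr "<*>" 75) where "a <*> b \<equiv> tens A B a b"

lemma kspA [lin]: "kspace A" by(rule coalgebra_kspace[OF coalgA])
lemma kspB [lin]: "kspace B" by(rule coalgebra_kspace[OF coalgB])

lemma sT: "car T = car (tensor A B)" "smul T = smul (tensor A B)" by(simp_all add: carT)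

lemma kspT [lin]: "kspace T" using kspace_cong[OF sT sT] by simp

lemma TT: "tensor (tensor A B) (tensor A B) = tensor T T" "tens (tensor A B) (tensor A B) = tens T T"
 using tensor_cong[OF sT sT] tens_cong[OF sT sT] by simp_all

lemma to_tensor [lin]: "klinear E T g ==> klinear E (tensor A B) g" by(simp add: klinear_def carT)

lemma from_tensor: "klinear E (tensor A B) g ==> klinear E T g" by(simp add: klinear_def carT)

lemma from_tensor': "klinear (tensor A B) E g ==> klinear T E g" by(simp add: klinear_def carT)

lemma to_tensor': "klinear T E g ==> klinear (tensor A B) E g" by(simp add: klinear_def carT)

lemma tn_mem [lin]: "a .: A ==> b .: B ==> a <*> b .: T" unfolding carT by(rule tens_lin)

lemma tn_right [lin]: "a .: A ==> klinear E B g ==> klinear E T (%x. a <*> g x)" by(rule from_tensor, rule tens_lin)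

lemma tn_left [lin]: "b .: B ==> klinear E A g ==> klinear E T (%x. g x <*> b)" by(rule from_tensor, rule tens_lin)

lemma T_eqI:
 assumes "kspace D" "klinear T D f" "klinear T D g"
  and "!!a b. a .: A ==> b .: B ==> f (a <*> b) = g (a <*> b)" and "t .: T"
 shows "f t = g t" by(rule tensor_eqI[OF kspA assms(1) to_tensor'[OF assms(2)] to_tensor'[OF assms(3)] assms(4)])
  (use assms(5) carT in auto)

lemma tsum_tn: "kspace D ==> kbilinear A B D f ==> a .: A ==> b .: B ==> tsum A B (a <*> b) f = f a b"
 by(rule tsum_tens[OF kspA])

lemma cop_tn:
 shows "a .: A ==> b .: B ==> cop T (a <*> b) = sw A a (%a1 a2. sw B b (%b1 b2. tens T T (a1 <*> b1) (a2 <*> b2)))"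
  and klin_copT: "klinear T (tensor T T) (cop T)"
proof -
 let ?TT = "tensor T T"
 let ?g = "%a b. sw A a (%a1 a2. sw B b (%b1 b2. tens T T (a1 <*> b1) (a2 <*> b2)))"
 let ?f = "%a b. tlift A A ?TT (%a1 a2. tlift B B ?TT (%b1 b2. tens T T (a1 <*> b1) (a2 <*> b2)) (cop B b)) (cop A a)"
 have 1: "tlift B B ?TT (%b1 b2. tens T T (a1 <*> b1) (a2 <*> b2)) (cop B b) =
   sw B b (%b1 b2. tens T T (a1 <*> b1) (a2 <*> b2))"
  if "a1 .: A" "a2 .: A" "b .: B" for a1 a2 b by(rule tlift_eq_tsum) (rule lin that |assumption)+
 have 2: "?f a b = ?g a b" if ab: "a .: A" "b .: B" for a b
 proof -
  have b3: "kbilinear A A ?TT (%a1 a2. sw B b (%b1 b2. tens T T (a1 <*> b1) (a2 <*> b2)))"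
   by(rule lin ab |assumption)+
  have "kbilinear A A ?TT (%a1 a2. tlift B B ?TT (%b1 b2. tens T T (a1 <*> b1) (a2 <*> b2)) (cop B b))"
   apply(rule kbilinearI) apply(rule klin_cong[OF kspA kbilin(2)[OF b3 _ klin_id]], assumption)
    apply(rule 1[OF _ _ ab(2)]; assumption) apply(rule klin_cong[OF kspA kbilin(3)[OF b3 _ klin_id]], assumption)
   apply(rule 1[OF _ _ ab(2)]; assumption) done
  from tlift_eq_tsum[OF kspA ksp_tens this cop_mem[OF coalgA ab(1)]]
  show ?thesis by(simp add: 1 ab)
 qed
 have g: "kbilinear A B ?TT ?g" by(rule lin |assumption)+
 have f: "kbilinear A B ?TT ?f" apply(rule kbilinearI)
   apply(rule klin_cong[OF kspB kbilin(2)[OF g _ klin_id]], assumption) apply(rule 2; assumption)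
  apply(rule klin_cong[OF kspA kbilin(3)[OF g _ klin_id]], assumption) apply(rule 2; assumption) done
 have tc: "tens_cop A B = tlift A B ?TT ?f" by(intro ext) (simp add: tens_cop_def Let_def TT)
 show "a .: A ==> b .: B ==> cop T (a <*> b) = ?g a b"
  by(simp add: copT tn_mem tc tlift_tens[OF ksp_tens f] 2)
 show "klinear T (tensor T T) (cop T)"
  by(rule klin_cong[OF kspT from_tensor'[OF klinear_tlift[OF ksp_tens f]]]) (simp add: copT tc)
qed

lemma cou_tn:
 shows "a .: A ==> b .: B ==> cou T (a <*> b) = cou A a * cou B b"
  and klin_couT: "klinear T ground (cou T)"
proof -
 have f: "kbilinear A B ground (%a b. cou A a * cou B b)" by(rule lin |assumption)+
 show "a .: A ==> b .: B ==> cou T (a <*> b) = cou A a * cou B b"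
  by(simp add: couT tn_mem tens_cou_def tlift_tens[OF ksp_ground f])
 show "klinear T ground (cou T)"
  by(rule klin_cong[OF kspT from_tensor'[OF klinear_tlift[OF ksp_ground f]]]) (simp add: couT tens_cou_def)
qed

lemma copT_lin: "klinear E T g ==> klinear E (tensor T T) (%x. cop T (g x))" by(rule klin_comp[OF klin_copT])

lemma couT_lin: "klinear E T g ==> klinear E ground (%x. cou T (g x))" by(rule klin_comp[OF cou_tn(2)])

lemma sw_tn:
 assumes D: "kspace D" and F: "kbilinear T T D F" and ab: "a .: A" "b .: B"
 shows "sw T (a <*> b) F = sw A a (%a1 a2. sw B b (%b1 b2. F (a1 <*> b1) (a2 <*> b2)))"
 unfolding cop_tn(1)[OF ab] apply(subst tsum_tsum[OF kspT D F]) apply(rule lin |assumption)+ apply(rule tsum_eq)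
 apply(subst tsum_tsum[OF kspT D F]) apply(rule lin |assumption)+ apply(rule tsum_eq) apply(rule tsum_tens[OF kspT D F])
  apply(rule lin |assumption)+ done

text \<open>The axioms are checked on pure tensors. There \<open>tsum_swap\<close> separates the
  sums over the two coproducts, and the axiom is used once in each factor.\<close>

lemma coalgT: "coalgebra T"
proof (rule coalgebraI[OF kspT klin_copT cou_tn(2)])
 fix u assume u: "u .: T"
 let ?D = "tensor T (tensor T T)"
 let ?F = "%x y z. tens T (tensor T T) x (tens T T y z)"
 have F: "ktrilinear T T T ?D ?F" by(rule lin |assumption)+
 show "sw T u (%a b. sw T a (%a1 a2. ?F a1 a2 b)) = sw T u (%a b. sw T b (%b1 b2. ?F a b1 b2))"
 proof (rule T_eqI[OF ksp_tens _ _ _ u])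
  show "klinear T ?D (%u. sw T u (%a b. sw T a (%a1 a2. ?F a1 a2 b)))" by(rule copT_lin lin ktrilin[OF F] |assumption)+
  show "klinear T ?D (%u. sw T u (%a b. sw T b (%b1 b2. ?F a b1 b2)))" by(rule copT_lin lin ktrilin[OF F] |assumption)+
  fix a b assume ab: "a .: A" "b .: B"
  have "sw T (a <*> b) (%a b. sw T a (%a1 a2. ?F a1 a2 b)) =
   sw A a (%a1 a2. sw B b (%b1 b2. sw T (a1 <*> b1) (%p q. ?F p q (a2 <*> b2))))"
   by(rule sw_tn[OF ksp_tens _ ab]) (rule copT_lin lin ktrilin[OF F] |assumption)+
  also have "... = sw A a (%a1 a2. sw B b (%b1 b2. sw A a1 (%p q. sw B b1 (%r s. ?F (p <*> r) (q <*> s) (a2 <*> b2)))))"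
   by(rule tsum_eq, rule tsum_eq, rule sw_tn[OF ksp_tens]) (rule lin ktrilin[OF F] |assumption)+
  also have "... = sw A a (%a1 a2. sw A a1 (%p q. sw B b (%b1 b2. sw B b1 (%r s. ?F (p <*> r) (q <*> s) (a2 <*> b2)))))"
   by(rule tsum_eq, rule tsum_swap)
  also have "... = sw A a (%a1 a2. sw A a1 (%p q. sw B b (%b1 b2. sw B b2 (%r s. ?F (p <*> b1) (q <*> r) (a2 <*> s)))))"
   by(rule tsum_eq, rule tsum_eq, rule sw_coassoc[OF ksp_tens coalgB ab(2)]) (rule lin ktrilin[OF F] |assumption)+
  also have "... = sw A a (%a1 a2. sw A a2 (%p q. sw B b (%b1 b2. sw B b2 (%r s. ?F (a1 <*> b1) (p <*> r) (q <*> s)))))"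
   by(rule sw_coassoc[OF ksp_tens coalgA ab(1)]) (rule lin ab ktrilin[OF F] |assumption)+
  also have "... = sw A a (%a1 a2. sw B b (%b1 b2. sw A a2 (%p q. sw B b2 (%r s. ?F (a1 <*> b1) (p <*> r) (q <*> s)))))"
   by(rule tsum_eq, rule tsum_swap)
  also have "... = sw A a (%a1 a2. sw B b (%b1 b2. sw T (a2 <*> b2) (%p q. ?F (a1 <*> b1) p q)))"
   by(rule tsum_eq, rule tsum_eq, rule sw_tn[OF ksp_tens, symmetric]) (rule lin ktrilin[OF F] |assumption)+
  also have "... = sw T (a <*> b) (%a b. sw T b (%b1 b2. ?F a b1 b2))"
   by(rule sw_tn[OF ksp_tens _ ab, symmetric]) (rule copT_lin lin ktrilin[OF F] |assumption)+
  finally show "sw T (a <*> b) (%a b. sw T a (%a1 a2. ?F a1 a2 b)) = sw T (a <*> b) (%a b. sw T b (%b1 b2. ?F a b1 b2))" .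
 qed
next
 fix u assume u: "u .: T"
 show "sw T u (%a b. smul T (cou T a) b) = u"
 proof (rule T_eqI[OF kspT _ klin_id _ u])
  show "klinear T T (%u. sw T u (%a b. smul T (cou T a) b))" by(rule copT_lin couT_lin lin |assumption)+
  fix a b assume ab: "a .: A" "b .: B"
  have "sw T (a <*> b) (%a b. smul T (cou T a) b) =
   sw A a (%a1 a2. sw B b (%b1 b2. smul T (cou T (a1 <*> b1)) (a2 <*> b2)))"
   by(rule sw_tn[OF kspT _ ab]) (rule copT_lin couT_lin lin |assumption)+
  also have "... = sw A a (%a1 a2. sw B b (%b1 b2. smul T (cou B b1) (smul T (cou A a1) (a2 <*> b2))))"
   by(rule tsum_eq, rule tsum_eq) (simp add: cou_tn(1) mult.commute)
  also have "... = sw A a (%a1 a2. smul T (cou A a1) (a2 <*> b))"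
   by(rule tsum_eq, rule sw_counit_left[OF kspT coalgB ab(2)]) (rule lin |assumption)+
  also have "... = a <*> b" by(rule sw_counit_left[OF kspT coalgA ab(1)]) (rule lin ab |assumption)+
  finally show "sw T (a <*> b) (%a b. smul T (cou T a) b) = a <*> b" .
 qed
 show "sw T u (%a b. smul T (cou T b) a) = u"
 proof (rule T_eqI[OF kspT _ klin_id _ u])
  show "klinear T T (%u. sw T u (%a b. smul T (cou T b) a))" by(rule copT_lin couT_lin lin |assumption)+
  fix a b assume ab: "a .: A" "b .: B"
  have "sw T (a <*> b) (%a b. smul T (cou T b) a) =
   sw A a (%a1 a2. sw B b (%b1 b2. smul T (cou T (a2 <*> b2)) (a1 <*> b1)))"
   by(rule sw_tn[OF kspT _ ab]) (rule copT_lin couT_lin lin |assumption)+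
  also have "... = sw A a (%a1 a2. sw B b (%b1 b2. smul T (cou B b2) (smul T (cou A a2) (a1 <*> b1))))"
   by(rule tsum_eq, rule tsum_eq) (simp add: cou_tn(1) mult.commute)
  also have "... = sw A a (%a1 a2. smul T (cou A a2) (a1 <*> b))"
   by(rule tsum_eq, rule sw_counit_right[OF kspT coalgB ab(2)]) (rule lin |assumption)+
  also have "... = a <*> b" by(rule sw_counit_right[OF kspT coalgA ab(1)]) (rule lin ab |assumption)+
  finally show "sw T (a <*> b) (%a b. smul T (cou T b) a) = a <*> b" .
 qed
qed

lemmas [lin] = coalgT

lemma cocommutative_T:
 assumes "cocommutative A" "cocommutative B"
 shows "cocommutative T"
proof (rule cocommutativeI[OF coalgT])
 fix u assume u: "u .: T"
 show "sw T u (%a b. tens T T b a) = sw T u (tens T T)"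
 proof (rule T_eqI[OF ksp_tens _ _ _ u])
  show "klinear T (tensor T T) (%u. sw T u (%a b. tens T T b a))" "klinear T (tensor T T) (%u. sw T u (tens T T))"
   by(rule lin |assumption)+
  fix a b assume ab: "a .: A" "b .: B"
  have "sw T (a <*> b) (%a b. tens T T b a) =
   sw A a (%a1 a2. sw B b (%b1 b2. tens T T (a2 <*> b2) (a1 <*> b1)))"
   by(rule sw_tn[OF ksp_tens _ ab]) (rule lin |assumption)+
  also have "... = sw A a (%a1 a2. sw B b (%b1 b2. tens T T (a2 <*> b1) (a1 <*> b2)))"
   by(rule tsum_eq, rule sw_cocomm[OF ksp_tens coalgB assms(2) ab(2)]) (rule lin |assumption)+
  also have "... = sw A a (%a1 a2. sw B b (%b1 b2. tens T T (a1 <*> b1) (a2 <*> b2)))"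
   by(rule sw_cocomm[OF ksp_tens coalgA assms(1) ab(1)]) (rule lin ab |assumption)+
  also have "... = sw T (a <*> b) (tens T T)" by(rule sw_tn[OF ksp_tens _ ab, symmetric]) (rule lin |assumption)+
  finally show "sw T (a <*> b) (%a b. tens T T b a) = sw T (a <*> b) (tens T T)" .
 qed
qed

end

section \<open>Super-Hopf algebras and their twisted tensor products\<close>

section \<open>Super-Hopf algebras\<close>

lemma component_lin [lin]:
 assumes "graded_space A G" "klinear E A g"
 shows "klinear E A (%x. component G (g x) i)"
proof (rule klin_comp[OF _ assms(2)])
 show "klinear A A (%x. component G x i)"
  by(rule klinearI) (simp_all add: component_mem[OF assms(1)] component_add[OF assms(1)] component_scale[OF assms(1)])
qed

lemmas [lin] = component_mem

locale super_hopf =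
 fixes B :: "('k::field, 'b::ab_group_add, 'z) kgbialg_scheme"
 assumes super: "super_hopf_algebra B"
begin

lemma algB [lin]: "assoc_algebra B" using super by(simp add: super_hopf_algebra_def)
lemma coalgB [lin]: "coalgebra B" using super by(simp add: super_hopf_algebra_def)
lemma gradB [lin]: "graded_space B (gr B)" using super by(simp add: super_hopf_algebra_def)
lemma kspB [lin]: "kspace B" by(rule coalgebra_kspace[OF coalgB])
lemma unit_gr: "unit B : gr B 0" using super by(simp add: super_hopf_algebra_def)
lemma mul_gr: "a : gr B i ==> b : gr B j ==> mul B a b : gr B (i + j)"
 using super by(simp add: super_hopf_algebra_def)
lemma cop_gr: "a : gr B n ==>
  cop B a : module.span pscale {tens B B b c |b c i j. b : gr B i & c : gr B j & i + j = n}"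
 using super by(simp add: super_hopf_algebra_def)
lemma cou_gr: "0 < n ==> a : gr B n ==> cou B a = 0" using super by(simp add: super_hopf_algebra_def)
lemma cop_mul: "a .: B ==> b .: B ==>
  cop B (mul B a b) = stens_mul B (gr B) (mul B) (cop B a) (cop B b)" using super by(simp add: super_hopf_algebra_def)
lemma cou_mul: "a .: B ==> b .: B ==> cou B (mul B a b) = cou B a * cou B b"
 using super by(simp add: super_hopf_algebra_def)
lemma cop_unit: "cop B (unit B) = tens B B (unit B) (unit B)" using super by(simp add: super_hopf_algebra_def)
lemma cou_unit: "cou B (unit B) = 1" using super by(simp add: super_hopf_algebra_def)
lemma graded_antipode: "\<exists>S. is_antipode B S & (\<forall>n. \<forall>a\<in>gr B n. S a : gr B n)"
 using super by(simp add: super_hopf_algebra_def)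

text \<open>The Sweedler form of multiplicativity of the coproduct; the sign is the Koszul sign of
  moving \<open>b2\<close> past \<open>d1\<close>.\<close>

lemma sw_mul:
 assumes D: "kspace D" and b: "b .: B" "b' .: B" and F: "kbilinear B B D F"
 shows "sw B (mul B b b') F = sw B b (%b1 b2. sw B b' (%d1 d2. hsum (gr B) b2 (%i b2. hsum (gr B) d1 (%j d1.
  smul D ((- 1) ^ (i * j)) (F (mul B b1 d1) (mul B b2 d2))))))"
proof -
 let ?L = "%t. tsum B B t F"
 have L: "klinear (tensor B B) D ?L" by(rule klin_tsum_out[OF kspB D F])
 note app = klin_tsum[where g = ?L, OF ksp_tens D L]
  and happ = klin_hsum_apply[where f = ?L, OF gradB _ ksp_tens D L]
 show ?thesis unfolding cop_mul[OF b]
  apply(subst stens_mul_eq[OF gradB kbil_mul[OF algB] cop_mem[OF coalgB b(1)] cop_mem[OF coalgB b(2)]])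
  apply(subst app) apply(rule lin |assumption)+ apply(rule tsum_eq) apply(subst app) apply(rule lin |assumption)+
  apply(rule tsum_eq) apply(subst happ, assumption) apply(rule lin |assumption)+
  apply(rule hsum_cong[OF gradB], assumption) apply(subst happ, assumption) apply(rule lin |assumption)+
  apply(rule hsum_cong[OF gradB], assumption) apply(subst klin_scale[OF L, unfolded smul_tensor])
   apply(rule lin |assumption)+ apply(rule arg_cong[where f = "smul D _"]) apply(rule tsum_tens[OF kspB D F])
   apply(rule lin |assumption)+ done
qed

lemma sw_unit: "kspace D ==> kbilinear B B D F ==> sw B (unit B) F = F (unit B) (unit B)"
 unfolding cop_unit by(rule tsum_tens[OF kspB _ _ unit_mem[OF algB] unit_mem[OF algB]])

end

lemma span_induct_subspace:
 assumes S: "vector_space s" and D: "vector_space s'" and W: "module.subspace s' W"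
  and add: "!!x y. x : module.span s X ==> y : module.span s X ==> f (x + y) = f x + f y"
  and scale: "!!c x. x : module.span s X ==> f (s c x) = s' c (f x)"
  and gen: "!!x. x : X ==> f x : W" and t: "t : module.span s X"
 shows "f t : W"
proof -
 interpret S: vector_space s by(rule S)
 interpret D: vector_space s' by(rule D)
 have z: "f 0 = 0" using scale[OF S.span_zero, of 0] by simp
 from t have "t : S.span X & f t : W"
 proof (induction rule: S.span_induct_alt)
  case base
  then show ?case using D.subspace_0[OF W] by(simp add: z S.span_zero)
 next
  case (step c x y)
  have x: "x : S.span X" by(rule S.span_base[OF step(1)])
  then have cx: "s c x : S.span X" by(rule S.span_scale)
  have "f (s c x + y) = s' c (f x) + f y" using step cx x by(simp add: add scale)
  then show ?case using step cx gen D.subspace_add[OF W] D.subspace_scale[OF W] S.span_add by auto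
 qed
 then show ?thesis by simp
qed

text \<open>A product on \<open>A \<otimes> B\<close> of the form \<open>(a \<otimes> b)(a' \<otimes> b') = a \<psi>(b \<otimes> a') b'\<close>. If the exchange map
 \<open>\<psi> : B \<otimes> A \<rightarrow> A \<otimes> B\<close> is compatible with the products and is a coalgebra map, this is a
 super-Hopf algebra. Both \<open>A \<rtimes> H\<close> and \<open>A \<ltimes> \<Lambda>(W)\<close> arise in this way.\<close>

locale twisted = tens_coalg A B T
 for A :: "('k::field, 'a::ab_group_add, 'x) kbialg_scheme"
  and B :: "('k, 'b::ab_group_add, 'y) kgbialg_scheme"
  and T :: "('k, ('a, 'b, 'k) tensor, 'z) kgbialg_scheme" +
 fixes ps :: "'b => 'a => ('a, 'b, 'k) tensor"
 assumes hopfA: "hopf_algebra A" and superB: "super_hopf_algebra B"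
  and unitT: "unit T = unit A <*> unit B"
  and mulT: "!!u v. u .: T ==> v .: T ==>
   mul T u v = tsum A B u (%a b. tsum A B v (%a' b'. tsum A B (ps b a') (%p r. mul A a p <*> mul B r b')))"
  and grT: "!!n. gr T n = module.span pscale {a <*> b |a b. a .: A & b : gr B n}"
  and psi: "kbilinear B A T ps"
  and psi_unit_left: "!!a. a .: A ==> ps (unit B) a = a <*> unit B"
  and psi_unit_right: "!!b. b .: B ==> ps b (unit A) = unit A <*> b"
  and psi_mulB: "!!b b' a. b .: B ==> b' .: B ==> a .: A ==>
   ps (mul B b b') a = tsum A B (ps b' a) (%p r. tsum A B (ps b p) (%q s. q <*> mul B s r))"
  and psi_mulA: "!!b a a'. b .: B ==> a .: A ==> a' .: A ==>
   ps b (mul A a a') = tsum A B (ps b a) (%p r. tsum A B (ps r a') (%q s. mul A p q <*> s))"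
  and psi_cop: "!!b a. b .: B ==> a .: A ==>
   cop T (ps b a) = sw B b (%b1 b2. sw A a (%a1 a2. tens T T (ps b1 a1) (ps b2 a2)))"
  and psi_cou: "!!b a. b .: B ==> a .: A ==> cou T (ps b a) = cou B b * cou A a"
  and psi_gr: "!!n b a. b : gr B n ==> a .: A ==> ps b a : gr T n"
begin

sublocale A: hopf A by unfold_locales (rule hopfA)
sublocale B: super_hopf B by unfold_locales (rule superB)

lemmas [lin] = A.bialg A.alg B.algB B.gradB kbilin[OF psi]

lemma psi_mulB_sum:
 assumes D: "kspace D" and F: "kbilinear A B D F" and b: "b .: B" "b' .: B" and a: "a .: A"
 shows "tsum A B (ps (mul B b b') a) F = tsum A B (ps b' a) (%p r. tsum A B (ps b p) (%q s. F q (mul B s r)))"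
 unfolding psi_mulB[OF b a] apply(subst tsum_tsum[OF kspA D F, folded carT]) apply(rule lin b |assumption)+
 apply(rule tsum_eq) apply(subst tsum_tsum[OF kspA D F, folded carT]) apply(rule lin b |assumption)+ apply(rule tsum_eq)
 apply(rule tsum_tn[OF D F]) apply(rule lin |assumption)+ done

lemma psi_mulA_sum:
 assumes D: "kspace D" and F: "kbilinear A B D F" and b: "b .: B" and a: "a .: A" "a' .: A"
 shows "tsum A B (ps b (mul A a a')) F = tsum A B (ps b a) (%p r. tsum A B (ps r a') (%q s. F (mul A p q) s))"
 unfolding psi_mulA[OF b a] apply(subst tsum_tsum[OF kspA D F, folded carT]) apply(rule lin a |assumption)+
 apply(rule tsum_eq) apply(subst tsum_tsum[OF kspA D F, folded carT]) apply(rule lin a |assumption)+ apply(rule tsum_eq)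
 apply(rule tsum_tn[OF D F]) apply(rule lin |assumption)+ done

section \<open>Twisted tensor products: the algebra structure\<close>

lemma mulT_bilinear: "kbilinear T T T (mul T)"
proof -
 let ?M = "%u v. tsum A B u (%a b. tsum A B v (%a' b'. tsum A B (ps b a') (%p r. mul A a p <*> mul B r b')))"
 have M: "kbilinear T T T ?M" by(rule lin |assumption)+
 show ?thesis apply(rule kbilinearI) apply(rule klin_cong[OF kspT kbilin(2)[OF M _ klin_id]], assumption)
   apply(rule mulT; assumption) apply(rule klin_cong[OF kspT kbilin(3)[OF M _ klin_id]], assumption)
  apply(rule mulT; assumption) done
qed

lemmas mulT_lin = kbilin[OF mulT_bilinear]

lemma mul_tn:
 assumes "a .: A" "b .: B" "a' .: A" "b' .: B"
 shows "mul T (a <*> b) (a' <*> b') = tsum A B (ps b a') (%p r. mul A a p <*> mul B r b')"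
proof -
 have "mul T (a <*> b) (a' <*> b') =
   tsum A B (a' <*> b') (%a' b'. tsum A B (ps b a') (%p r. mul A a p <*> mul B r b'))"
  unfolding mulT[OF tn_mem[OF assms(1,2)] tn_mem[OF assms(3,4)]]
  by(rule tsum_tn[OF kspT _ assms(1,2)]) (rule lin assms |assumption)+
 also have "... = tsum A B (ps b a') (%p r. mul A a p <*> mul B r b')"
  by(rule tsum_tn[OF kspT _ assms(3,4)]) (rule lin assms |assumption)+
 finally show ?thesis .
qed

text \<open>Let \<open>b\<close> pass \<open>a'\<close>, giving p \<otimes> r, and \<open>b'\<close>
  pass \<open>a''\<close>, giving p' \<otimes> r'; then let \<open>r\<close> pass \<open>p'\<close>.
  Both bracketings produce this sum: on the left by \<open>psi_mulB\<close>, on the right by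
  \<open>psi_mulA\<close>.\<close>

lemma mul_tn_assoc:
 assumes "a .: A" "b .: B" "a' .: A" "b' .: B" "a'' .: A" "b'' .: B"
 shows "mul T (mul T (a <*> b) (a' <*> b')) (a'' <*> b'') = mul T (a <*> b) (mul T (a' <*> b') (a'' <*> b''))"
proof -
 have "mul T (mul T (a <*> b) (a' <*> b')) (a'' <*> b'') =
   tsum A B (ps b a') (%p r. mul T (mul A a p <*> mul B r b') (a'' <*> b''))" unfolding mul_tn[OF assms(1-4)]
  by(rule kbil_tsum_left[OF mulT_bilinear kspT kspT]) (rule lin assms |assumption)+
 also have "... = tsum A B (ps b a') (%p r. tsum A B (ps (mul B r b') a'') (%q s. mul A (mul A a p) q <*> mul B s b''))"
  by(rule tsum_eq, rule mul_tn) (rule lin assms |assumption)+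
 also have "... = tsum A B (ps b a') (%p r. tsum A B (ps b' a'') (%p' r'. tsum A B (ps r p') (%q s.
   mul A (mul A a p) q <*> mul B (mul B s r') b'')))"
  by(rule tsum_eq, rule psi_mulB_sum[OF kspT]) (rule lin assms |assumption)+
 also have "... = tsum A B (ps b' a'') (%p' r'. tsum A B (ps b a') (%p r. tsum A B (ps r p') (%q s.
   mul A (mul A a p) q <*> mul B (mul B s r') b'')))" by(rule tsum_swap)
 also have "... = tsum A B (ps b' a'') (%p' r'. tsum A B (ps b a') (%p r. tsum A B (ps r p') (%q s.
   mul A a (mul A p q) <*> mul B s (mul B r' b''))))"
  by(intro tsum_eq) (simp only: mul_assoc[OF A.alg] mul_assoc[OF B.algB] assms)
 also have "... = tsum A B (ps b' a'') (%p' r'. tsum A B (ps b (mul A a' p')) (%q s. mul A a q <*> mul B s (mul B r' b'')))"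
  by(rule tsum_eq, rule psi_mulA_sum[OF kspT, symmetric]) (rule lin assms |assumption)+
 also have "... = tsum A B (ps b' a'') (%p' r'. mul T (a <*> b) (mul A a' p' <*> mul B r' b''))"
  by(rule tsum_eq, rule mul_tn[symmetric]) (rule lin assms |assumption)+
 also have "... = mul T (a <*> b) (mul T (a' <*> b') (a'' <*> b''))" unfolding mul_tn[OF assms(3-6)]
  by(rule kbil_tsum_right[OF mulT_bilinear kspT kspT, symmetric]) (rule lin assms |assumption)+
 finally show ?thesis .
qed

lemma algT: "assoc_algebra T"
proof -
 have u: "unit T .: T" unfolding unitT by(rule lin)+
 have 2: "mul T (mul T (a <*> b) (a' <*> b')) w = mul T (a <*> b) (mul T (a' <*> b') w)"
  if "a .: A" "b .: B" "a' .: A" "b' .: B" "w .: T" for a b a' b' w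
  by(rule T_eqI[where f = "%w. mul T (mul T (a <*> b) (a' <*> b')) w" and g = "%w. mul T (a <*> b) (mul T (a' <*> b') w)", OF kspT _ _ mul_tn_assoc that(5)]) (rule mulT_lin lin that |assumption)+
 have 3: "mul T (mul T (a <*> b) v) w = mul T (a <*> b) (mul T v w)"
  if "a .: A" "b .: B" "v .: T" "w .: T" for a b v w
  by(rule T_eqI[where f = "%v. mul T (mul T (a <*> b) v) w" and g = "%v. mul T (a <*> b) (mul T v w)", OF kspT _ _ 2 that(3)]) (rule mulT_lin lin that |assumption)+
 have 4: "mul T (mul T u v) w = mul T u (mul T v w)"
  if "u .: T" "v .: T" "w .: T" for u v w
  by(rule T_eqI[where f = "%u. mul T (mul T u v) w" and g = "%u. mul T u (mul T v w)", OF kspT _ _ 3 that(1)]) (rule mulT_lin lin that |assumption)+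
 have l: "mul T (unit T) (a <*> b) = a <*> b" "mul T (a <*> b) (unit T) = a <*> b" if ab: "a .: A" "b .: B" for a b
 proof -
  have "mul T (unit T) (a <*> b) = mul A (unit A) a <*> mul B (unit B) b"
   unfolding unitT mul_tn[OF unit_mem[OF A.alg] unit_mem[OF B.algB] ab] psi_unit_left[OF ab(1)]
   by(rule tsum_tn[OF kspT]) (rule lin ab |assumption)+
  then show "mul T (unit T) (a <*> b) = a <*> b" by(simp add: mul_unit[OF A.alg] mul_unit[OF B.algB] ab)
  have "mul T (a <*> b) (unit T) = mul A a (unit A) <*> mul B b (unit B)"
   unfolding unitT mul_tn[OF ab unit_mem[OF A.alg] unit_mem[OF B.algB]] psi_unit_right[OF ab(2)]
   by(rule tsum_tn[OF kspT]) (rule lin ab |assumption)+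
  then show "mul T (a <*> b) (unit T) = a <*> b" by(simp add: mul_unit[OF A.alg] mul_unit[OF B.algB] ab)
 qed
 have 5: "mul T (unit T) v = v" if "v .: T" for v
  by(rule T_eqI[where f = "%v. mul T (unit T) v" and g = "%v. v", OF kspT _ _ l(1) that]) (rule u mulT_lin lin |assumption)+
 have 6: "mul T v (unit T) = v" if "v .: T" for v
  by(rule T_eqI[where f = "%v. mul T v (unit T)" and g = "%v. v", OF kspT _ _ l(2) that]) (rule u mulT_lin lin |assumption)+
 show ?thesis unfolding assoc_algebra_def by(simp add: kspT mulT_bilinear u 4 5 6)
qed

lemmas [lin] = algT

section \<open>Twisted tensor products: the grading by the degree of the second factor\<close>

lemma grT_subset: "gr T n \<subseteq> car T"
proof -
 have "{a <*> b |a b. a .: A & b : gr B n} \<subseteq> car T"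
  by(auto intro: tn_mem graded_subset[OF B.gradB])
 from module.span_minimal[OF module_pscale this] show ?thesis unfolding grT using ksp_subspace[OF kspT] by simp
qed

lemma tn_gr: "a .: A ==> b : gr B n ==> a <*> b : gr T n"
 unfolding grT by(rule module.span_base[OF module_pscale]) auto

lemma grT_subspace: "module.subspace (smul T) (gr T n)" unfolding grT smulT by(rule module.subspace_span[OF module_pscale])

lemma grT_image:
 assumes D: "kspace D" and f: "klinear T D f" and W: "module.subspace (smul D) W"
  and gen: "!!a b. a .: A ==> b : gr B n ==> f (a <*> b) : W" and t: "t : gr T n"
 shows "f t : W"
proof (rule span_induct_subspace[where f = f and t = t and s = pscale and X = "{a <*> b |a b. a .: A & b : gr B n}",
   OF vector_space_pscale kspace_vector_space[OF D] W])
 note sub = grT_subset[of n, unfolded grT, THEN subsetD]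
 show "t : module.span pscale {a <*> b |a b. a .: A & b : gr B n}" using t by(simp only: grT)
 show "f (x + y) = f x + f y"
  if "x : module.span pscale {a <*> b |a b. a .: A & b : gr B n}"
   "y : module.span pscale {a <*> b |a b. a .: A & b : gr B n}" for x y
  by(rule klin_add[OF f]) (rule sub that)+
 show "f (pscale c x) = smul D c (f x)"
  if "x : module.span pscale {a <*> b |a b. a .: A & b : gr B n}" for c x
  using klin_scale[OF f sub[OF that], of c] by simp
qed (use gen in auto)

lemma subspace_zero: "kspace D ==> module.subspace (smul D) {0}" by(simp add: module.subspace_single_0[OF ksp_module])

lemma gradT: "graded_space T (gr T)"
proof -
 \<comment> \<open>The projection to degree \<open>n\<close> acts on the second factor
   alone.\<close>
 let ?p = "%n t. tsum A B t (%a b. a <*> component (gr B) b n)"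
 have pl: "klinear T T (?p n)" for n by(rule lin |assumption)+
 have bil: "kbilinear A B T (%a b. a <*> component (gr B) b n)" for n by(rule lin |assumption)+
 have p_tn: "?p n (a <*> b) = a <*> component (gr B) b n" if "a .: A" "b .: B" for a b n
  by(rule tsum_tn[OF kspT bil that])
 have zero: "a <*> 0 = 0" if "a .: A" for a
  using klin_0[OF kspB kspT, of "%b. a <*> b"] that by(simp add: tn_right klin_id)
 have hom: "?p m t = (if m = n then t else 0)" if "t : gr T n" for m n t
 proof -
  have "?p m t - (if m = n then t else 0) : {0}"
  proof (rule grT_image[OF kspT _ subspace_zero[OF kspT] _ that])
   show "klinear T T (%t. ?p m t - (if m = n then t else 0))"
    by(cases "m = n") (simp, rule klin_minus[OF kspT pl klin_id], simp, rule pl)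
   fix a b assume "a .: A" "b : gr B n"
   then show "?p m (a <*> b) - (if m = n then a <*> b else 0) : {0}"
    by(simp add: p_tn graded_subset[OF B.gradB] component_homogeneous[OF B.gradB] zero)
  qed
  then show ?thesis by simp
 qed
 have sums: "finite {n. ?p n t ~= 0} & t = (\<Sum>n | ?p n t ~= 0. ?p n t)" if t: "t .: T" for t
 proof -
  \<comment> \<open>The finitely many degrees that occur in the second factors of the chosen
    representation of \<open>t\<close>; outside this set all projections of \<open>t\<close>
    vanish.\<close>
  let ?N = "\<Union>q\<in>set (trep A B t). {n. component (gr B) (snd q) n ~= 0}"
  have fin: "finite ?N" by(auto dest: trep_mem intro: component_finite[OF B.gradB])
  have out: "?p n t = 0" if "n \<notin> ?N" for n
  proof -
   have "?p n t = (\<Sum>q\<leftarrow>trep A B t. 0)" unfolding tsum_def case_prod_unfold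
    apply(rule arg_cong[of _ _ sum_list], rule map_cong[OF refl]) using that by(auto simp: zero dest: trep_mem)
   then show ?thesis by simp
  qed
  have "t = tsum A B t (%a b. a <*> b)" using tsum_tens_id[OF kspA t[unfolded carT]] by simp
  also have "... = tsum A B t (%a b. \<Sum>n\<in>?N. a <*> component (gr B) b n)" unfolding tsum_def case_prod_unfold
  proof (rule arg_cong[of _ _ sum_list], rule map_cong[OF refl])
   fix q assume q: "q : set (trep A B t)"
   then have qc: "fst q .: A" "snd q .: B" by(auto dest: trep_mem)
   have "snd q = (\<Sum>n | component (gr B) (snd q) n ~= 0. component (gr B) (snd q) n)"
    by(rule component_sum[OF B.gradB qc(2)])
   also have "... = (\<Sum>n\<in>?N. component (gr B) (snd q) n)" by(rule sum_nonzero_superset[OF fin]) (use q in auto)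
   finally have "fst q <*> snd q = fst q <*> (\<Sum>n\<in>?N. component (gr B) (snd q) n)" by simp
   also have "... = (\<Sum>n\<in>?N. fst q <*> component (gr B) (snd q) n)"
    by(rule klin_sum[OF kspB kspT]) (rule lin qc)+
   finally show "fst q <*> snd q = (\<Sum>n\<in>?N. fst q <*> component (gr B) (snd q) n)" .
  qed
  also have "... = (\<Sum>n\<in>?N. ?p n t)" by(rule tsum_sum)
  also have "... = (\<Sum>n | ?p n t ~= 0. ?p n t)" by(rule sum_nonzero_superset[OF fin, symmetric]) (use out in auto)
  finally have 1: "t = ..." .
  have "{n. ?p n t ~= 0} \<subseteq> ?N" using out by blast
  then have "finite {n. ?p n t ~= 0}" using fin by(rule finite_subset)
  with 1 show ?thesis by blast
 qed
 show ?thesis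
 proof (rule graded_spaceI[where p = ?p, OF kspT grT_subset grT_subspace pl])
  show "?p n t : gr T n" if "t .: T" for n t
  proof -
   have "(\<Sum>q\<leftarrow>trep A B t. fst q <*> component (gr B) (snd q) n) : gr T n"
    if "set xs \<subseteq> car A \<times> car B" and "xs = trep A B t" for xs
   proof -
    have "(\<Sum>q\<leftarrow>xs. fst q <*> component (gr B) (snd q) n) : gr T n" using that(1)
    proof (induction xs)
     case Nil
     show ?case unfolding list.map sum_list.Nil by(rule module.subspace_0[OF ksp_module[OF kspT] grT_subspace])
    next
     case (Cons q xs)
     then have q: "fst q .: A" "snd q .: B" and xs: "set xs \<subseteq> car A \<times> car B" by auto
     show ?case unfolding list.map sum_list.Cons by(rule module.subspace_add[OF ksp_module[OF kspT] grT_subspace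
        tn_gr[OF q(1) component_grade[OF B.gradB q(2)]] Cons.IH[OF xs]])
    qed
    then show ?thesis by(simp only: that(2))
   qed
   from this[OF trep_subset refl] show ?thesis by(simp add: tsum_def case_prod_unfold)
  qed
 qed (use hom sums in auto)
qed

lemmas [lin] = gradT

lemma hsum_tn:
 assumes D: "kspace D" and g: "!!i. klinear T D (g i)" and a: "a .: A" and b: "b .: B"
 shows "hsum (gr T) (a <*> b) g = hsum (gr B) b (%i b. g i (a <*> b))"
proof (rule graded_eqI[OF B.gradB D _ _ _ b])
 note gl = klin_comp[OF g]
 show "klinear B D (%b. hsum (gr T) (a <*> b) g)" by(rule lin D a g |assumption)+
 show "klinear B D (%b. hsum (gr B) b (%i b. g i (a <*> b)))" by(rule lin gl D a |assumption)+
 fix n x assume x: "x : gr B n"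
 have z: "klinear B D (%b. g n (a <*> b))" by(rule lin gl D a |assumption)+
 show "hsum (gr T) (a <*> x) g = hsum (gr B) x (%i b. g i (a <*> b))"
  by(simp only: hsum_homogeneous[where g = g, OF gradT tn_gr[OF a x] klin_0[OF kspT D g]]
    hsum_homogeneous[where g = "%i b. g i (a <*> b)", OF B.gradB x klin_0[OF kspB D z]])
qed

text \<open>\<open>\<psi>\<close> preserves the degree.\<close>

lemma psi_hsum:
 assumes D: "kspace D" and g: "!!i. kbilinear A B D (g i)" and a: "a .: A" and b: "b .: B"
 shows "tsum A B (ps b a) (%p r. hsum (gr B) r (%i r. g i p r)) = hsum (gr B) b (%i b. tsum A B (ps b a) (g i))"
proof (rule graded_eqI[OF B.gradB D _ _ _ b])
 have gl: "kbilinear A B D (%p r. hsum (gr B) r (%i r. g i p r))" by(rule lin D kbilin[OF g] |assumption)+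
 show "klinear B D (%b. tsum A B (ps b a) (%p r. hsum (gr B) r (%i r. g i p r)))"
  by(rule lin D a kbilin[OF g] |assumption)+
 show "klinear B D (%b. hsum (gr B) b (%i b. tsum A B (ps b a) (g i)))" by(rule g lin D a |assumption)+
 fix n x assume x: "x : gr B n"
 have l1: "klinear B D (%b. tsum A B (ps b a) (g n))" by(rule g lin D a |assumption)+
 have l2: "klinear T D (%t. tsum A B t (%p r. hsum (gr B) r (%i r. g i p r)) - tsum A B t (g n))"
  by(rule lin kbilin[OF g] D |assumption)+
 have "tsum A B t (%p r. hsum (gr B) r (%i r. g i p r)) - tsum A B t (g n) : {0}" if "t : gr T n" for t
 proof (rule grT_image[OF D l2 subspace_zero[OF D] _ that])
  fix p r assume p: "p .: A" and r: "r : gr B n"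
  note rc = graded_subset[OF B.gradB r]
  have "klinear B D (g n p)" using g[of n] p by(simp add: kbilinear_def)
  then show "tsum A B (p <*> r) (%p r. hsum (gr B) r (%i r. g i p r)) - tsum A B (p <*> r) (g n) : {0}"
   by(simp add: tsum_tn[OF D gl p rc] tsum_tn[OF D g p rc] hsum_homogeneous[OF B.gradB r] klin_0[OF kspB D])
 qed
 from this[OF psi_gr[OF x a]]
 show "tsum A B (ps x a) (%p r. hsum (gr B) r (%i r. g i p r)) = hsum (gr B) x (%i b. tsum A B (ps b a) (g i))"
  by(simp only: hsum_homogeneous[where g = "%i b. tsum A B (ps b a) (g i)", OF B.gradB x klin_0[OF kspB D l1]]) simp
qed

lemma mul_grT:
 assumes u: "u : gr T i" and v: "v : gr T j"
 shows "mul T u v : gr T (i + j)"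
proof -
 note uc = subsetD[OF grT_subset u] and vc = subsetD[OF grT_subset v]
 have 1: "mul T (a <*> b) (a' <*> b') : gr T (i + j)"
  if ab: "a .: A" "b : gr B i" "a' .: A" "b' : gr B j" for a b a' b'
 proof -
  note bc = graded_subset[OF B.gradB ab(2)] graded_subset[OF B.gradB ab(4)]
  show ?thesis unfolding mul_tn[OF ab(1) bc(1) ab(3) bc(2)]
  proof (rule grT_image[where f = "%t. tsum A B t (%p r. mul A a p <*> mul B r b')", OF kspT _ grT_subspace _ psi_gr[OF ab(2,3)]])
   show "klinear T T (%t. tsum A B t (%p r. mul A a p <*> mul B r b'))" by(rule lin ab bc |assumption)+
   fix p r assume p: "p .: A" and r: "r : gr B i"
   note rc = graded_subset[OF B.gradB r]
   have "tsum A B (p <*> r) (%p r. mul A a p <*> mul B r b') = mul A a p <*> mul B r b'"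
    by(rule tsum_tn[OF kspT _ p rc]) (rule lin ab bc |assumption)+
   also have "... : gr T (i + j)" by(rule tn_gr[OF mul_mem[OF A.alg ab(1) p] B.mul_gr[OF r ab(4)]])
   finally show "tsum A B (p <*> r) (%p r. mul A a p <*> mul B r b') : gr T (i + j)" .
  qed
 qed
 have 2: "mul T (a <*> b) v : gr T (i + j)" if ab: "a .: A" "b : gr B i" for a b
  by(rule grT_image[where f = "%v. mul T (a <*> b) v", OF kspT _ grT_subspace 1[OF ab] v])
   (rule mulT_lin tn_mem klin_id ab graded_subset[OF B.gradB ab(2)])+
 show ?thesis by(rule grT_image[where f = "%u. mul T u v", OF kspT _ grT_subspace 2 u])
   (rule mulT_lin klin_id vc)+
qed

lemma cop_grT:
 assumes u: "u : gr T n"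
 shows "cop T u : module.span pscale {tens T T b c |b c i j. b : gr T i & c : gr T j & i + j = n}"
  (is "_ : ?S")
proof (rule grT_image[where f = "cop T", OF ksp_tens klin_copT _ _ u])
 let ?SB = "{tens B B b c |b c i j. b : gr B i & c : gr B j & i + j = n}"
 show S: "module.subspace (smul (tensor T T)) ?S" unfolding smul_tensor by(rule module.subspace_span[OF module_pscale])
 fix a b assume a: "a .: A" and b: "b : gr B n"
 note bc = graded_subset[OF B.gradB b]
 let ?f = "%t. sw A a (%a1 a2. tsum B B t (%b1 b2. tens T T (a1 <*> b1) (a2 <*> b2)))"
 have f: "klinear (tensor B B) (tensor T T) ?f" by(rule lin a |assumption)+
 have sub: "module.span pscale ?SB \<subseteq> car (tensor B B)"
 proof (rule module.span_minimal[OF module_pscale])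
  show "?SB \<subseteq> car (tensor B B)" by(auto intro!: tens_lin graded_subset[OF B.gradB])
  show "module.subspace pscale (car (tensor B B))" using ksp_subspace[OF ksp_tens] by simp
 qed
 have "?f (cop B b) : ?S"
 proof (rule span_induct_subspace[where f = ?f and t = "cop B b" and s = pscale and X = ?SB,
    OF vector_space_pscale kspace_vector_space[OF ksp_tens] S])
  show "?f (x + y) = ?f x + ?f y" if "x : module.span pscale ?SB" "y : module.span pscale ?SB" for x y
   by(rule klin_add[OF f subsetD[OF sub that(1)] subsetD[OF sub that(2)]])
  show "?f (pscale c x) = smul (tensor T T) c (?f x)" if "x : module.span pscale ?SB" for c x
   using klin_scale[OF f subsetD[OF sub that], of c] by simp
  show "cop B b : module.span pscale ?SB" by(rule B.cop_gr[OF b])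
  fix x assume "x : ?SB"
  then obtain y z i j where x: "x = tens B B y z" and y: "y : gr B i" and z: "z : gr B j" and ij: "i + j = n" by blast
  note yc = graded_subset[OF B.gradB y] and zc = graded_subset[OF B.gradB z]
  have "?f x = sw A a (%a1 a2. tens T T (a1 <*> y) (a2 <*> z))" unfolding x
   by(rule tsum_eq, rule tsum_tens[OF B.kspB ksp_tens _ yc zc]) (rule lin |assumption)+
  also have "... : ?S"
  proof -
   have "(\<Sum>q\<leftarrow>xs. tens T T (fst q <*> y) (snd q <*> z)) : ?S" if "set xs \<subseteq> car A \<times> car A" for xs
    using that
   proof (induction xs)
    case Nil
    show ?case unfolding list.map sum_list.Nil by(rule module.span_zero[OF module_pscale])
   next
    case (Cons q xs)
    then have q: "fst q .: A" "snd q .: A" and xs: "set xs \<subseteq> car A \<times> car A" by auto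
    have "tens T T (fst q <*> y) (snd q <*> z) : ?S"
     by(rule module.span_base[OF module_pscale]) (use tn_gr[OF q(1) y] tn_gr[OF q(2) z] ij in blast)
    then show ?case unfolding list.map sum_list.Cons by(rule module.span_add[OF module_pscale _ Cons.IH[OF xs]])
   qed
   from this[OF trep_subset] show ?thesis by(simp add: tsum_def case_prod_unfold)
  qed
  finally show "?f x : ?S" .
 qed
 then show "cop T (a <*> b) : ?S" by(simp only: cop_tn(1)[OF a bc])
qed

lemma cou_grT:
 assumes n: "0 < n" and u: "u : gr T n"
 shows "cou T u = 0"
proof -
 have "cou T u : {0}" by(rule grT_image[where f = "cou T", OF ksp_ground cou_tn(2) subspace_zero[OF ksp_ground] _ u])
   (simp add: cou_tn(1) graded_subset[OF B.gradB] B.cou_gr[OF n])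
 then show ?thesis by simp
qed

section \<open>Twisted tensor products: the coproduct and counit are multiplicative\<close>

lemma psi_sum_mem [lin]:
 "kspace D ==> (!!p r. p .: A ==> r .: B ==> f p r .: D) ==> tsum A B t f .: D" by(rule tsum_mem)

text \<open>Multiplicativity of the coproducts of \<open>A\<close> and \<open>B\<close> reduces the
  claim to the coproduct of \<open>ps b a'\<close>, which is known because \<open>ps\<close> is a
  coalgebra map. The only signs are those of \<open>B\<close>, and they survive the exchange because
  \<open>ps\<close> preserves degrees.\<close>

lemma cop_mul_tn:
 assumes a: "a .: A" and b: "b .: B" and a': "a' .: A" and b': "b' .: B"
 shows "cop T (mul T (a <*> b) (a' <*> b')) = stens_mul T (gr T) (mul T) (cop T (a <*> b)) (cop T (a' <*> b'))"
proof -
 let ?TT = "tensor T T"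
 note c = a b a' b'
 let ?E = "%a1 a2 p1 p2 r1 r2 d1 d2. hsum (gr B) r2 (%i r2. hsum (gr B) d1 (%j d1.
   pscale ((- 1) ^ (i * j)) (tens T T (mul A a1 p1 <*> mul B r1 d1) (mul A a2 p2 <*> mul B r2 d2))))"
 \<comment> \<open>The summand as a bilinear function of two elements \<open>u\<close>,
   \<open>v\<close> of \<open>T\<close>. In this form the two legs of the coproduct of
   \<open>ps b a'\<close> can be inserted and \<open>psi_cop\<close> applied.\<close>
 let ?K = "%a1 a2 d1 d2 u v. tsum A B u (%p1 r1. tsum A B v (%p2 r2. ?E a1 a2 p1 p2 r1 r2 d1 d2))"
 have "cop T (mul T (a <*> b) (a' <*> b')) = tsum A B (ps b a') (%p r. cop T (mul A a p <*> mul B r b'))"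
  unfolding mul_tn[OF c] by(rule klin_tsum[OF kspT ksp_tens klin_copT]) (rule lin c |assumption)+
 also have "... = tsum A B (ps b a') (%p r. sw A (mul A a p) (%x1 x2. sw B (mul B r b') (%y1 y2. tens T T (x1 <*> y1) (x2 <*> y2))))"
  by(rule tsum_eq, rule cop_tn(1)) (rule lin c |assumption)+
 also have "... = tsum A B (ps b a') (%p r. sw A a (%a1 a2. sw A p (%p1 p2. sw B (mul B r b') (%y1 y2.
   tens T T (mul A a1 p1 <*> y1) (mul A a2 p2 <*> y2)))))"
  by(rule tsum_eq, rule sw_mul[OF ksp_tens A.bialg a]) (rule lin c |assumption)+
 also have "... = tsum A B (ps b a') (%p r. sw A a (%a1 a2. sw A p (%p1 p2. sw B r (%r1 r2. sw B b' (%d1 d2.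
   ?E a1 a2 p1 p2 r1 r2 d1 d2)))))" apply(rule tsum_eq, rule tsum_eq, rule tsum_eq)
  apply(rule B.sw_mul[OF ksp_tens, unfolded smul_tensor]) apply(rule lin c |assumption)+ done
 also have "... = tsum A B (ps b a') (%p r. sw A a (%a1 a2. sw B b' (%d1 d2. sw A p (%p1 p2. sw B r (%r1 r2.
   ?E a1 a2 p1 p2 r1 r2 d1 d2)))))" by(simp only: tsum_swap[of B B "cop B b'"])
 also have "... = sw A a (%a1 a2. sw B b' (%d1 d2. tsum A B (ps b a') (%p r. sw A p (%p1 p2. sw B r (%r1 r2.
   ?E a1 a2 p1 p2 r1 r2 d1 d2)))))" by(simp only: tsum_swap[of A B "ps b a'"])
 also have "... = sw A a (%a1 a2. sw B b' (%d1 d2. sw T (ps b a') (%u v. ?K a1 a2 d1 d2 u v)))"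
 proof (rule tsum_eq, rule tsum_eq)
  fix a1 a2 d1 d2 assume d: "a1 .: A" "a2 .: A" "d1 .: B" "d2 .: B"
  have K: "kbilinear T T ?TT (?K a1 a2 d1 d2)" by(rule lin d |assumption)+
  show "tsum A B (ps b a') (%p r. sw A p (%p1 p2. sw B r (%r1 r2. ?E a1 a2 p1 p2 r1 r2 d1 d2))) =
   sw T (ps b a') (%u v. ?K a1 a2 d1 d2 u v)"
  proof (rule T_eqI[where f = "%t. tsum A B t (%p r. sw A p (%p1 p2. sw B r (%r1 r2. ?E a1 a2 p1 p2 r1 r2 d1 d2)))"
     and g = "%t. sw T t (%u v. ?K a1 a2 d1 d2 u v)", OF ksp_tens])
   show "klinear T ?TT (%t. tsum A B t (%p r. sw A p (%p1 p2. sw B r (%r1 r2. ?E a1 a2 p1 p2 r1 r2 d1 d2))))"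
    by(rule lin d |assumption)+
   show "klinear T ?TT (%t. sw T t (%u v. ?K a1 a2 d1 d2 u v))"
    by(rule klin_tsum_arg[OF kspT ksp_tens klin_copT K])
   show "ps b a' .: T" by(rule lin c)+
   fix p r assume p: "p .: A" and r: "r .: B"
   have "sw T (p <*> r) (%u v. ?K a1 a2 d1 d2 u v) =
    sw A p (%p1 p2. sw B r (%r1 r2. ?K a1 a2 d1 d2 (p1 <*> r1) (p2 <*> r2)))"
    by(rule sw_tn[OF ksp_tens K p r])
   also have "... = sw A p (%p1 p2. sw B r (%r1 r2. tsum A B (p2 <*> r2) (%p2 r2. ?E a1 a2 p1 p2 r1 r2 d1 d2)))"
    by(rule tsum_eq, rule tsum_eq, rule tsum_tn[OF ksp_tens]) (rule lin d |assumption)+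
   also have "... = sw A p (%p1 p2. sw B r (%r1 r2. ?E a1 a2 p1 p2 r1 r2 d1 d2))"
    by(rule tsum_eq, rule tsum_eq, rule tsum_tn[OF ksp_tens]) (rule lin d |assumption)+
   also have "... = tsum A B (p <*> r) (%p r. sw A p (%p1 p2. sw B r (%r1 r2. ?E a1 a2 p1 p2 r1 r2 d1 d2)))"
    by(rule tsum_tn[OF ksp_tens _ p r, symmetric]) (rule lin d |assumption)+
   finally show "tsum A B (p <*> r) (%p r. sw A p (%p1 p2. sw B r (%r1 r2. ?E a1 a2 p1 p2 r1 r2 d1 d2))) =
    sw T (p <*> r) (%u v. ?K a1 a2 d1 d2 u v)" by(rule sym)
  qed
 qed
 also have "... = sw A a (%a1 a2. sw B b' (%d1 d2. sw B b (%b1 b2. sw A a' (%a1' a2'. ?K a1 a2 d1 d2 (ps b1 a1') (ps b2 a2')))))"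
 proof (rule tsum_eq, rule tsum_eq)
  fix a1 a2 d1 d2 assume d: "a1 .: A" "a2 .: A" "d1 .: B" "d2 .: B"
  have K: "kbilinear T T ?TT (?K a1 a2 d1 d2)" by(rule lin d |assumption)+
  show "sw T (ps b a') (%u v. ?K a1 a2 d1 d2 u v) = sw B b (%b1 b2. sw A a' (%a1' a2'. ?K a1 a2 d1 d2 (ps b1 a1') (ps b2 a2')))"
   unfolding psi_cop[OF b a'] apply(subst tsum_tsum[OF kspT ksp_tens K]) apply(rule lin c |assumption)+
   apply(rule tsum_eq) apply(subst tsum_tsum[OF kspT ksp_tens K]) apply(rule lin c |assumption)+ apply(rule tsum_eq)
   apply(rule tsum_tens[OF kspT ksp_tens K]) apply(rule lin |assumption)+ done
 qed
 also have "... = sw A a (%a1 a2. sw B b' (%d1 d2. sw B b (%b1 b2. sw A a' (%a1' a2'.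
   hsum (gr B) b2 (%i b2. hsum (gr B) d1 (%j d1.
    pscale ((- 1) ^ (i * j)) (tens T T (mul T (a1 <*> b1) (a1' <*> d1)) (mul T (a2 <*> b2) (a2' <*> d2)))))))))"
 proof (rule tsum_eq, rule tsum_eq, rule tsum_eq, rule tsum_eq)
  fix a1 a2 d1 d2 b1 b2 a1' a2'
  assume d: "a1 .: A" "a2 .: A" "d1 .: B" "d2 .: B" "b1 .: B" "b2 .: B" "a1' .: A" "a2' .: A"
  \<comment> \<open>Since \<open>ps\<close> preserves degrees, the sign that depends on the degree
    of the exchanged factor \<open>r2\<close> may be read off from \<open>b2\<close>.\<close>
  have "?K a1 a2 d1 d2 (ps b1 a1') (ps b2 a2') =
   tsum A B (ps b1 a1') (%p1 r1. hsum (gr B) b2 (%i b2. tsum A B (ps b2 a2') (%p2 r2. hsum (gr B) d1 (%j d1.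
    pscale ((- 1) ^ (i * j)) (tens T T (mul A a1 p1 <*> mul B r1 d1) (mul A a2 p2 <*> mul B r2 d2))))))"
   by(rule tsum_eq, rule psi_hsum[OF ksp_tens _ d(8,6)]) (rule lin d |assumption)+
  also have "... = hsum (gr B) b2 (%i b2. hsum (gr B) d1 (%j d1. tsum A B (ps b1 a1') (%p1 r1. tsum A B (ps b2 a2') (%p2 r2.
    pscale ((- 1) ^ (i * j)) (tens T T (mul A a1 p1 <*> mul B r1 d1) (mul A a2 p2 <*> mul B r2 d2))))))"
   by(simp only: hsum_tsum)
  also have "... = hsum (gr B) b2 (%i b2. hsum (gr B) d1 (%j d1.
    pscale ((- 1) ^ (i * j)) (tens T T (mul T (a1 <*> b1) (a1' <*> d1)) (mul T (a2 <*> b2) (a2' <*> d2)))))"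
  proof (rule hsum_cong[OF B.gradB d(6)], rule hsum_cong[OF B.gradB d(3)])
   fix i j x y assume xy: "x .: B" "y .: B"
   have "tens T T (mul T (a1 <*> b1) (a1' <*> y)) (mul T (a2 <*> x) (a2' <*> d2)) =
    tsum A B (ps b1 a1') (%p1 r1. tens T T (mul A a1 p1 <*> mul B r1 y) (mul T (a2 <*> x) (a2' <*> d2)))"
    unfolding mul_tn[OF d(1,5,7) xy(2)]
    by(rule kbil_tsum_left[OF kbil_tens kspT ksp_tens]) (rule lin d xy |assumption)+
   also have "... = tsum A B (ps b1 a1') (%p1 r1. tsum A B (ps x a2') (%p2 r2. tens T T (mul A a1 p1 <*> mul B r1 y) (mul A a2 p2 <*> mul B r2 d2)))"
    unfolding mul_tn[OF d(2) xy(1) d(8,4)]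
    by(rule tsum_eq, rule kbil_tsum_right[OF kbil_tens kspT ksp_tens]) (rule lin d xy |assumption)+
   finally show "tsum A B (ps b1 a1') (%p1 r1. tsum A B (ps x a2') (%p2 r2.
     pscale ((- 1) ^ (i * j)) (tens T T (mul A a1 p1 <*> mul B r1 y) (mul A a2 p2 <*> mul B r2 d2)))) =
    pscale ((- 1) ^ (i * j)) (tens T T (mul T (a1 <*> b1) (a1' <*> y)) (mul T (a2 <*> x) (a2' <*> d2)))"
    by(simp only: smul_tsum[OF ksp_tens, of T T, unfolded smul_tensor])
  qed
  finally show "?K a1 a2 d1 d2 (ps b1 a1') (ps b2 a2') = hsum (gr B) b2 (%i b2. hsum (gr B) d1 (%j d1.
    pscale ((- 1) ^ (i * j)) (tens T T (mul T (a1 <*> b1) (a1' <*> d1)) (mul T (a2 <*> b2) (a2' <*> d2)))))" .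
 qed
 also have "... = sw A a (%a1 a2. sw B b (%b1 b2. sw A a' (%a1' a2'. sw B b' (%d1 d2.
   hsum (gr B) b2 (%i b2. hsum (gr B) d1 (%j d1.
    pscale ((- 1) ^ (i * j)) (tens T T (mul T (a1 <*> b1) (a1' <*> d1)) (mul T (a2 <*> b2) (a2' <*> d2)))))))))"
  by(simp only: tsum_swap[of B B "cop B b'"])
 also have "... = stens_mul T (gr T) (mul T) (cop T (a <*> b)) (cop T (a' <*> b'))"
 proof -
  let ?Q = "%U V U' V'. hsum (gr T) V (%i V. hsum (gr T) U' (%j U'. pscale ((- 1) ^ (i * j)) (tens T T (mul T U U') (mul T V V'))))"
  have "stens_mul T (gr T) (mul T) (cop T (a <*> b)) (cop T (a' <*> b')) =
    sw T (a <*> b) (%U V. sw T (a' <*> b') (%U' V'. ?Q U V U' V'))"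
   by(rule stens_mul_eq[OF gradT mulT_bilinear cop_mem[OF coalgT tn_mem[OF a b]] cop_mem[OF coalgT tn_mem[OF a' b']]])
  also have "... = sw A a (%a1 a2. sw B b (%b1 b2. sw T (a' <*> b') (%U' V'. ?Q (a1 <*> b1) (a2 <*> b2) U' V')))"
   by(rule sw_tn[OF ksp_tens _ a b]) (rule mulT_lin lin c |assumption)+
  also have "... = sw A a (%a1 a2. sw B b (%b1 b2. sw A a' (%a1' a2'. sw B b' (%d1 d2. ?Q (a1 <*> b1) (a2 <*> b2) (a1' <*> d1) (a2' <*> d2)))))"
   by(rule tsum_eq, rule tsum_eq, rule sw_tn[OF ksp_tens _ a' b']) (rule mulT_lin lin c |assumption)+
  also have "... = sw A a (%a1 a2. sw B b (%b1 b2. sw A a' (%a1' a2'. sw B b' (%d1 d2.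
   hsum (gr B) b2 (%i b2. hsum (gr B) d1 (%j d1.
    pscale ((- 1) ^ (i * j)) (tens T T (mul T (a1 <*> b1) (a1' <*> d1)) (mul T (a2 <*> b2) (a2' <*> d2)))))))))"
  proof (rule tsum_eq, rule tsum_eq, rule tsum_eq, rule tsum_eq)
   fix a1 a2 b1 b2 a1' a2' d1 d2
   assume d: "a1 .: A" "a2 .: A" "b1 .: B" "b2 .: B" "a1' .: A" "a2' .: A" "d1 .: B" "d2 .: B"
   have "?Q (a1 <*> b1) (a2 <*> b2) (a1' <*> d1) (a2' <*> d2) =
    hsum (gr B) b2 (%i b2. hsum (gr T) (a1' <*> d1) (%j U'. pscale ((- 1) ^ (i * j)) (tens T T (mul T (a1 <*> b1) U') (mul T (a2 <*> b2) (a2' <*> d2)))))"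
    by(rule hsum_tn[OF ksp_tens _ d(2,4)]) (rule mulT_lin lin d |assumption)+
   also have "... = hsum (gr B) b2 (%i b2. hsum (gr B) d1 (%j d1.
    pscale ((- 1) ^ (i * j)) (tens T T (mul T (a1 <*> b1) (a1' <*> d1)) (mul T (a2 <*> b2) (a2' <*> d2)))))"
    by(rule hsum_cong[OF B.gradB d(4)], rule hsum_tn[OF ksp_tens _ d(5,7)]) (rule mulT_lin lin d |assumption)+
   finally show "?Q (a1 <*> b1) (a2 <*> b2) (a1' <*> d1) (a2' <*> d2) = hsum (gr B) b2 (%i b2. hsum (gr B) d1 (%j d1.
    pscale ((- 1) ^ (i * j)) (tens T T (mul T (a1 <*> b1) (a1' <*> d1)) (mul T (a2 <*> b2) (a2' <*> d2)))))" .
  qed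
  finally show ?thesis by(rule sym)
 qed
 finally show ?thesis .
qed

lemma klin_stens_mul:
 assumes v: "v .: (tensor T T)"
 shows "klinear (tensor T T) (tensor T T) (%u. stens_mul T (gr T) (mul T) u v)"
  and "klinear (tensor T T) (tensor T T) (%u. stens_mul T (gr T) (mul T) v u)"
proof -
 show "klinear (tensor T T) (tensor T T) (%u. stens_mul T (gr T) (mul T) u v)"
  by(rule klin_cong[OF ksp_tens _ stens_mul_eq[OF gradT mulT_bilinear _ v]]) (rule mulT_lin lin v |assumption)+
 show "klinear (tensor T T) (tensor T T) (%u. stens_mul T (gr T) (mul T) v u)"
  by(rule klin_cong[OF ksp_tens _ stens_mul_eq[OF gradT mulT_bilinear v]]) (rule mulT_lin lin v |assumption)+
qed

lemma cop_mulT: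
 assumes u: "u .: T" and v: "v .: T"
 shows "cop T (mul T u v) = stens_mul T (gr T) (mul T) (cop T u) (cop T v)"
proof -
 note l = klin_comp[OF klin_stens_mul(1)] klin_comp[OF klin_stens_mul(2)]
 have 1: "cop T (mul T (a <*> b) v) = stens_mul T (gr T) (mul T) (cop T (a <*> b)) (cop T v)"
  if "a .: A" "b .: B" for a b
  by(rule T_eqI[where f = "%v. cop T (mul T (a <*> b) v)" and g = "%v. stens_mul T (gr T) (mul T) (cop T (a <*> b)) (cop T v)",
    OF ksp_tens _ _ cop_mul_tn[OF that] v]) (rule mulT_lin l lin that |assumption)+
 show ?thesis by(rule T_eqI[where f = "%u. cop T (mul T u v)" and g = "%u. stens_mul T (gr T) (mul T) (cop T u) (cop T v)",
    OF ksp_tens _ _ 1 u]) (rule mulT_lin l lin v |assumption)+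
qed

lemma cou_mulT:
 assumes u: "u .: T" and v: "v .: T"
 shows "cou T (mul T u v) = cou T u * cou T v"
proof -
 have 0: "cou T (mul T (a <*> b) (a' <*> b')) = cou T (a <*> b) * cou T (a' <*> b')"
  if c: "a .: A" "b .: B" "a' .: A" "b' .: B" for a b a' b'
 proof -
  have "cou T (mul T (a <*> b) (a' <*> b')) = tsum A B (ps b a') (%p r. cou T (mul A a p <*> mul B r b'))"
   unfolding mul_tn[OF c] by(rule klin_tsum[OF kspT ksp_ground cou_tn(2)]) (rule lin c |assumption)+
  also have "... = tsum A B (ps b a') (%p r. smul ground (cou A a * cou B b') (cou T (p <*> r)))" by(rule tsum_eq)
    (simp add: cou_tn(1) mul_mem[OF A.alg] mul_mem[OF B.algB] bialgebra_cou[OF A.bialg] B.cou_mul c)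
  also have "... = smul ground (cou A a * cou B b') (tsum A B (ps b a') (%p r. cou T (p <*> r)))"
   by(rule smul_tsum[OF ksp_ground, symmetric])
  also have "tsum A B (ps b a') (%p r. cou T (p <*> r)) = cou T (tsum A B (ps b a') (%p r. p <*> r))"
   by(rule klin_tsum[OF kspT ksp_ground cou_tn(2), symmetric]) (rule lin c |assumption)+
  also have "tsum A B (ps b a') (%p r. p <*> r) = ps b a'"
   using tsum_tens_id[OF kspA, of "ps b a'" B] kbilin(1)[OF psi c(2,3)] by(simp add: carT)
  finally show ?thesis using c by(simp add: psi_cou cou_tn(1))
 qed
 note l = couT_lin
 have 1: "cou T (mul T (a <*> b) v) = cou T (a <*> b) * cou T v"
  if "a .: A" "b .: B" for a b
  by(rule T_eqI[where f = "%v. cou T (mul T (a <*> b) v)" and g = "%v. cou T (a <*> b) * cou T v",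
    OF ksp_ground _ _ 0[OF that] v]) (rule mulT_lin l lin that |assumption)+
 show ?thesis by(rule T_eqI[where f = "%u. cou T (mul T u v)" and g = "%u. cou T u * cou T v",
    OF ksp_ground _ _ 1 u]) (rule mulT_lin l lin v |assumption)+
qed

section \<open>Twisted tensor products: the antipode\<close>

lemma mul_unit_tn:
 assumes a: "a .: A" and b: "b .: B"
 shows mul_tn_left: "a' .: A ==> mul T (a <*> unit B) (a' <*> b) = mul A a a' <*> b"
  and mul_tn_right: "b' .: B ==> mul T (a <*> b) (unit A <*> b') = a <*> mul B b b'"
proof -
 note u = unit_mem[OF A.alg] unit_mem[OF B.algB]
 show "mul T (a <*> unit B) (a' <*> b) = mul A a a' <*> b" if a': "a' .: A"
 proof -
  have "mul T (a <*> unit B) (a' <*> b) = mul A a a' <*> mul B (unit B) b"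
   unfolding mul_tn[OF a u(2) a' b] psi_unit_left[OF a'] by(rule tsum_tn[OF kspT]) (rule lin a b a' u |assumption)+
  then show ?thesis by(simp add: mul_unit[OF B.algB] b)
 qed
 show "mul T (a <*> b) (unit A <*> b') = a <*> mul B b b'" if b': "b' .: B"
 proof -
  have "mul T (a <*> b) (unit A <*> b') = mul A a (unit A) <*> mul B b b'"
   unfolding mul_tn[OF a b u(1) b'] psi_unit_right[OF b] by(rule tsum_tn[OF kspT]) (rule lin a b b' u |assumption)+
  then show ?thesis by(simp add: mul_unit[OF A.alg] a)
 qed
qed

lemma antipode_T: "\<exists>S. is_antipode T S & (\<forall>n. \<forall>u\<in>gr T n. S u : gr T n)"
proof -
 obtain SB where SB: "is_antipode B SB" and SBgr: "!!n b. b : gr B n ==> SB b : gr B n" using B.graded_antipode by blast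
 have SBl: "klinear B B SB" using SB by(simp add: is_antipode_def)
 note [lin] = klin_mem[OF SBl] klin_comp[OF SBl]
 note m = mul_assoc[OF algT]
 note u = unit_mem[OF A.alg] unit_mem[OF B.algB]
 have SB_eq: "sw B b (%x y. mul B (SB x) y) = smul B (cou B b) (unit B)"
  "sw B b (%x y. mul B x (SB y)) = smul B (cou B b) (unit B)" if "b .: B" for b
 proof -
  have 1: "kbilinear B B B (%x y. mul B (SB x) y)" "kbilinear B B B (%x y. mul B x (SB y))" by(rule lin |assumption)+
  show "sw B b (%x y. mul B (SB x) y) = smul B (cou B b) (unit B)"
   using SB that tlift_eq_tsum[OF kspB kspB 1(1) cop_mem[OF coalgB that]] by(simp add: is_antipode_def)
  show "sw B b (%x y. mul B x (SB y)) = smul B (cou B b) (unit B)"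
   using SB that tlift_eq_tsum[OF kspB kspB 1(2) cop_mem[OF coalgB that]] by(simp add: is_antipode_def)
 qed
 \<comment> \<open>The element \<open>a <*> b\<close> is the product of \<open>a <*> unit B\<close>
   and \<open>unit A <*> b\<close>, so its antipode is the product of the antipodes in the opposite
   order. No sign arises because \<open>A\<close> sits in degree zero.\<close>
 define P where "P a b = mul T (unit A <*> SB b) (A.S a <*> unit B)" for a b
 have P_bil: "kbilinear A B T P" unfolding P_def by(rule u mulT_lin lin |assumption)+
 note [lin] = kbilin[OF P_bil]
 let ?S = "%t. tsum A B t P"
 have S_lin: "klinear T T ?S" by(rule lin |assumption)+
 have S_tn: "?S (a <*> b) = P a b" if "a .: A" "b .: B" for a b by(rule tsum_tn[OF kspT P_bil that])
 have gr: "?S t : gr T n" if "t : gr T n" for t n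
 proof (rule grT_image[where f = ?S, OF kspT S_lin grT_subspace _ that])
  fix a b assume a: "a .: A" and b: "b : gr B n"
  note bc = graded_subset[OF B.gradB b]
  have "mul T (unit A <*> SB b) (A.S a <*> unit B) : gr T (n + 0)"
   by(rule mul_grT[OF tn_gr[OF u(1) SBgr[OF b]] tn_gr[OF A.S_mem[OF a] B.unit_gr]])
  then show "?S (a <*> b) : gr T n" unfolding S_tn[OF a bc] P_def by(simp only: add_0_right)
 qed
 have left: "sw T t (%x y. mul T (?S x) y) = smul T (cou T t) (unit T)" if t: "t .: T" for t
 proof (rule T_eqI[OF kspT _ _ _ t])
  show "klinear T T (%t. sw T t (%x y. mul T (?S x) y))" by(rule mulT_lin lin |assumption)+
  show "klinear T T (%t. smul T (cou T t) (unit T))" by(rule couT_lin lin |assumption)+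
  fix a b assume ab: "a .: A" "b .: B"
  have "sw T (a <*> b) (%x y. mul T (?S x) y) =
   sw A a (%a1 a2. sw B b (%b1 b2. mul T (?S (a1 <*> b1)) (a2 <*> b2)))"
   by(rule sw_tn[OF kspT _ ab]) (rule mulT_lin lin |assumption)+
  also have "... = sw A a (%a1 a2. sw B b (%b1 b2. mul T (unit A <*> SB b1) (mul A (A.S a1) a2 <*> b2)))"
  proof (rule tsum_eq, rule tsum_eq)
   fix a1 a2 b1 b2 assume d: "a1 .: A" "a2 .: A" "b1 .: B" "b2 .: B"
   have "mul T (?S (a1 <*> b1)) (a2 <*> b2) = mul T (unit A <*> SB b1) (mul T (A.S a1 <*> unit B) (a2 <*> b2))"
    unfolding S_tn[OF d(1,3)] P_def by(rule m) (rule lin d u |assumption)+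
   also have "mul T (A.S a1 <*> unit B) (a2 <*> b2) = mul A (A.S a1) a2 <*> b2"
    by(rule mul_tn_left[OF A.S_mem[OF d(1)] d(4,2)])
   finally show "mul T (?S (a1 <*> b1)) (a2 <*> b2) = mul T (unit A <*> SB b1) (mul A (A.S a1) a2 <*> b2)" .
  qed
  also have "... = sw B b (%b1 b2. sw A a (%a1 a2. mul T (unit A <*> SB b1) (mul A (A.S a1) a2 <*> b2)))"
   by(rule tsum_swap)
  also have "... = sw B b (%b1 b2. smul T (cou A a) (mul T (unit A <*> SB b1) (unit A <*> b2)))"
   by(rule tsum_eq, rule A.antipode_left[OF kspT _ ab(1)]) (rule mulT_lin lin u |assumption)+
  also have "... = sw B b (%b1 b2. smul T (cou A a) (unit A <*> mul B (SB b1) b2))"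
   by(rule tsum_eq) (simp only: mul_tn_right[OF u(1) klin_mem[OF SBl]])
  also have "... = smul T (cou A a) (unit A <*> sw B b (%b1 b2. mul B (SB b1) b2))"
   unfolding smul_tsum[OF kspT, symmetric] apply(rule arg_cong[where f = "smul T _"])
   apply(rule kbil_tsum_right[OF kbil_tens kspB ksp_tens u(1), symmetric]) apply(rule lin |assumption)+ done
  also have "... = smul T (cou T (a <*> b)) (unit T)" by(simp add: SB_eq ab cou_tn(1) unitT tens_scale_right u)
  finally show "sw T (a <*> b) (%x y. mul T (?S x) y) = smul T (cou T (a <*> b)) (unit T)" .
 qed
 have right: "sw T t (%x y. mul T x (?S y)) = smul T (cou T t) (unit T)" if t: "t .: T" for t
 proof (rule T_eqI[OF kspT _ _ _ t])
  show "klinear T T (%t. sw T t (%x y. mul T x (?S y)))" by(rule mulT_lin lin |assumption)+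
  show "klinear T T (%t. smul T (cou T t) (unit T))" by(rule couT_lin lin |assumption)+
  fix a b assume ab: "a .: A" "b .: B"
  have "sw T (a <*> b) (%x y. mul T x (?S y)) =
   sw A a (%a1 a2. sw B b (%b1 b2. mul T (a1 <*> b1) (?S (a2 <*> b2))))"
   by(rule sw_tn[OF kspT _ ab]) (rule mulT_lin lin |assumption)+
  also have "... = sw A a (%a1 a2. sw B b (%b1 b2. mul T (a1 <*> mul B b1 (SB b2)) (A.S a2 <*> unit B)))"
  proof (rule tsum_eq, rule tsum_eq)
   fix a1 a2 b1 b2 assume d: "a1 .: A" "a2 .: A" "b1 .: B" "b2 .: B"
   have "mul T (a1 <*> b1) (?S (a2 <*> b2)) = mul T (mul T (a1 <*> b1) (unit A <*> SB b2)) (A.S a2 <*> unit B)"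
    unfolding S_tn[OF d(2,4)] P_def by(rule m[symmetric]) (rule lin d u |assumption)+
   also have "mul T (a1 <*> b1) (unit A <*> SB b2) = a1 <*> mul B b1 (SB b2)"
    by(rule mul_tn_right[OF d(1,3) klin_mem[OF SBl d(4)]])
   finally show "mul T (a1 <*> b1) (?S (a2 <*> b2)) = mul T (a1 <*> mul B b1 (SB b2)) (A.S a2 <*> unit B)" .
  qed
  also have "... = sw A a (%a1 a2. mul T (a1 <*> sw B b (%b1 b2. mul B b1 (SB b2))) (A.S a2 <*> unit B))"
   apply(rule tsum_eq)
   apply(rule klin_tsum[where g = "%z. mul T (_ <*> z) (A.S _ <*> unit B)", OF kspB kspT, symmetric])
    apply(rule mulT_lin u lin |assumption)+ done
  also have "... = sw A a (%a1 a2. smul T (cou B b) (mul A a1 (A.S a2) <*> unit B))"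
  proof (rule tsum_eq)
   fix a1 a2 assume d: "a1 .: A" "a2 .: A"
   have l: "klinear B T (%z. mul T (a1 <*> z) (A.S a2 <*> unit B))" by(rule mulT_lin u lin d |assumption)+
   show "mul T (a1 <*> sw B b (%b1 b2. mul B b1 (SB b2))) (A.S a2 <*> unit B) = smul T (cou B b) (mul A a1 (A.S a2) <*> unit B)"
    by(simp only: SB_eq(2)[OF ab(2)] klin_scale[OF l u(2)] mul_tn_left[OF d(1) u(2) A.S_mem[OF d(2)]])
  qed
  also have "... = smul T (cou A a) (smul T (cou B b) (unit A <*> unit B))"
   by(rule A.antipode_right[where g = "%z. smul T (cou B b) (z <*> unit B)", OF kspT _ ab(1)]) (rule u lin |assumption)+
  also have "... = smul T (cou T (a <*> b)) (unit T)" by(simp add: ab cou_tn(1) unitT)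
  finally show "sw T (a <*> b) (%x y. mul T x (?S y)) = smul T (cou T (a <*> b)) (unit T)" .
 qed
 have bil: "kbilinear T T T (%b c. mul T (?S b) c)" "kbilinear T T T (%b c. mul T b (?S c))" by(rule mulT_lin lin |assumption)+
 have "is_antipode T ?S" unfolding is_antipode_def
  by(simp add: S_lin left right tlift_eq_tsum[OF kspT kspT bil(1) cop_mem[OF coalgT]]
    tlift_eq_tsum[OF kspT kspT bil(2) cop_mem[OF coalgT]])
 then show ?thesis using gr by blast
qed

theorem super_hopf_T: "super_hopf_algebra T"
proof -
 have "cop T (unit T) = tens T T (unit T) (unit T)"
 proof -
  note u = unit_mem[OF A.alg] unit_mem[OF B.algB]
  have "cop T (unit T) = sw B (unit B) (%b1 b2. tens T T (unit A <*> b1) (unit A <*> b2))"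
   unfolding unitT cop_tn(1)[OF u] by(rule sw_unit[OF ksp_tens A.bialg]) (rule lin |assumption)+
  also have "... = tens T T (unit A <*> unit B) (unit A <*> unit B)"
   by(rule B.sw_unit[OF ksp_tens]) (rule u lin |assumption)+
  finally show ?thesis by(simp add: unitT)
 qed
 moreover have "cou T (unit T) = 1"
  by(simp add: unitT cou_tn(1) unit_mem[OF A.alg] unit_mem[OF B.algB] bialgebra_cou[OF A.bialg] B.cou_unit)
 moreover have "unit T : gr T 0" unfolding unitT by(rule tn_gr[OF unit_mem[OF A.alg] B.unit_gr])
 ultimately show ?thesis unfolding super_hopf_algebra_def
  using algT coalgT gradT mul_grT cop_grT cou_grT cop_mulT cou_mulT antipode_T by simp
qed

end

lemma coalgebra_iff:
 "coalgebra C \<longleftrightarrow> kspace C & klinear C (tensor C C) (cop C) & klinear C ground (cou C) &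
  (\<forall>c\<in>car C.
   sw C c (%a b. sw C a (%a1 a2. tens C (tensor C C) a1 (tens C C a2 b))) =
   sw C c (%a b. sw C b (%b1 b2. tens C (tensor C C) a (tens C C b1 b2))) &
   sw C c (%a b. smul C (cou C a) b) = c & sw C c (%a b. smul C (cou C b) a) = c)"
 (is "_ \<longleftrightarrow> ?R")
proof
 assume C: "coalgebra C"
 note k = coalgebra_kspace[OF C]
 have F: "ktrilinear C C C (tensor C (tensor C C)) (%a b c. tens C (tensor C C) a (tens C C b c))"
  by(rule lin k C |assumption)+
 show ?R using k sw_coassoc[OF ksp_tens C _ F] sw_counit_left[OF k C _ klin_id]
   sw_counit_right[OF k C _ klin_id] klin_cop[OF C] klin_cou[OF C] by blast
next
 assume ?R
 then show "coalgebra C" by(intro coalgebraI) blast+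
qed

lemma is_antipode_iff:
 assumes "assoc_algebra A" "coalgebra A"
 shows "is_antipode A S \<longleftrightarrow> klinear A A S &
  (\<forall>a\<in>car A. sw A a (%b c. mul A (S b) c) = smul A (cou A a) (unit A) &
   sw A a (%b c. mul A b (S c)) = smul A (cou A a) (unit A))"
proof (cases "klinear A A S")
 case True
 note k = assoc_algebra_kspace[OF assms(1)]
 have b: "kbilinear A A A (%b c. mul A (S b) c)" "kbilinear A A A (%b c. mul A b (S c))"
  by(rule lin klin_mem[OF True] klin_comp[OF True] assms k |assumption)+
 show ?thesis by(simp add: is_antipode_def True tlift_eq_tsum[OF k k b(1) cop_mem[OF assms(2)]]
    tlift_eq_tsum[OF k k b(2) cop_mem[OF assms(2)]])
next
 case False
 then show ?thesis by(simp add: is_antipode_def)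
qed

section \<open>Ordinary Hopf algebras as super-Hopf algebras in degree zero\<close>

section \<open>Hopf algebras concentrated in degree zero\<close>

text \<open>Lets the graded theory of twisted tensor products cover the ungraded cross product S(D)
  \<rtimes> H as well: in degree zero all Koszul signs are trivial.\<close>

definition trivially_graded ::
 "('k::field, 'a::ab_group_add, 'z) kbialg_scheme => ('k, 'a) kgbialg" where
 "trivially_graded A =
   \<lparr>car = car A, smul = smul A, cop = cop A, cou = cou A, mul = mul A, unit = unit A,
   gr = (%n. if n = 0 then car A else {0})\<rparr>"

lemma trivially_graded_simps [simp]:
 "car (trivially_graded A) = car A" "smul (trivially_graded A) = smul A"
 "cop (trivially_graded A) = cop A" "cou (trivially_graded A) = cou A"
 "mul (trivially_graded A) = mul A" "unit (trivially_graded A) = unit A"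
 "gr (trivially_graded A) n = (if n = 0 then car A else {0})" by(simp_all add: trivially_graded_def)

lemma trivially_graded_spaces:
 fixes A :: "('k::field, 'a::ab_group_add, 'z) kbialg_scheme"
 shows "kspace (trivially_graded A) = kspace A"
  and "tensor (trivially_graded A) (trivially_graded A) = tensor A A"
  and "tens (trivially_graded A) (trivially_graded A) = tens A A"
  and "tsum (trivially_graded A) (trivially_graded A) = (tsum A A :: _ => _ => 'c::ab_group_add)"
 by(rule kspace_cong tensor_cong tens_cong tsum_cong_spaces; simp)+

lemma klin_trivially_graded:
 "klinear (trivially_graded A) X f = klinear A X f" "klinear X (trivially_graded A) g = klinear X A g"
 by(simp_all add: klinear_def)

lemma trivially_graded_coalgebra: "coalgebra (trivially_graded A) \<longleftrightarrow> coalgebra A"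
proof -
 have *: "tensor (trivially_graded A) (tensor A A) = tensor A (tensor A A)"
  "tens (trivially_graded A) (tensor A A) = tens A (tensor A A)" by(rule tensor_cong tens_cong; simp)+
 show ?thesis unfolding coalgebra_iff by(simp add: trivially_graded_spaces * klin_trivially_graded)
qed

lemma trivially_graded_algebra: "assoc_algebra (trivially_graded A) \<longleftrightarrow> assoc_algebra A"
 by(simp add: assoc_algebra_def trivially_graded_spaces kbilinear_def klin_trivially_graded)

lemma trivially_graded_antipode:
 assumes "assoc_algebra A" "coalgebra A"
 shows "is_antipode (trivially_graded A) S \<longleftrightarrow> is_antipode A S" using is_antipode_iff[OF assms, of S]
  is_antipode_iff[of "trivially_graded A" S, unfolded trivially_graded_algebra trivially_graded_coalgebra, OF assms]
 by(simp add: trivially_graded_spaces klin_trivially_graded)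

lemma trivially_graded_space:
 assumes A: "kspace A"
 shows "graded_space (trivially_graded A) (gr (trivially_graded A))"
proof (rule graded_spaceI[where p = "%i x. if i = 0 then x else 0"])
 show T: "kspace (trivially_graded A)" by(simp add: trivially_graded_spaces A)
 show "klinear (trivially_graded A) (trivially_graded A) (%x. if i = 0 then x else 0)" for i :: nat
  using klin_id klin_const_0[OF T] by(cases "i = 0") auto
 show "finite {i. (if i = (0::nat) then x else 0) ~= 0}" for x :: 'b by(rule finite_subset[of _ "{0}"]) auto
 show "x = (\<Sum>i | (if i = (0::nat) then x else 0) ~= 0. if i = 0 then x else 0)" for x :: 'b
 proof -
  have "{i. (if i = (0::nat) then x else 0) ~= 0} = (if x = 0 then {} else {0})" by auto
  then show ?thesis by simp
 qed
 show "module.subspace (smul (trivially_graded A)) (gr (trivially_graded A) i)" for i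
  using ksp_subspace[OF A] module.subspace_single_0[OF ksp_module[OF A]] by simp
qed (use ksp_zero[OF A] in \<open>auto split: if_splits\<close>)

lemma stens_mul_trivially_graded:
 assumes A: "kspace A" and m: "kbilinear A A A m" and u: "u .: (tensor A A)" and v: "v .: (tensor A A)"
 shows "stens_mul (trivially_graded A) (gr (trivially_graded A)) m u v = tens_mul A m u v"
proof -
 let ?A = "trivially_graded A"
 note G = trivially_graded_space[OF A]
 have m': "kbilinear ?A ?A ?A m" using m by(simp add: kbilinear_def klin_trivially_graded)
 have g: "a .: A ==> a : gr ?A 0" for a by simp
 have z: "tens A A 0 b = 0" "tens A A b 0 = 0" if "b .: A" for b
  using klin_0[OF A ksp_tens tens_lin(3)[OF that klin_id]]
   klin_0[OF A ksp_tens tens_lin(2)[OF that klin_id]] by simp_all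
 have mz: "m 0 b = 0" "m b 0 = 0" if "b .: A" for b
  using klin_0[OF A A, of "%x. m x b"] klin_0[OF A A, of "%x. m b x"] that
   kbilin(2,3)[OF m that klin_id] by auto
 have "stens_mul ?A (gr ?A) m u v = tsum A A u (%a b. tsum A A v (%a' b'.
  hsum (gr ?A) b (%i b. hsum (gr ?A) a' (%j a'. pscale ((- 1) ^ (i * j)) (tens A A (m a a') (m b b'))))))"
  by(subst stens_mul_eq[OF G m']) (simp_all add: trivially_graded_spaces u v)
 also have "... = tsum A A u (%a b. tsum A A v (%a' b'. tens A A (m a a') (m b b')))"
 proof (rule tsum_eq, rule tsum_eq)
  fix a b a' b' assume c: "a .: A" "b .: A" "a' .: A" "b' .: A"
  have 1: "hsum (gr ?A) a' (%j a'. pscale ((- 1) ^ (i * j)) (tens A A (m a a') (m b b'))) = tens A A (m a a') (m b b')"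
   if "b .: A" for i b
   by(subst hsum_homogeneous[OF G g[OF c(3)]]) (use c that in \<open>simp_all add: mz z kbilin(1)[OF m]\<close>)
  have "hsum (gr ?A) b (%i b. hsum (gr ?A) a' (%j a'. pscale ((- 1) ^ (i * j)) (tens A A (m a a') (m b b')))) =
   hsum (gr ?A) b (%i b. tens A A (m a a') (m b b'))" by(rule hsum_cong[OF G]) (use c in \<open>simp_all add: 1\<close>)
  also have "... = tens A A (m a a') (m b b')"
   by(subst hsum_homogeneous[OF G g[OF c(2)]]) (use c in \<open>simp_all add: mz z kbilin(1)[OF m]\<close>)
  finally show "hsum (gr ?A) b (%i b. hsum (gr ?A) a' (%j a'. pscale ((- 1) ^ (i * j)) (tens A A (m a a') (m b b')))) =
   tens A A (m a a') (m b b')" .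
 qed
 also have "... = tens_mul A m u v" by(rule tens_mul_eq_tsum[OF A m u v, symmetric])
 finally show ?thesis .
qed

text \<open>Serves in both directions: from right to left to admit \<open>H\<close> as second factor
  of a twisted tensor product, from left to right to read off that the resulting cross product is an
  ordinary Hopf algebra.\<close>

theorem super_hopf_trivially_graded: "super_hopf_algebra (trivially_graded A) \<longleftrightarrow> hopf_algebra A"
proof
 assume L: "super_hopf_algebra (trivially_graded A)"
 then have alg: "assoc_algebra A" and coalg: "coalgebra A"
  by(simp_all add: super_hopf_algebra_def trivially_graded_algebra trivially_graded_coalgebra)
 note k = assoc_algebra_kspace[OF alg]
 have mul: "cop A (mul A a b) = tens_mul A (mul A) (cop A a) (cop A b)" "cou A (mul A a b) = cou A a * cou A b"
  if ab: "a .: A" "b .: A" for a b using L ab unfolding super_hopf_algebra_def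
  by(simp_all add: stens_mul_trivially_graded[OF k kbil_mul[OF alg] cop_mem[OF coalg ab(1)] cop_mem[OF coalg ab(2)]])
 have "cop A (unit A) = tens A A (unit A) (unit A)" "cou A (unit A) = 1"
  using L by(simp_all add: super_hopf_algebra_def trivially_graded_spaces)
 moreover have "\<exists>S. is_antipode A S"
  using L trivially_graded_antipode[OF alg coalg] by(auto simp: super_hopf_algebra_def)
 ultimately show "hopf_algebra A" using alg coalg mul by(simp add: hopf_algebra_def bialgebra_def)
next
 assume "hopf_algebra A"
 then interpret hopf A by unfold_locales
 let ?A = "trivially_graded A"
 have mul: "cop A (mul A a b) = stens_mul ?A (gr ?A) (mul A) (cop A a) (cop A b)" "cou A (mul A a b) = cou A a * cou A b"
  if ab: "a .: A" "b .: A" for a b using bialg ab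
  by(simp_all add: bialgebra_def stens_mul_trivially_graded[OF ksp kbil_mul[OF alg] cop_mem[OF coalg ab(1)] cop_mem[OF coalg ab(2)]])
 have sp: "cop A a : module.span pscale {tens A A b c |b c i j. b : gr ?A i & c : gr ?A j & i + j = n}"
  if a: "a : gr ?A n" for a n
 proof (cases "n = 0")
  case True
  have "cop A a .: (tensor A A)" using a True by(simp add: cop_mem[OF coalg])
  then have "cop A a : module.span pscale (case_prod (tens A A) ` (car A \<times> car A))"
   by(simp add: tensor_def gen_space_def tens_def case_prod_unfold)
  moreover have "case_prod (tens A A) ` (car A \<times> car A) \<subseteq> {tens A A b c |b c i j. b : gr ?A i & c : gr ?A j & i + j = n}"
   using True by force
  ultimately show ?thesis using module.span_mono[OF module_pscale] by blast
 next
  case False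
  then have "a = 0" using a by simp
  then have "cop A a = 0" using klin_0[OF ksp ksp_tens klin_cop[OF coalg]] by simp
  then show ?thesis by(simp add: module.span_zero[OF module_pscale])
 qed
 have gm: "mul A a b : gr ?A (i + j)" if "a : gr ?A i" "b : gr ?A j" for a b i j
 proof -
  have z: "mul A 0 x = 0" "mul A x 0 = 0" if "x .: A" for x
   using klin_0[OF ksp ksp mul_left[OF alg that klin_id]]
    klin_0[OF ksp ksp mul_right[OF alg that klin_id]] by simp_all
  show ?thesis using that z z(1)[OF ksp_zero[OF ksp]] by(auto simp: mul_mem[OF alg] split: if_splits)
 qed
 have e0: "cou A 0 = 0" by(rule klin_0[OF ksp ksp_ground klin_cou[OF coalg]])
 have S0: "S 0 = 0" by(rule klin_0[OF ksp ksp klin_S])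
 have "\<exists>S. is_antipode ?A S & (\<forall>n. \<forall>a\<in>gr ?A n. S a : gr ?A n)" using is_antipode S0
  by(intro exI[of _ S]) (auto simp: trivially_graded_antipode[OF alg coalg] S_mem)
 then show "super_hopf_algebra ?A" unfolding super_hopf_algebra_def trivially_graded_algebra trivially_graded_coalgebra
  using alg coalg trivially_graded_space[OF ksp] gm sp mul e0 bialg unit_mem[OF alg]
  by(simp add: trivially_graded_spaces bialgebra_def)
qed

section \<open>Words modulo symmetric or alternating relations: product, sign map and
  grading\<close>

section \<open>Symmetric and exterior algebras\<close>

text \<open>Both algebras are treated at once: \<open>alt\<close> selects the exterior algebra.\<close>

definition word_forms ::
 "bool => ('k::field, 'w::ab_group_add, 'z) kspace_scheme => ('w list => 'k) set" where
 "word_forms alt W = {F \<in> multilinear_forms W.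
   \<forall>us\<in>lists (car W). \<forall>vs\<in>lists (car W). \<forall>x\<in>car W. \<forall>y\<in>car W.
    F (us @ x # y # vs) = (if alt then - 1 else 1) * F (us @ y # x # vs) &
    (alt \<longrightarrow> F (us @ x # x # vs) = 0)}"

lemma symmetric_word_forms: "symmetric_forms W = word_forms False W" by(simp add: symmetric_forms_def word_forms_def)

text \<open>Polarisation: expanding a form at \<open>x + y\<close>, \<open>x + y\<close> in adjacent
  places gives the sign rule under transpositions.\<close>

lemma alternating_word_forms:
 assumes W: "kspace W"
 shows "alternating_forms W = word_forms True W"
proof -
 have neg: "F (us @ x # y # vs) = - F (us @ y # x # vs)"
  if F: "F : alternating_forms W" and c: "us : lists (car W)" "vs : lists (car W)" "x .: W" "y .: W" for F us vs x y
 proof -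
  have l: "klinear W ground (%w. F (us @ w # vs))" if "us : lists (car W)" "vs : lists (car W)" for us vs
   using F that by(simp add: alternating_forms_def multilinear_forms_def)
  have z: "F (us @ w # w # vs) = 0" if "w .: W" for w using F c that by(simp add: alternating_forms_def)
  have xy: "x + y .: W" by(rule ksp_add[OF W c(3,4)])
  have "0 = F (us @ (x + y) # (x + y) # vs)" using z[OF xy] by simp
  also have "... = F (us @ x # (x + y) # vs) + F (us @ y # (x + y) # vs)"
   using klin_add[OF l[of us "(x + y) # vs"] c(3,4)] c xy by simp
  also have "F (us @ x # (x + y) # vs) = F (us @ x # x # vs) + F (us @ x # y # vs)"
   using klin_add[OF l[of "us @ [x]" vs] c(3,4)] c by simp
  also have "F (us @ y # (x + y) # vs) = F (us @ y # x # vs) + F (us @ y # y # vs)"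
   using klin_add[OF l[of "us @ [y]" vs] c(3,4)] c by simp
  finally show ?thesis using z c by(simp add: eq_neg_iff_add_eq_0)
 qed
 show ?thesis
 proof (intro set_eqI iffI)
  fix F assume F: "F : alternating_forms W"
  then have "F : multilinear_forms W"
   "\<forall>us\<in>lists (car W). \<forall>vs\<in>lists (car W). \<forall>x\<in>car W. F (us @ x # x # vs) = 0"
   unfolding alternating_forms_def by blast+
  then show "F : word_forms True W" unfolding word_forms_def
  proof (intro CollectI conjI ballI impI)
   fix us vs x y assume c: "us : lists (car W)" "vs : lists (car W)" "x .: W" "y .: W"
   show "F (us @ x # y # vs) = (if True then - 1 else 1) * F (us @ y # x # vs)" using neg[OF F c] by simp
  qed blast+
 next
  fix F assume "F : word_forms True W"
  then show "F : alternating_forms W" unfolding word_forms_def alternating_forms_def by blast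
 qed
qed

lemmas lists_lin [lin] = lists.Nil lists.Cons

lemma append_lists [lin]: "us : lists A ==> vs : lists A ==> us @ vs : lists A" by simp

locale word_algebra =
 fixes W :: "('k::field, 'w::ab_group_add, 'y) kspace_scheme" and alt :: bool
  and X :: "('k, ('w list, 'k) functional, 'z) kbialg_scheme"
 assumes kspW [lin]: "kspace W"
  and carX: "car X = car (word_space (word_forms alt W) W)" and smulX [lin, simp]: "smul X = pscale"
  and mulX: "mul X = word_mul (word_forms alt W) W" and unitX: "unit X = gen (word_forms alt W) []"
begin

abbreviation "R \<equiv> word_forms alt W"
abbreviation "L \<equiv> lists (car W)"
abbreviation "WS \<equiv> word_space R W"
abbreviation "q \<equiv> (if alt then - 1 else 1 :: 'k)"
abbreviation "gw \<equiv> gen R :: 'w list => ('w list, 'k) functional"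

lemma sX: "car X = car WS" "smul X = smul WS" by(simp_all add: carX word_space_def gen_space_def)

lemma spX: "car X = module.span pscale (gw ` L)" by(simp add: carX word_space_def gen_space_def)

lemma kspX [lin]: "kspace X" using kspace_cong[OF sX sX] by(simp add: word_space_def kspace_gen_space)

lemma klin_WS: "klinear X D f = klinear WS D f" "klinear D X g = klinear D WS g"
 by(simp_all add: klinear_def carX word_space_def gen_space_def)

lemma sWS: "car WS = car X" "smul WS = pscale" by(simp_all add: carX word_space_def gen_space_def)

lemma klin_gen: "klinear X D f = klinear (gen_space R L) D f" by(simp add: klin_WS word_space_def)

lemma gw_mem [lin]: "ws : L ==> gw ws .: X" unfolding spX by(rule module.span_base[OF module_pscale]) simp

lemma gw_klinear: "us : L ==> vs : L ==> klinear W X (%w. gw (us @ w # vs))"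
proof (rule klinearI)
 assume c: "us : L" "vs : L"
 show "gw (us @ x # vs) .: X" if "x .: W" for x using c that by(intro gw_mem) simp
 have l: "klinear W ground (%w. F (us @ w # vs))" if "F : R" for F
  using c that by(simp add: word_forms_def multilinear_forms_def)
 show "gw (us @ (x + y) # vs) = gw (us @ x # vs) + gw (us @ y # vs)" if "x .: W" "y .: W" for x y
 proof
  fix F
  show "gw (us @ (x + y) # vs) F = (gw (us @ x # vs) + gw (us @ y # vs)) F"
   using klin_add[OF l that, of F] by(cases "F : R") (simp_all add: gen_def)
 qed
 show "gw (us @ smul W k x # vs) = smul X k (gw (us @ x # vs))" if "x .: W" for k x
 proof
  fix F
  show "gw (us @ smul W k x # vs) F = smul X k (gw (us @ x # vs)) F"
   using klin_scale[OF l that, of F k] by(cases "F : R") (simp_all add: gen_def pscale_def)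
 qed
qed

lemma gw_lin [lin]: "us : L ==> vs : L ==> klinear E W g ==> klinear E X (%x. gw (us @ g x # vs))"
 by(rule klin_comp[OF gw_klinear])

lemma gw1_lin [lin]: "klinear E W g ==> klinear E X (%x. gw [g x])" using gw_lin[of "[]" "[]"] by simp

lemma gw1_mem [lin]: "w .: W ==> gw [w] .: X" by(rule gw_mem) simp

lemma gw0_mem [lin]: "gw [] .: X" by(rule gw_mem) simp

lemma gw_swap:
 assumes "us : L" "vs : L" "x .: W" "y .: W"
 shows "gw (us @ x # y # vs) = pscale q (gw (us @ y # x # vs))"
proof
 fix F
 have "F (us @ x # y # vs) = q * F (us @ y # x # vs)" if "F : R" using that assms unfolding word_forms_def by blast
 then show "gw (us @ x # y # vs) F = pscale q (gw (us @ y # x # vs)) F" by(cases "F : R") (simp_all add: gen_def pscale_def)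
qed

lemma gw_alt:
 assumes "alt" "us : L" "vs : L" "x .: W"
 shows "gw (us @ x # x # vs) = 0"
proof
 fix F
 have "F (us @ x # x # vs) = 0" if "F : R" using that assms unfolding word_forms_def by blast
 then show "gw (us @ x # x # vs) F = 0 F" by(cases "F : R") (simp_all add: gen_def)
qed

text \<open>The conditions under which a map on words descends to the symmetric or exterior algebra.
  Product, coproduct, actions and the cocycle are all obtained by verifying them.\<close>

definition word_map :: "('k, 'c::ab_group_add, 'zz) kspace_scheme => ('w list => 'c) => bool" where
 "word_map C f \<longleftrightarrow>
   (\<forall>ws\<in>L. f ws .: C) &
   (\<forall>us\<in>L. \<forall>vs\<in>L. klinear W C (%w. f (us @ w # vs))) &
   (\<forall>us\<in>L. \<forall>vs\<in>L. \<forall>x\<in>car W. \<forall>y\<in>car W.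
    f (us @ x # y # vs) = smul C q (f (us @ y # x # vs)) & (alt \<longrightarrow> f (us @ x # x # vs) = 0))"

lemma word_ext:
 assumes C: "kspace C" and f: "word_map C f"
 shows word_ext_lin: "klinear X C (lin_ext R L C f)"
  and word_ext_gw: "ws : L ==> lin_ext R L C f (gw ws) = f ws"
proof -
 have m: "f ws .: C" if "ws : L" for ws using f that unfolding word_map_def by blast
 have r: "(%ws. l (f ws)) : R" if l: "klinear C ground l" for l
 proof -
  have "l 0 = 0" by(rule klin_0[OF C ksp_ground l])
  then show ?thesis unfolding word_forms_def multilinear_forms_def
  proof (intro CollectI conjI ballI impI)
   fix us vs assume c: "us : L" "vs : L"
   show "klinear W ground (%w. l (f (us @ w # vs)))"
    by(rule klin_comp[OF l]) (use f c in \<open>unfold word_map_def, blast\<close>)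
  next
   fix us vs x y assume c: "us : L" "vs : L" "x .: W" "y .: W"
   have "f (us @ x # y # vs) = smul C q (f (us @ y # x # vs))" using f c unfolding word_map_def by blast
   moreover have "f (us @ y # x # vs) .: C" using c by(intro m) simp
   ultimately show "l (f (us @ x # y # vs)) = q * l (f (us @ y # x # vs))" using klin_scale[OF l] by simp
   show "l (f (us @ x # x # vs)) = 0" if alt
   proof -
    have "f (us @ x # x # vs) = 0" using f c that unfolding word_map_def by blast
    then show ?thesis by(simp add: \<open>l 0 = 0\<close>)
   qed
  qed
 qed
 show "klinear X C (lin_ext R L C f)" unfolding klin_gen by(rule klinear_lin_ext[where f = f, OF C m r])
 show "ws : L ==> lin_ext R L C f (gw ws) = f ws" by(rule lin_ext_gen[where f = f, OF C m r])
qed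

lemma X_image:
 assumes D: "kspace D" and f: "klinear X D f" and V: "module.subspace (smul D) V"
  and gen: "!!ws. ws : L ==> f (gw ws) : V" and x: "x .: X"
 shows "f x : V"
proof (rule span_induct_subspace[where f = f and t = x and s = pscale and X = "gw ` L",
   OF vector_space_pscale kspace_vector_space[OF D] V])
 show "f (x + y) = f x + f y" if "x : module.span pscale (gw ` L)" "y : module.span pscale (gw ` L)" for x y
  by(rule klin_add[OF f]) (simp_all add: spX that)
 show "f (pscale c x) = smul D c (f x)" if "x : module.span pscale (gw ` L)" for c x
  using klin_scale[OF f, of x c] that by(simp add: spX)
qed (use gen x spX in auto)

lemma X_eqI:
 assumes D: "kspace D" and f: "klinear X D f" and g: "klinear X D g"
  and gen: "!!ws. ws : L ==> f (gw ws) = g (gw ws)" and x: "x .: X"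
 shows "f x = g x"
proof -
 have "f x - g x : {0}"
  by(rule X_image[where f = "%x. f x - g x", OF D klin_minus[OF D f g] module.subspace_single_0[OF ksp_module[OF D]] _ x])
   (simp add: gen)
 then show ?thesis by simp
qed

text \<open>The product is an extension in the left word of an extension in the right word. The
  outer extension needs the inner value at \<open>y\<close> to respect the relations in the left
  word; by linearity this is tested on words \<open>y\<close>, where it is a relation inside the
  concatenation.\<close>

lemma mul_gw_aux:
 fixes y
 assumes y: "y .: X"
 defines "inner \<equiv> %us. lin_ext R L WS (%vs. gw (us @ vs))"
 shows "us : L ==> klinear X X (inner us)" and "us : L ==> vs : L ==> inner us (gw vs) = gw (us @ vs)"
  and "word_map X (%us. inner us y)"
proof -
 have wm: "word_map WS (%vs. gw (us @ vs))" if "us : L" for us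
  unfolding word_map_def klin_WS(2)[symmetric] sX[symmetric] smulX
 proof (intro conjI ballI impI)
  fix vs ws x y assume c: "vs : L" "ws : L" "x .: W" "y .: W"
  show "gw (us @ vs @ x # y # ws) = pscale q (gw (us @ vs @ y # x # ws))" using gw_swap[of "us @ vs" ws x y] c that by simp
  show "alt ==> gw (us @ vs @ x # x # ws) = 0" using gw_alt[of "us @ vs" ws x] c that by simp
 next
  fix vs ws assume c: "vs : L" "ws : L"
  show "klinear W X (%w. gw (us @ vs @ w # ws))" using gw_klinear[of "us @ vs" ws] c that by simp
 next
  fix ws assume "ws : L"
  then show "gw (us @ ws) .: X" using that by(intro gw_mem) simp
 qed
 have WS: "kspace WS" by(simp add: word_space_def kspace_gen_space)
 have il: "klinear X X (inner us)" if "us : L" for us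
  unfolding inner_def klin_WS(2) by(rule word_ext_lin[OF WS wm[OF that]])
 then show "us : L ==> klinear X X (inner us)" .
 have ig: "inner us (gw vs) = gw (us @ vs)" if "us : L" "vs : L" for us vs
  unfolding inner_def by(rule word_ext_gw[OF WS wm[OF that(1)] that(2)])
 then show "us : L ==> vs : L ==> inner us (gw vs) = gw (us @ vs)" .
 show "word_map X (%us. inner us y)" unfolding word_map_def
 proof (intro conjI ballI impI)
  fix us assume "us : L"
  then show "inner us y .: X" using klin_mem[OF il y] by simp
 next
  fix us vs assume c: "us : L" "vs : L"
  have i1: "klinear X X (inner (us @ w # vs))" if "w .: W" for w using c that by(intro il) simp
  show "klinear W X (%w. inner (us @ w # vs) y)"
  proof (rule klinearI)
   fix w assume w: "w .: W"
   show "inner (us @ w # vs) y .: X" by(rule klin_mem[OF i1[OF w] y])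
   fix k
   show "inner (us @ smul W k w # vs) y = smul X k (inner (us @ w # vs) y)"
   proof (rule X_eqI[OF kspX i1[OF ksp_scale[OF kspW w]] klin_smul[OF kspX i1[OF w]] _ y])
    fix ws assume "ws : L"
    then show "inner (us @ smul W k w # vs) (gw ws) = smul X k (inner (us @ w # vs) (gw ws))"
     using klin_scale[OF gw_klinear[of us "vs @ ws"] w, of k] c w ksp_scale[OF kspW w] by(simp add: ig)
   qed
  next
   fix w w' assume w: "w .: W" "w' .: W"
   show "inner (us @ (w + w') # vs) y = inner (us @ w # vs) y + inner (us @ w' # vs) y"
   proof (rule X_eqI[OF kspX i1[OF ksp_add[OF kspW w]] klin_plus[OF kspX i1[OF w(1)] i1[OF w(2)]] _ y])
    fix ws assume "ws : L"
    then show "inner (us @ (w + w') # vs) (gw ws) = inner (us @ w # vs) (gw ws) + inner (us @ w' # vs) (gw ws)"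
     using klin_add[OF gw_klinear[of us "vs @ ws"] w] c w ksp_add[OF kspW w] by(simp add: ig)
   qed
  qed
 next
  fix us vs x z assume c: "us : L" "vs : L" "x .: W" "z .: W"
  have i1: "klinear X X (inner (us @ x # z # vs))" if "x .: W" "z .: W" for x z using c that by(intro il) simp
  show "inner (us @ x # z # vs) y = smul X q (inner (us @ z # x # vs) y)"
  proof (rule X_eqI[OF kspX i1[OF c(3,4)] klin_smul[OF kspX i1[OF c(4,3)]] _ y])
   fix ws assume "ws : L"
   then show "inner (us @ x # z # vs) (gw ws) = smul X q (inner (us @ z # x # vs) (gw ws))"
    using gw_swap[of us "vs @ ws" x z] c by(simp add: ig)
  qed
  show "inner (us @ x # x # vs) y = 0" if alt
  proof (rule X_eqI[OF kspX i1[OF c(3,3)] klin_const_0[OF kspX] _ y])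
   fix ws assume "ws : L"
   then show "inner (us @ x # x # vs) (gw ws) = 0" using gw_alt[OF that, of us "vs @ ws" x] c by(simp add: ig)
  qed
 qed
qed

lemma mulX_bilinear: "kbilinear X X X (mul X)"
 and mul_gw: "us : L ==> vs : L ==> mul X (gw us) (gw vs) = gw (us @ vs)"
proof -
 define inner where "inner us = lin_ext R L WS (%vs. gw (us @ vs))" for us
 note aux = mul_gw_aux[folded inner_def]
 have WS: "kspace WS" by(simp add: word_space_def kspace_gen_space)
 have mulX': "mul X x y = lin_ext R L WS (%us. inner us y) x" for x y by(simp add: mulX word_mul_def inner_def)
 have wm: "word_map WS (%us. inner us y)" if "y .: X" for y
  using aux(3)[OF that] unfolding word_map_def by(simp only: klin_WS sWS smulX)
 have left: "klinear X X (%x. mul X x y)" if "y .: X" for y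
  unfolding mulX' klin_WS(2) by(rule word_ext_lin[OF WS wm[OF that]])
 have gwl: "mul X (gw us) y = inner us y" if "us : L" "y .: X" for us y
  unfolding mulX' by(rule word_ext_gw[OF WS wm[OF that(2)] that(1)])
 show "us : L ==> vs : L ==> mul X (gw us) (gw vs) = gw (us @ vs)" by(simp add: gwl gw_mem aux(2)[OF gw0_mem])
 show "kbilinear X X X (mul X)"
 proof (rule kbilinearI[OF _ left])
  fix x assume x: "x .: X"
  note il = aux(1)[OF gw0_mem]
  show "klinear X X (mul X x)"
  proof (rule klinearI)
   fix y assume y: "y .: X"
   show "mul X x y .: X" by(rule klin_mem[OF left[OF y] x])
   fix k
   have ky: "smul X k y .: X" by(rule ksp_scale[OF kspX y])
   show "mul X x (smul X k y) = smul X k (mul X x y)"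
    by(rule X_eqI[where f = "%x. mul X x (smul X k y)" and g = "%x. smul X k (mul X x y)",
      OF kspX left[OF ky] klin_smul[OF kspX left[OF y]] _ x])
     (simp only: gwl y ky klin_scale[OF il])
  next
   fix y z assume y: "y .: X" and z: "z .: X"
   have yz: "y + z .: X" by(rule ksp_add[OF kspX y z])
   show "mul X x (y + z) = mul X x y + mul X x z"
    by(rule X_eqI[where f = "%x. mul X x (y + z)" and g = "%x. mul X x y + mul X x z",
      OF kspX left[OF yz] klin_plus[OF kspX left[OF y] left[OF z]] _ x])
     (simp only: gwl y z yz klin_add[OF il])
  qed
 qed
qed

lemmas mulX_lin = kbilin[OF mulX_bilinear]

lemma algX: "assoc_algebra X"
proof -
 have 1: "mul X (mul X (gw us) (gw vs)) z = mul X (gw us) (mul X (gw vs) z)"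
  if "us : L" "vs : L" "z .: X" for us vs z
  apply(rule X_eqI[where f = "%z. mul X (mul X (gw us) (gw vs)) z" and g = "%z. mul X (gw us) (mul X (gw vs) z)", OF kspX _ _ _ that(3)])
   apply(rule mulX_lin lin that |assumption)+ apply(use that in \<open>simp add: mul_gw\<close>) done
 have 2: "mul X (mul X (gw us) y) z = mul X (gw us) (mul X y z)"
  if "us : L" "y .: X" "z .: X" for us y z
  by(rule X_eqI[where f = "%y. mul X (mul X (gw us) y) z" and g = "%y. mul X (gw us) (mul X y z)", OF kspX _ _ 1 that(2)]) (rule mulX_lin lin that |assumption)+
 have 3: "mul X (mul X x y) z = mul X x (mul X y z)"
  if "x .: X" "y .: X" "z .: X" for x y z
  by(rule X_eqI[where f = "%x. mul X (mul X x y) z" and g = "%x. mul X x (mul X y z)", OF kspX _ _ 2 that(1)]) (rule mulX_lin lin that |assumption)+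
 have 4: "mul X (gw []) x = x" "mul X x (gw []) = x" if "x .: X" for x
 proof -
  show "mul X (gw []) x = x" apply(rule X_eqI[where f = "%x. mul X (gw []) x" and g = "%x. x", OF kspX _ _ _ that])
    apply(rule mulX_lin lin that |assumption)+ apply(simp add: mul_gw) done
  show "mul X x (gw []) = x" apply(rule X_eqI[where f = "%x. mul X x (gw [])" and g = "%x. x", OF kspX _ _ _ that])
    apply(rule mulX_lin lin that |assumption)+ apply(simp add: mul_gw) done
 qed
 show ?thesis unfolding assoc_algebra_def unitX by(simp add: kspX mulX_bilinear gw0_mem 3 4)
qed

lemmas [lin] = algX

abbreviation mm (infixl "<.>" 70) where "x <.> y \<equiv> mul X x y"

lemma gw_Cons: "w .: W ==> ws : L ==> gw (w # ws) = gw [w] <.> gw ws" using mul_gw[of "[w]" ws] by simp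

lemma gw_move:
 "pre : L ==> us : L ==> vs : L ==> w .: W ==>
  gw (pre @ us @ w # vs) = pscale (q ^ length us) (gw (pre @ w # us @ vs))"
proof (induction us arbitrary: pre)
 case (Cons u us)
 have "gw (pre @ (u # us) @ w # vs) = gw ((pre @ [u]) @ us @ w # vs)" by simp
 also have "... = pscale (q ^ length us) (gw (pre @ u # w # us @ vs))" using Cons.IH[of "pre @ [u]"] Cons.prems by simp
 also have "gw (pre @ u # w # us @ vs) = pscale q (gw (pre @ w # u # us @ vs))" using Cons.prems by(intro gw_swap) auto
 finally show ?case by(simp add: mult.commute)
qed simp

text \<open>Multiplication by \<open>c ^ n\<close> in degree \<open>n\<close>. For
  \<open>c = q\<close> it supplies the signs in the coproduct of a product with a letter, and for
  \<open>c = - 1\<close> it is the antipode.\<close>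

definition sc :: "'k => ('w list, 'k) functional => ('w list, 'k) functional" where
 "sc c = lin_ext R L X (%ws. pscale (c ^ length ws) (gw ws))"

lemma sc_word_map: "word_map X (%ws. pscale (c ^ length ws) (gw ws))" unfolding word_map_def
proof (intro conjI ballI impI)
 fix us vs x y assume a: "us : L" "vs : L" "x .: W" "y .: W"
 show "pscale (c ^ length (us @ x # y # vs)) (gw (us @ x # y # vs)) =
  smul X q (pscale (c ^ length (us @ y # x # vs)) (gw (us @ y # x # vs)))" using gw_swap[OF a] by(simp add: mult.commute)
 show "alt ==> pscale (c ^ length (us @ x # x # vs)) (gw (us @ x # x # vs)) = 0" using gw_alt[OF _ a(1-3)] by simp
next
 fix us vs assume a: "us : L" "vs : L"
 have "klinear W X (%w. pscale (c ^ (length us + Suc (length vs))) (gw (us @ w # vs)))" by(rule lin a |assumption)+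
 then show "klinear W X (%w. pscale (c ^ length (us @ w # vs)) (gw (us @ w # vs)))" by simp
next
 fix ws assume ws: "ws : L"
 show "pscale (c ^ length ws) (gw ws) .: X" by(rule lin ws)+
qed

lemma sc_klinear: "klinear X X (sc c)" unfolding sc_def by(rule word_ext_lin[OF kspX sc_word_map])
lemma sc_gw: "ws : L ==> sc c (gw ws) = pscale (c ^ length ws) (gw ws)"
 unfolding sc_def by(rule word_ext_gw[OF kspX sc_word_map])
lemma sc_mem [lin]: "x .: X ==> sc c x .: X" by(rule klin_mem[OF sc_klinear])
lemma sc_lin [lin]: "klinear E X g ==> klinear E X (%x. sc c (g x))" by(rule klin_comp[OF sc_klinear])

lemma sc_letter:
 assumes w: "w .: W" and x: "x .: X"
 shows "sc c (gw [w] <.> x) = pscale c (gw [w] <.> sc c x)"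
 apply(rule X_eqI[where f = "%x. sc c (gw [w] <.> x)" and g = "%x. pscale c (gw [w] <.> sc c x)", OF kspX _ _ _ x])
  apply(rule lin w |assumption)+
 apply(use w mul_smul(2)[OF algX gw1_mem[OF w] gw_mem] in \<open>simp add: sc_gw mul_gw gw_Cons[symmetric]\<close>) done

lemma sc_unit: "sc c (gw []) = gw []" by(simp add: sc_gw)

lemma q_square: "q ^ n * q ^ n = 1"
proof -
 have "q ^ n * q ^ n = (q * q) ^ n" by(simp only: power_mult_distrib)
 also have "q * q = 1" by simp
 finally show ?thesis by simp
qed

text \<open>Moving the letter to the front produces one factor \<open>q\<close> for each letter of
  \<open>x\<close>. The map \<open>sc q\<close> compensates this because \<open>q\<close> squares to
  one.\<close>

lemma sc_commute:
 assumes x: "x .: X" and w: "w .: W"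
 shows "sc q x <.> gw [w] = gw [w] <.> x"
proof (rule X_eqI[where f = "%x. sc q x <.> gw [w]" and g = "%x. gw [w] <.> x", OF kspX _ _ _ x])
 show "klinear X X (%x. sc q x <.> gw [w])" "klinear X X (%x. gw [w] <.> x)" by(rule lin w |assumption)+
 fix ws assume ws: "ws : L"
 have "sc q (gw ws) <.> gw [w] = pscale (q ^ length ws) (gw ws <.> gw [w])"
  using mul_smul(1)[OF algX gw_mem[OF ws] gw1_mem[OF w]] by(simp only: sc_gw[OF ws] smulX)
 also have "gw ws <.> gw [w] = gw (ws @ [w])" using w ws by(intro mul_gw) auto
 also have "gw (ws @ [w]) = pscale (q ^ length ws) (gw (w # ws))"
  using gw_move[of "[]" ws "[]" w] w ws by(simp only: append_Nil append_Nil2 lists.Nil)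
 finally show "sc q (gw ws) <.> gw [w] = gw [w] <.> gw ws"
  by(simp only: pscale_simps(4) q_square pscale_simps(1) gw_Cons[OF w ws])
qed

abbreviation "G \<equiv> word_grade R W"

lemma gw_grade: "ws : L ==> gw ws : G (length ws)"
 unfolding word_grade_def by(rule module.span_base[OF module_pscale]) auto

lemma grade_subset: "G n \<subseteq> car X" unfolding word_grade_def spX by(rule module.span_mono[OF module_pscale]) auto

lemma grade_subspace: "module.subspace (smul X) (G n)"
 unfolding word_grade_def smulX by(rule module.subspace_span[OF module_pscale])

lemma grade_image:
 assumes D: "kspace D" and f: "klinear X D f" and V: "module.subspace (smul D) V"
  and gen: "!!ws. ws : L ==> length ws = n ==> f (gw ws) : V" and x: "x : G n"
 shows "f x : V"
proof (rule span_induct_subspace[where f = f and t = x and s = pscale and X = "gw ` {ws \<in> L. length ws = n}",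
   OF vector_space_pscale kspace_vector_space[OF D] V])
 note sub = grade_subset[of n, unfolded word_grade_def, THEN subsetD]
 show "f (x + y) = f x + f y" if "x : module.span pscale (gw ` {ws \<in> L. length ws = n})"
  "y : module.span pscale (gw ` {ws \<in> L. length ws = n})" for x y by(rule klin_add[OF f]) (rule sub that)+
 show "f (pscale c x) = smul D c (f x)" if "x : module.span pscale (gw ` {ws \<in> L. length ws = n})" for c x
  using klin_scale[OF f sub[OF that], of c] by simp
 show "x : module.span pscale (gw ` {ws \<in> L. length ws = n})" using x by(simp only: word_grade_def)
qed (use gen in auto)

lemma gradX: "graded_space X G"
proof -
 let ?f = "%n ws. if length ws = n then gw ws else 0"
 let ?p = "%n. lin_ext R L X (?f n)"
 have wm: "word_map X (?f n)" for n unfolding word_map_def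
 proof (intro conjI ballI impI)
  fix us vs x y assume a: "us : L" "vs : L" "x .: W" "y .: W"
  show "?f n (us @ x # y # vs) = smul X q (?f n (us @ y # x # vs))" using gw_swap[OF a] by auto
  show "alt ==> ?f n (us @ x # x # vs) = 0" using gw_alt[OF _ a(1-3)] by simp
 next
  fix us vs assume a: "us : L" "vs : L"
  show "klinear W X (%w. ?f n (us @ w # vs))"
   using gw_klinear[OF a] klin_const_0[OF kspX] by(cases "length us + Suc (length vs) = n") auto
 next
  fix ws assume "ws : L"
  then show "?f n ws .: X" using gw_mem ksp_zero[OF kspX] by simp
 qed
 note pl = word_ext_lin[OF kspX wm] and pg = word_ext_gw[OF kspX wm]
 have pG: "?p n x : G n" if "x .: X" for n x
 proof (rule X_image[OF kspX pl grade_subspace _ that])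
  fix ws assume ws: "ws : L"
  show "?p n (gw ws) : G n" unfolding pg[OF ws]
   using gw_grade[OF ws] module.subspace_0[OF ksp_module[OF kspX] grade_subspace] by auto
 qed
 have hom: "?p m x = (if m = n then x else 0)" if "x : G n" for m n x
 proof -
  have "?p m x - (if m = n then x else 0) : {0}"
  proof (rule grade_image[where f = "%x. ?p m x - (if m = n then x else 0)", OF kspX _ module.subspace_single_0[OF ksp_module[OF kspX]] _ that])
   show "klinear X X (%x. ?p m x - (if m = n then x else 0))"
    by(cases "m = n") (simp, rule klin_minus[OF kspX pl klin_id], simp, rule pl)
  qed (auto simp: pg)
  then show ?thesis by simp
 qed
 \<comment> \<open>Stated with initial segments instead of the set of nonzero components: in this
   form the claim passes to linear combinations by taking a larger bound.\<close>
 have ev: "\<exists>m. (\<forall>n\<ge>m. ?p n x = 0) & (\<forall>m'\<ge>m. x = (\<Sum>n<m'. ?p n x))" if "x .: X" for x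
 proof -
  have "x : module.span pscale (gw ` L)" using that spX by simp
  then have "x .: X & (\<exists>m. (\<forall>n\<ge>m. ?p n x = 0) & (\<forall>m'\<ge>m. x = (\<Sum>n<m'. ?p n x)))"
  proof (induction rule: module.span_induct_alt[OF module_pscale, consumes 1, case_names base step])
   case base
   have "?p n 0 = 0" for n by(rule klin_0[OF kspX kspX pl])
   then show ?case using ksp_zero[OF kspX] by(auto simp: zero_fun_def)
  next
   case (step c x y)
   then obtain ws where ws: "ws : L" and x: "x = gw ws" by auto
   from step obtain m where yX: "y .: X" and m: "\<forall>n\<ge>m. ?p n y = 0" "\<forall>m'\<ge>m. y = (\<Sum>n<m'. ?p n y)" by blast
   have cx: "pscale c x .: X" using ksp_scale[OF kspX gw_mem[OF ws], of c] by(simp add: x)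
   have add: "?p n (pscale c x + y) = (if n = length ws then pscale c x else 0) + ?p n y" for n
    using klin_add[OF pl cx yX] klin_scale[OF pl gw_mem[OF ws], of n c] ws by(simp add: x pg)
   let ?m = "max m (Suc (length ws))"
   have "pscale c x + y = (\<Sum>n<m'. ?p n (pscale c x + y))" if "m' \<ge> ?m" for m'
    using that m(2) by(simp add: add sum.distrib sum.delta)
   moreover have "?p n (pscale c x + y) = 0" if "n \<ge> ?m" for n using that m(1) by(simp add: add)
   ultimately show ?case using ksp_add[OF kspX cx yX] by blast
  qed
  then show ?thesis by blast
 qed
 show ?thesis
 proof (rule graded_spaceI[where p = ?p, OF kspX grade_subset grade_subspace pl pG])
  fix x assume "x .: X"
  then obtain m where m: "\<forall>n\<ge>m. ?p n x = 0" "x = (\<Sum>n<m. ?p n x)" using ev by blast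
  have sub: "{n. ?p n x ~= 0} \<subseteq> {..<m}" using m(1) not_less by blast
  then show "finite {n. ?p n x ~= 0}" by(rule finite_subset) simp
  have "(\<Sum>n | ?p n x ~= 0. ?p n x) = (\<Sum>n<m. ?p n x)" by(rule sum_nonzero_superset[OF _ sub]) simp_all
  then show "x = (\<Sum>n | ?p n x ~= 0. ?p n x)" using m(2) by simp
 qed (use hom in auto)
qed

lemma grade_mul:
 assumes x: "x : G i" and y: "y : G j"
 shows "x <.> y : G (i + j)"
proof -
 note yc = subsetD[OF grade_subset y]
 have 1: "gw us <.> y : G (i + j)" if us: "us : L" "length us = i" for us
 proof (rule grade_image[where f = "%y. gw us <.> y", OF kspX _ grade_subspace _ y])
  show "klinear X X (%y. gw us <.> y)" by(rule lin us |assumption)+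
  fix ws assume ws: "ws : L" "length ws = j"
  then show "gw us <.> gw ws : G (i + j)" using gw_grade[of "us @ ws"] us by(simp add: mul_gw)
 qed
 show ?thesis by(rule grade_image[where f = "%x. x <.> y", OF kspX _ grade_subspace 1 x])
   (rule lin yc |assumption)+
qed

lemma unit_grade: "unit X : G 0" using gw_grade[of "[]"] by(simp add: unitX)

end

section \<open>The coproduct on words with primitive letters\<close>

locale word_bialgebra = word_algebra W alt X
 for W :: "('k::field, 'w::ab_group_add, 'y) kspace_scheme" and alt :: bool
  and X :: "('k, ('w list, 'k) functional, 'z) kbialg_scheme" +
 fixes M :: "(('w list, 'k) functional, ('w list, 'k) functional, 'k) tensor
  => (('w list, 'k) functional, ('w list, 'k) functional, 'k) tensor
  => (('w list, 'k) functional, ('w list, 'k) functional, 'k) tensor"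
 assumes copX: "cop X = word_cop R W M" and couX: "cou X = word_cou R W"
  and M_bilinear: "kbilinear (tensor X X) (tensor X X) (tensor X X) M"
  and M_words: "!!a b c d. a : L ==> b : L ==> c : L ==> d : L ==>
   M (tens X X (gw a) (gw b)) (tens X X (gw c) (gw d)) =
   pscale (q ^ (length b * length c)) (tens X X (gw (a @ c)) (gw (b @ d)))"
begin

abbreviation "TT \<equiv> tensor X X"
abbreviation tn (infixr "<*>" 75) where "x <*> y \<equiv> tens X X x y"

lemmas M_lin = kbilin[OF M_bilinear]

lemma TT_eqI:
 assumes D: "kspace D" and f: "klinear TT D f" and g: "klinear TT D g"
  and gen: "!!a b. a : L ==> b : L ==> f (gw a <*> gw b) = g (gw a <*> gw b)" and t: "t .: TT"
 shows "f t = g t"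
proof (rule tensor_eqI[OF kspX D f g _ t])
 note fg = klin_comp[OF f] klin_comp[OF g]
 have 1: "f (gw a <*> y) = g (gw a <*> y)" if "a : L" "y .: X" for a y
  by(rule X_eqI[where f = "%y. f (gw a <*> y)" and g = "%y. g (gw a <*> y)", OF D _ _ gen[OF that(1)] that(2)]) (rule fg lin that |assumption)+
 show "f (x <*> y) = g (x <*> y)" if "x .: X" "y .: X" for x y
  by(rule X_eqI[where f = "%x. f (x <*> y)" and g = "%x. g (x <*> y)", OF D _ _ 1[OF _ that(2)] that(1)]) (rule fg lin that |assumption)+
qed

text \<open>\<open>M\<close> stands for the ordinary or the super product of X \<otimes> X. On words
  both sides carry the exponent |b||c| + |b||e| + |d||e|, and the rest is linear extension.\<close>

lemma M_assoc:
 assumes "s .: TT" "t .: TT" "u .: TT"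
 shows "M (M s t) u = M s (M t u)"
proof -
 have scale: "M (pscale k x) y = pscale k (M x y)" "M x (pscale k y) = pscale k (M x y)"
  if "x .: TT" "y .: TT" for k x y using M_bilinear that by(simp_all add: kbilinear_def klinear_def)
 have gm: "gw a <*> gw b .: TT" if "a : L" "b : L" for a b by(rule lin that)+
 have 1: "M (M (gw a <*> gw b) (gw c <*> gw d)) (gw e <*> gw f) = M (gw a <*> gw b) (M (gw c <*> gw d) (gw e <*> gw f))"
  if h: "a : L" "b : L" "c : L" "d : L" "e : L" "f : L" for a b c d e f
  by(simp only: M_words h append_lists scale gm pscale_simps(4) append_assoc length_append power_add[symmetric]
    add_mult_distrib add_mult_distrib2 add_ac)
 have 2: "M (M (gw a <*> gw b) (gw c <*> gw d)) u = M (gw a <*> gw b) (M (gw c <*> gw d) u)"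
  if "a : L" "b : L" "c : L" "d : L" "u .: TT" for a b c d u
  by(rule TT_eqI[where f = "%u. M (M (gw a <*> gw b) (gw c <*> gw d)) u" and g = "%u. M (gw a <*> gw b) (M (gw c <*> gw d) u)", OF ksp_tens _ _ 1[OF that(1-4)] that(5)]) (rule M_lin lin that |assumption)+
 have 3: "M (M (gw a <*> gw b) t) u = M (gw a <*> gw b) (M t u)"
  if "a : L" "b : L" "t .: TT" "u .: TT" for a b t u
  by(rule TT_eqI[where f = "%t. M (M (gw a <*> gw b) t) u" and g = "%t. M (gw a <*> gw b) (M t u)", OF ksp_tens _ _ 2[OF that(1,2) _ _ that(4)] that(3)]) (rule M_lin lin that |assumption)+
 show ?thesis
  by(rule TT_eqI[where f = "%s. M (M s t) u" and g = "%s. M s (M t u)", OF ksp_tens _ _ 3[OF _ _ assms(2,3)] assms(1)]) (rule M_lin lin assms |assumption)+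
qed

lemma M_unit: "t .: TT ==> M (gw [] <*> gw []) t = t"
 apply(rule TT_eqI[where f = "M (gw [] <*> gw [])" and g = "%t. t", OF ksp_tens _ _ _ ])
   apply(rule M_lin lin |assumption)+ apply(simp add: M_words) apply assumption done

text \<open>Left multiplication by the coproduct of the primitive letter \<open>w\<close>. The
  coproduct of a word is the composite of these operators applied to the unit.\<close>

definition lmul :: "'w => (('w list, 'k) functional, ('w list, 'k) functional, 'k) tensor
  => (('w list, 'k) functional, ('w list, 'k) functional, 'k) tensor" where
 "lmul w = M (gw [w] <*> gw [] + gw [] <*> gw [w])"

lemma lmul_bilinear: "kbilinear W TT TT lmul" unfolding lmul_def by(rule M_lin lin |assumption)+

lemmas lmul_lin = kbilin[OF lmul_bilinear]

lemma lmul_words: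
 assumes w: "w .: W" and a: "a : L" and b: "b : L"
 shows "lmul w (gw a <*> gw b) = gw (w # a) <*> gw b + pscale (q ^ length a) (gw a <*> gw (w # b))"
proof -
 have "lmul w (gw a <*> gw b) = M (gw [w] <*> gw []) (gw a <*> gw b) + M (gw [] <*> gw [w]) (gw a <*> gw b)"
  unfolding lmul_def by(rule klin_add[OF M_lin(3)[OF _ klin_id]]) (rule lin w a b |assumption)+
 then show ?thesis using w a b by(simp add: M_words)
qed

lemma lmul_eq:
 assumes w: "w .: W" and t: "t .: TT"
 shows "lmul w t = tsum X X t (%a b. (gw [w] <.> a) <*> b + sc q a <*> (gw [w] <.> b))"
proof -
 have bil: "kbilinear X X TT (%a b. (gw [w] <.> a) <*> b + sc q a <*> (gw [w] <.> b))"
  by(rule lin w |assumption)+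
 show ?thesis
 proof (rule TT_eqI[where f = "lmul w" and g = "%t. tsum X X t (%a b. (gw [w] <.> a) <*> b + sc q a <*> (gw [w] <.> b))", OF ksp_tens _ _ _ t])
  show "klinear TT TT (lmul w)" by(rule lmul_lin klin_id w)+
  show "klinear TT TT (%t. tsum X X t (%a b. (gw [w] <.> a) <*> b + sc q a <*> (gw [w] <.> b)))"
   by(rule klin_tsum_out[OF kspX ksp_tens bil])
  fix a b assume a: "a : L" and b: "b : L"
  show "lmul w (gw a <*> gw b) = tsum X X (gw a <*> gw b) (%a b. (gw [w] <.> a) <*> b + sc q a <*> (gw [w] <.> b))"
   unfolding tsum_tens[OF kspX ksp_tens bil gw_mem[OF a] gw_mem[OF b]] lmul_words[OF w a b]
    sc_gw[OF a] gw_Cons[OF w a] gw_Cons[OF w b]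
   using tens_scale_left[of "gw a" X "gw [w] <.> gw b" X "q ^ length a"] a b w by(simp add: gw_mem mul_mem[OF algX])
 qed
qed

text \<open>The operators satisfy the commutation rule of the letters: outer terms correspond to
  outer terms, and the two mixed terms match crosswise. Together with \<open>lmul_alt\<close> this
  makes the coproduct well defined on the quotient.\<close>

lemma lmul_swap:
 assumes x: "x .: W" and y: "y .: W" and t: "t .: TT"
 shows "lmul x (lmul y t) = pscale q (lmul y (lmul x t))"
proof (rule TT_eqI[where f = "%t. lmul x (lmul y t)" and g = "%t. pscale q (lmul y (lmul x t))", OF ksp_tens _ _ _ t])
 show "klinear TT TT (%t. lmul x (lmul y t))" "klinear TT TT (%t. pscale q (lmul y (lmul x t)))"
  by(rule lmul_lin lin x y |assumption)+
 fix a b assume a: "a : L" and b: "b : L"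
 have two: "lmul x (lmul y (gw a <*> gw b)) =
  (gw (x # y # a) <*> gw b + pscale (q * q ^ length a) (gw (y # a) <*> gw (x # b))) +
  (pscale (q ^ length a) (gw (x # a) <*> gw (y # b)) + gw a <*> gw (x # y # b))"
  if x: "x .: W" and y: "y .: W" for x y
 proof -
  have l: "klinear TT TT (lmul x)" by(rule lmul_lin klin_id x)+
  have m: "gw (y # a) <*> gw b .: TT" "gw a <*> gw (y # b) .: TT" by(rule lin a b y)+
  have "lmul x (lmul y (gw a <*> gw b)) = lmul x (gw (y # a) <*> gw b) + pscale (q ^ length a) (lmul x (gw a <*> gw (y # b)))"
   unfolding lmul_words[OF y a b]
   using klin_add[OF l m(1) ksp_scale[OF ksp_tens m(2), of "q ^ length a"]] klin_scale[OF l m(2), of "q ^ length a"]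
   by(simp only: smul_tensor)
  moreover have "lmul x (gw (y # a) <*> gw b) = gw (x # y # a) <*> gw b + pscale (q ^ Suc (length a)) (gw (y # a) <*> gw (x # b))"
   using lmul_words[OF x, of "y # a" b] a b y by simp
  moreover have "lmul x (gw a <*> gw (y # b)) = gw (x # a) <*> gw (y # b) + pscale (q ^ length a) (gw a <*> gw (x # y # b))"
   using lmul_words[OF x a, of "y # b"] b y by simp
  ultimately show ?thesis by(simp only: pscale_add pscale_simps(4) q_square pscale_simps(1) power_Suc)
 qed
 have s: "gw (x # y # a) = pscale q (gw (y # x # a))" if "a : L" for a using gw_swap[of "[]" a x y] that x y by simp
 have ts: "gw (x # y # a) <*> gw b = pscale q (gw (y # x # a) <*> gw b)"
  unfolding s[OF a] using tens_scale_left[of "gw (y # x # a)" X "gw b" X q] a b x y by(simp add: gw_mem)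
 have ts': "gw a <*> gw (x # y # b) = pscale q (gw a <*> gw (y # x # b))"
  unfolding s[OF b] using tens_scale_right[of "gw a" X "gw (y # x # b)" X q] a b x y by(simp add: gw_mem)
 have qq: "q * (q * k) = k" for k :: 'k by simp
 show "lmul x (lmul y (gw a <*> gw b)) = pscale q (lmul y (lmul x (gw a <*> gw b)))"
  unfolding two[OF x y] two[OF y x] ts ts' by(simp only: pscale_add pscale_simps(4) qq add_ac)
qed

lemma lmul_alt:
 assumes alt and x: "x .: W" and t: "t .: TT"
 shows "lmul x (lmul x t) = 0"
proof (rule TT_eqI[where f = "%t. lmul x (lmul x t)" and g = "%t. 0", OF ksp_tens _ _ _ t])
 show "klinear TT TT (%t. lmul x (lmul x t))" "klinear TT TT (%t. 0)" by(rule lmul_lin lin x |assumption)+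
 fix a b assume a: "a : L" and b: "b : L"
 have l: "klinear TT TT (lmul x)" by(rule lmul_lin klin_id x)+
 have m: "gw (x # a) <*> gw b .: TT" "gw a <*> gw (x # b) .: TT" by(rule lin a b x)+
 have z: "gw (x # x # c) = 0" if "c : L" for c using gw_alt[OF assms(1), of "[]" c x] that x by simp
 have tz: "(0 :: ('w list, 'k) functional) <*> y = 0" "y <*> (0 :: ('w list, 'k) functional) = 0" if "y .: X" for y
  using klin_0[OF kspX ksp_tens tens_lin(3)[OF that klin_id]]
   klin_0[OF kspX ksp_tens tens_lin(2)[OF that klin_id]] by simp_all
 have "lmul x (lmul x (gw a <*> gw b)) = lmul x (gw (x # a) <*> gw b) + pscale (q ^ length a) (lmul x (gw a <*> gw (x # b)))"
  unfolding lmul_words[OF x a b]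
  using klin_add[OF l m(1) ksp_scale[OF ksp_tens m(2), of "q ^ length a"]] klin_scale[OF l m(2), of "q ^ length a"]
  by(simp only: smul_tensor)
 also have "lmul x (gw (x # a) <*> gw b) = pscale (q ^ Suc (length a)) (gw (x # a) <*> gw (x # b))"
  using lmul_words[OF x, of "x # a" b] a b x by(simp add: z tz gw_mem)
 also have "lmul x (gw a <*> gw (x # b)) = gw (x # a) <*> gw (x # b)"
  using lmul_words[OF x a, of "x # b"] a b x by(simp add: z tz gw_mem)
 also have "pscale (q ^ Suc (length a)) (gw (x # a) <*> gw (x # b)) + pscale (q ^ length a) (gw (x # a) <*> gw (x # b)) = 0"
  using assms(1) by simp
 finally show "lmul x (lmul x (gw a <*> gw b)) = 0" .
qed

lemma foldr_lmul_linear: "us : L ==> klinear TT TT (foldr lmul us)"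
proof (induction us)
 case Nil
 then show ?case by(simp add: klinear_def)
next
 case (Cons u us)
 then have "klinear TT TT (foldr lmul us)" and u: "u .: W" by auto
 from lmul_lin(2)[OF u this(1)] show ?case by(simp add: o_def)
qed

lemma foldr_lmul_mem: "us : L ==> t .: TT ==> foldr lmul us t .: TT" by(rule klin_mem[OF foldr_lmul_linear])

lemma cop_word_map: "word_map TT (%ws. foldr lmul ws (gw [] <*> gw []))" unfolding word_map_def
proof (intro conjI ballI impI)
 have e: "gw [] <*> gw [] .: TT" by(rule lin)+
 note fm = foldr_lmul_mem[OF _ e]
 show "foldr lmul ws (gw [] <*> gw []) .: TT" if "ws : L" for ws by(rule fm[OF that])
 fix us vs assume us: "us : L" and vs: "vs : L"
 show "klinear W TT (%w. foldr lmul (us @ w # vs) (gw [] <*> gw []))"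
  using klin_comp[OF foldr_lmul_linear[OF us] lmul_lin(3)[OF fm[OF vs] klin_id]] by simp
 fix x y assume x: "x .: W" and y: "y .: W"
 show "foldr lmul (us @ x # y # vs) (gw [] <*> gw []) = smul TT q (foldr lmul (us @ y # x # vs) (gw [] <*> gw []))"
  using klin_scale[OF foldr_lmul_linear[OF us] lmul_lin(1)[OF y lmul_lin(1)[OF x fm[OF vs]]], of q]
  by(simp only: foldr_append foldr_Cons o_apply lmul_swap[OF x y fm[OF vs]] smul_tensor)
 show "foldr lmul (us @ x # x # vs) (gw [] <*> gw []) = 0" if alt
  using klin_0[OF ksp_tens ksp_tens foldr_lmul_linear[OF us]]
  by(simp only: foldr_append foldr_Cons o_apply lmul_alt[OF that x fm[OF vs]])
qed

lemma copX_eq: "cop X = lin_ext R L TT (%ws. foldr lmul ws (gw [] <*> gw []))" unfolding copX word_cop_def Let_def lmul_def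
 using tensor_cong[OF sX sX] tens_cong[OF sX sX] by simp

lemma klin_copX: "klinear X TT (cop X)" unfolding copX_eq by(rule word_ext_lin[OF ksp_tens cop_word_map])

lemma copX_gw: "ws : L ==> cop X (gw ws) = foldr lmul ws (gw [] <*> gw [])"
 unfolding copX_eq by(rule word_ext_gw[OF ksp_tens cop_word_map])

lemma copX_lin: "klinear E X g ==> klinear E TT (%x. cop X (g x))" by(rule klin_comp[OF klin_copX])

lemma copX_mem: "x .: X ==> cop X x .: TT" by(rule klin_mem[OF klin_copX])

lemma cop_letter:
 assumes w: "w .: W" and x: "x .: X"
 shows "cop X (gw [w] <.> x) = lmul w (cop X x)"
proof (rule X_eqI[where f = "%x. cop X (gw [w] <.> x)" and g = "%x. lmul w (cop X x)", OF ksp_tens _ _ _ x])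
 show "klinear X TT (%x. cop X (gw [w] <.> x))" "klinear X TT (%x. lmul w (cop X x))"
  by(rule copX_lin lmul_lin lin w |assumption)+
 fix ws assume ws: "ws : L"
 have "cop X (gw (w # ws)) = lmul w (cop X (gw ws))" using copX_gw[of "w # ws"] copX_gw[OF ws] w ws by simp
 then show "cop X (gw [w] <.> gw ws) = lmul w (cop X (gw ws))" by(simp only: gw_Cons[OF w ws])
qed

text \<open>The recursion for Sweedler sums over words: the new first letter joins the left leg, or
  passes the left leg with the sign \<open>sc q\<close> and joins the right one. The coalgebra and
  antipode axioms on words are inductions along this rule.\<close>

lemma sw_letter:
 assumes D: "kspace D" and F: "kbilinear X X D F" and w: "w .: W" and x: "x .: X"
 shows "sw X (gw [w] <.> x) F = sw X x (%a b. F (gw [w] <.> a) b + F (sc q a) (gw [w] <.> b))"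
 unfolding cop_letter[OF w x] lmul_eq[OF w copX_mem[OF x]] apply(subst tsum_tsum[OF kspX D F]) apply(rule lin w |assumption)+
 apply(rule tsum_eq) apply(subst klin_add[OF klin_tsum_out[OF kspX D F]]) apply(rule lin w |assumption)+
 apply(subst tsum_tens[OF kspX D F]) apply(rule lin w |assumption)+ apply(subst tsum_tens[OF kspX D F])
  apply(rule lin w |assumption)+ apply(rule refl) done

lemma sw_one:
 assumes D: "kspace D" and F: "kbilinear X X D F"
 shows "sw X (gw []) F = F (gw []) (gw [])" using tsum_tens[OF kspX D F gw0_mem gw0_mem] by(simp add: copX_gw)

lemma cou_word_map: "word_map ground (%ws. if ws = [] then 1 else 0)" unfolding word_map_def
 by(intro conjI ballI impI) (simp_all add: klin_const_0[OF ksp_ground])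

lemma couX_eq: "cou X = lin_ext R L ground (%ws. if ws = [] then 1 else 0)" unfolding couX word_cou_def ..

lemma klin_couX: "klinear X ground (cou X)" unfolding couX_eq by(rule word_ext_lin[OF ksp_ground cou_word_map])

lemma cou_gw: "ws : L ==> cou X (gw ws) = (if ws = [] then 1 else 0)"
 unfolding couX_eq by(rule word_ext_gw[OF ksp_ground cou_word_map])

lemma couX_lin: "klinear E X g ==> klinear E ground (%x. cou X (g x))" by(rule klin_comp[OF klin_couX])

lemma cou_letter:
 assumes w: "w .: W" and x: "x .: X"
 shows "cou X (gw [w] <.> x) = 0"
proof (rule X_eqI[where f = "%x. cou X (gw [w] <.> x)" and g = "%x. 0", OF ksp_ground _ _ _ x])
 show "klinear X ground (%x. cou X (gw [w] <.> x))" "klinear X ground (%x. 0)" by(rule couX_lin lin w |assumption)+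
 fix ws assume ws: "ws : L"
 show "cou X (gw [w] <.> gw ws) = 0" using cou_gw[of "w # ws"] w ws by(simp add: gw_Cons[symmetric])
qed

lemma cou_sc: "x .: X ==> cou X (sc c x) = cou X x"
proof (rule X_eqI[where f = "%x. cou X (sc c x)" and g = "%x. cou X x", OF ksp_ground])
 show "klinear X ground (%x. cou X (sc c x))" "klinear X ground (%x. cou X x)" by(rule couX_lin lin |assumption)+
 fix ws assume ws: "ws : L"
 show "cou X (sc c (gw ws)) = cou X (gw ws)"
  using klin_scale[OF klin_couX gw_mem[OF ws], of "c ^ length ws"] by(simp add: sc_gw[OF ws] cou_gw[OF ws])
qed

lemma sc_sc_comm:
 assumes x: "x .: X"
 shows "sc c (sc d x) = sc d (sc c x)"
proof (rule X_eqI[where f = "%x. sc c (sc d x)" and g = "%x. sc d (sc c x)", OF kspX _ _ _ x])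
 show "klinear X X (%x. sc c (sc d x))" "klinear X X (%x. sc d (sc c x))" by(rule lin)+
 fix ws assume ws: "ws : L"
 show "sc c (sc d (gw ws)) = sc d (sc c (gw ws))"
  by(simp only: sc_gw[OF ws] klin_scale[OF sc_klinear gw_mem[OF ws], unfolded smulX] pscale_simps(4) mult.commute)
qed

lemma sw_scale:
 assumes D: "kspace D" and F: "kbilinear X X D F" and x: "x .: X"
 shows "sw X (pscale c x) F = smul D c (sw X x F)"
 using klin_scale[OF klin_comp[OF klin_tsum_out[OF kspX D F] klin_copX] x, of c] by simp

text \<open>The sign map respects coproducts. This is required because \<open>sc q\<close> occurs
  inside the recursion \<open>sw_letter\<close> and has to be taken through a further
  coproduct.\<close>

lemma sw_sc_gw:
 assumes D: "kspace D" and ws: "ws : L"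
 shows "kbilinear X X D F ==> sw X (sc c (gw ws)) F = sw X (gw ws) (%a b. F (sc c a) (sc c b))" using ws
proof (induction ws arbitrary: F)
 case Nil
 have "kbilinear X X D (%a b. F (sc c a) (sc c b))" by(rule lin kbilin[OF Nil] |assumption)+
 then show ?case by(simp add: sc_unit sw_one[OF D Nil] sw_one[OF D])
next
 case (Cons w ws)
 note F = Cons.prems
 have w: "w .: W" and ws: "ws : L" using Cons.hyps by auto
 have x: "gw ws .: X" by(rule gw_mem[OF ws])
 have F1: "kbilinear X X D (%a b. F (gw [w] <.> a) b + F (sc q a) (gw [w] <.> b))"
  by(rule lin kbilin[OF F] D w |assumption)+
 have F2: "kbilinear X X D (%a b. F (sc c a) (sc c b))" by(rule lin kbilin[OF F] |assumption)+
 have sm: "F (pscale c a) b = smul D c (F a b)" "F a (pscale c b) = smul D c (F a b)" if "a .: X" "b .: X" for a b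
  using F that by(simp_all add: kbilinear_def klinear_def)
 have "sw X (sc c (gw (w # ws))) F = smul D c (sw X (gw [w] <.> sc c (gw ws)) F)"
  unfolding gw_Cons[OF w ws] sc_letter[OF w x] by(rule sw_scale[OF D F]) (rule lin w x)+
 also have "sw X (gw [w] <.> sc c (gw ws)) F =
   sw X (gw ws) (%a b. F (gw [w] <.> sc c a) (sc c b) + F (sc q (sc c a)) (gw [w] <.> sc c b))"
  by(simp only: sw_letter[OF D F w sc_mem[OF x]] Cons.IH[OF F1])
 also have "smul D c ... = sw X (gw ws) (%a b. F (sc c (gw [w] <.> a)) (sc c b) + F (sc c (sc q a)) (sc c (gw [w] <.> b)))"
  unfolding smul_tsum[OF D]
 proof (rule tsum_eq)
  fix a b assume ab: "a .: X" "b .: X"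
  have m: "gw [w] <.> sc c a .: X" "gw [w] <.> sc c b .: X" "sc c a .: X" "sc c b .: X" "sc q (sc c a) .: X"
   by(rule lin ab w)+
  show "smul D c (F (gw [w] <.> sc c a) (sc c b) + F (sc q (sc c a)) (gw [w] <.> sc c b)) =
   F (sc c (gw [w] <.> a)) (sc c b) + F (sc c (sc q a)) (sc c (gw [w] <.> b))"
   by(simp only: smul_add_right[OF D] sc_letter[OF w ab(1)] sc_letter[OF w ab(2)] sm m sc_sc_comm[OF ab(1), of c q])
 qed
 also have "... = sw X (gw (w # ws)) (%a b. F (sc c a) (sc c b))"
  unfolding gw_Cons[OF w ws] by(rule sw_letter[OF D F2 w x, symmetric])
 finally show ?case .
qed

lemma sw_sc:
 assumes D: "kspace D" and F: "kbilinear X X D F" and x: "x .: X"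
 shows "sw X (sc c x) F = sw X x (%a b. F (sc c a) (sc c b))"
 by(rule X_eqI[where f = "%x. sw X (sc c x) F" and g = "%x. sw X x (%a b. F (sc c a) (sc c b))",
   OF D _ _ sw_sc_gw[OF D _ F] x]) (rule copX_lin lin kbilin[OF F] D |assumption)+

section \<open>Hopf algebra axioms on words, by induction on the first letter\<close>

lemma coassoc_gw:
 assumes D: "kspace D" and ws: "ws : L"
 shows "ktrilinear X X X D F ==> sw X (gw ws) (%a b. sw X a (%a1 a2. F a1 a2 b)) =
  sw X (gw ws) (%a b. sw X b (%b1 b2. F a b1 b2))" using ws
proof (induction ws arbitrary: F)
 case Nil
 note F = Nil
 have "kbilinear X X D (%a b. sw X a (%a1 a2. F a1 a2 b))" "kbilinear X X D (%a b. sw X b (%b1 b2. F a b1 b2))"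
  "kbilinear X X D (%a1 a2. F a1 a2 (gw []))" "kbilinear X X D (%b1 b2. F (gw []) b1 b2)"
  by(rule copX_lin lin ktrilin[OF F] D |assumption)+
 from sw_one[OF D this(1)] sw_one[OF D this(2)] sw_one[OF D this(3)] sw_one[OF D this(4)]
 show ?case by(simp only:)
next
 case (Cons w ws)
 note F = Cons.prems
 have w: "w .: W" and ws: "ws : L" using Cons.hyps by auto
 have x: "gw ws .: X" by(rule gw_mem[OF ws])
 \<comment> \<open>The letter \<open>w\<close> attached to one of the three legs, with the signs for
   passing the earlier ones. Both bracketings lead to this sum, to which the induction hypothesis
   applies.\<close>
 let ?F = "%a b c. F (gw [w] <.> a) b c + (F (sc q a) (gw [w] <.> b) c + F (sc q a) (sc q b) (gw [w] <.> c))"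
 have F': "ktrilinear X X X D ?F" by(rule lin ktrilin[OF F] D w |assumption)+
 have "sw X (gw (w # ws)) (%a b. sw X a (%a1 a2. F a1 a2 b)) =
  sw X (gw ws) (%a b. sw X (gw [w] <.> a) (%a1 a2. F a1 a2 b) + sw X (sc q a) (%a1 a2. F a1 a2 (gw [w] <.> b)))"
  unfolding gw_Cons[OF w ws] by(rule sw_letter[OF D _ w x]) (rule copX_lin lin ktrilin[OF F] D |assumption)+
 also have "... = sw X (gw ws) (%a b. sw X a (%a1 a2. ?F a1 a2 b))"
 proof (rule tsum_eq)
  fix a b assume ab: "a .: X" "b .: X"
  have 1: "sw X (gw [w] <.> a) (%a1 a2. F a1 a2 b) = sw X a (%a1 a2. F (gw [w] <.> a1) a2 b + F (sc q a1) (gw [w] <.> a2) b)"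
   by(rule sw_letter[OF D _ w ab(1)]) (rule copX_lin lin ktrilin[OF F] D ab |assumption)+
  have 2: "sw X (sc q a) (%a1 a2. F a1 a2 (gw [w] <.> b)) = sw X a (%a1 a2. F (sc q a1) (sc q a2) (gw [w] <.> b))"
   by(rule sw_sc[OF D _ ab(1)]) (rule copX_lin lin ktrilin[OF F] D ab w |assumption)+
  show "sw X (gw [w] <.> a) (%a1 a2. F a1 a2 b) + sw X (sc q a) (%a1 a2. F a1 a2 (gw [w] <.> b)) = sw X a (%a1 a2. ?F a1 a2 b)"
   unfolding 1 2 by(simp only: tsum_add add.assoc)
 qed
 also have "... = sw X (gw ws) (%a b. sw X b (%b1 b2. ?F a b1 b2))" by(rule Cons.IH[OF F'])
 also have "... = sw X (gw ws) (%a b. sw X b (%b1 b2. F (gw [w] <.> a) b1 b2) + sw X (gw [w] <.> b) (%b1 b2. F (sc q a) b1 b2))"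
 proof (rule tsum_eq)
  fix a b assume ab: "a .: X" "b .: X"
  have "sw X (gw [w] <.> b) (%b1 b2. F (sc q a) b1 b2) = sw X b (%b1 b2. F (sc q a) (gw [w] <.> b1) b2 + F (sc q a) (sc q b1) (gw [w] <.> b2))"
   by(rule sw_letter[OF D _ w ab(2)]) (rule copX_lin lin ktrilin[OF F] D ab |assumption)+
  then show "sw X b (%b1 b2. ?F a b1 b2) = sw X b (%b1 b2. F (gw [w] <.> a) b1 b2) + sw X (gw [w] <.> b) (%b1 b2. F (sc q a) b1 b2)"
   by(simp only: tsum_add)
 qed
 also have "... = sw X (gw (w # ws)) (%a b. sw X b (%b1 b2. F a b1 b2))" unfolding gw_Cons[OF w ws]
  by(rule sw_letter[OF D _ w x, symmetric]) (rule copX_lin lin ktrilin[OF F] D |assumption)+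
 finally show ?case .
qed

lemma coalgX: "coalgebra X"
proof (rule coalgebraI[OF kspX klin_copX klin_couX])
 fix x assume x: "x .: X"
 let ?D = "tensor X TT"
 let ?F = "%x y z. tens X TT x (y <*> z)"
 have F: "ktrilinear X X X ?D ?F" by(rule lin |assumption)+
 show "sw X x (%a b. sw X a (%a1 a2. ?F a1 a2 b)) = sw X x (%a b. sw X b (%b1 b2. ?F a b1 b2))"
  by(rule X_eqI[where f = "%x. sw X x (%a b. sw X a (%a1 a2. ?F a1 a2 b))" and g = "%x. sw X x (%a b. sw X b (%b1 b2. ?F a b1 b2))",
    OF ksp_tens _ _ coassoc_gw[OF ksp_tens _ F] x]) (rule copX_lin lin |assumption)+
 have b1: "kbilinear X X X (%a b. pscale (cou X a) b)" and b2: "kbilinear X X X (%a b. pscale (cou X b) a)"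
  by(rule couX_lin lin |assumption)+
 have l: "klinear X X (%y. gw [w] <.> y)" if "w .: W" for w by(rule lin that)+
 have c1: "sw X (gw ws) (%a b. pscale (cou X a) b) = gw ws & sw X (gw ws) (%a b. pscale (cou X b) a) = gw ws"
  if "ws : L" for ws using that
 proof (induction ws)
  case Nil
  show ?case by(simp add: sw_one[OF kspX b1] sw_one[OF kspX b2] cou_gw)
 next
  case (Cons w ws)
  have w: "w .: W" and ws: "ws : L" using Cons.hyps by auto
  have x: "gw ws .: X" by(rule gw_mem[OF ws])
  have "sw X (gw [w] <.> gw ws) (%a b. pscale (cou X a) b) = sw X (gw ws) (%a b. gw [w] <.> pscale (cou X a) b)"
   unfolding sw_letter[OF kspX b1 w x] by(rule tsum_eq)
    (simp add: cou_letter[OF w] cou_sc mul_smul(2)[OF algX gw1_mem[OF w], unfolded smulX])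
  also have "... = gw [w] <.> sw X (gw ws) (%a b. pscale (cou X a) b)"
   by(rule klin_tsum[OF kspX kspX l[OF w], symmetric]) (rule kbilin(1)[OF b1])
  finally have 1: "sw X (gw [w] <.> gw ws) (%a b. pscale (cou X a) b) = gw [w] <.> sw X (gw ws) (%a b. pscale (cou X a) b)" .
  have "sw X (gw [w] <.> gw ws) (%a b. pscale (cou X b) a) = sw X (gw ws) (%a b. gw [w] <.> pscale (cou X b) a)"
   unfolding sw_letter[OF kspX b2 w x] by(rule tsum_eq)
    (simp add: cou_letter[OF w] mul_smul(2)[OF algX gw1_mem[OF w], unfolded smulX])
  also have "... = gw [w] <.> sw X (gw ws) (%a b. pscale (cou X b) a)"
   by(rule klin_tsum[OF kspX kspX l[OF w], symmetric]) (rule kbilin(1)[OF b2])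
  finally have 2: "sw X (gw [w] <.> gw ws) (%a b. pscale (cou X b) a) = gw [w] <.> sw X (gw ws) (%a b. pscale (cou X b) a)" .
  show ?case using Cons.IH by(simp only: gw_Cons[OF w ws] 1 2)
 qed
 show "sw X x (%a b. smul X (cou X a) b) = x" unfolding smulX
  by(rule X_eqI[where f = "%x. sw X x (%a b. pscale (cou X a) b)" and g = "%x. x", OF kspX _ klin_id conjunct1[OF c1] x]) (rule couX_lin copX_lin lin |assumption)+
 show "sw X x (%a b. smul X (cou X b) a) = x" unfolding smulX
  by(rule X_eqI[where f = "%x. sw X x (%a b. pscale (cou X b) a)" and g = "%x. x", OF kspX _ klin_id conjunct2[OF c1] x]) (rule couX_lin copX_lin lin |assumption)+
qed

lemmas [lin] = coalgX

lemma cop_mulX: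
 assumes x: "x .: X" and y: "y .: X"
 shows "cop X (x <.> y) = M (cop X x) (cop X y)"
proof -
 have 1: "cop X (gw ws <.> y) = M (cop X (gw ws)) (cop X y)" if "ws : L" for ws using that
 proof (induction ws)
  case Nil
  show ?case using mul_unit(1)[OF algX y] by(simp add: copX_gw unitX M_unit[OF copX_mem[OF y]])
 next
  case (Cons w ws)
  have w: "w .: W" and ws: "ws : L" using Cons.hyps by auto
  have x: "gw ws .: X" by(rule gw_mem[OF ws])
  have dw: "gw [w] <*> gw [] + gw [] <*> gw [w] .: TT" by(rule lin w)+
  have "cop X ((gw [w] <.> gw ws) <.> y) = lmul w (cop X (gw ws <.> y))"
   unfolding mul_assoc[OF algX gw1_mem[OF w] x y] by(rule cop_letter[OF w]) (rule lin x y)+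
  also have "... = M (lmul w (cop X (gw ws))) (cop X y)"
   unfolding Cons.IH lmul_def by(rule M_assoc[OF dw copX_mem[OF x] copX_mem[OF y], symmetric])
  also have "... = M (cop X (gw [w] <.> gw ws)) (cop X y)" by(simp only: cop_letter[OF w x])
  finally show ?case by(simp only: gw_Cons[OF w ws])
 qed
 show ?thesis
  by(rule X_eqI[where f = "%x. cop X (x <.> y)" and g = "%x. M (cop X x) (cop X y)", OF ksp_tens _ _ 1 x]) (rule M_lin lin y |assumption)+
qed

lemma cou_mulX:
 assumes x: "x .: X" and y: "y .: X"
 shows "cou X (x <.> y) = cou X x * cou X y"
proof -
 have 1: "cou X (gw ws <.> y) = cou X (gw ws) * cou X y" if ws: "ws : L" for ws
 proof (cases ws)
  case Nil
  then show ?thesis using mul_unit(1)[OF algX y] by(simp add: unitX cou_gw)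
 next
  case (Cons w vs)
  then have w: "w .: W" and vs: "vs : L" using ws by auto
  have "cou X ((gw [w] <.> gw vs) <.> y) = 0" unfolding mul_assoc[OF algX gw1_mem[OF w] gw_mem[OF vs] y]
   by(rule cou_letter[OF w]) (rule lin vs y)+
  then show ?thesis using cou_gw[OF ws] Cons by(simp add: gw_Cons[OF w vs])
 qed
 show ?thesis
  by(rule X_eqI[where f = "%x. cou X (x <.> y)" and g = "%x. cou X x * cou X y", OF ksp_ground _ _ 1 x]) (rule lin y |assumption)+
qed

lemma sc_grade: "x : G n ==> sc c x : G n"
proof (rule grade_image[OF kspX sc_klinear grade_subspace])
 fix ws assume "ws : L" "length ws = n"
 then show "sc c (gw ws) : G n"
  using module.subspace_scale[OF ksp_module[OF kspX] grade_subspace gw_grade[of ws]] by(simp add: sc_gw)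
qed

text \<open>On a nonempty word the two terms of the recursion cancel: the antipode turns the leading
  letter into its negative, and \<open>sc_commute\<close> moves the other copy of the letter to the
  front without a sign.\<close>

lemma antipodeX: "is_antipode X (sc (- 1))"
proof -
 let ?S = "sc (- 1)"
 have b1: "kbilinear X X X (%a b. ?S a <.> b)" and b2: "kbilinear X X X (%a b. a <.> ?S b)"
  by(rule lin |assumption)+
 have m1: "pscale c y <.> z = pscale c (y <.> z)" "y <.> pscale c z = pscale c (y <.> z)" if "y .: X" "z .: X" for c y z
  using mul_smul[OF algX that] by simp_all
 have 1: "sw X (gw ws) (%a b. ?S a <.> b) = pscale (cou X (gw ws)) (gw []) &
  sw X (gw ws) (%a b. a <.> ?S b) = pscale (cou X (gw ws)) (gw [])" if ws: "ws : L" for ws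
 proof (cases ws)
  case Nil
  then show ?thesis by(simp add: sw_one[OF kspX b1] sw_one[OF kspX b2] cou_gw sc_unit mul_gw)
 next
  case (Cons w vs)
  then have w: "w .: W" and vs: "vs : L" using ws by auto
  have x: "gw vs .: X" by(rule gw_mem[OF vs])
  note wX = gw1_mem[OF w]
  have "sw X (gw [w] <.> gw vs) (%a b. ?S a <.> b) = sw X (gw vs) (%a b. 0)" unfolding sw_letter[OF kspX b1 w x]
  proof (rule tsum_eq)
   fix a b assume ab: "a .: X" "b .: X"
   have Sa: "?S a .: X" "?S (sc q a) .: X" "sc q (?S a) .: X" by(rule lin ab)+
   have 1: "?S (gw [w] <.> a) <.> b = - (gw [w] <.> (?S a <.> b))"
    by(simp add: sc_letter[OF w ab(1)] m1 mul_mem[OF algX] wX Sa ab mul_assoc[OF algX]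
      klin_neg[OF kspX kspX mul_left[OF algX ab(2) klin_id]])
   have "?S (sc q a) <.> (gw [w] <.> b) = (sc q (?S a) <.> gw [w]) <.> b"
    by(simp only: mul_assoc[OF algX Sa(2) wX ab(2)] sc_sc_comm[OF ab(1), of q "- 1"])
   also have "... = gw [w] <.> (?S a <.> b)"
    by(simp only: sc_commute[OF Sa(1) w] mul_assoc[OF algX wX Sa(1) ab(2)])
   finally have 2: "?S (sc q a) <.> (gw [w] <.> b) = gw [w] <.> (?S a <.> b)" .
   show "?S (gw [w] <.> a) <.> b + ?S (sc q a) <.> (gw [w] <.> b) = 0"
    unfolding 1 2 by(rule left_minus)
  qed
  moreover have "sw X (gw [w] <.> gw vs) (%a b. a <.> ?S b) = sw X (gw vs) (%a b. 0)"
   unfolding sw_letter[OF kspX b2 w x]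
  proof (rule tsum_eq)
   fix a b assume ab: "a .: X" "b .: X"
   have Sb: "?S b .: X" "sc q a .: X" by(rule lin ab)+
   have "sc q a <.> ?S (gw [w] <.> b) = - (sc q a <.> (gw [w] <.> ?S b))"
    by(simp add: sc_letter[OF w ab(2)] m1 mul_mem[OF algX] wX Sb
      klin_neg[OF kspX kspX mul_right[OF algX Sb(2) klin_id]])
   also have "sc q a <.> (gw [w] <.> ?S b) = gw [w] <.> a <.> ?S b"
    unfolding mul_assoc[OF algX Sb(2) wX Sb(1), symmetric] sc_commute[OF ab(1) w] ..
   finally have "sc q a <.> ?S (gw [w] <.> b) = - (gw [w] <.> a <.> ?S b)" .
   then show "(gw [w] <.> a) <.> ?S b + sc q a <.> ?S (gw [w] <.> b) = 0" by(simp only: right_minus)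
  qed
  ultimately show ?thesis using cou_gw[OF ws] Cons by(simp add: gw_Cons[OF w vs])
 qed
 have "sw X x (%a b. ?S a <.> b) = pscale (cou X x) (gw [])" if "x .: X" for x
  by(rule X_eqI[where f = "%x. sw X x (%a b. ?S a <.> b)" and g = "%x. pscale (cou X x) (gw [])", OF kspX _ _ conjunct1[OF 1] that]) (rule lin |assumption)+
 moreover have "sw X x (%a b. a <.> ?S b) = pscale (cou X x) (gw [])" if "x .: X" for x
  by(rule X_eqI[where f = "%x. sw X x (%a b. a <.> ?S b)" and g = "%x. pscale (cou X x) (gw [])", OF kspX _ _ conjunct2[OF 1] that]) (rule lin |assumption)+
 ultimately show ?thesis by(simp add: is_antipode_iff[OF algX coalgX] sc_klinear unitX)
qed

lemma cop_unitX: "cop X (unit X) = unit X <*> unit X" by(simp add: unitX copX_gw)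

lemma cou_unitX: "cou X (unit X) = 1" by(simp add: unitX cou_gw)

lemma sc_1: "x .: X ==> sc 1 x = x" by(rule X_eqI[OF kspX sc_klinear klin_id]) (simp_all add: sc_gw)

text \<open>Without signs the two terms of the recursion are interchanged by the flip.\<close>

lemma cocommX:
 assumes "\<not> alt"
 shows "cocommutative X"
proof (rule cocommutativeI[OF coalgX])
 have gen: "kbilinear X X TT F ==> sw X (gw ws) F = sw X (gw ws) (%a b. F b a)" if ws: "ws : L" for ws F using ws
 proof (induction ws arbitrary: F)
  case Nil
  have "kbilinear X X TT (%a b. F b a)" by(rule kbilin[OF Nil] lin |assumption)+
  then show ?case by(simp only: sw_one[OF ksp_tens Nil] sw_one[OF ksp_tens])
 next
  case (Cons w ws)
  note F = Cons.prems
  have w: "w .: W" and ws: "ws : L" using Cons.hyps by auto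
  have x: "gw ws .: X" by(rule gw_mem[OF ws])
  have F1: "kbilinear X X TT (%a b. F (gw [w] <.> a) b + F a (gw [w] <.> b))"
   by(rule kbilin[OF F] lin w |assumption)+
  have F2: "kbilinear X X TT (%a b. F b a)" by(rule kbilin[OF F] lin w |assumption)+
  have q1: "sc q a = a" if "a .: X" for a using assms sc_1[OF that] by simp
  have "sw X (gw [w] <.> gw ws) F = sw X (gw ws) (%a b. F (gw [w] <.> a) b + F a (gw [w] <.> b))"
   unfolding sw_letter[OF ksp_tens F w x] by(rule tsum_eq) (simp only: q1)
  also have "... = sw X (gw ws) (%a b. F (gw [w] <.> b) a + F b (gw [w] <.> a))" by(rule Cons.IH[OF F1])
  also have "... = sw X (gw [w] <.> gw ws) (%a b. F b a)"
   unfolding sw_letter[OF ksp_tens F2 w x] by(rule tsum_eq) (simp only: q1 add.commute)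
  finally show ?case by(simp only: gw_Cons[OF w ws])
 qed
 fix x assume x: "x .: X"
 show "sw X x (%a b. b <*> a) = sw X x (<*>)"
  by(rule X_eqI[where f = "%x. sw X x (%a b. b <*> a)" and g = "%x. sw X x (<*>)", OF ksp_tens _ _ gen[OF _ kbil_tens, symmetric] x]) (rule lin |assumption)+
qed

lemma cop_grade:
 assumes x: "x : G n"
 shows "cop X x : module.span pscale {b <*> c |b c i j. b : G i & c : G j & i + j = n}"
proof -
 let ?S = "%n. {b <*> c |b c i j. b : G i & c : G j & i + j = n}"
 let ?P = "%n. module.span pscale (?S n)"
 have sub: "module.subspace (smul TT) (?P n)" for n unfolding smul_tensor by(rule module.subspace_span[OF module_pscale])
 have car: "?P n \<subseteq> car TT" for n
 proof (rule module.span_minimal[OF module_pscale])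
  show "?S n \<subseteq> car TT" by(auto intro!: tens_lin subsetD[OF grade_subset])
  show "module.subspace pscale (car TT)" using ksp_subspace[OF ksp_tens] by simp
 qed
 have step: "lmul w t : ?P (Suc n)" if w: "w .: W" and t: "t : ?P n" for w t n
 proof -
  have l: "klinear TT TT (lmul w)" by(rule lmul_lin klin_id w)+
  show ?thesis
  proof (rule span_induct_subspace[where f = "lmul w" and t = t and s = pscale and X = "?S n",
     OF vector_space_pscale kspace_vector_space[OF ksp_tens] sub])
   show "lmul w (x + y) = lmul w x + lmul w y" if "x : ?P n" "y : ?P n" for x y
    by(rule klin_add[OF l subsetD[OF car that(1)] subsetD[OF car that(2)]])
   show "lmul w (pscale c x) = smul TT c (lmul w x)" if "x : ?P n" for c x
    using klin_scale[OF l subsetD[OF car that], of c] by simp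
   show "t : ?P n" by(rule t)
   fix x assume "x : ?S n"
   then obtain b c i j where x: "x = b <*> c" and b: "b : G i" and c: "c : G j" and ij: "i + j = n" by blast
   note bc = subsetD[OF grade_subset b] subsetD[OF grade_subset c]
   have bil: "kbilinear X X TT (%a b. (gw [w] <.> a) <*> b + sc q a <*> (gw [w] <.> b))"
    by(rule lin w |assumption)+
   have e: "lmul w x = (gw [w] <.> b) <*> c + sc q b <*> (gw [w] <.> c)"
    unfolding x lmul_eq[OF w tens_lin(1)[OF bc]] by(rule tsum_tens[OF kspX ksp_tens bil bc])
   have w1: "gw [w] : G 1" using gw_grade[of "[w]"] w by simp
   have "gw [w] <.> b : G (1 + i)" "gw [w] <.> c : G (1 + j)" by(rule grade_mul[OF w1 b] grade_mul[OF w1 c])+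
   then have "(gw [w] <.> b) <*> c : ?S (Suc n)" "sc q b <*> (gw [w] <.> c) : ?S (Suc n)"
    using sc_grade[OF b] c ij by(force+)
   then show "lmul w x : ?P (Suc n)"
    unfolding e by(intro module.span_add[OF module_pscale] module.span_base[OF module_pscale])
  qed
 qed
 have word: "cop X (gw ws) : ?P (length ws)" if "ws : L" for ws using that
 proof (induction ws)
  case Nil
  have "gw [] <*> gw [] : ?S 0" using gw_grade[of "[]"] by force
  then show ?case by(simp add: copX_gw module.span_base[OF module_pscale])
 next
  case (Cons w ws)
  have w: "w .: W" and ws: "ws : L" using Cons.hyps by auto
  from step[OF w Cons.IH] show ?case by(simp add: gw_Cons[OF w ws] cop_letter[OF w gw_mem[OF ws]])
 qed
 show ?thesis by(rule grade_image[OF ksp_tens klin_copX sub _ x]) (use word in blast)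
qed

lemma cou_grade:
 assumes n: "0 < n" and x: "x : G n"
 shows "cou X x = 0"
proof -
 have "cou X x : {0}"
  by(rule grade_image[OF ksp_ground klin_couX module.subspace_single_0[OF ksp_module[OF ksp_ground]] _ x])
   (use n in \<open>auto simp: cou_gw\<close>)
 then show ?thesis by simp
qed

end

section \<open>The two concrete algebras as instances of the theory of words\<close>

section \<open>The Hopf algebra \<open>S(W)\<close> and the super-Hopf algebra \<open>\<Lambda>(W)\<close>\<close>

lemma sym_alg_simps [simp]:
 "car (sym_alg W) = car (word_space (symmetric_forms W) W)"
 "smul (sym_alg W) = pscale" "unit (sym_alg W) = sym_word W []"
 "mul (sym_alg W) = word_mul (symmetric_forms W) W"
 "cou (sym_alg W) = word_cou (symmetric_forms W) W"
 "cop (sym_alg W) = word_cop (symmetric_forms W) W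
   (tens_mul (word_space (symmetric_forms W) W) (word_mul (symmetric_forms W) W))"
 by(simp_all add: sym_alg_def Let_def word_space_def gen_space_def sym_word_def)

lemma ext_alg_simps [simp]:
 "car (ext_alg W) = car (word_space (alternating_forms W) W)"
 "smul (ext_alg W) = pscale" "unit (ext_alg W) = ext_word W []"
 "mul (ext_alg W) = word_mul (alternating_forms W) W"
 "cou (ext_alg W) = word_cou (alternating_forms W) W"
 "gr (ext_alg W) = word_grade (alternating_forms W) W"
 "cop (ext_alg W) = word_cop (alternating_forms W) W
   (stens_mul (word_space (alternating_forms W) W) (word_grade (alternating_forms W) W)
    (word_mul (alternating_forms W) W))" by(simp_all add: ext_alg_def Let_def word_space_def gen_space_def ext_word_def)

context word_algebra
begin

text \<open>The definitions of \<open>sym_alg\<close> and \<open>ext_alg\<close> build their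
  coproducts over the bare space of words, the Hopf axioms over the finished record. Both have the
  same underlying space.\<close>

lemma tens_WS: "tensor WS WS = tensor X X" "tens WS WS = tens X X"
 "tsum WS WS = (tsum X X :: _ => _ => 'c::ab_group_add)"
 by(rule tensor_cong[symmetric] tens_cong[symmetric] tsum_cong_spaces[symmetric]; simp add: sWS)+

lemma kspWS: "kspace WS" by(simp add: word_space_def kspace_gen_space)

lemma mul_WS: "kbilinear WS WS WS (mul X)" using mulX_bilinear by(simp add: kbilinear_def klin_WS sX)

lemma graded_WS: "graded_space WS G" using gradX by(simp add: graded_space_def kspX kspWS sWS)

lemma tens_mul_WS:
 assumes "u .: (tensor X X)" "v .: (tensor X X)"
 shows "tens_mul WS (mul X) u v = tsum X X u (%a b. tsum X X v (%a' b'. tens X X (a <.> a') (b <.> b')))"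
  and "tens_mul X (mul X) u v = tens_mul WS (mul X) u v"
 using tens_mul_eq_tsum[OF kspWS mul_WS, of u v] tens_mul_eq_tsum[OF kspX mulX_bilinear, of u v] assms by(simp_all add: tens_WS)

lemma stens_mul_WS:
 assumes "u .: (tensor X X)" "v .: (tensor X X)"
 shows "stens_mul WS G (mul X) u v = tsum X X u (%a b. tsum X X v (%a' b'.
   hsum G b (%i b. hsum G a' (%j a'. pscale ((- 1) ^ (i * j)) (tens X X (a <.> a') (b <.> b'))))))"
  and "stens_mul X G (mul X) u v = stens_mul WS G (mul X) u v"
 using stens_mul_eq[OF graded_WS mul_WS, of u v] stens_mul_eq[OF gradX mulX_bilinear, of u v] assms by(simp_all add: tens_WS)

lemma sym_bialgebra:
 assumes "\<not> alt" "cop X = word_cop R W (tens_mul WS (mul X))" "cou X = word_cou R W"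
 shows "word_bialgebra W alt X (tens_mul WS (mul X))"
proof unfold_locales
 let ?M = "%u v. tsum X X u (%a b. tsum X X v (%a' b'. tens X X (a <.> a') (b <.> b')))"
 have M: "kbilinear (tensor X X) (tensor X X) (tensor X X) ?M" by(rule lin |assumption)+
 show "kbilinear (tensor X X) (tensor X X) (tensor X X) (tens_mul WS (mul X))" apply(rule kbilinearI)
   apply(rule klin_cong[OF ksp_tens kbilin(2)[OF M _ klin_id]], assumption)
   apply(rule tens_mul_WS(1); assumption)
  apply(rule klin_cong[OF ksp_tens kbilin(3)[OF M _ klin_id]], assumption)
  apply(rule tens_mul_WS(1); assumption) done
 fix a b c d assume w: "a : L" "b : L" "c : L" "d : L"
 note m = w[THEN gw_mem]
 have q1: "q ^ n = 1" for n using assms(1) by simp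
 have "tens_mul WS (mul X) (tens X X (gw a) (gw b)) (tens X X (gw c) (gw d)) =
   tsum X X (tens X X (gw c) (gw d)) (%a' b'. tens X X (gw a <.> a') (gw b <.> b'))"
  unfolding tens_mul_WS(1)[OF tens_lin(1)[OF m(1,2)] tens_lin(1)[OF m(3,4)]]
  by(rule tsum_tens[OF kspX ksp_tens _ m(1,2)]) (rule m lin |assumption)+
 also have "... = tens X X (gw a <.> gw c) (gw b <.> gw d)"
  by(rule tsum_tens[OF kspX ksp_tens _ m(3,4)]) (rule m lin |assumption)+
 finally show "tens_mul WS (mul X) (tens X X (gw a) (gw b)) (tens X X (gw c) (gw d)) =
   pscale (q ^ (length b * length c)) (tens X X (gw (a @ c)) (gw (b @ d)))"
  using q1 by(simp only: mul_gw[OF w(1,3)] mul_gw[OF w(2,4)] pscale_simps(1))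
qed (use assms in auto)

lemma ext_bialgebra:
 assumes "alt" "cop X = word_cop R W (stens_mul WS G (mul X))" "cou X = word_cou R W"
 shows "word_bialgebra W alt X (stens_mul WS G (mul X))"
proof unfold_locales
 let ?E = "%a b a' b'. hsum G b (%i b. hsum G a' (%j a'. pscale ((- 1) ^ (i * j)) (tens X X (a <.> a') (b <.> b'))))"
 let ?M = "%u v. tsum X X u (%a b. tsum X X v (%a' b'. ?E a b a' b'))"
 note [lin] = gradX
 have M: "kbilinear (tensor X X) (tensor X X) (tensor X X) ?M" by(rule lin |assumption)+
 show "kbilinear (tensor X X) (tensor X X) (tensor X X) (stens_mul WS G (mul X))" apply(rule kbilinearI)
   apply(rule klin_cong[OF ksp_tens kbilin(2)[OF M _ klin_id]], assumption)
   apply(rule stens_mul_WS(1); assumption)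
  apply(rule klin_cong[OF ksp_tens kbilin(3)[OF M _ klin_id]], assumption)
  apply(rule stens_mul_WS(1); assumption) done
 fix a b c d assume w: "a : L" "b : L" "c : L" "d : L"
 note m = w[THEN gw_mem]
 have q1: "q ^ n = (- 1) ^ n" for n using assms(1) by simp
 have z: "gw a <.> 0 = 0" "0 <.> gw d = 0"
  using klin_0[OF kspX kspX mul_right[OF algX m(1) klin_id]] klin_0[OF kspX kspX mul_left[OF algX m(4) klin_id]] by simp_all
 have tz: "tens X X 0 y = 0" "tens X X y 0 = 0" if "y .: X" for y
  using klin_0[OF kspX ksp_tens tens_lin(3)[OF that klin_id]]
   klin_0[OF kspX ksp_tens tens_lin(2)[OF that klin_id]] by simp_all
 have "stens_mul WS G (mul X) (tens X X (gw a) (gw b)) (tens X X (gw c) (gw d)) =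
   tsum X X (tens X X (gw c) (gw d)) (?E (gw a) (gw b))"
  unfolding stens_mul_WS(1)[OF tens_lin(1)[OF m(1,2)] tens_lin(1)[OF m(3,4)]]
  by(rule tsum_tens[OF kspX ksp_tens _ m(1,2)]) (rule m lin |assumption)+
 also have "... = ?E (gw a) (gw b) (gw c) (gw d)" by(rule tsum_tens[OF kspX ksp_tens _ m(3,4)]) (rule m lin |assumption)+
 also have "... = hsum G (gw b) (%i b. pscale ((- 1) ^ (i * length c)) (tens X X (gw a <.> gw c) (b <.> gw d)))"
  apply(rule hsum_cong[OF gradX m(2)]) apply(rule hsum_homogeneous[OF gradX gw_grade[OF w(3)]])
  apply(simp add: z tz mul_mem[OF algX] m) done
 also have "... = pscale ((- 1) ^ (length b * length c)) (tens X X (gw a <.> gw c) (gw b <.> gw d))"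
  by(rule hsum_homogeneous[OF gradX gw_grade[OF w(2)]]) (simp add: z tz mul_mem[OF algX] m)
 finally show "stens_mul WS G (mul X) (tens X X (gw a) (gw b)) (tens X X (gw c) (gw d)) =
   pscale (q ^ (length b * length c)) (tens X X (gw (a @ c)) (gw (b @ d)))"
  using q1 by(simp only: mul_gw[OF w(1,3)] mul_gw[OF w(2,4)])
qed (use assms in auto)

end

lemma sym_alg_words:
 assumes "kspace W"
 shows "word_algebra W False (sym_alg W)" using assms by unfold_locales (simp_all add: symmetric_word_forms sym_word_def)

lemma sym_alg_word_bialgebra:
 assumes W: "kspace W"
 shows "word_bialgebra W False (sym_alg W) (tens_mul (word_space (word_forms False W) W) (mul (sym_alg W)))"
proof -
 interpret word_algebra W False "sym_alg W" by(rule sym_alg_words[OF W])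
 show ?thesis by(rule sym_bialgebra) (simp_all add: symmetric_word_forms)
qed

theorem hopf_sym_alg:
 assumes W: "kspace W"
 shows "hopf_algebra (sym_alg W)" and "cocommutative (sym_alg W)"
proof -
 let ?M = "tens_mul (word_space (word_forms False W) W) (mul (sym_alg W))"
 interpret word_bialgebra W False "sym_alg W" ?M by(rule sym_alg_word_bialgebra[OF W])
 have "cop (sym_alg W) (mul (sym_alg W) x y) = tens_mul (sym_alg W) (mul (sym_alg W)) (cop (sym_alg W) x) (cop (sym_alg W) y)"
  if "x .: (sym_alg W)" "y .: (sym_alg W)" for x y
  using cop_mulX[OF that] tens_mul_WS(2)[OF copX_mem[OF that(1)] copX_mem[OF that(2)]] by(simp only:)
 then show "hopf_algebra (sym_alg W)" unfolding hopf_algebra_def bialgebra_def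
  using algX coalgX cou_mulX cop_unitX cou_unitX antipodeX by blast
 show "cocommutative (sym_alg W)" by(rule cocommX) simp
qed

lemma ext_alg_words:
 assumes "kspace W"
 shows "word_algebra W True (ext_alg W)" using assms by unfold_locales (simp_all add: alternating_word_forms ext_word_def)

lemma ext_alg_word_bialgebra:
 assumes W: "kspace W"
 shows "word_bialgebra W True (ext_alg W)
  (stens_mul (word_space (word_forms True W) W) (word_grade (word_forms True W) W) (mul (ext_alg W)))"
proof -
 interpret word_algebra W True "ext_alg W" by(rule ext_alg_words[OF W])
 show ?thesis by(rule ext_bialgebra) (simp_all add: alternating_word_forms[OF W])
qed

theorem super_hopf_ext_alg:
 assumes W: "kspace W"
 shows "super_hopf_algebra (ext_alg W)"
proof -
 let ?M = "stens_mul (word_space (word_forms True W) W) (word_grade (word_forms True W) W) (mul (ext_alg W))"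
 interpret word_bialgebra W True "ext_alg W" ?M by(rule ext_alg_word_bialgebra[OF W])
 have gr: "gr (ext_alg W) = G" by(simp add: alternating_word_forms[OF W])
 have "cop (ext_alg W) (mul (ext_alg W) x y) = stens_mul (ext_alg W) G (mul (ext_alg W)) (cop (ext_alg W) x) (cop (ext_alg W) y)"
  if "x .: (ext_alg W)" "y .: (ext_alg W)" for x y
  using cop_mulX[OF that] stens_mul_WS(2)[OF copX_mem[OF that(1)] copX_mem[OF that(2)]] by(simp only:)
 moreover have "\<exists>S. is_antipode (ext_alg W) S & (\<forall>n. \<forall>a\<in>G n. S a : G n)"
  using antipodeX sc_grade by blast
 ultimately show ?thesis unfolding super_hopf_algebra_def gr
  using algX coalgX gradX unit_grade grade_mul cop_grade cou_grade cou_mulX cop_unitX cou_unitX by blast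
qed

section \<open>Extension of an action on letters to symmetric and exterior algebras\<close>

section \<open>Actions on symmetric and exterior algebras\<close>

lemma sw_swap_first:
 assumes D: "kspace D" and C: "coalgebra C" and co: "cocommutative C" and c: "c .: C"
  and F: "ktrilinear C C C D F"
 shows "sw C c (%a r. sw C r (%b d. F a b d)) = sw C c (%a r. sw C r (%b d. F b a d))"
proof -
 note [lin] = D C coalgebra_kspace[OF C]
 have "sw C c (%a r. sw C r (%b d. F a b d)) = sw C c (%e d. sw C e (%a b. F a b d))" by(rule sw_coassoc[OF D C c F, symmetric])
 also have "... = sw C c (%e d. sw C e (%a b. F b a d))"
  by(rule tsum_eq, rule sw_cocomm[OF D C co], assumption) (rule lin ktrilin[OF F] |assumption)+
 also have "... = sw C c (%a r. sw C r (%b d. F b a d))" by(rule sw_coassoc[OF D C c]) (rule lin ktrilin[OF F] |assumption)+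
 finally show ?thesis .
qed

lemma tsum_subspace:
 assumes D: "kspace D" and V: "module.subspace (smul D) V" and f: "!!a b. a .: A ==> b .: B ==> f a b : V"
 shows "tsum A B t f : V"
proof -
 have "(\<Sum>p\<leftarrow>xs. f (fst p) (snd p)) : V" if "set xs \<subseteq> car A \<times> car B" for xs using that
 proof (induction xs)
  case Nil
  show ?case unfolding list.map sum_list.Nil by(rule module.subspace_0[OF ksp_module[OF D] V])
 next
  case (Cons p xs)
  then have p: "fst p .: A" "snd p .: B" and xs: "set xs \<subseteq> car A \<times> car B" by auto
  show ?case unfolding list.map sum_list.Cons by(rule module.subspace_add[OF ksp_module[OF D] V f[OF p] Cons.IH[OF xs]])
 qed
 from this[OF trep_subset] show ?thesis by(simp add: tsum_def case_prod_unfold)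
qed

text \<open>\<open>p\<close> is the product of \<open>H\<close> for left actions and the opposite product for right actions.\<close>

locale word_action = word_bialgebra W alt X M
 for W :: "('k::field, 'w::ab_group_add, 'y) kspace_scheme" and alt :: bool
  and X :: "('k, ('w list, 'k) functional, 'z) kbialg_scheme" and M +
 fixes H :: "('k, 'h::ab_group_add, 'zz) kbialg_scheme"
  and t :: "'h => 'w => 'w" and p :: "'h => 'h => 'h"
  and aw :: "'w list => 'h => ('w list, 'k) functional"
 assumes bialgH [lin]: "bialgebra H" and cocommH: "cocommutative H"
  and t_bilinear: "kbilinear H W W t"
  and t_unit: "!!w. w .: W ==> t (unit H) w = w"
  and p_cases: "p = mul H \<or> p = (%a b. mul H b a)"
  and t_p: "!!g h w. g .: H ==> h .: H ==> w .: W ==> t (p g h) w = t g (t h w)"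
  and aw_Nil: "!!h. aw [] h = pscale (cou H h) (gw [])"
  and aw_Cons: "!!w ws h. aw (w # ws) h = tlift H H X (%h1 h2. mul X (gw [t h1 w]) (aw ws h2)) (cop H h)"
begin

lemma coalgH [lin]: "coalgebra H" by(rule bialgebra_coalgebra[OF bialgH])
lemma algH [lin]: "assoc_algebra H" by(rule bialgebra_algebra[OF bialgH])
lemma kspH [lin]: "kspace H" by(rule coalgebra_kspace[OF coalgH])

lemmas t_lin [lin] = kbilin[OF t_bilinear]

lemma p_mem [lin]: "g .: H ==> h .: H ==> p g h .: H" using p_cases mul_mem[OF algH] by auto

lemma sw_p:
 assumes D: "kspace D" and F: "kbilinear H H D F" and g: "g .: H" and h: "h .: H"
 shows "sw H (p g h) F = sw H g (%g1 g2. sw H h (%h1 h2. F (p g1 h1) (p g2 h2)))" using p_cases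
proof
 assume p: "p = mul H"
 show ?thesis unfolding p by(rule sw_mul[OF D bialgH g h F])
next
 assume p: "p = (%a b. mul H b a)"
 show ?thesis unfolding p sw_mul[OF D bialgH h g F] by(rule tsum_swap)
qed

lemma cou_p: "g .: H ==> h .: H ==> cou H (p g h) = cou H g * cou H h"
 using p_cases by(auto simp: bialgebra_cou[OF bialgH])

text \<open>The recursion is written with \<open>tlift\<close>, which can be read as a Sweedler sum
  once the action on the tail is linear. Linearity is therefore carried through the induction, and
  the recursion in Sweedler form comes out of it.\<close>

lemma aw_klinear: "ws : L ==> klinear H X (aw ws)"
 and aw_letter: "w .: W ==> ws : L ==> h .: H ==> aw (w # ws) h = sw H h (%h1 h2. gw [t h1 w] <.> aw ws h2)"
proof -
 have bil: "kbilinear H H X (%h1 h2. gw [t h1 w] <.> aw ws h2)" if "klinear H X (aw ws)" "w .: W" for w ws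
  by(rule lin that klin_mem[OF that(1)] klin_comp[OF that(1)] |assumption)+
 have letter: "aw (w # ws) h = sw H h (%h1 h2. gw [t h1 w] <.> aw ws h2)"
  if "klinear H X (aw ws)" "w .: W" "h .: H" for w ws h
  unfolding aw_Cons by(rule tlift_eq_tsum[OF kspH kspX bil[OF that(1,2)] cop_mem[OF coalgH that(3)]])
 show lin: "klinear H X (aw ws)" if "ws : L" for ws using that
 proof (induction ws)
  case Nil
  show ?case unfolding aw_Nil by(rule cou_lin lin |assumption)+
 next
  case (Cons w ws)
  then have w: "w .: W" and IH: "klinear H X (aw ws)" by auto
  show ?case
   by(rule klin_cong[OF kspH klin_tsum_arg[OF kspH kspX cop_lin[OF coalgH klin_id] bil[OF IH w]] letter[OF IH w]])
 qed
 show "w .: W ==> ws : L ==> h .: H ==> aw (w # ws) h = sw H h (%h1 h2. gw [t h1 w] <.> aw ws h2)"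
  by(rule letter[OF lin])
qed

lemma aw_mem [lin]: "ws : L ==> h .: H ==> aw ws h .: X" by(rule klin_mem[OF aw_klinear])

lemma aw_lin [lin]: "ws : L ==> klinear E H g ==> klinear E X (%x. aw ws (g x))" by(rule klin_comp[OF aw_klinear])

lemma gw_letter_swap: "x .: W ==> y .: W ==> gw [x] <.> gw [y] = pscale q (gw [y] <.> gw [x])"
 using gw_swap[of "[]" "[]" x y] mul_gw[of "[x]" "[y]"] mul_gw[of "[y]" "[x]"] by(simp only: append_Nil append_Cons) simp

lemma gw_letter_alt: "alt ==> x .: W ==> gw [x] <.> gw [x] = 0"
 using gw_alt[of "[]" "[]" x] mul_gw[of "[x]" "[x]"] by(simp only: append_Nil append_Cons) simp

lemma aw_two:
 assumes x: "x .: W" and y: "y .: W" and vs: "vs : L" and h: "h .: H"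
 shows "aw (x # y # vs) h = sw H h (%r h3. sw H r (%h1 h2. (gw [t h1 x] <.> gw [t h2 y]) <.> aw vs h3))"
proof -
 have yvs: "y # vs : L" using y vs by simp
 have "aw (x # y # vs) h = sw H h (%h1 r. gw [t h1 x] <.> sw H r (%h2 h3. gw [t h2 y] <.> aw vs h3))"
  unfolding aw_letter[OF x yvs h] by(rule tsum_eq) (simp only: aw_letter[OF y vs])
 also have "... = sw H h (%h1 r. sw H r (%h2 h3. gw [t h1 x] <.> (gw [t h2 y] <.> aw vs h3)))"
  by(rule tsum_eq, rule mul_tsum_right[OF algX]) (rule lin x y vs |assumption)+
 also have "... = sw H h (%r h3. sw H r (%h1 h2. gw [t h1 x] <.> (gw [t h2 y] <.> aw vs h3)))"
  by(rule sw_coassoc[OF kspX coalgH h, symmetric]) (rule lin x y vs |assumption)+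
 also have "... = sw H h (%r h3. sw H r (%h1 h2. (gw [t h1 x] <.> gw [t h2 y]) <.> aw vs h3))"
  by(rule tsum_eq, rule tsum_eq, rule mul_assoc[OF algX, symmetric]) (rule lin x y vs |assumption)+
 finally show ?thesis .
qed

text \<open>The two adjacent letters receive consecutive Sweedler factors of \<open>h\<close>.
  Cocommutativity interchanges these factors, after which the letters are interchanged in the
  algebra.\<close>

lemma aw_swap:
 assumes x: "x .: W" and y: "y .: W" and vs: "vs : L" and h: "h .: H"
 shows "aw (x # y # vs) h = pscale q (aw (y # x # vs) h)"
proof -
 have "aw (x # y # vs) h = sw H h (%r h3. sw H r (%h1 h2. (gw [t h2 x] <.> gw [t h1 y]) <.> aw vs h3))"
  unfolding aw_two[OF x y vs h]
  by(rule tsum_eq, rule sw_cocomm[OF kspX coalgH cocommH], assumption) (rule lin x y vs |assumption)+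
 also have "... = sw H h (%r h3. sw H r (%h1 h2. smul X q ((gw [t h1 y] <.> gw [t h2 x]) <.> aw vs h3)))"
 proof (rule tsum_eq, rule tsum_eq)
  fix r h3 h1 h2 assume c: "h3 .: H" "h1 .: H" "h2 .: H"
  have tm: "t h2 x .: W" "t h1 y .: W" by(rule lin c x y)+
  have m: "gw [t h1 y] <.> gw [t h2 x] .: X" "aw vs h3 .: X" by(rule lin c x y vs)+
  show "(gw [t h2 x] <.> gw [t h1 y]) <.> aw vs h3 = smul X q ((gw [t h1 y] <.> gw [t h2 x]) <.> aw vs h3)"
   using mul_smul(1)[OF algX m, of q] by(simp only: gw_letter_swap[OF tm] smulX)
 qed
 also have "... = smul X q (aw (y # x # vs) h)" unfolding aw_two[OF y x vs h] by(simp only: smul_tsum[OF kspX])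
 finally show ?thesis by simp
qed

text \<open>The product of two copies of \<open>x\<close> under \<open>h1\<close> and
  \<open>h2\<close> is alternating in these factors, hence vanishes on the symmetric tensor given by
  the coproduct. The rule for interchanging letters would not give this in characteristic
  two.\<close>

lemma aw_alt:
 assumes alt: alt and x: "x .: W" and vs: "vs : L" and h: "h .: H"
 shows "aw (x # x # vs) h = 0"
proof -
 have "aw (x # x # vs) h = sw H h (%r h3. 0)" unfolding aw_two[OF x x vs h]
 proof (rule tsum_eq, rule sw_alternating[OF kspX coalgH cocommH])
  fix r h3 assume h3: "h3 .: H"
  show "kbilinear H H X (%h1 h2. (gw [t h1 x] <.> gw [t h2 x]) <.> aw vs h3)" by(rule lin x vs h3 |assumption)+
  fix g assume g: "g .: H"
  have "t g x .: W" by(rule lin g x)+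
  then show "(gw [t g x] <.> gw [t g x]) <.> aw vs h3 = 0"
   using klin_0[OF kspX kspX mul_left[OF algX aw_mem[OF vs h3] klin_id]] by(simp only: gw_letter_alt[OF alt])
 qed
 then show ?thesis by simp
qed

lemma aw_context:
 assumes us: "us : L" and ab: "a : L" "b : L" and eq: "!!h. h .: H ==> aw a h = pscale c (aw b h)" and h: "h .: H"
 shows "aw (us @ a) h = pscale c (aw (us @ b) h)" using us h
proof (induction us arbitrary: h)
 case Nil
 then show ?case by(simp add: eq)
next
 case (Cons u us)
 have u: "u .: W" and us: "us : L" using Cons.hyps by auto
 have l: "us @ a : L" "us @ b : L" using us ab by auto
 have "aw (u # us @ a) h = sw H h (%h1 h2. smul X c (gw [t h1 u] <.> aw (us @ b) h2))"
  unfolding aw_letter[OF u l(1) Cons.prems]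
 proof (rule tsum_eq)
  fix h1 h2 assume c: "h1 .: H" "h2 .: H"
  have m: "gw [t h1 u] .: X" "aw (us @ b) h2 .: X" by(rule gw1_mem[OF t_lin(1)[OF c(1) u]], rule aw_mem[OF l(2) c(2)])
  show "gw [t h1 u] <.> aw (us @ a) h2 = smul X c (gw [t h1 u] <.> aw (us @ b) h2)"
   using mul_smul(2)[OF algX m, of c] by(simp only: Cons.IH[OF c(2)] smulX)
 qed
 also have "... = smul X c (aw (u # us @ b) h)" unfolding aw_letter[OF u l(2) Cons.prems] by(simp only: smul_tsum[OF kspX])
 finally show ?case by simp
qed

lemma aw_word_map:
 assumes h: "h .: H"
 shows "word_map X (%ws. aw ws h)" unfolding word_map_def
proof (intro conjI ballI impI)
 show "aw ws h .: X" if "ws : L" for ws by(rule aw_mem[OF that h])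
 fix us vs assume us: "us : L" and vs: "vs : L"
 show "klinear W X (%w. aw (us @ w # vs) h)" using us h
 proof (induction us arbitrary: h)
  case Nil
  have "klinear W X (%w. sw H h (%h1 h2. gw [t h1 w] <.> aw vs h2))" by(rule lin vs |assumption)+
  from klin_cong[OF kspW this] aw_letter[OF _ vs Nil] show ?case by simp
 next
  case (Cons u us)
  have u: "u .: W" and us: "us : L" using Cons.hyps by auto
  have l: "us @ w # vs : L" if "w .: W" for w using us vs that by simp
  have "klinear W X (%w. sw H h (%h1 h2. gw [t h1 u] <.> aw (us @ w # vs) h2))" apply(rule klin_tsum_fun[OF kspX])
   apply(rule mul_right[OF algX]) apply(rule lin u |assumption)+ apply(rule Cons.IH) apply assumption done
  from klin_cong[OF kspW this] aw_letter[OF u l Cons.prems] show ?case by simp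
 qed
 fix x y assume x: "x .: W" and y: "y .: W"
 show "aw (us @ x # y # vs) h = smul X q (aw (us @ y # x # vs) h)"
  unfolding smulX by(rule aw_context[OF us _ _ aw_swap[OF x y vs] h]) (use x y vs in auto)
 show "aw (us @ x # x # vs) h = 0" if alt
 proof -
  have "aw (us @ x # x # vs) h = pscale 0 (aw (us @ x # x # vs) h)"
   by(rule aw_context[OF us _ _ _ h]) (use x vs aw_alt[OF that x vs] in auto)
  then show ?thesis by simp
 qed
qed

section \<open>The extended action is a module algebra and module coalgebra structure preserving the
  degree\<close>

definition act :: "'h => ('w list, 'k) functional => ('w list, 'k) functional" where
 "act h = lin_ext R L X (%ws. aw ws h)"

lemma act_klinear: "h .: H ==> klinear X X (act h)" unfolding act_def by(rule word_ext_lin[OF kspX aw_word_map])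

lemma act_gw: "h .: H ==> ws : L ==> act h (gw ws) = aw ws h"
 unfolding act_def by(rule word_ext_gw[OF kspX aw_word_map])

lemma act_bilinear: "kbilinear H X X act"
proof (rule kbilinearI)
 show "klinear X X (act h)" if "h .: H" for h by(rule act_klinear[OF that])
 fix x assume x: "x .: X"
 show "klinear H X (%h. act h x)"
 proof (rule klinearI)
  show "act h x .: X" if "h .: H" for h by(rule klin_mem[OF act_klinear[OF that] x])
  fix g h assume g: "g .: H" and h: "h .: H"
  have gh: "g + h .: H" by(rule ksp_add[OF kspH g h])
  show "act (g + h) x = act g x + act h x"
   by(rule X_eqI[where f = "act (g + h)" and g = "%x. act g x + act h x", OF kspX act_klinear[OF gh]
      klin_plus[OF kspX act_klinear[OF g] act_klinear[OF h]] _ x])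
    (simp only: act_gw g h gh klin_add[OF aw_klinear])
 next
  fix c h assume h: "h .: H"
  have ch: "smul H c h .: H" by(rule ksp_scale[OF kspH h])
  show "act (smul H c h) x = smul X c (act h x)"
   by(rule X_eqI[where f = "act (smul H c h)" and g = "%x. smul X c (act h x)", OF kspX act_klinear[OF ch]
      klin_smul[OF kspX act_klinear[OF h]] _ x])
    (simp only: act_gw h ch klin_scale[OF aw_klinear])
 qed
qed

lemmas act_lin [lin] = kbilin[OF act_bilinear]

lemma act_one: "h .: H ==> act h (gw []) = pscale (cou H h) (gw [])" by(simp add: act_gw aw_Nil)

lemma act_letter:
 assumes h: "h .: H" and w: "w .: W" and x: "x .: X"
 shows "act h (gw [w] <.> x) = sw H h (%h1 h2. gw [t h1 w] <.> act h2 x)"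
proof (rule X_eqI[where f = "%x. act h (gw [w] <.> x)" and g = "%x. sw H h (%h1 h2. gw [t h1 w] <.> act h2 x)", OF kspX _ _ _ x])
 show "klinear X X (%x. act h (gw [w] <.> x))" "klinear X X (%x. sw H h (%h1 h2. gw [t h1 w] <.> act h2 x))"
  by(rule lin h w |assumption)+
 fix ws assume ws: "ws : L"
 have wws: "w # ws : L" using w ws by simp
 have "act h (gw (w # ws)) = sw H h (%h1 h2. gw [t h1 w] <.> act h2 (gw ws))"
  unfolding act_gw[OF h wws] aw_letter[OF w ws h] by(rule tsum_eq) (simp only: act_gw ws)
 then show "act h (gw [w] <.> gw ws) = sw H h (%h1 h2. gw [t h1 w] <.> act h2 (gw ws))"
  by(simp only: gw_Cons[OF w ws])
qed

lemma act_gw1: "h .: H ==> w .: W ==> act h (gw [w]) = gw [t h w]"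
proof -
 assume h: "h .: H" and w: "w .: W"
 have "act h (gw [w]) = act h (gw [w] <.> gw [])" using w by(simp add: mul_gw)
 also have "... = sw H h (%h1 h2. gw [t h1 w] <.> act h2 (gw []))" by(rule act_letter[OF h w gw0_mem])
 also have "... = sw H h (%h1 h2. smul X (cou H h2) (gw [t h1 w]))"
 proof (rule tsum_eq)
  fix h1 h2 assume c: "h1 .: H" "h2 .: H"
  have tw: "t h1 w .: W" by(rule lin c w)+
  show "gw [t h1 w] <.> act h2 (gw []) = smul X (cou H h2) (gw [t h1 w])"
   using mul_smul(2)[OF algX gw1_mem[OF tw] gw0_mem, of "cou H h2"] tw by(simp add: act_one c mul_gw)
 qed
 also have "... = gw [t h w]" by(rule sw_counit_right[OF kspX coalgH h]) (rule lin w)+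
 finally show ?thesis .
qed

lemma act_mul:
 assumes h: "h .: H" and x: "x .: X" and y: "y .: X"
 shows "act h (x <.> y) = sw H h (%h1 h2. act h1 x <.> act h2 y)"
proof -
 have gen: "act h (gw ws <.> y) = sw H h (%h1 h2. act h1 (gw ws) <.> act h2 y)" if "ws : L" "h .: H" for ws h
  using that
 proof (induction ws arbitrary: h)
  case Nil
  note h = Nil
  have "sw H h (%h1 h2. act h1 (gw []) <.> act h2 y) = sw H h (%h1 h2. smul X (cou H h1) (act h2 y))"
  proof (rule tsum_eq)
   fix h1 h2 assume c: "h1 .: H" "h2 .: H"
   have ay: "act h2 y .: X" by(rule lin c y)+
   show "act h1 (gw []) <.> act h2 y = smul X (cou H h1) (act h2 y)"
    using mul_smul(1)[OF algX gw0_mem ay, of "cou H h1"] mul_unit(1)[OF algX ay] by(simp add: act_one c unitX)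
  qed
  also have "... = act h y" by(rule sw_counit_left[OF kspX coalgH h]) (rule lin y)+
  finally show ?case using mul_unit(1)[OF algX y] by(simp add: unitX)
 next
  case (Cons w ws)
  note h = Cons.prems
  have w: "w .: W" and ws: "ws : L" using Cons.hyps by auto
  have x: "gw ws .: X" by(rule gw_mem[OF ws])
  have xy: "gw ws <.> y .: X" by(rule mul_mem[OF algX x y])
  have "act h ((gw [w] <.> gw ws) <.> y) = act h (gw [w] <.> (gw ws <.> y))"
   by(simp only: mul_assoc[OF algX gw1_mem[OF w] x y])
  also have "... = sw H h (%h1 r. gw [t h1 w] <.> act r (gw ws <.> y))" by(rule act_letter[OF h w xy])
  also have "... = sw H h (%h1 r. gw [t h1 w] <.> sw H r (%h2 h3. act h2 (gw ws) <.> act h3 y))"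
   by(rule tsum_eq) (simp only: Cons.IH)
  also have "... = sw H h (%h1 r. sw H r (%h2 h3. gw [t h1 w] <.> (act h2 (gw ws) <.> act h3 y)))"
   by(rule tsum_eq, rule mul_tsum_right[OF algX]) (rule x y w lin |assumption)+
  also have "... = sw H h (%r h3. sw H r (%h1 h2. gw [t h1 w] <.> (act h2 (gw ws) <.> act h3 y)))"
   by(rule sw_coassoc[OF kspX coalgH h, symmetric]) (rule x y w lin |assumption)+
  also have "... = sw H h (%r h3. sw H r (%h1 h2. (gw [t h1 w] <.> act h2 (gw ws)) <.> act h3 y))"
   by(rule tsum_eq, rule tsum_eq, rule mul_assoc[OF algX, symmetric]) (rule x y w lin |assumption)+
  also have "... = sw H h (%r h3. act r (gw [w] <.> gw ws) <.> act h3 y)" apply(rule tsum_eq)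
   apply(subst act_letter[OF _ w x], assumption) apply(rule mul_tsum_left[OF algX, symmetric])
    apply(rule x y w lin |assumption)+ done
  finally show ?case by(simp only: gw_Cons[OF w ws])
 qed
 show ?thesis
  by(rule X_eqI[where f = "%x. act h (x <.> y)" and g = "%x. sw H h (%h1 h2. act h1 x <.> act h2 y)", OF kspX _ _ gen[OF _ h] x]) (rule lin h y |assumption)+
qed

lemma act_unit: "x .: X ==> act (unit H) x = x"
proof (rule X_eqI[OF kspX act_klinear[OF unit_mem[OF algH]] klin_id])
 fix ws assume "ws : L"
 then show "act (unit H) (gw ws) = gw ws"
 proof (induction ws)
  case Nil
  show ?case by(simp add: act_one unit_mem[OF algH] bialgebra_cou[OF bialgH])
 next
  case (Cons w ws)
  have w: "w .: W" and ws: "ws : L" using Cons.hyps by auto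
  have x: "gw ws .: X" by(rule gw_mem[OF ws])
  have "act (unit H) (gw [w] <.> gw ws) = gw [t (unit H) w] <.> act (unit H) (gw ws)"
   unfolding act_letter[OF unit_mem[OF algH] w x] by(rule sw_unit[OF kspX bialgH]) (rule x w lin |assumption)+
  then show ?case by(simp only: t_unit[OF w] Cons.IH gw_Cons[OF w ws])
 qed
qed

lemma act_p:
 assumes g: "g .: H" and h: "h .: H" and x: "x .: X"
 shows "act (p g h) x = act g (act h x)"
proof -
 have gen: "act (p g h) (gw ws) = act g (act h (gw ws))" if "ws : L" "g .: H" "h .: H" for ws g h using that
 proof (induction ws arbitrary: g h)
  case Nil
  then show ?case
   using klin_scale[OF act_klinear[OF Nil(1)] gw0_mem, of "cou H h"] by(simp add: act_one p_mem cou_p mult.commute)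
 next
  case (Cons w ws)
  note gh = Cons.prems
  have w: "w .: W" and ws: "ws : L" using Cons.hyps by auto
  have x: "gw ws .: X" by(rule gw_mem[OF ws])
  have "act (p g h) (gw [w] <.> gw ws) = sw H g (%g1 g2. sw H h (%h1 h2. gw [t (p g1 h1) w] <.> act (p g2 h2) (gw ws)))"
   unfolding act_letter[OF p_mem[OF gh] w x] by(rule sw_p[OF kspX _ gh]) (rule x w lin |assumption)+
  also have "... = sw H g (%g1 g2. sw H h (%h1 h2. gw [t g1 (t h1 w)] <.> act g2 (act h2 (gw ws))))"
   by(rule tsum_eq, rule tsum_eq) (simp only: t_p[OF _ _ w] Cons.IH)
  also have "... = sw H h (%h1 h2. sw H g (%g1 g2. gw [t g1 (t h1 w)] <.> act g2 (act h2 (gw ws))))" by(rule tsum_swap)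
  also have "... = sw H h (%h1 h2. act g (gw [t h1 w] <.> act h2 (gw ws)))"
   by(rule tsum_eq, rule act_letter[OF gh(1), symmetric]) (rule x w lin |assumption)+
  also have "... = act g (act h (gw [w] <.> gw ws))" unfolding act_letter[OF gh(2) w x]
   by(rule klin_tsum[OF kspX kspX act_klinear[OF gh(1)], symmetric]) (rule x w lin |assumption)+
  finally show ?case by(simp only: gw_Cons[OF w ws])
 qed
 show ?thesis
  by(rule X_eqI[where f = "act (p g h)" and g = "%x. act g (act h x)", OF kspX _ _ gen[OF _ g h] x]) (rule lin g h |assumption)+
qed

lemma act_cou:
 assumes h: "h .: H" and x: "x .: X"
 shows "cou X (act h x) = cou H h * cou X x"
proof -
 have gen: "cou X (act h (gw ws)) = cou H h * cou X (gw ws)" if "ws : L" for ws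
 proof (cases ws)
  case Nil
  then show ?thesis using klin_scale[OF klin_couX gw0_mem, of "cou H h"] by(simp add: act_one h cou_gw)
 next
  case (Cons w vs)
  then have w: "w .: W" and vs: "vs : L" using that by auto
  have x: "gw vs .: X" by(rule gw_mem[OF vs])
  have "cou X (act h (gw [w] <.> gw vs)) = sw H h (%h1 h2. cou X (gw [t h1 w] <.> act h2 (gw vs)))"
   unfolding act_letter[OF h w x] by(rule klin_tsum[OF kspX ksp_ground klin_couX]) (rule x w lin |assumption)+
  also have "... = sw H h (%h1 h2. 0)" by(rule tsum_eq, rule cou_letter) (rule x w lin |assumption)+
  finally show ?thesis by(simp add: Cons gw_Cons[OF w vs] cou_letter[OF w x])
 qed
 show ?thesis
  by(rule X_eqI[where f = "%x. cou X (act h x)" and g = "%x. cou H h * cou X x", OF ksp_ground _ _ gen x]) (rule lin h |assumption)+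
qed

lemma act_sc:
 assumes h: "h .: H" and x: "x .: X"
 shows "act h (sc c x) = sc c (act h x)"
proof -
 have gen: "act h (sc c (gw ws)) = sc c (act h (gw ws))" if "ws : L" "h .: H" for ws h using that
 proof (induction ws arbitrary: h)
  case Nil
  then show ?case using klin_scale[OF sc_klinear gw0_mem, of c "cou H h"] by(simp add: sc_unit act_one)
 next
  case (Cons w ws)
  note h = Cons.prems
  have w: "w .: W" and ws: "ws : L" using Cons.hyps by auto
  have x: "gw ws .: X" by(rule gw_mem[OF ws])
  have wx: "gw [w] <.> sc c (gw ws) .: X" by(rule lin w x)+
  have "act h (sc c (gw [w] <.> gw ws)) = smul X c (act h (gw [w] <.> sc c (gw ws)))"
   unfolding sc_letter[OF w x] using klin_scale[OF act_klinear[OF h] wx, of c] by simp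
  also have "... = sw H h (%h1 h2. smul X c (gw [t h1 w] <.> sc c (act h2 (gw ws))))"
   unfolding act_letter[OF h w sc_mem[OF x]] smul_tsum[OF kspX] by(rule tsum_eq) (simp only: Cons.IH)
  also have "... = sw H h (%h1 h2. sc c (gw [t h1 w] <.> act h2 (gw ws)))" unfolding smulX
   by(rule tsum_eq, rule sc_letter[symmetric]) (rule x w lin |assumption)+
  also have "... = sc c (act h (gw [w] <.> gw ws))" unfolding act_letter[OF h w x]
   by(rule klin_tsum[OF kspX kspX sc_klinear, symmetric]) (rule x w lin |assumption)+
  finally show ?case by(simp only: gw_Cons[OF w ws])
 qed
 show ?thesis
  by(rule X_eqI[where f = "%x. act h (sc c x)" and g = "%x. sc c (act h x)", OF kspX _ _ gen[OF _ h] x]) (rule lin h |assumption)+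
qed

text \<open>The recursion gives two sums, \<open>?P\<close> with the new letter on the left leg and
  \<open>?Q\<close> with it on the right leg. In \<open>?P\<close> coassociativity lets the letter
  and the rest of the left leg share one factor of \<open>h\<close>; in \<open>?Q\<close> the factor
  acting on the letter must first be exchanged with the one acting on the left leg, which uses
  cocommutativity.\<close>

lemma act_cop:
 assumes D: "kspace D" and F: "kbilinear X X D F" and h: "h .: H" and x: "x .: X"
 shows "sw X (act h x) F = sw H h (%h1 h2. sw X x (%a b. F (act h1 a) (act h2 b)))"
proof -
 have gen: "kbilinear X X D F ==> sw X (act h (gw ws)) F = sw H h (%h1 h2. sw X (gw ws) (%a b. F (act h1 a) (act h2 b)))"
  if "ws : L" "h .: H" for ws h F using that
 proof (induction ws arbitrary: h F)
  case Nil
  note F = Nil(1) and h = Nil(2)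
  note [lin] = kbilin[OF F]
  have b: "kbilinear X X D (%a b. F (act h1 a) (act h2 b))" if "h1 .: H" "h2 .: H" for h1 h2
   by(rule lin that |assumption)+
  have "sw H h (%h1 h2. sw X (gw []) (%a b. F (act h1 a) (act h2 b))) = sw H h (%h1 h2. F (act h1 (gw [])) (act h2 (gw [])))"
   by(rule tsum_eq) (simp only: sw_one[OF D b])
  also have "... = sw H h (%h1 h2. smul D (cou H h1) (smul D (cou H h2) (F (gw []) (gw []))))"
   using F by(intro tsum_eq) (simp add: act_one kbilinear_def klinear_def gw0_mem ksp_pscale[OF kspX smulX]
     module.scale_left_commute[OF ksp_module[OF D]])
  also have "... = smul D (cou H h) (F (gw []) (gw []))" by(rule sw_counit_left[OF D coalgH h]) (rule cou_lin lin D)+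
  also have "... = sw X (act h (gw [])) F" using sw_scale[OF D F gw0_mem, of "cou H h"] by(simp add: act_one h sw_one[OF D F])
  finally show ?case by(rule sym)
 next
  case (Cons w ws)
  note F = Cons.prems(1) and h = Cons.prems(2)
  have w: "w .: W" and ws: "ws : L" using Cons.hyps by auto
  have x: "gw ws .: X" by(rule gw_mem[OF ws])
  note [lin] = x w kbilin[OF F] D
  let ?P = "%h1 h2 h3. sw X (gw ws) (%a b. F (gw [t h1 w] <.> act h2 a) (act h3 b))"
  let ?Q = "%h1 h2 h3. sw X (gw ws) (%a b. F (sc q (act h2 a)) (gw [t h1 w] <.> act h3 b))"
  have P: "ktrilinear H H H D ?P" and Q: "ktrilinear H H H D ?Q" by(rule x lin |assumption)+
  have "sw X (act h (gw [w] <.> gw ws)) F = sw H h (%h1 r. sw X (gw [t h1 w] <.> act r (gw ws)) F)"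
   unfolding act_letter[OF h w x] by(rule klin_tsum[where g = "%z. sw X z F", OF kspX D]) (rule x lin |assumption)+
  also have "... = sw H h (%h1 r. sw X (act r (gw ws)) (%a b. F (gw [t h1 w] <.> a) b + F (sc q a) (gw [t h1 w] <.> b)))"
   by(rule tsum_eq, rule sw_letter[OF D F]) (rule x lin |assumption)+
  also have "... = sw H h (%h1 r. sw H r (%h2 h3. ?P h1 h2 h3 + ?Q h1 h2 h3))" unfolding tsum_add[symmetric]
   by(rule tsum_eq, rule Cons.IH) (rule x lin |assumption)+
  also have "... = sw H h (%h1 r. sw H r (%h2 h3. ?P h1 h2 h3)) + sw H h (%h1 r. sw H r (%h2 h3. ?Q h1 h2 h3))"
   by(simp only: tsum_add)
  also have "sw H h (%h1 r. sw H r (%h2 h3. ?P h1 h2 h3)) = sw H h (%r h3. sw H r (%h1 h2. ?P h1 h2 h3))"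
   by(rule sw_coassoc[OF D coalgH h P, symmetric])
  also have "... = sw H h (%r h3. sw X (gw ws) (%a b. F (act r (gw [w] <.> a)) (act h3 b)))"
  proof (rule tsum_eq)
   fix r h3 assume c: "r .: H" "h3 .: H"
   have "sw H r (%h1 h2. ?P h1 h2 h3) = sw X (gw ws) (%a b. sw H r (%h1 h2. F (gw [t h1 w] <.> act h2 a) (act h3 b)))"
    by(rule tsum_swap)
   also have "... = sw X (gw ws) (%a b. F (act r (gw [w] <.> a)) (act h3 b))"
   proof (rule tsum_eq)
    fix a b assume ab: "a .: X" "b .: X"
    have b': "act h3 b .: X" by(rule act_lin(1)[OF c(2) ab(2)])
    show "sw H r (%h1 h2. F (gw [t h1 w] <.> act h2 a) (act h3 b)) = F (act r (gw [w] <.> a)) (act h3 b)"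
     unfolding act_letter[OF c(1) w ab(1)]
     by(rule kbil_tsum_left[OF F kspX D b', symmetric]) (rule x ab lin |assumption)+
   qed
   finally show "sw H r (%h1 h2. ?P h1 h2 h3) = sw X (gw ws) (%a b. F (act r (gw [w] <.> a)) (act h3 b))" .
  qed
  also have "sw H h (%h1 r. sw H r (%h2 h3. ?Q h1 h2 h3)) = sw H h (%h1 r. sw H r (%h2 h3. ?Q h2 h1 h3))"
   by(rule sw_swap_first[OF D coalgH cocommH h Q])
  also have "... = sw H h (%h1 r. sw X (gw ws) (%a b. F (act h1 (sc q a)) (act r (gw [w] <.> b))))"
  proof (rule tsum_eq)
   fix h1 r assume c: "h1 .: H" "r .: H"
   have "sw H r (%h2 h3. ?Q h2 h1 h3) = sw X (gw ws) (%a b. sw H r (%h2 h3. F (sc q (act h1 a)) (gw [t h2 w] <.> act h3 b)))"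
    by(rule tsum_swap)
   also have "... = sw X (gw ws) (%a b. F (act h1 (sc q a)) (act r (gw [w] <.> b)))"
   proof (rule tsum_eq)
    fix a b assume ab: "a .: X" "b .: X"
    have a': "sc q (act h1 a) .: X" by(rule sc_mem[OF act_lin(1)[OF c(1) ab(1)]])
    show "sw H r (%h2 h3. F (sc q (act h1 a)) (gw [t h2 w] <.> act h3 b)) = F (act h1 (sc q a)) (act r (gw [w] <.> b))"
     unfolding act_letter[OF c(2) w ab(2)] act_sc[OF c(1) ab(1)]
     by(rule kbil_tsum_right[OF F kspX D a', symmetric]) (rule x ab lin |assumption)+
   qed
   finally show "sw H r (%h2 h3. ?Q h2 h1 h3) = sw X (gw ws) (%a b. F (act h1 (sc q a)) (act r (gw [w] <.> b)))" .
  qed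
  also have "sw H h (%r h3. sw X (gw ws) (%a b. F (act r (gw [w] <.> a)) (act h3 b))) +
    sw H h (%h1 r. sw X (gw ws) (%a b. F (act h1 (sc q a)) (act r (gw [w] <.> b)))) =
   sw H h (%h1 h2. sw X (gw ws) (%a b. F (act h1 (gw [w] <.> a)) (act h2 b) + F (act h1 (sc q a)) (act h2 (gw [w] <.> b))))"
   by(simp only: tsum_add)
  also have "... = sw H h (%h1 h2. sw X (gw [w] <.> gw ws) (%a b. F (act h1 a) (act h2 b)))"
   by(rule tsum_eq, rule sw_letter[OF D _ w x, symmetric]) (rule x lin |assumption)+
  finally show ?case by(simp only: gw_Cons[OF w ws])
 qed
 note [lin] = kbilin[OF F] D h
 show ?thesis
  by(rule X_eqI[where f = "%x. sw X (act h x) F" and g = "%x. sw H h (%h1 h2. sw X x (%a b. F (act h1 a) (act h2 b)))", OF D _ _ gen[OF _ h F] x]) (rule lin |assumption)+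
qed

lemma act_grade:
 assumes h: "h .: H" and x: "x : G n"
 shows "act h x : G n"
proof -
 have gen: "aw ws h : G (length ws)" if "ws : L" "h .: H" for ws h using that
 proof (induction ws arbitrary: h)
  case Nil
  then show ?case
   using module.subspace_scale[OF ksp_module[OF kspX] grade_subspace gw_grade[of "[]"], of "cou H h"] by(simp add: aw_Nil)
 next
  case (Cons w ws)
  have w: "w .: W" and ws: "ws : L" using Cons.hyps by auto
  show ?case unfolding aw_letter[OF w ws Cons.prems]
  proof (rule tsum_subspace[OF kspX grade_subspace])
   fix h1 h2 assume c: "h1 .: H" "h2 .: H"
   have "t h1 w .: W" by(rule lin c w)+
   then have "gw [t h1 w] : G 1" using gw_grade[of "[t h1 w]"] by simp
   from grade_mul[OF this Cons.IH[OF c(2)]] show "gw [t h1 w] <.> aw ws h2 : G (length (w # ws))" by simp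
  qed
 qed
 show ?thesis by(rule grade_image[OF kspX act_klinear[OF h] grade_subspace _ x]) (use gen[OF _ h] act_gw[OF h] in auto)
qed

end

section \<open>Left and right cross products are twisted tensor products\<close>

section \<open>Cross products as twisted tensor products\<close>

lemma kbil_cong:
 assumes A: "kspace A" and B: "kspace B" and g: "kbilinear A B C g"
  and eq: "!!a b. a .: A ==> b .: B ==> f a b = g a b"
 shows "kbilinear A B C f" apply(rule kbilinearI)
  apply(rule klin_cong[OF B kbilin(2)[OF g _ klin_id]], assumption, rule eq; assumption)
 apply(rule klin_cong[OF A kbilin(3)[OF g _ klin_id]], assumption, rule eq; assumption) done

text \<open>Made for the nested \<open>tlift\<close> in the products: the integrand need only be
  known in Sweedler form on the carriers.\<close>

lemma tlift_cong_tsum: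
 assumes A: "kspace A" and B: "kspace B" and C: "kspace C" and g: "kbilinear A B C g"
  and eq: "!!a b. a .: A ==> b .: B ==> f a b = g a b" and t: "t .: (tensor A B)"
 shows "tlift A B C f t = tsum A B t g"
proof -
 have "kbilinear A B C f" by(rule kbil_cong[OF A B g eq])
 from tlift_eq_tsum[OF A C this t] show ?thesis by(simp only:) (rule tsum_eq[OF eq])
qed

lemma tens_trivially_graded:
 fixes A :: "('k::field, 'a::ab_group_add, 'y) kcoalg_scheme" and H :: "('k, 'h::ab_group_add, 'z) kbialg_scheme"
 shows "tensor A (trivially_graded H) = tensor A H"
  and "tens A (trivially_graded H) = tens A H"
  and "tsum A (trivially_graded H) = (tsum A H :: _ => _ => 'c::ab_group_add)"
  and "tens_cop A (trivially_graded H) = tens_cop A H"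
  and "tens_cou A (trivially_graded H) = tens_cou A H"
proof -
 show *: "tensor A (trivially_graded H) = tensor A H" "tens A (trivially_graded H) = tens A H"
  "tsum A (trivially_graded H) = (tsum A H :: _ => _ => 'c::ab_group_add)"
  by(rule tensor_cong tens_cong tsum_cong_spaces; simp)+
 have "bilinear_forms (trivially_graded H) (trivially_graded H) = bilinear_forms H H"
  "bilinear_forms A (trivially_graded H) = bilinear_forms A H"
  by(simp_all add: bilinear_forms_def kbilinear_def klin_trivially_graded)
 then show "tens_cop A (trivially_graded H) = tens_cop A H" "tens_cou A (trivially_graded H) = tens_cou A H"
  by(simp_all add: tens_cop_def tens_cou_def * tlift_def)
qed

section \<open>The left cross product with a cocommutative Hopf algebra\<close>

locale left_smash = tens_coalg A B T
 for A :: "('k::field, 'a::ab_group_add, 'x) kbialg_scheme"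
  and B :: "('k, 'h::ab_group_add, 'y) kbialg_scheme"
  and T :: "('k, ('a, 'h, 'k) tensor, 'z) kbialg_scheme" +
 fixes la :: "'h => 'a => 'a"
 assumes hopfA: "hopf_algebra A" and hopfH: "hopf_algebra B" and cocommH: "cocommutative B"
  and la: "kbilinear B A A la"
  and la_unit: "!!x. x .: A ==> la (unit B) x = x"
  and la_mul: "!!g h x. g .: B ==> h .: B ==> x .: A ==> la (mul B g h) x = la g (la h x)"
  and la_one: "!!h. h .: B ==> la h (unit A) = smul A (cou B h) (unit A)"
  and la_prod: "!!h x y. h .: B ==> x .: A ==> y .: A ==>
   la h (mul A x y) = sw B h (%h1 h2. mul A (la h1 x) (la h2 y))"
  and la_cop: "!!h x. h .: B ==> x .: A ==>
   cop A (la h x) = sw B h (%h1 h2. sw A x (%a b. tens A A (la h1 a) (la h2 b)))"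
  and la_cou: "!!h x. h .: B ==> x .: A ==> cou A (la h x) = cou B h * cou A x"
  and unitT: "unit T = unit A <*> unit B"
  and mulT_def: "mul T = mul (left_cross_product A B la)"
begin

sublocale A: hopf A by unfold_locales (rule hopfA)
sublocale B: cocomm_hopf B by unfold_locales (rule hopfH, rule cocommH)

lemmas [lin] = A.bialg A.alg B.bialg B.alg kbilin[OF la]

text \<open>The cross relation h y = (h1 \<rhd> y) h2 read as an exchange map.\<close>

definition ps where "ps h y = sw B h (%h1 h2. la h1 y <*> h2)"

lemma psi: "kbilinear B A T ps" unfolding ps_def by(rule lin |assumption)+

lemma tsum_psi:
 assumes D: "kspace D" and F: "kbilinear A B D F" and h: "h .: B" and y: "y .: A"
 shows "tsum A B (ps h y) F = sw B h (%h1 h2. F (la h1 y) h2)" unfolding ps_def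
 apply(subst tsum_tsum[OF kspA D F, folded carT]) apply(rule lin y |assumption)+ apply(rule tsum_eq, rule tsum_tn[OF D F])
  apply(rule lin y |assumption)+ done

lemma mulT:
 assumes u: "u .: T" and v: "v .: T"
 shows "mul T u v = tsum A B u (%a b. tsum A B v (%a' b'. tsum A B (ps b a') (%p r. mul A a p <*> mul B r b')))"
proof -
 let ?m = "%a b. tsum A B v (%a' b'. tsum A B (ps b a') (%p r. mul A a p <*> mul B r b'))"
 have inner: "tlift B B (tensor A B) (%h1 h2. mul A x (la h1 y) <*> mul B h2 g) (cop B h) =
   tsum A B (ps h y) (%p r. mul A x p <*> mul B r g)"
  if m: "x .: A" "h .: B" "y .: A" "g .: B" for x h y g
 proof -
  have "tlift B B (tensor A B) (%h1 h2. mul A x (la h1 y) <*> mul B h2 g) (cop B h) =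
    sw B h (%h1 h2. mul A x (la h1 y) <*> mul B h2 g)" by(rule tlift_eq_tsum) (rule m lin |assumption)+
  also have "... = tsum A B (ps h y) (%p r. mul A x p <*> mul B r g)"
   by(rule tsum_psi[symmetric]) (rule kspT m lin |assumption)+
  finally show ?thesis .
 qed
 note [lin] = kbilin[OF psi]
 have mid: "tlift A B (tensor A B) (%y g. tlift B B (tensor A B) (%h1 h2. mul A x (la h1 y) <*> mul B h2 g) (cop B h)) v =
   ?m x h" if m: "x .: A" "h .: B" for x h
  by(rule tlift_cong_tsum[OF kspA kspB ksp_tens _ inner[OF m] v[unfolded carT]]) (rule m lin |assumption)+
 have "tlift A B (tensor A B) (%x h. tlift A B (tensor A B)
   (%y g. tlift B B (tensor A B) (%h1 h2. mul A x (la h1 y) <*> mul B h2 g) (cop B h)) v) u = tsum A B u ?m"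
  by(rule tlift_cong_tsum[OF kspA kspB ksp_tens _ mid u[unfolded carT]]) (rule v lin |assumption)+
 then show ?thesis by(simp add: mulT_def left_cross_product_def Let_def)
qed

lemma sw_la:
 assumes D: "kspace D" and F: "kbilinear A A D F" and h: "h .: B" and x: "x .: A"
 shows "sw A (la h x) F = sw B h (%h1 h2. sw A x (%a b. F (la h1 a) (la h2 b)))" unfolding la_cop[OF h x]
 apply(subst tsum_tsum[OF kspA D F]) apply(rule x lin |assumption)+ apply(rule tsum_eq) apply(subst tsum_tsum[OF kspA D F])
  apply(rule x lin |assumption)+ apply(rule tsum_eq) apply(rule tsum_tens[OF kspA D F]) apply(rule lin |assumption)+ done

lemma span_tn: "module.span pscale {a <*> b |a b. a .: A & b .: B} = car T"
proof -
 have "{a <*> b |a b. a .: A & b .: B} = case_prod (tens A B) ` (car A \<times> car B)" by auto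
 then show ?thesis by(simp add: carT tensor_def gen_space_def tens_def case_prod_unfold)
qed

text \<open>Each requirement on the exchange map is one axiom of the action: \<open>psi_mulB\<close>
  is the module law, \<open>psi_mulA\<close> the module algebra property and \<open>psi_cop\<close>
  the module coalgebra property. For the last, the middle two of four Sweedler factors of
  \<open>b\<close> must be exchanged, which is where cocommutativity enters.\<close>

theorem twisted_smash: "twisted A (trivially_graded B) (trivially_graded T) ps"
proof (unfold_locales, unfold tens_trivially_graded[of A B] trivially_graded_simps trivially_graded_spaces super_hopf_trivially_graded trivially_graded_coalgebra)
 show "kbilinear (trivially_graded B) A (trivially_graded T) ps"
  using psi by(simp add: kbilinear_def klin_trivially_graded)
 show "mul T u v = tsum A B u (%a b. tsum A B v (%a' b'. tsum A B (ps b a') (%p r. mul A a p <*> mul B r b')))"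
  if "u .: T" "v .: T" for u v by(rule mulT[OF that])
 show "(if n = 0 then car T else {0}) = module.span pscale {a <*> b |a b. a .: A & b : (if n = 0 then car B else {0})}" for n :: nat
 proof (cases "n = 0")
  case True
  then show ?thesis using span_tn by simp
 next
  case False
  have "x <*> 0 = 0" if "x .: A" for x by(rule klin_0[OF kspB kspT tn_right[OF that klin_id]])
  then have "a <*> 0 = 0 & (\<exists>a. a .: A)" if "a .: A" for a using that by blast
  then have "{a <*> b |a b. a .: A & b : {0}} = {0}" using ksp_zero[OF kspA] by force
  moreover have "module.span pscale {0} = {0 :: ('a, 'h, 'k) tensor}"
   using module.subspace_single_0[OF module_pscale] module.span_eq_iff[OF module_pscale] by blast
  ultimately show ?thesis using False by simp
 qed
 show "ps (unit B) a = a <*> unit B" if a: "a .: A" for a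
 proof -
  have "ps (unit B) a = la (unit B) a <*> unit B"
   unfolding ps_def by(rule sw_unit[OF kspT B.bialg]) (rule a lin |assumption)+
  then show ?thesis by(simp only: la_unit[OF a])
 qed
 show "ps b (unit A) = unit A <*> b" if b: "b .: B" for b
 proof -
  have u: "unit A .: A" by(rule unit_mem[OF A.alg])
  have "ps b (unit A) = sw B b (%h1 h2. smul T (cou B h1) (unit A <*> h2))"
   unfolding ps_def by(rule tsum_eq) (simp only: la_one klin_scale[OF tn_left[OF _ klin_id] u])
  also have "... = unit A <*> b" by(rule sw_counit_left[OF kspT coalgB b]) (rule u lin)+
  finally show ?thesis .
 qed
 show "ps (mul B b b') a = tsum A B (ps b' a) (%p r. tsum A B (ps b p) (%q s. q <*> mul B s r))"
  if m: "b .: B" "b' .: B" "a .: A" for b b' a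
 proof -
  note [lin] = kbilin[OF psi]
  have "tsum A B (ps b' a) (%p r. tsum A B (ps b p) (%q s. q <*> mul B s r)) =
    sw B b' (%g1 g2. tsum A B (ps b (la g1 a)) (%q s. q <*> mul B s g2))"
   by(rule tsum_psi) (rule kspT m lin |assumption)+
  also have "... = sw B b' (%g1 g2. sw B b (%h1 h2. la h1 (la g1 a) <*> mul B h2 g2))"
   by(rule tsum_eq, rule tsum_psi) (rule kspT m lin |assumption)+
  also have "... = sw B b (%h1 h2. sw B b' (%g1 g2. la h1 (la g1 a) <*> mul B h2 g2))" by(rule tsum_swap)
  also have "... = sw B b (%h1 h2. sw B b' (%g1 g2. la (mul B h1 g1) a <*> mul B h2 g2))"
   by(rule tsum_eq, rule tsum_eq) (simp only: la_mul m(3))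
  also have "... = ps (mul B b b') a" unfolding ps_def
   by(rule sw_mul[OF kspT B.bialg m(1,2), symmetric]) (rule m lin |assumption)+
  finally show ?thesis by(rule sym)
 qed
 show "ps b (mul A a a') = tsum A B (ps b a) (%p r. tsum A B (ps r a') (%q s. mul A p q <*> s))"
  if m: "b .: B" "a .: A" "a' .: A" for b a a'
 proof -
  note [lin] = kbilin[OF psi]
  have "tsum A B (ps b a) (%p r. tsum A B (ps r a') (%q s. mul A p q <*> s)) =
    sw B b (%h1 r. tsum A B (ps r a') (%q s. mul A (la h1 a) q <*> s))"
   by(rule tsum_psi) (rule kspT m lin |assumption)+
  also have "... = sw B b (%h1 r. sw B r (%h2 h3. mul A (la h1 a) (la h2 a') <*> h3))"
   by(rule tsum_eq, rule tsum_psi) (rule kspT m lin |assumption)+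
  also have "... = sw B b (%r h3. sw B r (%h1 h2. mul A (la h1 a) (la h2 a') <*> h3))"
   by(rule sw_coassoc[OF kspT coalgB m(1), symmetric]) (rule m lin |assumption)+
  also have "... = sw B b (%r h3. la r (mul A a a') <*> h3)"
  proof (rule tsum_eq)
   fix r h3 assume c: "r .: B" "h3 .: B"
   show "sw B r (%h1 h2. mul A (la h1 a) (la h2 a') <*> h3) = la r (mul A a a') <*> h3"
    unfolding la_prod[OF c(1) m(2,3)]
    by(rule klin_tsum[OF kspA kspT tn_left[OF c(2) klin_id], symmetric]) (rule m lin |assumption)+
  qed
  finally show ?thesis unfolding ps_def by(rule sym)
 qed
 show "cop T (ps b a) = sw B b (%b1 b2. sw A a (%a1 a2. tens T T (ps b1 a1) (ps b2 a2)))"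
  if m: "b .: B" "a .: A" for b a
 proof -
  note [lin] = kbilin[OF psi]
  let ?F = "%p q x y. sw A a (%a1 a2. tens T T (la p a1 <*> x) (la q a2 <*> y))"
  have "cop T (ps b a) = sw B b (%r s. cop T (la r a <*> s))" unfolding ps_def
   by(rule klin_tsum[OF kspT ksp_tens klin_copT]) (rule m lin |assumption)+
  also have "... = sw B b (%r s. sw A (la r a) (%a1 a2. sw B s (%x y. tens T T (a1 <*> x) (a2 <*> y))))"
   by(rule tsum_eq, rule cop_tn) (rule m lin |assumption)+
  also have "... = sw B b (%r s. sw B r (%p q. sw A a (%a1 a2. sw B s (%x y. tens T T (la p a1 <*> x) (la q a2 <*> y)))))"
   by(rule tsum_eq, rule sw_la) (rule m lin |assumption)+
  also have "... = sw B b (%r s. sw B r (%p q. sw B s (%x y. ?F p q x y)))" by(rule tsum_eq, rule tsum_eq, rule tsum_swap)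
  also have "... = sw B b (%r s. sw B r (%p q. sw B s (%x y. ?F p x q y)))"
   by(rule sw_exchange[OF ksp_tens coalgB cocommH m(1)]) (rule m lin |assumption)+
  also have "... = sw B b (%r s. sw A a (%a1 a2. tens T T (ps r a1) (ps s a2)))"
  proof (rule tsum_eq)
   fix r s assume c: "r .: B" "s .: B"
   have "sw B r (%p q. sw B s (%x y. ?F p x q y)) =
     sw B r (%p q. sw A a (%a1 a2. sw B s (%x y. tens T T (la p a1 <*> q) (la x a2 <*> y))))"
    by(rule tsum_eq, rule tsum_swap)
   also have "... = sw A a (%a1 a2. sw B r (%p q. sw B s (%x y. tens T T (la p a1 <*> q) (la x a2 <*> y))))"
    by(rule tsum_swap)
   also have "... = sw A a (%a1 a2. tens T T (ps r a1) (ps s a2))"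
   proof (rule tsum_eq)
    fix a1 a2 assume d: "a1 .: A" "a2 .: A"
    have ps: "ps s a2 .: T" by(rule kbilin(1)[OF psi c(2) d(2)])
    have "tens T T (ps r a1) (ps s a2) = sw B r (%p q. tens T T (la p a1 <*> q) (ps s a2))"
     unfolding ps_def[of r a1]
     by(rule klin_tsum[where g = "%x. tens T T x (ps s a2)", OF kspT ksp_tens tens_lin(3)[OF ps klin_id]]) (rule d lin |assumption)+
    also have "... = sw B r (%p q. sw B s (%x y. tens T T (la p a1 <*> q) (la x a2 <*> y)))"
    proof (rule tsum_eq)
     fix p q assume e: "p .: B" "q .: B"
     have lp: "la p a1 <*> q .: T" by(rule tn_mem[OF kbilin(1)[OF la e(1) d(1)] e(2)])
     show "tens T T (la p a1 <*> q) (ps s a2) = sw B s (%x y. tens T T (la p a1 <*> q) (la x a2 <*> y))"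
      unfolding ps_def
      by(rule klin_tsum[where g = "tens T T (la p a1 <*> q)", OF kspT ksp_tens tens_lin(2)[OF lp klin_id]]) (rule d lin |assumption)+
    qed
    finally show "sw B r (%p q. sw B s (%x y. tens T T (la p a1 <*> q) (la x a2 <*> y))) = tens T T (ps r a1) (ps s a2)"
     by(rule sym)
   qed
   finally show "sw B r (%p q. sw B s (%x y. ?F p x q y)) = sw A a (%a1 a2. tens T T (ps r a1) (ps s a2))" .
  qed
  finally show ?thesis .
 qed
 show "cou T (ps b a) = cou B b * cou A a" if m: "b .: B" "a .: A" for b a
 proof -
  have "cou T (ps b a) = sw B b (%h1 h2. cou T (la h1 a <*> h2))" unfolding ps_def
   by(rule klin_tsum[OF kspT ksp_ground klin_couT]) (rule m lin |assumption)+
  also have "... = sw B b (%h1 h2. smul ground (cou B h1) (cou A a * cou B h2))" by(rule tsum_eq)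
    (simp only: cou_tn(1) kbilin(1)[OF la] m la_cou ground_def kspace.simps mult_ac)
  also have "... = cou A a * cou B b" by(rule sw_counit_left[OF ksp_ground coalgB m(1)]) (rule cou_lin m lin)+
  finally show ?thesis by(simp only: mult.commute)
 qed
 show "ps b a : (if n = 0 then car T else {0})" if "b : (if n = 0 then car B else {0})" "a .: A" for n :: nat and b a
  using that kbilin(1)[OF psi] klin_0[OF kspB kspT kbilin(3)[OF psi that(2) klin_id]] by(auto split: if_splits)
qed (use coalgA coalgB carT copT couT unitT hopfA hopfH in simp_all)

theorem hopf_T: "hopf_algebra T" using twisted.super_hopf_T[OF twisted_smash] by(simp only: super_hopf_trivially_graded)

end

section \<open>The right cross product with a super-Hopf algebra\<close>

locale right_smash = tens_coalg A B T
 for A :: "('k::field, 'a::ab_group_add, 'x) kbialg_scheme"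
  and B :: "('k, 'b::ab_group_add, 'y) kgbialg_scheme"
  and T :: "('k, ('a, 'b, 'k) tensor, 'z) kgbialg_scheme" +
 fixes ra :: "'b => 'a => 'b"
 assumes hopfA: "hopf_algebra A" and cocommA: "cocommutative A" and superB: "super_hopf_algebra B"
  and ra: "kbilinear B A B ra"
  and ra_unit: "!!x. x .: B ==> ra x (unit A) = x"
  and ra_mul: "!!a b x. a .: A ==> b .: A ==> x .: B ==> ra x (mul A a b) = ra (ra x a) b"
  and ra_one: "!!a. a .: A ==> ra (unit B) a = smul B (cou A a) (unit B)"
  and ra_prod: "!!a x y. a .: A ==> x .: B ==> y .: B ==>
   ra (mul B x y) a = sw A a (%a1 a2. mul B (ra x a1) (ra y a2))"
  and ra_cop: "!!a x. a .: A ==> x .: B ==>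
   cop B (ra x a) = sw A a (%a1 a2. sw B x (%x1 x2. tens B B (ra x1 a1) (ra x2 a2)))"
  and ra_cou: "!!a x. a .: A ==> x .: B ==> cou B (ra x a) = cou A a * cou B x"
  and ra_gr: "!!a x n. a .: A ==> x : gr B n ==> ra x a : gr B n"
  and unitT: "unit T = unit A <*> unit B"
  and mulT_tlift: "mul T = (%u v. tlift A B (tensor A B) (%a x. tlift A B (tensor A B) (%b y.
   tlift A A (tensor A B) (%b1 b2. mul A a b1 <*> mul B (ra x b2) y) (cop A b)) v) u)"
  and grT: "!!n. gr T n = module.span pscale {a <*> b |a b. a .: A & b : gr B n}"
begin

sublocale A: cocomm_hopf A by unfold_locales (rule hopfA, rule cocommA)
sublocale B: super_hopf B by unfold_locales (rule superB)

lemmas [lin] = A.bialg A.alg B.algB B.gradB kbilin[OF ra]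

text \<open>The relation x b = b1 (x \<lhd> b2) read as an exchange map.\<close>

definition ps where "ps x b = sw A b (%b1 b2. b1 <*> ra x b2)"

lemma psi: "kbilinear B A T ps" unfolding ps_def by(rule lin |assumption)+

lemma tsum_psi:
 assumes D: "kspace D" and F: "kbilinear A B D F" and x: "x .: B" and b: "b .: A"
 shows "tsum A B (ps x b) F = sw A b (%b1 b2. F b1 (ra x b2))" unfolding ps_def
 apply(subst tsum_tsum[OF kspA D F, folded carT]) apply(rule lin x |assumption)+ apply(rule tsum_eq, rule tsum_tn[OF D F])
  apply(rule lin x |assumption)+ done

lemma mulT:
 assumes u: "u .: T" and v: "v .: T"
 shows "mul T u v = tsum A B u (%a b. tsum A B v (%a' b'. tsum A B (ps b a') (%p r. mul A a p <*> mul B r b')))"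
proof -
 let ?m = "%a b. tsum A B v (%a' b'. tsum A B (ps b a') (%p r. mul A a p <*> mul B r b'))"
 have inner: "tlift A A (tensor A B) (%b1 b2. mul A a b1 <*> mul B (ra x b2) y) (cop A b) =
   tsum A B (ps x b) (%p r. mul A a p <*> mul B r y)"
  if m: "a .: A" "x .: B" "b .: A" "y .: B" for a x b y
 proof -
  have "tlift A A (tensor A B) (%b1 b2. mul A a b1 <*> mul B (ra x b2) y) (cop A b) =
    sw A b (%b1 b2. mul A a b1 <*> mul B (ra x b2) y)" by(rule tlift_eq_tsum) (rule m lin |assumption)+
  also have "... = tsum A B (ps x b) (%p r. mul A a p <*> mul B r y)"
   by(rule tsum_psi[symmetric]) (rule kspT m lin |assumption)+
  finally show ?thesis .
 qed
 note [lin] = kbilin[OF psi]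
 have mid: "tlift A B (tensor A B) (%b y. tlift A A (tensor A B) (%b1 b2. mul A a b1 <*> mul B (ra x b2) y) (cop A b)) v =
   ?m a x" if m: "a .: A" "x .: B" for a x
  by(rule tlift_cong_tsum[OF kspA kspB ksp_tens _ inner[OF m] v[unfolded carT]]) (rule m lin |assumption)+
 have "tlift A B (tensor A B) (%a x. tlift A B (tensor A B)
   (%b y. tlift A A (tensor A B) (%b1 b2. mul A a b1 <*> mul B (ra x b2) y) (cop A b)) v) u = tsum A B u ?m"
  by(rule tlift_cong_tsum[OF kspA kspB ksp_tens _ mid u[unfolded carT]]) (rule v lin |assumption)+
 then show ?thesis by(simp only: mulT_tlift)
qed

lemma sw_ra:
 assumes D: "kspace D" and F: "kbilinear B B D F" and a: "a .: A" and x: "x .: B"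
 shows "sw B (ra x a) F = sw A a (%a1 a2. sw B x (%x1 x2. F (ra x1 a1) (ra x2 a2)))" unfolding ra_cop[OF a x]
 apply(subst tsum_tsum[OF kspB D F]) apply(rule x lin |assumption)+ apply(rule tsum_eq) apply(subst tsum_tsum[OF kspB D F])
  apply(rule x lin |assumption)+ apply(rule tsum_eq) apply(rule tsum_tens[OF kspB D F]) apply(rule lin |assumption)+ done

text \<open>The mirror image of the left case: now \<open>psi_mulA\<close> is the module law and
  \<open>psi_mulB\<close> the module algebra property, while \<open>psi_cop\<close> again needs
  cocommutativity of the acting algebra.\<close>

theorem twisted_smash: "twisted A B T ps"
proof unfold_locales
 show "kbilinear B A T ps" by(rule psi)
 show "mul T u v = tsum A B u (%a b. tsum A B v (%a' b'. tsum A B (ps b a') (%p r. mul A a p <*> mul B r b')))"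
  if "u .: T" "v .: T" for u v by(rule mulT[OF that])
 show "ps (unit B) b = b <*> unit B" if b: "b .: A" for b
 proof -
  have u: "unit B .: B" by(rule unit_mem[OF B.algB])
  have "ps (unit B) b = sw A b (%h1 h2. smul T (cou A h2) (h1 <*> unit B))"
   unfolding ps_def by(rule tsum_eq) (simp only: ra_one klin_scale[OF tn_right[OF _ klin_id] u])
  also have "... = b <*> unit B" by(rule sw_counit_right[OF kspT coalgA b]) (rule u lin)+
  finally show ?thesis .
 qed
 show "ps x (unit A) = unit A <*> x" if x: "x .: B" for x
 proof -
  have "ps x (unit A) = unit A <*> ra x (unit A)"
   unfolding ps_def by(rule sw_unit[OF kspT A.bialg]) (rule x lin |assumption)+
  then show ?thesis by(simp only: ra_unit[OF x])
 qed
 show "ps b (mul A a a') = tsum A B (ps b a) (%p r. tsum A B (ps r a') (%q s. mul A p q <*> s))"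
  if m: "b .: B" "a .: A" "a' .: A" for b a a'
 proof -
  note [lin] = kbilin[OF psi]
  have "tsum A B (ps b a) (%p r. tsum A B (ps r a') (%q s. mul A p q <*> s)) =
    sw A a (%g1 g2. tsum A B (ps (ra b g2) a') (%q s. mul A g1 q <*> s))"
   by(rule tsum_psi) (rule kspT m lin |assumption)+
  also have "... = sw A a (%g1 g2. sw A a' (%h1 h2. mul A g1 h1 <*> ra (ra b g2) h2))"
   by(rule tsum_eq, rule tsum_psi) (rule kspT m lin |assumption)+
  also have "... = sw A a (%g1 g2. sw A a' (%h1 h2. mul A g1 h1 <*> ra b (mul A g2 h2)))"
   by(rule tsum_eq, rule tsum_eq) (simp only: ra_mul m(1))
  also have "... = ps b (mul A a a')" unfolding ps_def
   by(rule sw_mul[OF kspT A.bialg m(2,3), symmetric]) (rule m lin |assumption)+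
  finally show ?thesis by(rule sym)
 qed
 show "ps (mul B b b') a = tsum A B (ps b' a) (%p r. tsum A B (ps b p) (%q s. q <*> mul B s r))"
  if m: "b .: B" "b' .: B" "a .: A" for b b' a
 proof -
  note [lin] = kbilin[OF psi]
  have "tsum A B (ps b' a) (%p r. tsum A B (ps b p) (%q s. q <*> mul B s r)) =
    sw A a (%r h3. tsum A B (ps b r) (%q s. q <*> mul B s (ra b' h3)))"
   by(rule tsum_psi) (rule kspT m lin |assumption)+
  also have "... = sw A a (%r h3. sw A r (%h1 h2. h1 <*> mul B (ra b h2) (ra b' h3)))"
   by(rule tsum_eq, rule tsum_psi) (rule kspT m lin |assumption)+
  also have "... = sw A a (%h1 r. sw A r (%h2 h3. h1 <*> mul B (ra b h2) (ra b' h3)))"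
   by(rule sw_coassoc[OF kspT coalgA m(3)]) (rule m lin |assumption)+
  also have "... = sw A a (%h1 r. h1 <*> ra (mul B b b') r)"
  proof (rule tsum_eq)
   fix h1 r assume c: "h1 .: A" "r .: A"
   show "sw A r (%h2 h3. h1 <*> mul B (ra b h2) (ra b' h3)) = h1 <*> ra (mul B b b') r"
    unfolding ra_prod[OF c(2) m(1,2)]
    by(rule klin_tsum[OF kspB kspT tn_right[OF c(1) klin_id], symmetric]) (rule m lin |assumption)+
  qed
  finally show ?thesis unfolding ps_def by(rule sym)
 qed
 show "cop T (ps b a) = sw B b (%b1 b2. sw A a (%a1 a2. tens T T (ps b1 a1) (ps b2 a2)))"
  if m: "b .: B" "a .: A" for b a
 proof -
  note [lin] = kbilin[OF psi]
  let ?F = "%p q x y. sw B b (%b1 b2. tens T T (p <*> ra b1 x) (q <*> ra b2 y))"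
  have "cop T (ps b a) = sw A a (%r s. cop T (r <*> ra b s))" unfolding ps_def
   by(rule klin_tsum[OF kspT ksp_tens klin_copT]) (rule m lin |assumption)+
  also have "... = sw A a (%r s. sw A r (%p q. sw B (ra b s) (%b1 b2. tens T T (p <*> b1) (q <*> b2))))"
   by(rule tsum_eq, rule cop_tn) (rule m lin |assumption)+
  also have "... = sw A a (%r s. sw A r (%p q. sw A s (%x y. ?F p q x y)))"
   by(rule tsum_eq, rule tsum_eq, rule sw_ra) (rule m lin |assumption)+
  also have "... = sw A a (%r s. sw A r (%p q. sw A s (%x y. ?F p x q y)))"
   by(rule sw_exchange[OF ksp_tens coalgA cocommA m(2)]) (rule m lin |assumption)+
  also have "... = sw A a (%r s. sw B b (%b1 b2. tens T T (ps b1 r) (ps b2 s)))"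
  proof (rule tsum_eq)
   fix r s assume c: "r .: A" "s .: A"
   have "sw A r (%p q. sw A s (%x y. ?F p x q y)) =
     sw A r (%p q. sw B b (%b1 b2. sw A s (%x y. tens T T (p <*> ra b1 q) (x <*> ra b2 y))))"
    by(rule tsum_eq, rule tsum_swap)
   also have "... = sw B b (%b1 b2. sw A r (%p q. sw A s (%x y. tens T T (p <*> ra b1 q) (x <*> ra b2 y))))"
    by(rule tsum_swap)
   also have "... = sw B b (%b1 b2. tens T T (ps b1 r) (ps b2 s))"
   proof (rule tsum_eq)
    fix b1 b2 assume d: "b1 .: B" "b2 .: B"
    have ps: "ps b2 s .: T" by(rule kbilin(1)[OF psi d(2) c(2)])
    have "tens T T (ps b1 r) (ps b2 s) = sw A r (%p q. tens T T (p <*> ra b1 q) (ps b2 s))"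
     unfolding ps_def[of b1 r]
     by(rule klin_tsum[where g = "%x. tens T T x (ps b2 s)", OF kspT ksp_tens tens_lin(3)[OF ps klin_id]]) (rule d lin |assumption)+
    also have "... = sw A r (%p q. sw A s (%x y. tens T T (p <*> ra b1 q) (x <*> ra b2 y)))"
    proof (rule tsum_eq)
     fix p q assume e: "p .: A" "q .: A"
     have lp: "p <*> ra b1 q .: T" by(rule tn_mem[OF e(1) kbilin(1)[OF ra d(1) e(2)]])
     show "tens T T (p <*> ra b1 q) (ps b2 s) = sw A s (%x y. tens T T (p <*> ra b1 q) (x <*> ra b2 y))"
      unfolding ps_def
      by(rule klin_tsum[where g = "tens T T (p <*> ra b1 q)", OF kspT ksp_tens tens_lin(2)[OF lp klin_id]]) (rule d lin |assumption)+
    qed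
    finally show "sw A r (%p q. sw A s (%x y. tens T T (p <*> ra b1 q) (x <*> ra b2 y))) = tens T T (ps b1 r) (ps b2 s)"
     by(rule sym)
   qed
   finally show "sw A r (%p q. sw A s (%x y. ?F p x q y)) = sw B b (%b1 b2. tens T T (ps b1 r) (ps b2 s))" .
  qed
  also have "... = sw B b (%b1 b2. sw A a (%a1 a2. tens T T (ps b1 a1) (ps b2 a2)))" by(rule tsum_swap)
  finally show ?thesis .
 qed
 show "cou T (ps b a) = cou B b * cou A a" if m: "b .: B" "a .: A" for b a
 proof -
  have "cou T (ps b a) = sw A a (%h1 h2. cou T (h1 <*> ra b h2))" unfolding ps_def
   by(rule klin_tsum[OF kspT ksp_ground klin_couT]) (rule m lin |assumption)+
  also have "... = sw A a (%h1 h2. smul ground (cou A h1) (cou B b * cou A h2))" by(rule tsum_eq)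
    (simp only: cou_tn(1) kbilin(1)[OF ra] m ra_cou ground_def kspace.simps mult_ac)
  also have "... = cou B b * cou A a" by(rule sw_counit_left[OF ksp_ground coalgA m(2)]) (rule cou_lin m lin)+
  finally show ?thesis .
 qed
 show "ps b a : gr T n" if b: "b : gr B n" and a: "a .: A" for n b a unfolding ps_def grT
  by(rule tsum_subspace[OF kspT, unfolded smulT, OF module.subspace_span[OF module_pscale]])
   (rule module.span_base[OF module_pscale], use ra_gr[OF _ b] in blast)
qed (use unitT hopfA superB grT in simp_all)

sublocale twisted A B T ps by(rule twisted_smash)

end

section \<open>Cross products with symmetric and exterior algebras of a module\<close>

lemma left_smash_sym_alg:
 fixes W :: "('k::field, 'w::ab_group_add, 'y) kspace_scheme" and H :: "('k, 'h::ab_group_add, 'z) kbialg_scheme"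
 assumes W: "kspace W" and H: "hopf_algebra H" "cocommutative H" and t: "kbilinear H W W t"
  and t_unit: "!!w. w .: W ==> t (unit H) w = w"
  and t_mul: "!!g h w. g .: H ==> h .: H ==> w .: W ==> t (mul H g h) w = t g (t h w)"
 shows "left_smash (sym_alg W) H (left_cross_product (sym_alg W) H (sym_act H W t)) (sym_act H W t)"
  and "!!h w. h .: H ==> w .: W ==> sym_act H W t h (sym_word W [w]) = sym_word W [t h w]"
proof -
 interpret word_bialgebra W False "sym_alg W" "tens_mul (word_space (word_forms False W) W) (mul (sym_alg W))"
  by(rule sym_alg_word_bialgebra[OF W])
 interpret word_action W False "sym_alg W" "tens_mul (word_space (word_forms False W) W) (mul (sym_alg W))"
  H t "mul H" "sym_act_word H W t"
  by unfold_locales (use H t t_unit t_mul in \<open>simp_all add: hopf_algebra_def symmetric_word_forms sym_word_def\<close>)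
 have act: "sym_act H W t = act" by(intro ext) (simp add: sym_act_def act_def symmetric_word_forms)
 note [lin] = kspX
 show "left_smash (sym_alg W) H (left_cross_product (sym_alg W) H (sym_act H W t)) (sym_act H W t)" unfolding act
 proof unfold_locales
  show "cop (sym_alg W) (act h x) = sw H h (%h1 h2. sw (sym_alg W) x (%a b. tens (sym_alg W) (sym_alg W) (act h1 a) (act h2 b)))"
   if "h .: H" "x .: (sym_alg W)" for h x
  proof -
   have "sw (sym_alg W) (act h x) (tens (sym_alg W) (sym_alg W)) =
     sw H h (%h1 h2. sw (sym_alg W) x (%a b. tens (sym_alg W) (sym_alg W) (act h1 a) (act h2 b)))"
    by(rule act_cop[OF ksp_tens _ that]) (rule lin |assumption)+
   then show ?thesis using tsum_tens_id[OF kspX cop_mem[OF coalgX kbilin(1)[OF act_bilinear that]]] by simp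
  qed
  show "act h (unit (sym_alg W)) = smul (sym_alg W) (cou H h) (unit (sym_alg W))" if "h .: H" for h
   using act_one[OF that] by(simp only: unitX smulX)
  show "act h (mul (sym_alg W) x y) = sw H h (%h1 h2. mul (sym_alg W) (act h1 x) (act h2 y))"
   if "h .: H" "x .: (sym_alg W)" "y .: (sym_alg W)" for h x y by(rule act_mul[OF that])
  show "cou (sym_alg W) (act h x) = cou H h * cou (sym_alg W) x"
   if "h .: H" "x .: (sym_alg W)" for h x by(rule act_cou[OF that])
 qed (simp_all only: coalgX coalgH hopf_sym_alg[OF W] H act_bilinear act_unit act_p
   left_cross_product_def Let_def kcoalg.simps kbialg.simps kspace.simps sym_alg_simps tensor_def gen_space_def)
 show "sym_act H W t h (sym_word W [w]) = sym_word W [t h w]" if "h .: H" "w .: W" for h w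
  using act_gw1[OF that] by(simp add: act sym_word_def symmetric_word_forms)
qed

lemma right_smash_ext_alg:
 fixes W :: "('k::field, 'w::ab_group_add, 'y) kspace_scheme" and A :: "('k, 'a::ab_group_add, 'z) kbialg_scheme"
 assumes W: "kspace W" and A: "hopf_algebra A" "cocommutative A" and t: "kbilinear W A W t"
  and t_unit: "!!w. w .: W ==> t w (unit A) = w"
  and t_mul: "!!a b w. a .: A ==> b .: A ==> w .: W ==> t w (mul A a b) = t (t w a) b"
 shows "right_smash A (ext_alg W) (ext_cross_product A W t) (ext_act A W t)"
  and "!!a w. a .: A ==> w .: W ==> ext_act A W t (ext_word W [w]) a = ext_word W [t w a]"
proof -
 let ?M = "stens_mul (word_space (word_forms True W) W) (word_grade (word_forms True W) W) (mul (ext_alg W))"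
 interpret word_bialgebra W True "ext_alg W" ?M by(rule ext_alg_word_bialgebra[OF W])
 have t': "kbilinear A W W (%a w. t w a)" using t by(simp add: kbilinear_def)
 interpret word_action W True "ext_alg W" ?M A "%a w. t w a" "%a b. mul A b a" "ext_act_word A W t"
  by unfold_locales (use A t' t_unit t_mul in \<open>simp_all add: hopf_algebra_def alternating_word_forms[OF W] ext_word_def\<close>)
 have act: "ext_act A W t = (%x a. act a x)" by(intro ext) (simp add: ext_act_def act_def alternating_word_forms[OF W])
 have gr: "gr (ext_alg W) = G" by(simp add: alternating_word_forms[OF W])
 note [lin] = kspX
 have act': "kbilinear (ext_alg W) A (ext_alg W) (%x a. act a x)" using act_bilinear unfolding kbilinear_def by blast
 show "right_smash A (ext_alg W) (ext_cross_product A W t) (ext_act A W t)"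
 proof unfold_locales
  show "cop (ext_alg W) (ext_act A W t x a) = sw A a (%h1 h2. sw (ext_alg W) x (%a b. tens (ext_alg W) (ext_alg W) (ext_act A W t a h1) (ext_act A W t b h2)))"
   if "a .: A" "x .: (ext_alg W)" for a x
  proof -
   have "sw (ext_alg W) (act a x) (tens (ext_alg W) (ext_alg W)) =
     sw A a (%h1 h2. sw (ext_alg W) x (%a b. tens (ext_alg W) (ext_alg W) (act h1 a) (act h2 b)))"
    by(rule act_cop[OF ksp_tens _ that]) (rule lin |assumption)+
   then show ?thesis unfolding act using tsum_tens_id[OF kspX cop_mem[OF coalgX kbilin(1)[OF act_bilinear that]]] by simp
  qed
  show "ext_act A W t (unit (ext_alg W)) a = smul (ext_alg W) (cou A a) (unit (ext_alg W))" if "a .: A" for a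
   unfolding act using act_one[OF that] by(simp only: unitX smulX)
  show "ext_act A W t (mul (ext_alg W) x y) a = sw A a (%h1 h2. mul (ext_alg W) (ext_act A W t x h1) (ext_act A W t y h2))"
   if "a .: A" "x .: (ext_alg W)" "y .: (ext_alg W)" for a x y unfolding act by(rule act_mul[OF that])
  show "cou (ext_alg W) (ext_act A W t x a) = cou A a * cou (ext_alg W) x"
   if "a .: A" "x .: (ext_alg W)" for a x unfolding act by(rule act_cou[OF that])
  show "ext_act A W t x a : gr (ext_alg W) n" if "a .: A" "x : gr (ext_alg W) n" for a x n
   using act_grade[OF that[unfolded gr]] by(simp only: act gr)
  show "kbilinear (ext_alg W) A (ext_alg W) (ext_act A W t)" unfolding act by(rule act')
  show "ext_act A W t x (unit A) = x" if "x .: (ext_alg W)" for x unfolding act by(rule act_unit[OF that])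
  show "ext_act A W t x (mul A a b) = ext_act A W t (ext_act A W t x a) b"
   if "a .: A" "b .: A" "x .: (ext_alg W)" for a b x unfolding act by(rule act_p[OF that(2,1,3)])
 qed (simp_all only: coalgX coalgH super_hopf_ext_alg[OF W] A
   ext_cross_product_def Let_def kcoalg.simps kbialg.simps kgbialg.simps kspace.simps tensor_def gen_space_def)
 show "ext_act A W t (ext_word W [w]) a = ext_word W [t w a]" if "a .: A" "w .: W" for a w
  using act_gw1[OF that] by(simp add: act ext_word_def alternating_word_forms[OF W])
qed

section \<open>From a one-cocycle to a strongly bicovariant calculus\<close>

section \<open>The differential of a one-cocycle\<close>

lemma sw_swap_last:
 assumes D: "kspace D" and C: "coalgebra C" and co: "cocommutative C" and c: "c .: C"
  and F: "ktrilinear C C C D F"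
 shows "sw C c (%r d. sw C r (%a b. F a b d)) = sw C c (%r d. sw C r (%a b. F a d b))"
proof -
 note [lin] = D C coalgebra_kspace[OF C]
 have "sw C c (%r d. sw C r (%a b. F a b d)) = sw C c (%a r. sw C r (%b d. F a b d))" by(rule sw_coassoc[OF D C c F])
 also have "... = sw C c (%a r. sw C r (%b d. F a d b))"
  by(rule tsum_eq, rule sw_cocomm[OF D C co], assumption) (rule lin ktrilin[OF F] |assumption)+
 also have "... = sw C c (%r d. sw C r (%a b. F a d b))"
  by(rule sw_coassoc[OF D C c, symmetric]) (rule lin ktrilin[OF F] |assumption)+
 finally show ?thesis .
qed

lemma klin_sign_inv:
 assumes G: "graded_space A G"
 shows "klinear A A (sign_inv A G)"
proof -
 note [lin] = graded_space_kspace[OF G]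
 have "klinear A A (%x. hsum G x (%i y. smul A ((- 1) ^ i) y))" by(rule klin_hsum[OF G]) (rule lin)+
 then show ?thesis by(simp only: sign_inv_eq_hsum[abs_def])
qed

text \<open>\<open>e\<close> is the Maurer-Cartan form: \<open>e_mul\<close> is the cocycle
  identity, and the other axioms say that its values have degree one, square to zero, supercommute
  with \<open>B\<close> and are primitive. The algebra \<open>B\<close> models \<Lambda>(W) with
  scalars in degree zero.\<close>

locale cocycle_calculus = right_smash A B T ra
 for A :: "('k::field, 'a::ab_group_add, 'x) kbialg_scheme"
  and B :: "('k, 'b::ab_group_add, 'y) kgbialg_scheme"
  and T :: "('k, ('a, 'b, 'k) tensor, 'z) kgbialg_scheme" and ra +
 fixes e :: "'a => 'b"
 assumes e: "klinear A B e"
  and e_gr: "!!a. a .: A ==> e a : gr B 1"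
  and e_mul: "!!a b. a .: A ==> b .: A ==> e (mul A a b) = ra (e a) b + smul B (cou A a) (e b)"
  and e_alt: "!!a. a .: A ==> mul B (e a) (e a) = 0"
  and e_comm: "!!a x i. a .: A ==> x : gr B i ==> mul B x (e a) = smul B ((- 1) ^ i) (mul B (e a) x)"
  and e_cop: "!!a x. a .: A ==> x .: B ==> cop B (mul B (e a) x) =
   sw B x (%x1 x2. tens B B (mul B (e a) x1) x2 + tens B B (sign_inv B (gr B) x1) (mul B (e a) x2))"
  and gr_0: "!!x. x : gr B 0 ==> \<exists>c. x = smul B c (unit B)"
begin

abbreviation mB (infixl "<.>" 80) where "x <.> y \<equiv> mul B x y"
abbreviation sg where "sg \<equiv> sign_inv B (gr B)"

lemma e_lin [lin]: "klinear E A g ==> klinear E B (%x. e (g x))" by(rule klin_comp[OF e])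
lemma e_mem [lin]: "a .: A ==> e a .: B" by(rule klin_mem[OF e])
lemma sign_lin [lin]: "klinear E B g ==> klinear E B (%x. sg (g x))" by(rule klin_comp[OF klin_sign_inv[OF B.gradB]])
lemma sign_mem [lin]: "x .: B ==> sg x .: B" by(rule klin_mem[OF klin_sign_inv[OF B.gradB]])
lemma gr_mem: "x : gr B i ==> x .: B" using graded_subset[OF B.gradB] by blast
lemma uB [lin]: "unit B .: B" by(rule unit_mem[OF B.algB])
lemma uA [lin]: "unit A .: A" by(rule unit_mem[OF A.alg])

section \<open>The differential and its properties\<close>

definition d where "d t = tsum A B t (%a x. sw A a (%a1 a2. a1 <*> e a2 <.> x))"
definition j where "j a = a <*> unit B"

lemma d_bilinear: "kbilinear A B T (%a x. sw A a (%a1 a2. a1 <*> e a2 <.> x))" by(rule lin |assumption)+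

lemma d_klinear: "klinear T T d" unfolding d_def by(rule from_tensor'[OF klin_tsum_out[OF kspA kspT d_bilinear]])

lemma d_lin [lin]: "klinear E T g ==> klinear E T (%x. d (g x))" by(rule klin_comp[OF d_klinear])
lemma d_mem [lin]: "t .: T ==> d t .: T" by(rule klin_mem[OF d_klinear])

lemma d_tn: "a .: A ==> x .: B ==> d (a <*> x) = sw A a (%a1 a2. a1 <*> e a2 <.> x)"
 unfolding d_def by(rule tsum_tn[OF kspT d_bilinear])

lemma j_lin [lin]: "klinear E A g ==> klinear E T (%x. j (g x))" unfolding j_def by(rule tn_left[OF uB])
lemma j_mem [lin]: "a .: A ==> j a .: T" unfolding j_def by(rule tn_mem[OF _ uB])

lemma d_j: "a .: A ==> d (j a) = sw A a (%a1 a2. a1 <*> e a2)" unfolding j_def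
 by(simp only: d_tn uB) (rule tsum_eq, simp only: mul_unit(2)[OF B.algB] e_mem)

lemma d_gr:
 assumes t: "t : gr T i"
 shows "d t : gr T (i + 1)"
proof (rule grT_image[OF kspT d_klinear grT_subspace _ t])
 fix a x assume a: "a .: A" and x: "x : gr B i"
 show "d (a <*> x) : gr T (i + 1)" unfolding d_tn[OF a gr_mem[OF x]]
  apply(rule tsum_subspace[OF kspT grT_subspace], rule tn_gr, assumption) using B.mul_gr[OF e_gr x] by simp
qed

text \<open>Twofold application inserts the product of \<open>e a2\<close> and \<open>e a3\<close>,
  an alternating bilinear expression in two adjacent Sweedler factors. It vanishes on the
  cocommutative coproduct by \<open>sw_alternating\<close>.\<close>

lemma d_d:
 assumes t: "t .: T"
 shows "d (d t) = 0"
proof (rule T_eqI[where f = "%t. d (d t)" and g = "%t. 0", OF kspT _ _ _ t])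
 show "klinear T T (%t. d (d t))" "klinear T T (%t. 0)" by(rule lin)+
 fix a x assume a: "a .: A" and x: "x .: B"
 have "d (d (a <*> x)) = sw A a (%a1 a2. d (a1 <*> e a2 <.> x))" unfolding d_tn[OF a x]
  by(rule klin_tsum[OF kspT kspT d_klinear]) (rule x lin |assumption)+
 also have "... = sw A a (%r a3. sw A r (%a1 a2. a1 <*> e a2 <.> (e a3 <.> x)))"
  by(rule tsum_eq, rule d_tn) (rule x lin |assumption)+
 also have "... = sw A a (%a1 r. sw A r (%a2 a3. a1 <*> e a2 <.> (e a3 <.> x)))"
  by(rule sw_coassoc[OF kspT coalgA a]) (rule x lin |assumption)+
 also have "... = sw A a (%a1 r. 0)"
 proof (rule tsum_eq, rule sw_alternating[OF kspT coalgA cocommA])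
  fix a1 assume a1: "a1 .: A"
  show "kbilinear A A T (%a2 a3. a1 <*> e a2 <.> (e a3 <.> x))" by(rule x a1 lin |assumption)+
  fix g assume g: "g .: A"
  have "e g <.> (e g <.> x) = 0"
   using mul_assoc[OF B.algB e_mem[OF g] e_mem[OF g] x] klin_0[OF kspB kspB mul_left[OF B.algB x klin_id]]
   by(simp only: e_alt[OF g])
  then show "a1 <*> e g <.> (e g <.> x) = 0"
   using klin_0[OF kspB kspT tn_right[OF a1 klin_id]] by(simp only:)
 qed
 finally show "d (d (a <*> x)) = 0" by simp
qed

lemma mul_tn_sw:
 assumes m: "a .: A" "x .: B" "b .: A" "y .: B"
 shows "mul T (a <*> x) (b <*> y) = sw A b (%b1 b2. mul A a b1 <*> ra x b2 <.> y)" unfolding mul_tn[OF m]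
 by(rule tsum_psi) (rule kspT m lin |assumption)+

lemma mul_j_tn:
 assumes m: "a .: A" "b .: A" "y .: B"
 shows "mul T (j a) (b <*> y) = mul A a b <*> y"
proof -
 have "mul T (j a) (b <*> y) = tsum A B (b <*> unit B) (%p r. mul A a p <*> r <.> y)"
  unfolding j_def mul_tn[OF m(1) uB m(2,3)] psi_unit_left[OF m(2)] ..
 also have "... = mul A a b <*> unit B <.> y" by(rule tsum_tn[OF kspT]) (rule m lin |assumption)+
 finally show ?thesis by(simp only: mul_unit(1)[OF B.algB m(3)])
qed

lemma j_mul: "a .: A ==> b .: A ==> j (mul A a b) = mul T (j a) (j b)"
 by(simp only: j_def[of b] mul_j_tn uB) (simp only: j_def)

lemma mul_unit_tn_tn:
 assumes m: "x .: B" "y .: B"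
 shows "mul T (unit A <*> x) (unit A <*> y) = unit A <*> x <.> y"
proof -
 have "mul T (unit A <*> x) (unit A <*> y) = tsum A B (unit A <*> x) (%p r. mul A (unit A) p <*> r <.> y)"
  unfolding mul_tn[OF uA m(1) uA m(2)] psi_unit_right[OF m(1)] ..
 also have "... = mul A (unit A) (unit A) <*> x <.> y" by(rule tsum_tn[OF kspT]) (rule m lin |assumption)+
 finally show ?thesis by(simp only: mul_unit(1)[OF A.alg uA])
qed

text \<open>The cocycle identity splits the value of \<open>e\<close> on a product in two. The part
  with the action is the product of the differential of the first factor with the second factor. The
  part with the counit becomes the other term once \<open>e b\<close> has been moved past the form
  of degree \<open>i\<close>, which yields the sign.\<close>

lemma d_mul:
 assumes \<xi>: "\<xi> : gr T i" and et: "et .: T"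
 shows "d (mul T \<xi> et) = mul T (d \<xi>) et + smul T ((- 1) ^ i) (mul T \<xi> (d et))"
proof -
 have base: "d (mul T (a <*> x) (b <*> y)) = mul T (d (a <*> x)) (b <*> y) + smul T ((- 1) ^ i) (mul T (a <*> x) (d (b <*> y)))"
  if a: "a .: A" and xi: "x : gr B i" and b: "b .: A" and y: "y .: B" for a x b y
 proof -
  have x: "x .: B" by(rule gr_mem[OF xi])
  note m = a x b y
  \<comment> \<open>The summands of the two products on the right hand side, before the Sweedler
    factors of \<open>b\<close> are brought into order.\<close>
  let ?P = "%a1 a2 b1 b2 b3. mul A a1 b1 <*> ra (e a2) b2 <.> (ra x b3 <.> y)"
  let ?Q = "%b1 b2 b3. mul A a b1 <*> e b2 <.> (ra x b3 <.> y)"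
  have split: "sw A (mul A a b1) (%p r. p <*> e r <.> (ra x b2 <.> y)) =
    sw A a (%a1 a2. sw A b1 (%p q. ?P a1 a2 p q b2)) + sw A b1 (%p q. ?Q p q b2)"
   if c: "b1 .: A" "b2 .: A" for b1 b2
  proof -
   have "sw A (mul A a b1) (%p r. p <*> e r <.> (ra x b2 <.> y)) =
     sw A a (%a1 a2. sw A b1 (%p q. mul A a1 p <*> e (mul A a2 q) <.> (ra x b2 <.> y)))"
    by(rule sw_mul[OF kspT A.bialg a c(1)]) (rule m c lin |assumption)+
   also have "... = sw A a (%a1 a2. sw A b1 (%p q. ?P a1 a2 p q b2 + smul T (cou A a2) (mul A a1 p <*> e q <.> (ra x b2 <.> y))))"
   proof (rule tsum_eq, rule tsum_eq)
    fix a1 a2 p q assume h: "a1 .: A" "a2 .: A" "p .: A" "q .: A"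
    have k: "klinear B T (%z. mul A a1 p <*> z <.> (ra x b2 <.> y))" by(rule m c h lin)+
    have z: "ra (e a2) q .: B" "e q .: B" by(rule kbilin(1)[OF ra e_mem[OF h(2)] h(4)], rule e_mem[OF h(4)])
    show "mul A a1 p <*> e (mul A a2 q) <.> (ra x b2 <.> y) = ?P a1 a2 p q b2 + smul T (cou A a2) (mul A a1 p <*> e q <.> (ra x b2 <.> y))"
     by(simp only: e_mul[OF h(2,4)] klin_add[OF k z(1) ksp_scale[OF kspB z(2)]] klin_scale[OF k z(2)])
   qed
   also have "... = sw A a (%a1 a2. sw A b1 (%p q. ?P a1 a2 p q b2)) +
     sw A a (%a1 a2. smul T (cou A a2) (sw A b1 (%p q. mul A a1 p <*> e q <.> (ra x b2 <.> y))))"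
    by(simp only: tsum_add smul_tsum[OF kspT])
   also have "sw A a (%a1 a2. smul T (cou A a2) (sw A b1 (%p q. mul A a1 p <*> e q <.> (ra x b2 <.> y)))) = sw A b1 (%p q. ?Q p q b2)"
    by(rule sw_counit_right[OF kspT coalgA a]) (rule m c lin |assumption)+
   finally show ?thesis .
  qed
  have "d (mul T (a <*> x) (b <*> y)) = sw A b (%b1 b2. d (mul A a b1 <*> ra x b2 <.> y))"
   unfolding mul_tn_sw[OF m] by(rule klin_tsum[OF kspT kspT d_klinear]) (rule m lin |assumption)+
  also have "... = sw A b (%b1 b2. sw A (mul A a b1) (%p r. p <*> e r <.> (ra x b2 <.> y)))"
   by(rule tsum_eq, rule d_tn) (rule m lin |assumption)+
  also have "... = sw A b (%r b3. sw A a (%a1 a2. sw A r (%b1 b2. ?P a1 a2 b1 b2 b3))) +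
    sw A b (%r b3. sw A r (%b1 b2. ?Q b1 b2 b3))" unfolding tsum_add[symmetric] by(rule tsum_eq, rule split)
  also have "sw A b (%r b3. sw A a (%a1 a2. sw A r (%b1 b2. ?P a1 a2 b1 b2 b3))) = mul T (d (a <*> x)) (b <*> y)"
  proof -
   have "mul T (d (a <*> x)) (b <*> y) = sw A a (%a1 a2. mul T (a1 <*> e a2 <.> x) (b <*> y))"
    unfolding d_tn[OF a x] by(rule mul_tsum_left[OF algT]) (rule m lin |assumption)+
   also have "... = sw A a (%a1 a2. sw A b (%b1 r. mul A a1 b1 <*> ra (e a2 <.> x) r <.> y))"
    by(rule tsum_eq, rule mul_tn_sw) (rule m lin |assumption)+
   also have "... = sw A a (%a1 a2. sw A b (%b1 r. sw A r (%b2 b3. ?P a1 a2 b1 b2 b3)))"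
   proof (rule tsum_eq, rule tsum_eq)
    fix a1 a2 b1 r assume h: "a1 .: A" "a2 .: A" "b1 .: A" "r .: A"
    have k: "klinear B T (%z. mul A a1 b1 <*> z <.> y)" by(rule m h lin)+
    have "mul A a1 b1 <*> ra (e a2 <.> x) r <.> y = sw A r (%b2 b3. mul A a1 b1 <*> (ra (e a2) b2 <.> ra x b3) <.> y)"
     unfolding ra_prod[OF h(4) e_mem[OF h(2)] x] by(rule klin_tsum[OF kspB kspT k]) (rule m h lin |assumption)+
    also have "... = sw A r (%b2 b3. ?P a1 a2 b1 b2 b3)"
    proof (rule tsum_eq)
     fix b2 b3 assume g: "b2 .: A" "b3 .: A"
     show "mul A a1 b1 <*> (ra (e a2) b2 <.> ra x b3) <.> y = ?P a1 a2 b1 b2 b3"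
      by(simp only: mul_assoc[OF B.algB kbilin(1)[OF ra e_mem[OF h(2)] g(1)] kbilin(1)[OF ra x g(2)] y])
    qed
    finally show "mul A a1 b1 <*> ra (e a2 <.> x) r <.> y = sw A r (%b2 b3. ?P a1 a2 b1 b2 b3)" .
   qed
   also have "... = sw A a (%a1 a2. sw A b (%r b3. sw A r (%b1 b2. ?P a1 a2 b1 b2 b3)))"
    by(rule tsum_eq, rule sw_coassoc[OF kspT coalgA b, symmetric]) (rule m lin |assumption)+
   also have "... = sw A b (%r b3. sw A a (%a1 a2. sw A r (%b1 b2. ?P a1 a2 b1 b2 b3)))" by(rule tsum_swap)
   finally show ?thesis by(rule sym)
  qed
  also have "sw A b (%r b3. sw A r (%b1 b2. ?Q b1 b2 b3)) = smul T ((- 1) ^ i) (mul T (a <*> x) (d (b <*> y)))"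
  proof -
   have "mul T (a <*> x) (d (b <*> y)) = sw A b (%r b2. mul T (a <*> x) (r <*> e b2 <.> y))"
    unfolding d_tn[OF b y] by(rule mul_tsum_right[OF algT]) (rule m lin |assumption)+
   also have "... = sw A b (%r b3. sw A r (%b1 b2. mul A a b1 <*> ra x b2 <.> (e b3 <.> y)))"
    by(rule tsum_eq, rule mul_tn_sw) (rule m lin |assumption)+
   also have "... = sw A b (%r b3. sw A r (%b1 b2. smul T ((- 1) ^ i) (?Q b1 b3 b2)))"
   proof (rule tsum_eq, rule tsum_eq)
    fix r b3 b1 b2 assume h: "b3 .: A" "b1 .: A" "b2 .: A"
    have k: "klinear B T (%z. mul A a b1 <*> z <.> y)" by(rule m h lin)+
    have g: "ra x b2 .: B" "e b3 .: B" by(rule kbilin(1)[OF ra x h(3)], rule e_mem[OF h(1)])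
    have "ra x b2 <.> (e b3 <.> y) = (ra x b2 <.> e b3) <.> y" by(rule mul_assoc[OF B.algB g y, symmetric])
    then have "mul A a b1 <*> ra x b2 <.> (e b3 <.> y) = smul T ((- 1) ^ i) (mul A a b1 <*> (e b3 <.> ra x b2) <.> y)"
     by(simp only: e_comm[OF h(1) ra_gr[OF h(3) xi]] klin_scale[OF k mul_mem[OF B.algB g(2,1)]])
    then show "mul A a b1 <*> ra x b2 <.> (e b3 <.> y) = smul T ((- 1) ^ i) (?Q b1 b3 b2)"
     by(simp only: mul_assoc[OF B.algB g(2,1) y])
   qed
   also have "... = smul T ((- 1) ^ i) (sw A b (%r b3. sw A r (%b1 b2. ?Q b1 b3 b2)))" by(simp only: smul_tsum[OF kspT])
   \<comment> \<open>Moving the one-form past \<open>ra x b2\<close> has left the last two Sweedler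
     factors interchanged; cocommutativity restores their order.\<close>
   also have "sw A b (%r b3. sw A r (%b1 b2. ?Q b1 b3 b2)) = sw A b (%r b3. sw A r (%b1 b2. ?Q b1 b2 b3))"
    by(rule sw_swap_last[OF kspT coalgA cocommA b]) (rule m lin |assumption)+
   finally show ?thesis by(simp add: power_add[symmetric])
  qed
  finally show ?thesis .
 qed
 let ?L = "%\<xi> et. d (mul T \<xi> et)" and ?R = "%\<xi> et. mul T (d \<xi>) et + smul T ((- 1) ^ i) (mul T \<xi> (d et))"
 have L: "kbilinear T T T ?L" and R: "kbilinear T T T ?R" by(rule mulT_lin lin |assumption)+
 have "?L \<xi> et - ?R \<xi> et : {0}"
 proof (rule grT_image[where f = "%\<xi>. ?L \<xi> et - ?R \<xi> et", OF kspT _ module.subspace_single_0[OF ksp_module[OF kspT]] _ \<xi>])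
  show "klinear T T (%\<xi>. ?L \<xi> et - ?R \<xi> et)"
   by(rule klin_minus[OF kspT kbilin(3)[OF L et klin_id] kbilin(3)[OF R et klin_id]])
  fix a x assume a: "a .: A" and x: "x : gr B i"
  have ax: "a <*> x .: T" by(rule tn_mem[OF a gr_mem[OF x]])
  have "?L (a <*> x) et = ?R (a <*> x) et"
   by(rule T_eqI[where f = "?L (a <*> x)" and g = "?R (a <*> x)", OF kspT kbilin(2)[OF L ax klin_id] kbilin(2)[OF R ax klin_id] base[OF a x] et])
  then show "?L (a <*> x) et - ?R (a <*> x) et : {0}" by simp
 qed
 then show ?thesis by simp
qed

text \<open>\<open>A\<close> sits in degree zero, so the parity is that of the form.\<close>

lemma sign_tn:
 assumes a: "a .: A" and x: "x .: B"
 shows "sign_inv T (gr T) (a <*> x) = a <*> sg x"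
proof -
 have "sign_inv T (gr T) (a <*> x) = hsum (gr B) x (%i b. smul T ((- 1) ^ i) (a <*> b))" unfolding sign_inv_eq_hsum
  by(rule hsum_tn[OF kspT _ a x]) (rule lin)+
 also have "... = hsum (gr B) x (%i b. a <*> smul B ((- 1) ^ i) b)"
  by(rule hsum_cong[OF B.gradB x]) (simp only: klin_scale[OF tn_right[OF a klin_id]])
 also have "... = a <*> sg x" unfolding sign_inv_eq_hsum
  by(rule klin_hsum_apply[OF B.gradB x kspB kspT tn_right[OF a klin_id], symmetric]) (rule lin |assumption)+
 finally show ?thesis .
qed

text \<open>Primitivity of the values of \<open>e\<close> produces two sums, with the one-form on
  the left or on the right leg. The Sweedler factors of \<open>a\<close> are then rearranged so that
  the argument of \<open>e\<close> belongs to the leg on which the one-form stands.\<close>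

lemma cop_d:
 assumes t: "t .: T"
 shows "cop T (d t) = sw T t (%u v. tens T T (d u) v + tens T T (sign_inv T (gr T) u) (d v))"
proof -
 note [lin] = klin_comp[OF klin_sign_inv[OF gradT]] klin_mem[OF klin_sign_inv[OF gradT]]
 let ?F = "%u v. tens T T (d u) v + tens T T (sign_inv T (gr T) u) (d v)"
 have F: "kbilinear T T (tensor T T) ?F" by(rule lin |assumption)+
 show ?thesis
 proof (rule T_eqI[where f = "%t. cop T (d t)" and g = "%t. sw T t ?F", OF ksp_tens _ _ _ t])
  show "klinear T (tensor T T) (%t. cop T (d t))" by(rule copT_lin lin)+
  show "klinear T (tensor T T) (%t. sw T t ?F)" by(rule copT_lin kbilin[OF F] lin |assumption)+
  fix a x assume a: "a .: A" and x: "x .: B"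
  let ?P = "%p q s. sw B x (%x1 x2. tens T T (p <*> e s <.> x1) (q <*> x2))"
  let ?Q = "%p q s. sw B x (%x1 x2. tens T T (p <*> sg x1) (q <*> e s <.> x2))"
  have sw_e: "sw B (e s <.> x) (%y1 y2. tens T T (p <*> y1) (q <*> y2)) =
    sw B x (%x1 x2. tens T T (p <*> e s <.> x1) (q <*> x2) + tens T T (p <*> sg x1) (q <*> e s <.> x2))"
   if h: "p .: A" "q .: A" "s .: A" for p q s
  proof -
   let ?G = "%y1 y2. tens T T (p <*> y1) (q <*> y2)"
   have G: "kbilinear B B (tensor T T) ?G" by(rule h lin |assumption)+
   have "sw B (e s <.> x) ?G = sw B x (%x1 x2. tsum B B (tens B B (e s <.> x1) x2 + tens B B (sg x1) (e s <.> x2)) ?G)"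
    unfolding e_cop[OF h(3) x] by(rule tsum_tsum[OF kspB ksp_tens G]) (rule h lin |assumption)+
   also have "... = sw B x (%x1 x2. ?G (e s <.> x1) x2 + ?G (sg x1) (e s <.> x2))"
   proof (rule tsum_eq)
    fix x1 x2 assume g: "x1 .: B" "x2 .: B"
    have m: "e s <.> x1 .: B" "e s <.> x2 .: B" "sg x1 .: B"
     by(rule mul_mem[OF B.algB e_mem[OF h(3)]] sign_mem g)+
    show "tsum B B (tens B B (e s <.> x1) x2 + tens B B (sg x1) (e s <.> x2)) ?G = ?G (e s <.> x1) x2 + ?G (sg x1) (e s <.> x2)"
     by(simp only: klin_add[OF klin_tsum_out[OF kspB ksp_tens G] tens_lin(1)[OF m(1) g(2)] tens_lin(1)[OF m(3,2)]]
      tsum_tens[OF kspB ksp_tens G] m g)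
   qed
   finally show ?thesis .
  qed
  have "cop T (d (a <*> x)) = sw A a (%r s. cop T (r <*> e s <.> x))" unfolding d_tn[OF a x]
   by(rule klin_tsum[OF kspT ksp_tens klin_copT]) (rule x lin |assumption)+
  also have "... = sw A a (%r s. sw A r (%p q. sw B (e s <.> x) (%y1 y2. tens T T (p <*> y1) (q <*> y2))))"
   by(rule tsum_eq, rule cop_tn) (rule x lin |assumption)+
  also have "... = sw A a (%r s. sw A r (%p q. ?P p q s + ?Q p q s))"
   unfolding tsum_add[symmetric] by(rule tsum_eq, rule tsum_eq, rule sw_e)
  also have "... = sw A a (%r s. sw A r (%p q. ?P p q s)) + sw A a (%r s. sw A r (%p q. ?Q p q s))" by(simp only: tsum_add)
  \<comment> \<open>In \<open>?P\<close> the one-form \<open>e s\<close> stands on the leg of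
    \<open>p\<close>. Exchanging \<open>q\<close> and \<open>s\<close> makes \<open>p\<close> and
    \<open>s\<close> the two halves of one coproduct, as in the definition of
    \<open>d\<close>.\<close>
  also have "sw A a (%r s. sw A r (%p q. ?P p q s)) = sw A a (%r s. sw A r (%p q. ?P p s q))"
   by(rule sw_swap_last[OF ksp_tens coalgA cocommA a]) (rule x lin |assumption)+
  also have "sw A a (%r s. sw A r (%p q. ?Q p q s)) = sw A a (%p r. sw A r (%q s. ?Q p q s))"
   by(rule sw_coassoc[OF ksp_tens coalgA a]) (rule x lin |assumption)+
  also have "sw A a (%r s. sw A r (%p q. ?P p s q)) + sw A a (%p r. sw A r (%q s. ?Q p q s)) =
    sw A a (%a1 a2. sw B x (%x1 x2. sw A a1 (%p q. tens T T (p <*> e q <.> x1) (a2 <*> x2)) +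
     sw A a2 (%q s. tens T T (a1 <*> sg x1) (q <*> e s <.> x2))))"
   by(simp only: tsum_add tsum_swap[of A A _ B B])
  also have "... = sw A a (%a1 a2. sw B x (%x1 x2. ?F (a1 <*> x1) (a2 <*> x2)))"
  proof (rule tsum_eq, rule tsum_eq)
   fix a1 a2 x1 x2 assume h: "a1 .: A" "a2 .: A" "x1 .: B" "x2 .: B"
   have 1: "tens T T (d (a1 <*> x1)) (a2 <*> x2) = sw A a1 (%p q. tens T T (p <*> e q <.> x1) (a2 <*> x2))"
    unfolding d_tn[OF h(1,3)]
    by(rule klin_tsum[where g = "%z. tens T T z (a2 <*> x2)", OF kspT ksp_tens]) (rule h lin |assumption)+
   have 2: "tens T T (sign_inv T (gr T) (a1 <*> x1)) (d (a2 <*> x2)) = sw A a2 (%q s. tens T T (a1 <*> sg x1) (q <*> e s <.> x2))"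
    unfolding d_tn[OF h(2,4)] sign_tn[OF h(1,3)]
    by(rule klin_tsum[where g = "tens T T (a1 <*> sg x1)", OF kspT ksp_tens]) (rule h lin |assumption)+
   show "sw A a1 (%p q. tens T T (p <*> e q <.> x1) (a2 <*> x2)) + sw A a2 (%q s. tens T T (a1 <*> sg x1) (q <*> e s <.> x2)) =
     ?F (a1 <*> x1) (a2 <*> x2)" by(simp only: 1 2)
  qed
  also have "... = sw T (a <*> x) ?F" by(rule sw_tn[OF ksp_tens F a x, symmetric])
  finally show "cop T (d (a <*> x)) = sw T (a <*> x) ?F" .
 qed
qed

lemma bij_j: "bij_betw j (car A) (gr T 0)"
proof (rule bij_betwI')
 \<comment> \<open>Applying the counit of \<open>B\<close> to the second factor is a left inverse of
   \<open>j\<close>.\<close>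
 have inv: "tsum A B (j a) (%a x. smul A (cou B x) a) = a" if "a .: A" for a
 proof -
  have "tsum A B (j a) (%a x. smul A (cou B x) a) = smul A (cou B (unit B)) a" unfolding j_def
   by(rule tsum_tn[OF kspA]) (rule that cou_lin lin |assumption)+
  then show ?thesis by(simp add: B.cou_unit module.scale_one[OF ksp_module[OF kspA]])
 qed
 show "(j a = j b) = (a = b)" if "a .: A" "b .: A" for a b
 proof
  assume "j a = j b"
  then have "tsum A B (j a) (%a x. smul A (cou B x) a) = b" by(simp only: inv[OF that(2)])
  then show "a = b" by(simp only: inv[OF that(1)])
 qed simp
 show "j a : gr T 0" if "a .: A" for a unfolding j_def by(rule tn_gr[OF that B.unit_gr])
 fix t assume t: "t : gr T 0"
 have sub: "module.subspace (smul T) (j ` car A)"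
 proof (rule module.subspaceI[OF ksp_module[OF kspT]])
  have jl: "klinear A T j" by(rule j_lin[OF klin_id])
  show "0 : j ` car A" by(rule image_eqI, rule klin_0[OF kspA kspT jl, symmetric], rule ksp_zero[OF kspA])
  show "x + y : j ` car A" if xy: "x : j ` car A" "y : j ` car A" for x y
  proof -
   obtain a b where "x = j a" "y = j b" "a .: A" "b .: A" using xy by blast
   then show ?thesis using klin_add[OF jl, of a b] ksp_add[OF kspA, of a b] by(metis (no_types) imageI)
  qed
  show "smul T c x : j ` car A" if x: "x : j ` car A" for c x
  proof -
   obtain a where "x = j a" "a .: A" using x by blast
   then show ?thesis using klin_scale[OF jl, of a c] ksp_scale[OF kspA, of a c] by(metis (no_types) imageI)
  qed
 qed
 have "t : j ` car A"
 proof (rule grT_image[OF kspT klin_id sub _ t])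
  fix a b assume a: "a .: A" and "b : gr B 0"
  then obtain c where b: "b = smul B c (unit B)" using gr_0 by blast
  have "a <*> b = j (smul A c a)"
   by(simp only: b j_def klin_scale[OF tn_right[OF a klin_id] uB] klin_scale[OF tn_left[OF uB klin_id] a])
  then show "a <*> b : j ` car A" using ksp_scale[OF kspA a] by blast
 qed
 then show "\<exists>a\<in>car A. t = j a" by blast
qed

theorem strongly_bicovariant: "strongly_bicovariant_dga A j T d" unfolding strongly_bicovariant_dga_def
proof (intro conjI ballI allI)
 show "klinear A T j" by(rule j_lin[OF klin_id])
 show "j (unit A) = unit T" by(simp only: j_def unitT)
 fix a assume a: "a .: A"
 have jj: "kbilinear A A (tensor T T) (%a1 a2. tens T T (j a1) (j a2))" by(rule lin |assumption)+
 have "cop T (j a) = sw A a (%a1 a2. sw B (unit B) (%b1 b2. tens T T (a1 <*> b1) (a2 <*> b2)))"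
  unfolding j_def by(rule cop_tn(1)[OF a uB])
 also have "... = sw A a (%a1 a2. tens T T (j a1) (j a2))" unfolding j_def
  by(rule tsum_eq, rule B.sw_unit[OF ksp_tens]) (rule lin |assumption)+
 finally show "cop T (j a) = tmap A A T T j j (cop A a)"
  by(simp only: tmap_def tlift_eq_tsum[OF kspA ksp_tens jj cop_mem[OF coalgA a]])
 show "cou T (j a) = cou A a" by(simp add: j_def cou_tn(1)[OF a uB] B.cou_unit)
next
 fix t assume t: "t .: T"
 note [lin] = klin_comp[OF klin_sign_inv[OF gradT]] klin_mem[OF klin_sign_inv[OF gradT]]
 have F: "kbilinear T T (tensor T T) (%u v. tens T T (d u) v + tens T T (sign_inv T (gr T) u) (d v))" by(rule lin |assumption)+
 show "cop T (d t) = tlift T T (tensor T T) (%u v. tens T T (d u) v + tens T T (sign_inv T (gr T) u) (d v)) (cop T t)"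
  unfolding tlift_eq_tsum[OF kspT ksp_tens F cop_mem[OF coalgT t]] by(rule cop_d[OF t])
qed (fact hopfA super_hopf_T bij_j d_klinear | rule j_mul d_gr d_d d_mul; assumption)+

text \<open>The sum of S(a1) d(a2) equals 1 \<otimes> e(a), so the subalgebra generated by functions
  and exact one-forms contains all values of \<open>e\<close>, hence all of \<open>B\<close> by
  assumption, and then every pure tensor.\<close>

theorem standard:
 assumes gen: "!!X. module.subspace (smul B) X ==> unit B : X ==> e ` car A \<subseteq> X ==>
   (!!x y. x : X ==> y : X ==> x .: B ==> y .: B ==> x <.> y : X) ==> car B \<subseteq> X"
 shows "standard_dga A j T d" unfolding standard_dga_def generated_by_def
proof (intro allI impI, elim conjE)
 fix P assume sub: "module.subspace (smul T) P" and one: "unit T : P" and mul: "\<forall>a\<in>P. \<forall>b\<in>P. mul T a b : P"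
  and jP: "j ` car A \<union> d ` j ` car A \<subseteq> P"
 let ?S = "A.S"
 have e1: "unit A <*> e a : P" if a: "a .: A" for a
 proof -
  have "sw A a (%a1 a2. mul T (j (?S a1)) (d (j a2))) = sw A a (%a1 r. sw A r (%a2 a3. mul A (?S a1) a2 <*> e a3))"
  proof (rule tsum_eq)
   fix a1 r assume h: "a1 .: A" "r .: A"
   have "mul T (j (?S a1)) (d (j r)) = sw A r (%a2 a3. mul T (j (?S a1)) (a2 <*> e a3))" unfolding d_j[OF h(2)]
    by(rule mul_tsum_right[OF algT]) (rule A.S_mem h lin |assumption)+
   also have "... = sw A r (%a2 a3. mul A (?S a1) a2 <*> e a3)"
    by(rule tsum_eq, rule mul_j_tn) (rule A.S_mem h lin |assumption)+
   finally show "mul T (j (?S a1)) (d (j r)) = sw A r (%a2 a3. mul A (?S a1) a2 <*> e a3)" .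
  qed
  also have "... = sw A a (%r a3. sw A r (%a1 a2. mul A (?S a1) a2 <*> e a3))"
   by(rule sw_coassoc[OF kspT coalgA a, symmetric]) (rule A.S_mem A.S_lin lin |assumption)+
  also have "... = sw A a (%r a3. smul T (cou A r) (unit A <*> e a3))"
  proof (rule tsum_eq)
   fix r a3 assume h: "r .: A" "a3 .: A"
   have k: "klinear A T (%z. z <*> e a3)" by(rule tn_left[OF e_mem[OF h(2)] klin_id])
   show "sw A r (%a1 a2. mul A (?S a1) a2 <*> e a3) = smul T (cou A r) (unit A <*> e a3)"
    by(rule A.antipode_left[OF kspT k h(1)])
  qed
  also have "... = unit A <*> e a" by(rule sw_counit_left[OF kspT coalgA a]) (rule lin)+
  finally have eq: "sw A a (%a1 a2. mul T (j (?S a1)) (d (j a2))) = unit A <*> e a" .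
  have "sw A a (%a1 a2. mul T (j (?S a1)) (d (j a2))) : P"
  proof (rule tsum_subspace[OF kspT sub])
   fix a1 a2 assume h: "a1 .: A" "a2 .: A"
   have "j (?S a1) : P" "d (j a2) : P" using jP A.S_mem[OF h(1)] h(2) by auto
   then show "mul T (j (?S a1)) (d (j a2)) : P" using mul by simp
  qed
  then show ?thesis by(simp only: eq)
 qed
 let ?X = "{x \<in> car B. unit A <*> x : P}"
 have k: "klinear B T (%x. unit A <*> x)" by(rule tn_right[OF uA klin_id])
 have "car B \<subseteq> ?X"
 proof (rule gen)
  show "module.subspace (smul B) ?X"
  proof (rule module.subspaceI[OF ksp_module[OF kspB]])
   show "0 : ?X" using klin_0[OF kspB kspT k] ksp_zero[OF kspB] module.subspace_0[OF ksp_module[OF kspT] sub] by simp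
   show "x + y : ?X" if "x : ?X" "y : ?X" for x y
    using that klin_add[OF k, of x y] ksp_add[OF kspB, of x y] module.subspace_add[OF ksp_module[OF kspT] sub] by simp
   show "smul B c x : ?X" if "x : ?X" for c x
    using that klin_scale[OF k, of x c] ksp_scale[OF kspB, of x c] module.subspace_scale[OF ksp_module[OF kspT] sub, of _ c] by simp
  qed
  show "unit B : ?X" using one by(simp add: unitT uB)
  show "e ` car A \<subseteq> ?X" using e1 e_mem by blast
  show "x <.> y : ?X" if "x : ?X" "y : ?X" for x y
  proof -
   have xy: "x .: B" "y .: B" "unit A <*> x : P" "unit A <*> y : P" using that by auto
   have "mul T (unit A <*> x) (unit A <*> y) : P" using mul xy(3,4) by blast
   then show ?thesis using mul_mem[OF B.algB xy(1,2)] by(simp only: mul_unit_tn_tn[OF xy(1,2)] mem_Collect_eq simp_thms)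
  qed
 qed
 then have x1: "unit A <*> x : P" if "x .: B" for x using that by blast
 have ax: "a <*> x : P" if "a .: A" "x .: B" for a x
 proof -
  have "mul T (j a) (unit A <*> x) : P" using mul jP x1[OF that(2)] that(1) by blast
  then show ?thesis by(simp only: mul_j_tn[OF that(1) uA that(2)] mul_unit(2)[OF A.alg that(1)])
 qed
 show "car T \<subseteq> P"
 proof
  fix t assume t: "t .: T"
  have "tsum A B t (tens A B) : P" by(rule tsum_subspace[OF kspT sub ax])
  then show "t : P" using tsum_tens_id[OF kspA t[unfolded carT]] by simp
 qed
qed

end

text \<open>Letters of an exterior algebra square to zero, supercommute and are primitive, so a
  cocycle with values in the module \<open>W\<close> is all that has to be supplied. If it is onto,
  every letter is one of its values, and letters generate.\<close>

lemma ext_cocycle_calculus: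
 fixes W :: "('k::field, 'w::ab_group_add, 'y) kspace_scheme" and A :: "('k, 'a::ab_group_add, 'z) kbialg_scheme"
 assumes W: "kspace W" and A: "hopf_algebra A" "cocommutative A" and t: "kbilinear W A W t"
  and t_unit: "!!w. w .: W ==> t w (unit A) = w"
  and t_mul: "!!a b w. a .: A ==> b .: A ==> w .: W ==> t w (mul A a b) = t (t w a) b"
  and ze: "klinear A W ze"
  and ze_mul: "!!a b. a .: A ==> b .: A ==> ze (mul A a b) = t (ze a) b + smul W (cou A a) (ze b)"
 shows "cocycle_calculus A (ext_alg W) (ext_cross_product A W t) (ext_act A W t) (%a. ext_word W [ze a])"
  and "[|ze ` car A = car W; module.subspace (smul (ext_alg W)) X; unit (ext_alg W) : X; (%a. ext_word W [ze a]) ` car A \<subseteq> X;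
   !!x y. x : X ==> y : X ==> x .: (ext_alg W) ==> y .: (ext_alg W) ==> mul (ext_alg W) x y : X|] ==>
   car (ext_alg W) \<subseteq> X"
proof -
 let ?B = "ext_alg W"
 let ?M = "stens_mul (word_space (word_forms True W) W) (word_grade (word_forms True W) W) (mul ?B)"
 interpret word_bialgebra W True ?B ?M by(rule ext_alg_word_bialgebra[OF W])
 have gr: "gr ?B = G" by(simp add: alternating_word_forms[OF W])
 have ew: "ext_word W ws = gw ws" for ws by(simp add: ext_word_def alternating_word_forms[OF W])
 have zem: "ze a .: W" if "a .: A" for a by(rule klin_mem[OF ze that])
 note [lin] = kspX klin_comp[OF ze]
 have sign: "sign_inv ?B (gr ?B) x = sc (- 1) x" if "x : car ?B" for x
 proof (rule X_eqI[OF kspX klin_sign_inv[OF gradX, folded gr] sc_klinear _ that])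
  fix ws assume ws: "ws : L"
  show "sign_inv ?B (gr ?B) (gw ws) = sc (- 1) (gw ws)"
   unfolding sign_inv_eq_hsum gr hsum_homogeneous[OF gradX gw_grade[OF ws], where g = "%i y. smul ?B ((- 1) ^ i) y",
     OF module.scale_zero_right[OF ksp_module[OF kspX]]] by(simp only: sc_gw[OF ws] smulX)
 qed
 interpret R: right_smash A ?B "ext_cross_product A W t" "ext_act A W t" by(rule right_smash_ext_alg(1)[OF W A t t_unit t_mul])
 show "cocycle_calculus A ?B (ext_cross_product A W t) (ext_act A W t) (%a. ext_word W [ze a])"
 proof unfold_locales
  show "klinear A ?B (%a. ext_word W [ze a])" unfolding ew by(rule gw1_lin[OF ze])
  fix a assume a: "a .: A"
  note z = zem[OF a]
  show "ext_word W [ze a] : gr ?B 1" unfolding ew gr using gw_grade[of "[ze a]"] z by simp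
  show "mul ?B (ext_word W [ze a]) (ext_word W [ze a]) = 0"
   unfolding ew using gw_alt[of "[]" "[]" "ze a"] mul_gw[of "[ze a]" "[ze a]"] z by simp
  show "ext_word W [ze (mul A a b)] = ext_act A W t (ext_word W [ze a]) b + smul ?B (cou A a) (ext_word W [ze b])"
   if b: "b .: A" for b
  proof -
   have g: "klinear W ?B (%w. gw [w])" by(rule gw1_lin[OF klin_id])
   have tz: "t (ze a) b .: W" by(rule kbilin(1)[OF t z b])
   have act: "ext_act A W t (gw [ze a]) b = gw [t (ze a) b]"
    using right_smash_ext_alg(2)[OF W A t t_unit t_mul b z] by(simp only: ew)
   show ?thesis unfolding ze_mul[OF a b] ew
    by(simp only: act klin_add[OF g tz ksp_scale[OF W zem[OF b]]] klin_scale[OF g zem[OF b]])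
  qed
  show "mul ?B x (ext_word W [ze a]) = smul ?B ((- 1) ^ i) (mul ?B (ext_word W [ze a]) x)" if x: "x : gr ?B i" for x i
  proof -
   let ?f = "%x. mm (x) (gw [ze a]) - smul ?B ((- 1) ^ i) (mm (gw [ze a]) (x))"
   have k: "klinear ?B ?B ?f" by(rule z lin |assumption)+
   have "?f x : {0}"
   proof (rule grade_image[OF kspX k module.subspace_single_0[OF ksp_module[OF kspX]] _ x[unfolded gr]])
    fix ws assume ws: "ws : L" "length ws = i"
    show "?f (gw ws) : {0}"
     using gw_move[of "[]" ws "[]" "ze a"] ws z mul_gw[of ws "[ze a]"] mul_gw[of "[ze a]" ws] by simp
   qed
   then show ?thesis unfolding ew by simp
  qed
  show "cop ?B (mul ?B (ext_word W [ze a]) x) = sw ?B x (%x1 x2. tens ?B ?B (mul ?B (ext_word W [ze a]) x1) x2 +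
    tens ?B ?B (sign_inv ?B (gr ?B) x1) (mul ?B (ext_word W [ze a]) x2))" if x: "x : car ?B" for x
  proof -
   have m: "mm (gw [ze a]) (x) : car ?B" by(rule mul_mem[OF algX gw1_mem[OF z] x])
   have "cop ?B (mm (gw [ze a]) (x)) = sw ?B (mm (gw [ze a]) (x)) (tens ?B ?B)"
    by(rule tsum_tens_id[OF kspX copX_mem[OF m], symmetric])
   also have "... = sw ?B x (%x1 x2. tens ?B ?B (mm (gw [ze a]) (x1)) x2 + tens ?B ?B (sc (- 1) x1) (mm (gw [ze a]) (x2)))"
    by(rule trans[OF sw_letter[OF ksp_tens _ z x]]) (rule lin | simp)+
   also have "... = sw ?B x (%x1 x2. tens ?B ?B (mm (gw [ze a]) (x1)) x2 + tens ?B ?B (sign_inv ?B (gr ?B) x1) (mm (gw [ze a]) (x2)))"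
    by(rule tsum_eq) (simp only: sign)
   finally show ?thesis unfolding ew .
  qed
 next
  fix x assume "x : gr ?B 0"
  then have "x : module.span pscale {gw []}"
   by(simp add: gr word_grade_def Collect_conv_if alternating_word_forms[OF W] cong: conj_cong)
  then obtain c where "x = pscale c (gw [])" by(auto simp: module.span_singleton[OF module_pscale])
  then show "\<exists>c. x = smul ?B c (unit ?B)" by(simp only: unitX smulX) blast
 qed
 assume surj: "ze ` car A = car W" and X: "module.subspace (smul ?B) X" "unit ?B : X" "(%a. ext_word W [ze a]) ` car A \<subseteq> X"
  and cl: "!!x y. x : X ==> y : X ==> x : car ?B ==> y : car ?B ==> mul ?B x y : X"
 have "gw ws : X" if "ws : L" for ws using that
 proof (induction ws)
  case Nil
  show ?case using X(2) by(simp only: unitX)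
 next
  case (Cons w ws)
  have w: "w .: W" and ws: "ws : L" using Cons.hyps by auto
  have "gw [w] : X" using X(3) w unfolding ew surj[symmetric] by blast
  from cl[OF this Cons.IH gw1_mem[OF w] gw_mem[OF ws]] show ?case by(simp only: gw_Cons[OF w ws])
 qed
 then show "car ?B \<subseteq> X" using X_image[OF kspX klin_id X(1)] by blast
qed

section \<open>Right action of letters and of H on one-forms\<close>

section \<open>The one-forms on the cross product with a symmetric algebra\<close>

context left_smash
begin

lemma mul_tn_sw:
 assumes m: "x .: A" "h .: B" "y .: A" "g .: B"
 shows "mul T (x <*> h) (y <*> g) = sw B h (%h1 h2. mul A x (la h1 y) <*> mul B h2 g)"
proof -
 note [lin] = kbilin[OF psi]
 have "mul T (x <*> h) (y <*> g) =
   tsum A B (y <*> g) (%a' b'. tsum A B (ps h a') (%p r. mul A x p <*> mul B r b'))"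
  unfolding mulT[OF tn_mem[OF m(1,2)] tn_mem[OF m(3,4)]] by(rule tsum_tn[OF kspT _ m(1,2)]) (rule m lin |assumption)+
 also have "... = tsum A B (ps h y) (%p r. mul A x p <*> mul B r g)"
  by(rule tsum_tn[OF kspT _ m(3,4)]) (rule m lin |assumption)+
 also have "... = sw B h (%h1 h2. mul A x (la h1 y) <*> mul B h2 g)" by(rule tsum_psi) (rule kspT m lin |assumption)+
 finally show ?thesis .
qed

end

lemma dsum_simps [simp]:
 "car (dsum U V) = car U \<times> car V" "smul (dsum U V) c p = (smul U c (fst p), smul V c (snd p))"
 by(simp_all add: dsum_def case_prod_unfold)

lemma kspace_dsum [lin]:
 assumes U: "kspace U" and V: "kspace V"
 shows "kspace (dsum U V)"
proof -
 have vs: "vector_space (smul (dsum U V))" using kspace_vector_space[OF U] kspace_vector_space[OF V]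
  unfolding vector_space_def by(simp add: prod_eq_iff)
 show ?thesis unfolding kspace_def
 proof
  show "module.subspace (smul (dsum U V)) (car (dsum U V))" by(rule module.subspaceI[OF vs[folded module_iff_vector_space]])
    (auto simp: zero_prod_def ksp_zero U V ksp_add ksp_scale)
 qed (rule vs)
qed

lemma klin_Pair [lin]: "klinear E U f ==> klinear E V g ==> klinear E (dsum U V) (%x. (f x, g x))" by(simp add: klinear_def)

lemma dsum_mem [lin]: "a .: U ==> b .: V ==> (a, b) .: (dsum U V)" by simp

lemma klin_fst_snd:
 "klinear E (dsum U V) g ==> klinear E U (%x. fst (g x))"
 "klinear E (dsum U V) g ==> klinear E V (%x. snd (g x))" by(auto simp: klinear_def mem_Times_iff)

text \<open>In the application, \<open>U\<close> is the convolution algebra dual to \<open>V\<close>, and \<open>om\<close> is the composite of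
 \<open>\<omega>\<close> with the projection \<open>\<pi>\<close>.\<close>

locale module_algebra_pair = cocomm_hopf H
 for H :: "('k::field, 'h::ab_group_add, 'z) kbialg_scheme" +
 fixes U :: "('k, 'u::ab_group_add, 'x) kspace_scheme" and V :: "('k, 'v::ab_group_add, 'y) kspace_scheme"
  and m :: "'u => 'u => 'u" and la :: "'h => 'u => 'u" and act :: "'h => 'v => 'v" and om :: "'h => 'v"
 assumes kspU [lin]: "kspace U" and kspV [lin]: "kspace V"
  and m: "kbilinear U U U m" and m_commute: "!!a b. a .: U ==> b .: U ==> m a b = m b a"
  and m_assoc: "!!a b c. a .: U ==> b .: U ==> c .: U ==> m (m a b) c = m a (m b c)"
  and la: "kbilinear H U U la" and la_one: "!!a. a .: U ==> la one a = a"
  and la_mul: "!!g h a. g .: H ==> h .: H ==> a .: U ==> la (g \<cdot> h) a = la g (la h a)"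
  and la_m: "!!h a b. h .: H ==> a .: U ==> b .: U ==> la h (m a b) = sw H h (%h1 h2. m (la h1 a) (la h2 b))"
  and act: "kbilinear H V V act" and act_one: "!!v. v .: V ==> act one v = v"
  and act_mul: "!!g h v. g .: H ==> h .: H ==> v .: V ==> act (g \<cdot> h) v = act g (act h v)"
  and om: "klinear H V om"
  and om_mul: "!!g h. g .: H ==> h .: H ==> om (g \<cdot> h) = act (S h) (om g) + smul V (eps g) (om h)"
begin

abbreviation W where "W \<equiv> dsum U V"
abbreviation X where "X \<equiv> sym_alg U"
abbreviation sa where "sa \<equiv> sym_act H U la"
abbreviation HT where "HT \<equiv> left_cross_product X H sa"

definition rH where "rH et h = (la (S h) (fst et), act (S h) (snd et))"
definition rD where "rD et ph = (- m ph (fst et), 0 :: 'v)"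

lemma kspW [lin]: "kspace W" by(rule lin)+

lemmas [lin] = kbilin[OF m] kbilin[OF la] kbilin[OF act] klin_comp[OF om] klin_mem[OF om]

lemma fst_snd_mem: "et .: W ==> fst et .: U" "et .: W ==> snd et .: V" by auto

lemma rH: "kbilinear W H W rH" unfolding rH_def by(rule klin_fst_snd fst_snd_mem lin |assumption)+

lemma rD: "kbilinear W U W rD" unfolding rD_def by(rule klin_fst_snd fst_snd_mem lin |assumption)+

lemmas r_lin [lin] = kbilin[OF rH] kbilin[OF rD]

lemma rH_one: "et .: W ==> rH et one = et" by(auto simp: rH_def antipode_one la_one act_one)

lemma rH_mul: "et .: W ==> g .: H ==> h .: H ==> rH et (g \<cdot> h) = rH (rH et g) h"
 by(auto simp: rH_def antipode_mul la_mul act_mul S_mem)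

text \<open>Commutativity of convolution; it lets the letters act through the symmetric
  algebra.\<close>

lemma rD_swap: "et .: W ==> ph .: U ==> ps .: U ==> rD (rD et ph) ps = rD (rD et ps) ph"
proof -
 assume a: "et .: W" "ph .: U" "ps .: U"
 note f = fst_snd_mem(1)[OF a(1)]
 have "m ps (- m ph (fst et)) = - m ps (m ph (fst et))" "m ph (- m ps (fst et)) = - m ph (m ps (fst et))"
  using klin_neg[OF kspU kspU kbilin(2)[OF m _ klin_id]] kbilin(1)[OF m] a f by auto
 moreover have "m ps (m ph (fst et)) = m ph (m ps (fst et))"
  using m_assoc[of ps ph "fst et"] m_assoc[of ph ps "fst et"] m_commute[of ps ph] a f by simp
 ultimately show ?thesis by(simp add: rD_def)
qed

text \<open>The cross relation tested on a single letter. S(h2) acts on a convolution product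
  through its own coproduct, which \<open>sw_antipode\<close> expresses by antipodes of the factors
  of h2. One of them meets h1 and cancels, after cocommutativity has brought the pair into antipode
  order.\<close>

lemma rD_sem:
 assumes ze: "ze .: W" and w: "w .: U" and h: "h .: H"
 shows "sw H h (%h1 r. rH (rD ze (la h1 w)) r) = rD (rH ze h) w"
proof -
 let ?G = "%z r. (- m (la z w) (la (S r) (fst ze)), 0 :: 'v)"
 note f = fst_snd_mem(1)[OF ze]
 have "sw H h (%h1 r. rH (rD ze (la h1 w)) r) = sw H h (%h1 r. sw H r (%p q. ?G (S p \<cdot> h1) q))"
 proof (rule tsum_eq)
  fix h1 r assume c: "h1 .: H" "r .: H"
  have lw: "la h1 w .: U" by(rule lin c w)+
  have k: "klinear U W (%z. (- z, 0 :: 'v))" by(rule lin)+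
  have "act (S r) 0 = 0" by(rule klin_0[OF kspV kspV kbilin(2)[OF act S_mem[OF c(2)] klin_id]])
  moreover have "la (S r) (- m (la h1 w) (fst ze)) = - la (S r) (m (la h1 w) (fst ze))"
   by(rule klin_neg[OF kspU kspU kbilin(2)[OF la S_mem[OF c(2)] klin_id] kbilin(1)[OF m lw f]])
  ultimately have "rH (rD ze (la h1 w)) r = (- la (S r) (m (la h1 w) (fst ze)), 0)" by(simp add: rH_def rD_def)
  also have "la (S r) (m (la h1 w) (fst ze)) = sw H (S r) (%p q. m (la p (la h1 w)) (la q (fst ze)))"
   by(rule la_m[OF S_mem[OF c(2)] lw f])
  also have "... = sw H r (%p q. m (la (S p) (la h1 w)) (la (S q) (fst ze)))"
   by(rule sw_antipode[OF kspU _ c(2)]) (rule lw f lin |assumption)+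
  also have "... = sw H r (%p q. m (la (S p \<cdot> h1) w) (la (S q) (fst ze)))"
   by(rule tsum_eq) (simp only: la_mul[OF S_mem c(1) w])
  also have "(- sw H r (%p q. m (la (S p \<cdot> h1) w) (la (S q) (fst ze))), 0 :: 'v) = sw H r (%p q. ?G (S p \<cdot> h1) q)"
   by(rule klin_tsum[where g = "%z. (- z, 0 :: 'v)", OF kspU kspW k]) (rule w f c lin |assumption)+
  finally show "rH (rD ze (la h1 w)) r = sw H r (%p q. ?G (S p \<cdot> h1) q)" .
 qed
 also have "... = sw H h (%a q. sw H a (%h1 p. ?G (S p \<cdot> h1) q))"
  by(rule sw_coassoc[OF kspW coalg h, symmetric]) (rule w f lin |assumption)+
 also have "... = sw H h (%a q. sw H a (%p h1. ?G (S p \<cdot> h1) q))"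
  by(rule tsum_eq, rule sw_cocomm[OF kspW coalg cocomm], assumption) (rule w f lin |assumption)+
 also have "... = sw H h (%a q. smul W (eps a) (?G one q))"
 proof (rule tsum_eq)
  fix a q assume c: "a .: H" "q .: H"
  have k: "klinear H W (%z. ?G z q)" by(rule w f c lin)+
  show "sw H a (%p h1. ?G (S p \<cdot> h1) q) = smul W (eps a) (?G one q)" by(rule antipode_left[OF kspW k c(1)])
 qed
 also have "... = ?G one h" by(rule sw_counit_left[OF kspW coalg h]) (rule w f unit_mem[OF alg] lin)+
 also have "... = rD (rH ze h) w" by(simp add: rD_def rH_def la_one[OF w])
 finally show ?thesis .
qed

sublocale X: word_bialgebra U False X "tens_mul (word_space (word_forms False U) U) (mul X)"
 by(rule sym_alg_word_bialgebra[OF kspU])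

lemma smash: "left_smash X H HT sa"
 and sa_letter1: "h .: H ==> w .: U ==> sa h (sym_word U [w]) = sym_word U [la h w]"
 by(rule left_smash_sym_alg[OF kspU hopf cocomm la la_one la_mul]; assumption)+

sublocale Y: left_smash X H HT sa by(rule smash)

lemma gw: "sym_word U ws = X.gw ws" by(simp add: sym_word_def symmetric_word_forms)

lemma unitX: "unit X = X.gw []" by(rule X.unitX)

lemmas [lin] = X.kspX Y.kspT kbilin[OF Y.la]

lemma sa_one: "h .: H ==> sa h (X.gw []) = smul X (eps h) (X.gw [])" using Y.la_one by(simp only: unitX)

lemma sa_letter:
 assumes h: "h .: H" and w: "w .: U" and x: "x .: X"
 shows "sa h (mul X (X.gw [w]) x) = sw H h (%h1 h2. mul X (X.gw [la h1 w]) (sa h2 x))"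
 unfolding Y.la_prod[OF h X.gw1_mem[OF w] x] by(rule tsum_eq) (simp only: sa_letter1[unfolded gw, OF _ w])

lemma foldl_rD_lin [lin]: "vs : X.L ==> klinear E W g ==> klinear E W (%x. foldl rD (g x) vs)"
proof (induction vs arbitrary: g)
 case (Cons v vs)
 have v: "v .: U" "vs : X.L" using Cons.prems(1) by auto
 show ?case unfolding foldl.simps by(rule Cons.IH[OF v(2) kbilin(3)[OF rD v(1) Cons.prems(2)]])
qed simp

lemma foldl_rD_mem [lin]: "vs : X.L ==> et .: W ==> foldl rD et vs .: W"
 by(rule klin_mem[OF foldl_rD_lin[OF _ klin_id]])

lemma foldl_rD_word_map:
 assumes et: "et .: W"
 shows "X.word_map W (foldl rD et)" unfolding X.word_map_def
proof (intro conjI ballI impI)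
 fix us vs assume u: "us : X.L" "vs : X.L"
 show "klinear U W (%w. foldl rD et (us @ w # vs))" unfolding foldl_append foldl.simps by(rule u et lin)+
 fix x y assume x: "x .: U" "y .: U"
 show "foldl rD et (us @ x # y # vs) = smul W (if False then - 1 else 1) (foldl rD et (us @ y # x # vs))"
  unfolding if_False smul_one[OF kspW] foldl_append foldl.simps by(simp only: rD_swap[OF foldl_rD_mem[OF u(1) et] x])
qed (rule foldl_rD_mem[OF _ et], assumption, simp)

section \<open>The action of the symmetric algebra on one-forms and the cocycle on it\<close>

definition R where "R et = lin_ext (symmetric_forms U) (lists (car U)) W (foldl rD et)"

lemma R_gw: "et .: W ==> ws : X.L ==> R et (X.gw ws) = foldl rD et ws"
 using X.word_ext_gw[OF kspW foldl_rD_word_map] by(simp add: R_def symmetric_word_forms)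

lemma R_klinear: "et .: W ==> klinear X W (R et)"
 using X.word_ext_lin[OF kspW foldl_rD_word_map] by(simp add: R_def symmetric_word_forms)

lemma R: "kbilinear W X W R"
proof (rule kbilinearI)
 show "klinear X W (R et)" if "et .: W" for et by(rule R_klinear[OF that])
 fix x assume x: "x .: X"
 show "klinear W W (%et. R et x)"
 proof (rule klinearI)
  show "R et x .: W" if "et .: W" for et by(rule klin_mem[OF R_klinear[OF that] x])
  fix et \<theta> assume a: "et .: W" "\<theta> .: W"
  note s = ksp_add[OF kspW a]
  show "R (et + \<theta>) x = R et x + R \<theta> x"
   by(rule X.X_eqI[where f = "R (et + \<theta>)" and g = "%x. R et x + R \<theta> x", OF kspW R_klinear[OF s]
      klin_plus[OF kspW R_klinear[OF a(1)] R_klinear[OF a(2)]] _ x])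
    (simp only: R_gw a s klin_add[OF foldl_rD_lin[OF _ klin_id] a])
 next
  fix c et assume a: "et .: W"
  note s = ksp_scale[OF kspW a, of c]
  show "R (smul W c et) x = smul W c (R et x)"
   by(rule X.X_eqI[where f = "R (smul W c et)" and g = "%x. smul W c (R et x)", OF kspW R_klinear[OF s]
      klin_smul[OF kspW R_klinear[OF a]] _ x])
    (simp only: R_gw a s klin_scale[OF foldl_rD_lin[OF _ klin_id] a])
 qed
qed

lemmas R_lin [lin] = kbilin[OF R]

lemma R_one: "et .: W ==> R et (X.gw []) = et" by(simp only: R_gw lists.Nil foldl.simps)

lemma R_mul:
 assumes et: "et .: W" and x: "x .: X" and y: "y .: X"
 shows "R et (mul X x y) = R (R et x) y"
proof (rule X.X_eqI[where f = "%x. R et (mul X x y)" and g = "%x. R (R et x) y", OF kspW _ _ _ x])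
 show "klinear X W (%x. R et (mul X x y))" "klinear X W (%x. R (R et x) y)" by(rule et y X.mulX_lin lin)+
 fix us assume us: "us : X.L"
 have gu: "X.gw us .: X" by(rule X.gw_mem[OF us])
 have Ru: "R et (X.gw us) .: W" by(rule R_lin(1)[OF et gu])
 show "R et (mul X (X.gw us) y) = R (R et (X.gw us)) y"
 proof (rule X.X_eqI[where f = "%y. R et (mul X (X.gw us) y)" and g = "%y. R (R et (X.gw us)) y", OF kspW _ _ _ y])
  show "klinear X W (%y. R et (mul X (X.gw us) y))" "klinear X W (R (R et (X.gw us)))"
   by(rule et gu Ru X.mulX_lin lin)+
  fix vs assume vs: "vs : X.L"
  have "us @ vs : X.L" using us vs by simp
  then show "R et (mul X (X.gw us) (X.gw vs)) = R (R et (X.gw us)) (X.gw vs)"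
   by(simp only: X.mul_gw[OF us vs] R_gw[OF et] R_gw[OF Ru[unfolded R_gw[OF et us]] vs] foldl_append us)
 qed
qed

lemma R_letter:
 "et .: W ==> w .: U ==> y .: X ==> R et (mul X (X.gw [w]) y) = R (rD et w) y"
 using R_mul[of et "X.gw [w]" y] R_gw[of et "[w]"] X.gw1_mem[of w] by simp

text \<open>Extends \<open>rD_sem\<close> from letters to words. It is the compatibility that turns
  the separate actions of S(U) and \<open>H\<close> into an action of the cross product.\<close>

lemma R_sem:
 assumes ze: "ze .: W" and y: "y .: X" and h: "h .: H"
 shows "sw H h (%h1 h2. rH (R ze (sa h1 y)) h2) = R (rH ze h) y"
proof -
 have gen: "sw H h (%h1 h2. rH (R ze (sa h1 (X.gw ws))) h2) = R (rH ze h) (X.gw ws)"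
  if "ws : X.L" "ze .: W" "h .: H" for ws ze h using that
 proof (induction ws arbitrary: ze h)
  case Nil
  note ze = Nil(1) and h = Nil(2)
  have "sw H h (%h1 h2. rH (R ze (sa h1 (X.gw []))) h2) = sw H h (%h1 h2. smul W (eps h1) (rH ze h2))"
   by(rule tsum_eq)
    (simp only: sa_one klin_scale[OF R_klinear[OF ze] X.gw0_mem] R_one[OF ze] klin_scale[OF kbilin(3)[OF rH _ klin_id] ze])
  also have "... = rH ze h" by(rule sw_counit_left[OF kspW coalg h]) (rule ze lin)+
  finally show ?case by(simp only: R_one kbilin(1)[OF rH ze h])
 next
  case (Cons w ws)
  note ze = Cons.prems(1) and h = Cons.prems(2)
  have w: "w .: U" and ws: "ws : X.L" using Cons.hyps by auto
  have x: "X.gw ws .: X" by(rule X.gw_mem[OF ws])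
  note m' = ze w x
  have "sw H h (%h1 h2. rH (R ze (sa h1 (mul X (X.gw [w]) (X.gw ws)))) h2) =
    sw H h (%r h3. sw H r (%h1 h2. rH (R (rD ze (la h1 w)) (sa h2 (X.gw ws))) h3))"
  proof (rule tsum_eq)
   fix r h3 assume c: "r .: H" "h3 .: H"
   have k: "klinear X W (%z. rH (R ze z) h3)" by(rule ze c lin)+
   have "rH (R ze (sa r (mul X (X.gw [w]) (X.gw ws)))) h3 =
     sw H r (%h1 h2. rH (R ze (mul X (X.gw [la h1 w]) (sa h2 (X.gw ws)))) h3)" unfolding sa_letter[OF c(1) w x]
    by(rule klin_tsum[OF X.kspX kspW k]) (rule m' X.mulX_lin X.gw1_mem lin |assumption)+
   also have "... = sw H r (%h1 h2. rH (R (rD ze (la h1 w)) (sa h2 (X.gw ws))) h3)"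
   proof (rule tsum_eq)
    fix h1 h2 assume d: "h1 .: H" "h2 .: H"
    show "rH (R ze (mul X (X.gw [la h1 w]) (sa h2 (X.gw ws)))) h3 = rH (R (rD ze (la h1 w)) (sa h2 (X.gw ws))) h3"
     by(simp only: R_letter[OF ze kbilin(1)[OF la d(1) w] kbilin(1)[OF Y.la d(2) x]])
   qed
   finally show "rH (R ze (sa r (mul X (X.gw [w]) (X.gw ws)))) h3 =
     sw H r (%h1 h2. rH (R (rD ze (la h1 w)) (sa h2 (X.gw ws))) h3)" .
  qed
  also have "... = sw H h (%h1 r. sw H r (%h2 h3. rH (R (rD ze (la h1 w)) (sa h2 (X.gw ws))) h3))"
   by(rule sw_coassoc[OF kspW coalg h]) (rule m' lin |assumption)+
  also have "... = sw H h (%h1 r. R (rH (rD ze (la h1 w)) r) (X.gw ws))"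
   by(rule tsum_eq, rule Cons.IH) (rule m' lin |assumption)+
  also have "... = R (sw H h (%h1 r. rH (rD ze (la h1 w)) r)) (X.gw ws)"
   by(rule klin_tsum[where g = "%z. R z (X.gw ws)", OF kspW kspW, symmetric]) (rule m' lin |assumption)+
  also have "... = R (rH ze h) (mul X (X.gw [w]) (X.gw ws))"
   unfolding rD_sem[OF ze w h] by(rule R_letter[OF kbilin(1)[OF rH ze h] w x, symmetric])
  finally show ?case by(simp only: X.gw_Cons[OF w ws])
 qed
 show ?thesis
  by(rule X.X_eqI[where f = "%y. sw H h (%h1 h2. rH (R ze (sa h1 y)) h2)" and g = "R (rH ze h)", OF kspW _ _ gen[OF _ ze h] y]) (rule ze h lin |assumption)+
qed

text \<open>The cocycle on a word: the first letter becomes a one-form and the remaining letters act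
  on it. The value 0 on the empty word is forced, as a cocycle vanishes at the unit.\<close>

fun n0 where "n0 [] = 0" | "n0 (ph # phs) = foldl rD (ph, 0) phs"

lemma letter_mem [lin]: "w .: U ==> (w, 0) .: W" by(simp add: ksp_zero[OF kspV])

text \<open>Only an interchange involving the distinguished first letter needs an argument of its
  own: it is the commutativity of \<open>m\<close>. All later interchanges follow from
  \<open>rD_swap\<close>.\<close>

lemma n0_word_map: "X.word_map W n0" unfolding X.word_map_def
proof (intro conjI ballI impI)
 show "n0 ws .: W" if "ws : X.L" for ws
  using that by(cases ws) (auto simp del: dsum_simps intro: foldl_rD_mem letter_mem ksp_zero[OF kspW])
 fix us vs assume u: "us : X.L" "vs : X.L"
 show "klinear U W (%w. n0 (us @ w # vs))"
 proof (cases us)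
  case Nil
  show ?thesis unfolding Nil append_Nil n0.simps by(rule u lin)+
 next
  case (Cons w ws)
  then have w: "w .: U" "ws : X.L" using u by auto
  show ?thesis unfolding Cons append_Cons n0.simps foldl_append foldl.simps by(rule u w lin)+
 qed
 fix x y assume x: "x .: U" "y .: U"
 have "n0 (us @ x # y # vs) = n0 (us @ y # x # vs)"
 proof (cases us)
  case Nil
  then show ?thesis by(simp add: rD_def m_commute[OF x])
 next
  case (Cons w ws)
  then have w: "w .: U" "ws : X.L" using u by auto
  show ?thesis unfolding Cons append_Cons n0.simps foldl_append foldl.simps
   by(simp only: rD_swap[OF foldl_rD_mem[OF w(2) letter_mem[OF w(1)]] x])
 qed
 then show "n0 (us @ x # y # vs) = smul W (if False then - 1 else 1) (n0 (us @ y # x # vs))"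
  by(simp only: if_False smul_one[OF kspW])
qed simp

definition N where "N = lin_ext (symmetric_forms U) (lists (car U)) W n0"

lemma N_gw: "ws : X.L ==> N (X.gw ws) = n0 ws"
 using X.word_ext_gw[OF kspW n0_word_map] by(simp add: N_def symmetric_word_forms)

lemma N: "klinear X W N" using X.word_ext_lin[OF kspW n0_word_map] by(simp add: N_def symmetric_word_forms)

lemmas N_lin [lin] = klin_comp[OF N] klin_mem[OF N]

lemma N_letter:
 assumes w: "w .: U" and y: "y .: X"
 shows "N (mul X (X.gw [w]) y) = R (w, 0) y"
proof (rule X.X_eqI[where f = "%y. N (mul X (X.gw [w]) y)" and g = "R (w, 0)", OF kspW _ R_klinear[OF letter_mem[OF w]] _ y])
 show "klinear X W (%y. N (mul X (X.gw [w]) y))" by(rule w X.gw1_mem X.mulX_lin lin)+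
 fix ws assume ws: "ws : X.L"
 have "w # ws : X.L" using w ws by simp
 then show "N (mul X (X.gw [w]) (X.gw ws)) = R (w, 0) (X.gw ws)"
  by(simp only: X.gw_Cons[OF w ws, symmetric] N_gw n0.simps R_gw[OF letter_mem[OF w] ws])
qed

text \<open>The cocycle identity on the symmetric algebra. For a nonempty word the letters of
  \<open>y\<close> continue the action on the first letter and the counit vanishes; for the empty
  word the counit term alone remains.\<close>

lemma N_mul:
 assumes x: "x .: X" and y: "y .: X"
 shows "N (mul X x y) = R (N x) y + smul W (cou X x) (N y)"
proof (rule X.X_eqI[where f = "%x. N (mul X x y)" and g = "%x. R (N x) y + smul W (cou X x) (N y)", OF kspW _ _ _ x])
 show "klinear X W (%x. N (mul X x y))" "klinear X W (%x. R (N x) y + smul W (cou X x) (N y))"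
  by(rule y X.mulX_lin X.couX_lin lin)+
 fix ws assume ws: "ws : X.L"
 show "N (mul X (X.gw ws) y) = R (N (X.gw ws)) y + smul W (cou X (X.gw ws)) (N y)"
 proof (cases ws)
  case Nil
  have "R 0 y = 0" by(rule klin_0[OF kspW kspW kbilin(3)[OF R y klin_id]])
  then show ?thesis
   using mul_unit(1)[OF X.algX y] N_gw[of "[]"] X.cou_gw[of "[]"] smul_one[OF kspW, of "N y"] unfolding Nil unitX
   by(simp only: n0.simps lists.Nil) simp
 next
  case (Cons w us)
  then have w: "w .: U" "us : X.L" using ws by auto
  have u: "X.gw us .: X" by(rule X.gw_mem[OF w(2)])
  have "cou X (X.gw ws) = 0" using X.cou_gw[OF ws] Cons by simp
  moreover have "N (mul X (X.gw ws) y) = R (N (X.gw ws)) y"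
   unfolding Cons X.gw_Cons[OF w] mul_assoc[OF X.algX X.gw1_mem[OF w(1)] u y]
    N_letter[OF w(1) u] N_letter[OF w(1) mul_mem[OF X.algX u y]] by(rule R_mul[OF letter_mem[OF w(1)] u y])
  ultimately show ?thesis by(simp add: smul_zero_left[OF kspW, simplified])
 qed
qed

text \<open>Equivariance of the cocycle. By \<open>R_sem\<close> the action of h is concentrated on
  the first letter, where S(h2) and h1 cancel.\<close>

lemma N_sem:
 assumes y: "y .: X" and h: "h .: H"
 shows "sw H h (%h1 h2. rH (N (sa h1 y)) h2) = smul W (eps h) (N y)"
proof -
 have gen: "sw H h (%h1 h2. rH (N (sa h1 (X.gw ws))) h2) = smul W (eps h) (N (X.gw ws))" if "ws : X.L" for ws
 proof (cases ws)
  case Nil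
  have N0: "N (X.gw []) = 0" by(simp only: N_gw lists.Nil n0.simps)
  have "sw H h (%h1 h2. rH (N (sa h1 (X.gw ws))) h2) = sw H h (%h1 h2. 0)" unfolding Nil by(rule tsum_eq)
    (simp only: sa_one klin_scale[OF N X.gw0_mem] N0 smul_zero_right[OF kspW] klin_0[OF kspW kspW kbilin(3)[OF rH _ klin_id]])
  then show ?thesis unfolding Nil N0 smul_zero_right[OF kspW] tsum_0 .
 next
  case (Cons w us)
  then have w: "w .: U" and us: "us : X.L" using that by auto
  have x: "X.gw us .: X" by(rule X.gw_mem[OF us])
  note m' = w x
  have "sw H h (%h1 h2. rH (N (sa h1 (mul X (X.gw [w]) (X.gw us)))) h2) =
    sw H h (%r h3. sw H r (%h1 h2. rH (R (la h1 w, 0) (sa h2 (X.gw us))) h3))"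
  proof (rule tsum_eq)
   fix r h3 assume c: "r .: H" "h3 .: H"
   have k: "klinear X W (%z. rH (N z) h3)" by(rule c lin)+
   have "rH (N (sa r (mul X (X.gw [w]) (X.gw us)))) h3 =
     sw H r (%h1 h2. rH (N (mul X (X.gw [la h1 w]) (sa h2 (X.gw us)))) h3)" unfolding sa_letter[OF c(1) w x]
    by(rule klin_tsum[OF X.kspX kspW k]) (rule m' X.mulX_lin X.gw1_mem lin |assumption)+
   also have "... = sw H r (%h1 h2. rH (R (la h1 w, 0) (sa h2 (X.gw us))) h3)"
   proof (rule tsum_eq)
    fix h1 h2 assume d: "h1 .: H" "h2 .: H"
    show "rH (N (mul X (X.gw [la h1 w]) (sa h2 (X.gw us)))) h3 = rH (R (la h1 w, 0) (sa h2 (X.gw us))) h3"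
     by(simp only: N_letter[OF kbilin(1)[OF la d(1) w] kbilin(1)[OF Y.la d(2) x]])
   qed
   finally show "rH (N (sa r (mul X (X.gw [w]) (X.gw us)))) h3 =
     sw H r (%h1 h2. rH (R (la h1 w, 0) (sa h2 (X.gw us))) h3)" .
  qed
  also have "... = sw H h (%h1 r. sw H r (%h2 h3. rH (R (la h1 w, 0) (sa h2 (X.gw us))) h3))"
   by(rule sw_coassoc[OF kspW coalg h]) (rule m' lin |assumption)+
  also have "... = sw H h (%h1 r. R (rH (la h1 w, 0) r) (X.gw us))" by(rule tsum_eq, rule R_sem) (rule m' lin |assumption)+
  also have "... = sw H h (%h1 r. R (la (S r \<cdot> h1) w, 0) (X.gw us))"
  proof (rule tsum_eq)
   fix h1 r assume c: "h1 .: H" "r .: H"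
   have "act (S r) 0 = 0" by(rule klin_0[OF kspV kspV kbilin(2)[OF act S_mem[OF c(2)] klin_id]])
   then show "R (rH (la h1 w, 0) r) (X.gw us) = R (la (S r \<cdot> h1) w, 0) (X.gw us)"
    by(simp only: rH_def fst_conv snd_conv la_mul[OF S_mem[OF c(2)] c(1) w])
  qed
  also have "... = sw H h (%r h1. R (la (S r \<cdot> h1) w, 0) (X.gw us))"
   by(rule sw_cocomm[OF kspW coalg cocomm h]) (rule m' lin |assumption)+
  also have "... = smul W (eps h) (R (la one w, 0) (X.gw us))"
   by(rule antipode_left[where g = "%z. R (la z w, 0) (X.gw us)", OF kspW _ h]) (rule m' lin)+
  also have "... = smul W (eps h) (N (mul X (X.gw [w]) (X.gw us)))" by(simp only: N_letter[OF w x] la_one[OF w])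
  finally show ?thesis unfolding Cons by(simp only: X.gw_Cons[OF w us])
 qed
 show ?thesis
  by(rule X.X_eqI[where f = "%y. sw H h (%h1 h2. rH (N (sa h1 y)) h2)" and g = "%y. smul W (eps h) (N y)", OF kspW _ _ gen y]) (rule h lin |assumption)+
qed

text \<open>A letter acts as zero on the summand \<open>V\<close>, so only the constant term of
  \<open>y\<close> survives.\<close>

lemma R_V:
 assumes v: "v .: V" and y: "y .: X"
 shows "R (0, v) y = smul W (cou X y) (0, v)"
proof -
 have v': "(0, v) .: W" using v by(simp add: ksp_zero[OF kspU])
 have z: "foldl rD 0 ws = 0" if "ws : X.L" for ws by(rule klin_0[OF kspW kspW foldl_rD_lin[OF that klin_id]])
 show ?thesis
 proof (rule X.X_eqI[where f = "R (0, v)" and g = "%y. smul W (cou X y) (0, v)", OF kspW R_klinear[OF v'] _ _ y])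
  show "klinear X W (%y. smul W (cou X y) (0, v))" by(rule v' X.couX_lin lin)+
  fix ws assume ws: "ws : X.L"
  show "R (0, v) (X.gw ws) = smul W (cou X (X.gw ws)) (0, v)"
  proof (cases ws)
   case Nil
   then show ?thesis using X.cou_gw[OF ws] by(simp add: R_one[OF v', simplified] smul_one[OF kspV] smul_zero_right[OF kspU])
  next
   case (Cons w us)
   then have w: "w .: U" and us: "us : X.L" using ws by auto
   have "m w 0 = 0" by(rule klin_0[OF kspU kspU kbilin(2)[OF m w klin_id]])
   then have "rD (0, v) w = 0" by(simp add: rD_def zero_prod_def)
   then have "R (0, v) (X.gw ws) = 0" using R_gw[OF v' ws] z[OF us] by(simp only: Cons foldl.simps)
   moreover have "cou X (X.gw ws) = 0" using X.cou_gw[OF ws] Cons by simp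
   ultimately show ?thesis by(simp only: smul_zero_left[OF kspW])
  qed
 qed
qed

end

section \<open>The action and the cocycle on the whole cross product\<close>

context module_algebra_pair
begin

abbreviation tXH (infixr "<*>" 68) where "x <*> h \<equiv> tens X H x h"

definition ra where "ra et = tlift X H W (%x h. rH (R et x) h)"
text \<open>The form dictated by the cocycle identity for the product of \<open>x\<close> and
  \<open>h\<close>, once the values \<open>N\<close> on the symmetric algebra and \<open>om\<close>
  on \<open>H\<close> are given.\<close>

definition ze where "ze t = tsum X H t (%x h. rH (N x) h + smul W (cou X x) (0, om h))"

lemma om_mem [lin]: "h .: H ==> (0, om h) .: W" by(simp add: ksp_zero[OF kspU] klin_mem[OF om])

lemma om_lin [lin]: "klinear H W (%h. (0, om h))" by(rule lin)+

lemma ra_bil: "et .: W ==> kbilinear X H W (%x h. rH (R et x) h)" by(rule lin |assumption)+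

lemma zeta_bil: "kbilinear X H W (%x h. rH (N x) h + smul W (cou X x) (0, om h))"
 by(rule om_lin om_mem X.couX_lin lin |assumption)+

lemma ra_tn: "et .: W ==> x .: X ==> h .: H ==> ra et (x <*> h) = rH (R et x) h"
 unfolding ra_def by(rule tlift_tens[OF kspW ra_bil])

lemma zeta_tn: "x .: X ==> h .: H ==> ze (x <*> h) = rH (N x) h + smul W (cou X x) (0, om h)"
 unfolding ze_def by(rule Y.tsum_tn[OF kspW zeta_bil])

lemma zeta: "klinear HT W ze" unfolding ze_def by(rule Y.from_tensor'[OF klin_tsum_out[OF X.kspX kspW zeta_bil]])

lemma ra: "kbilinear W HT W ra"
proof (rule kbilinearI)
 show "klinear HT W (ra et)" if "et .: W" for et
  unfolding ra_def by(rule Y.from_tensor'[OF klinear_tlift[OF kspW ra_bil[OF that]]])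
 fix t assume t: "t .: HT"
 have "klinear W W (%et. tsum X H t (%x h. rH (R et x) h))" by(rule lin |assumption)+
 then show "klinear W W (%et. ra et t)" by(rule klin_cong[OF kspW])
   (simp only: ra_def tlift_eq_tsum[OF X.kspX kspW ra_bil t[unfolded Y.carT]])
qed

lemmas ra_lin [lin] = kbilin[OF ra]

lemma ra_unit: "et .: W ==> ra et (unit HT) = et"
 by(simp only: Y.unitT ra_tn unit_mem[OF X.algX] unit_mem[OF alg]) (simp only: unitX R_one rH_one)

lemma algHT [lin]: "assoc_algebra HT" using Y.hopf_T by(simp add: hopf_algebra_def bialgebra_algebra)

lemmas mul_HT_lin = kbilin[OF kbil_mul[OF algHT]]

lemma mul_HT_image:
 assumes D: "kspace D" and g: "klinear HT D g" and m': "x .: X" "h .: H" "y .: X" "k .: H"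
 shows "g (mul HT (x <*> h) (y <*> k)) = sw H h (%h1 h2. g (mul X x (sa h1 y) <*> h2 \<cdot> k))"
 unfolding Y.mul_tn_sw[OF m'] by(rule klin_tsum[OF Y.kspT D g]) (rule m' Y.tn_mem X.mulX_lin lin |assumption)+

text \<open>The laws \<open>R_mul\<close> and \<open>rH_mul\<close> for the two factors, joined by
  \<open>R_sem\<close> where \<open>h\<close> passes \<open>y\<close>.\<close>

lemma ra_mul:
 assumes s: "s .: HT" and t: "t .: HT" and et: "et .: W"
 shows "ra et (mul HT s t) = ra (ra et s) t"
proof (rule Y.T_eqI[where f = "%s. ra et (mul HT s t)" and g = "%s. ra (ra et s) t", OF kspW _ _ _ s])
 show "klinear HT W (%s. ra et (mul HT s t))" "klinear HT W (%s. ra (ra et s) t)" by(rule et t mul_HT_lin lin)+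
 fix x h assume x: "x .: X" and h: "h .: H"
 have xh: "x <*> h .: HT" by(rule Y.tn_mem[OF x h])
 have r: "ra et (x <*> h) .: W" by(rule ra_lin(1)[OF et xh])
 show "ra et (mul HT (x <*> h) t) = ra (ra et (x <*> h)) t"
 proof (rule Y.T_eqI[where f = "%t. ra et (mul HT (x <*> h) t)" and g = "%t. ra (ra et (x <*> h)) t", OF kspW _ _ _ t])
  show "klinear HT W (%t. ra et (mul HT (x <*> h) t))" "klinear HT W (ra (ra et (x <*> h)))"
   by(rule et xh r mul_HT_lin lin)+
  fix y k assume y: "y .: X" and k: "k .: H"
  have Rx: "R et x .: W" by(rule R_lin(1)[OF et x])
  have "ra et (mul HT (x <*> h) (y <*> k)) = sw H h (%h1 h2. ra et (mul X x (sa h1 y) <*> h2 \<cdot> k))"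
   by(rule mul_HT_image[OF kspW kbilin(2)[OF ra et klin_id] x h y k])
  also have "... = sw H h (%h1 h2. rH (rH (R (R et x) (sa h1 y)) h2) k)"
  proof (rule tsum_eq)
   fix h1 h2 assume c: "h1 .: H" "h2 .: H"
   have a: "sa h1 y .: X" by(rule kbilin(1)[OF Y.la c(1) y])
   show "ra et (mul X x (sa h1 y) <*> h2 \<cdot> k) = rH (rH (R (R et x) (sa h1 y)) h2) k"
    by(simp only: ra_tn[OF et mul_mem[OF X.algX x a] mul_mem[OF alg c(2) k]] R_mul[OF et x a]
      rH_mul[OF R_lin(1)[OF Rx a] c(2) k])
  qed
  also have "... = rH (sw H h (%h1 h2. rH (R (R et x) (sa h1 y)) h2)) k"
   by(rule klin_tsum[where g = "%z. rH z k", OF kspW kspW, symmetric]) (rule Rx y k lin |assumption)+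
  also have "... = ra (ra et (x <*> h)) (y <*> k)"
   by(simp only: R_sem[OF Rx y h] ra_tn[OF et x h] ra_tn[OF r_lin(1)[OF Rx h] y k])
  finally show "ra et (mul HT (x <*> h) (y <*> k)) = ra (ra et (x <*> h)) (y <*> k)" .
 qed
qed

text \<open>On pure tensors the value splits into three sums. \<open>R_sem\<close> absorbs
  \<open>h\<close> in the part where \<open>y\<close> acts on \<open>N x\<close>,
  \<open>N_sem\<close> absorbs it in the part with \<open>N y\<close>, and \<open>om_mul\<close>
  handles the counit part. By \<open>R_V\<close> the value \<open>om h\<close> sees \<open>y\<close>
  only through the counit, which makes the terms reassemble.\<close>

lemma zeta_mul:
 assumes s: "s .: HT" and t: "t .: HT"
 shows "ze (mul HT s t) = ra (ze s) t + smul W (cou HT s) (ze t)"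
proof (rule Y.T_eqI[where f = "%s. ze (mul HT s t)" and g = "%s. ra (ze s) t + smul W (cou HT s) (ze t)", OF kspW _ _ _ s])
 have zt: "ze t .: W" by(rule klin_mem[OF zeta t])
 note [lin] = klin_comp[OF zeta] klin_mem[OF zeta]
 show "klinear HT W (%s. ze (mul HT s t))" "klinear HT W (%s. ra (ze s) t + smul W (cou HT s) (ze t))"
  by(rule zt t mul_HT_lin Y.couT_lin lin)+
 fix x h assume x: "x .: X" and h: "h .: H"
 have xh: "x <*> h .: HT" by(rule Y.tn_mem[OF x h])
 show "ze (mul HT (x <*> h) t) = ra (ze (x <*> h)) t + smul W (cou HT (x <*> h)) (ze t)"
 proof (rule Y.T_eqI[where f = "%t. ze (mul HT (x <*> h) t)" and g = "%t. ra (ze (x <*> h)) t + smul W (cou HT (x <*> h)) (ze t)", OF kspW _ _ _ t])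
  have zx: "ze (x <*> h) .: W" by(rule klin_mem[OF zeta xh])
  show "klinear HT W (%t. ze (mul HT (x <*> h) t))" "klinear HT W (%t. ra (ze (x <*> h)) t + smul W (cou HT (x <*> h)) (ze t))"
   by(rule zx xh mul_HT_lin lin)+
  fix y k assume y: "y .: X" and k: "k .: H"
  have Nx: "N x .: W" and Ny: "N y .: W" by(rule N_lin(2) x y)+
  have Nk: "rH (N y) k .: W" and Nxh: "rH (N x) h .: W" by(rule r_lin(1) Nx Ny k h)+
  let ?a = "cou X x" and ?b = "cou X y"
  have cX: "kspace ground" by(rule ksp_ground)
  have "ze (mul HT (x <*> h) (y <*> k)) = sw H h (%h1 h2. ze (mul X x (sa h1 y) <*> h2 \<cdot> k))"
   by(rule mul_HT_image[OF kspW zeta x h y k])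
  also have "... = sw H h (%h1 h2. rH (rH (R (N x) (sa h1 y)) h2) k + smul W ?a (rH (rH (N (sa h1 y)) h2) k) +
    smul W (eps h1) (smul W (?a * ?b) (0, om (h2 \<cdot> k))))"
  proof (rule tsum_eq)
   fix h1 h2 assume c: "h1 .: H" "h2 .: H"
   have a: "sa h1 y .: X" by(rule kbilin(1)[OF Y.la c(1) y])
   have hk: "h2 \<cdot> k .: H" by(rule mul_mem[OF alg c(2) k])
   have n: "R (N x) (sa h1 y) .: W" "N (sa h1 y) .: W" by(rule R_lin(1)[OF Nx a], rule N_lin(2)[OF a])
   have l: "klinear W W (%z. rH z (h2 \<cdot> k))" by(rule kbilin(3)[OF rH hk klin_id])
   have cx: "cou X (mul X x (sa h1 y)) = eps h1 * (?a * ?b)" by(simp only: X.cou_mulX[OF x a] Y.la_cou[OF c(1) y]) simp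
   show "ze (mul X x (sa h1 y) <*> h2 \<cdot> k) = rH (rH (R (N x) (sa h1 y)) h2) k + smul W ?a (rH (rH (N (sa h1 y)) h2) k) +
    smul W (eps h1) (smul W (?a * ?b) (0, om (h2 \<cdot> k)))"
    by(simp only: zeta_tn[OF mul_mem[OF X.algX x a] hk] N_mul[OF x a] klin_add[OF l n(1) ksp_scale[OF kspW n(2)]]
      klin_scale[OF l n(2)] rH_mul[OF n(1) c(2) k] rH_mul[OF n(2) c(2) k] cx smul_smul[OF kspW])
  qed
  also have "... = sw H h (%h1 h2. rH (rH (R (N x) (sa h1 y)) h2) k) + smul W ?a (sw H h (%h1 h2. rH (rH (N (sa h1 y)) h2) k)) +
    sw H h (%h1 h2. smul W (eps h1) (smul W (?a * ?b) (0, om (h2 \<cdot> k))))" by(simp only: tsum_add smul_tsum[OF kspW])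
  also have "sw H h (%h1 h2. rH (rH (R (N x) (sa h1 y)) h2) k) = ra (rH (N x) h) (y <*> k)"
  proof -
   have "sw H h (%h1 h2. rH (rH (R (N x) (sa h1 y)) h2) k) = rH (sw H h (%h1 h2. rH (R (N x) (sa h1 y)) h2)) k"
    by(rule klin_tsum[where g = "%z. rH z k", OF kspW kspW, symmetric]) (rule Nx y k lin |assumption)+
   then show ?thesis by(simp only: R_sem[OF Nx y h] ra_tn[OF Nxh y k])
  qed
  also have "sw H h (%h1 h2. rH (rH (N (sa h1 y)) h2) k) = smul W (eps h) (rH (N y) k)"
  proof -
   have "sw H h (%h1 h2. rH (rH (N (sa h1 y)) h2) k) = rH (sw H h (%h1 h2. rH (N (sa h1 y)) h2)) k"
    by(rule klin_tsum[where g = "%z. rH z k", OF kspW kspW, symmetric]) (rule y k lin |assumption)+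
   then show ?thesis by(simp only: N_sem[OF y h] klin_scale[OF kbilin(3)[OF rH k klin_id] Ny])
  qed
  also have "sw H h (%h1 h2. smul W (eps h1) (smul W (?a * ?b) (0, om (h2 \<cdot> k)))) = smul W (?a * ?b) (0, om (h \<cdot> k))"
   by(rule sw_counit_left[OF kspW coalg h]) (rule k lin)+
  also have "(0, om (h \<cdot> k)) = rH (0, om h) k + smul W (eps h) (0, om k)"
  proof -
   have "la (S k) 0 = 0" by(rule klin_0[OF kspU kspU kbilin(2)[OF la S_mem[OF k] klin_id]])
   then show ?thesis by(simp add: rH_def om_mul[OF h k] smul_zero_right[OF kspU])
  qed
  also have "smul W (?a * ?b) (rH (0, om h) k + smul W (eps h) (0, om k)) =
    ra (smul W ?a (0, om h)) (y <*> k) + smul W (?a * eps h) (smul W ?b (0, om k))"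
  proof -
   have o: "(0, om h) .: W" by(rule om_mem[OF h])
   have "ra (smul W ?a (0, om h)) (y <*> k) = smul W ?a (smul W ?b (rH (0, om h) k))"
    unfolding klin_scale[OF kbilin(3)[OF ra Y.tn_mem[OF y k] klin_id] o] ra_tn[OF o y k] R_V[OF klin_mem[OF om h] y]
     klin_scale[OF kbilin(3)[OF rH k klin_id] o] ..
   then show ?thesis by(simp only: smul_add_right[OF kspW] smul_smul[OF kspW] mult_ac)
  qed
  also have "ra (rH (N x) h) (y <*> k) + smul W ?a (smul W (eps h) (rH (N y) k)) +
    (ra (smul W ?a (0, om h)) (y <*> k) + smul W (?a * eps h) (smul W ?b (0, om k))) =
    ra (ze (x <*> h)) (y <*> k) + smul W (cou HT (x <*> h)) (ze (y <*> k))"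
   by(simp only: zeta_tn[OF x h] zeta_tn[OF y k] klin_add[OF kbilin(3)[OF ra Y.tn_mem[OF y k] klin_id] Nxh ksp_scale[OF kspW om_mem[OF h]]]
    Y.cou_tn(1)[OF x h] smul_add_right[OF kspW] smul_smul[OF kspW] add_ac)
  finally show "ze (mul HT (x <*> h) (y <*> k)) = ra (ze (x <*> h)) (y <*> k) + smul W (cou HT (x <*> h)) (ze (y <*> k))" .
 qed
qed

lemma cocommutative_HT: "cocommutative HT" by(rule Y.cocommutative_T[OF hopf_sym_alg(2)[OF kspU] cocomm])

sublocale Z: cocycle_calculus HT "ext_alg W" "ext_cross_product HT W ra" "ext_act HT W ra" "%a. ext_word W [ze a]"
 by(rule ext_cocycle_calculus(1)[OF kspW Y.hopf_T cocommutative_HT ra ra_unit ra_mul zeta zeta_mul])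

lemma zeta_letter: "ph .: U ==> ze (X.gw [ph] <*> one) = (ph, 0)"
 using N_gw[of "[ph]"] X.cou_gw[of "[ph]"] X.gw1_mem[of ph]
 by(simp add: zeta_tn unit_mem[OF alg] rH_one[OF letter_mem, simplified] smul_zero_left[OF kspU] smul_zero_left[OF kspV])

lemma zeta_H:
 assumes h: "h .: H"
 shows "ze (X.gw [] <*> h) = (0, om h)"
proof -
 have "rH 0 h = 0" by(rule klin_0[OF kspW kspW kbilin(3)[OF rH h klin_id]])
 then show ?thesis unfolding zeta_tn[OF X.gw0_mem h] using N_gw[of "[]"] X.cou_gw[of "[]"]
  by(simp add: smul_one[OF kspU] smul_one[OF kspV] smul_zero_right[OF kspU])
qed

text \<open>A pair of a letter and a value of \<open>om\<close> is the sum of the values of the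
  cocycle at the letter and at an element of \<open>H\<close>.\<close>

lemma surj_zeta:
 assumes "om ` car H = car V"
 shows "ze ` car HT = car W"
proof
 show "ze ` car HT \<subseteq> car W" using klin_mem[OF zeta] by blast
 show "car W \<subseteq> ze ` car HT"
 proof
  fix p assume "p .: W"
  then obtain ph h where p: "p = (ph, om h)" "ph .: U" "h .: H" using assms by(metis dsum_simps(1) imageE mem_Sigma_iff surj_pair)
  have t: "X.gw [ph] <*> one .: HT" "X.gw [] <*> h .: HT"
   by(rule Y.tn_mem[OF X.gw1_mem[OF p(2)] unit_mem[OF alg]], rule Y.tn_mem[OF X.gw0_mem p(3)])
  have "ze (X.gw [ph] <*> one + X.gw [] <*> h) = p"
   by(simp add: klin_add[OF zeta t] zeta_letter[OF p(2)] zeta_H[OF p(3)] p(1))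
  then show "p : ze ` car HT" using ksp_add[OF Y.kspT t] by blast
 qed
qed

lemma standard:
 assumes "om ` car H = car V"
 shows "standard_dga HT Z.j (ext_cross_product HT W ra) Z.d" by(rule Z.standard)
  (rule ext_cocycle_calculus(2)[OF kspW Y.hopf_T cocommutative_HT ra ra_unit ra_mul zeta zeta_mul surj_zeta[OF assms]]; assumption)

end

section \<open>Shuffles as subsets of positions\<close>

section \<open>Shuffles\<close>

text \<open>The coproduct of a word is naturally indexed by subsets of positions. Shuffles appear
  only when these subsets are sorted by cardinality.\<close>

definition sub :: "'a list => nat set => 'a list" where
 "sub xs A = map ((!) xs) (sorted_list_of_set A)"

lemma sorted_list_of_set_eqI:
 "sorted_wrt (<) xs ==> set xs = A ==> sorted_list_of_set A = xs" for xs :: "nat list"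
 by(metis List.finite_set sorted_list_of_set.set_sorted_key_list_of_set strict_sorted_equal strict_sorted_list_of_set)

lemma sub_Cons:
 assumes B: "finite B"
 shows "sub (x # xs) (insert 0 (Suc ` B)) = x # sub xs B" "sub (x # xs) (Suc ` B) = sub xs B"
proof -
 have S: "sorted_wrt (<) (map Suc (sorted_list_of_set B))" using strict_sorted_list_of_set[of B] by(simp add: sorted_wrt_map)
 have "sorted_list_of_set (insert 0 (Suc ` B)) = 0 # map Suc (sorted_list_of_set B)"
  by(rule sorted_list_of_set_eqI) (use S B in auto)
 then show "sub (x # xs) (insert 0 (Suc ` B)) = x # sub xs B" by(simp add: sub_def)
 have "sorted_list_of_set (Suc ` B) = map Suc (sorted_list_of_set B)" by(rule sorted_list_of_set_eqI) (use S B in auto)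
 then show "sub (x # xs) (Suc ` B) = sub xs B" by(simp add: sub_def)
qed

lemma sub_all: "sub xs {..<length xs} = xs" by(simp add: sub_def lessThan_atLeast0 map_nth)

lemma sub_empty [simp]: "sub xs {} = []" by(simp add: sub_def)

lemma length_sub: "length (sub xs A) = card A" by(simp add: sub_def)

lemma set_sub: "A \<subseteq> {..<length xs} ==> set (sub xs A) \<subseteq> set xs"
 using finite_subset[of A "{..<length xs}"] by(auto simp: sub_def)

text \<open>Distinguishes whether position 0 belongs to the subset, which mirrors the two terms of
  the recursion \<open>sw_letter\<close>.\<close>

lemma sum_Pow_Suc:
 "(\<Sum>A\<in>Pow {..<Suc n}. g A) = (\<Sum>B\<in>Pow {..<n}. g (insert 0 (Suc ` B)) + g (Suc ` B))"
proof -
 have inj: "inj_on (%B. Suc ` B) X" for X by(rule inj_onI) (simp add: inj_image_eq_iff)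
 have e: "Pow {..<Suc n} = (%B. Suc ` B) ` Pow {..<n} \<union> insert 0 ` (%B. Suc ` B) ` Pow {..<n}"
  unfolding lessThan_Suc_eq_insert_0 Pow_insert image_Pow_surj[OF refl] ..
 have d: "(%B. Suc ` B) ` Pow {..<n} \<inter> insert 0 ` (%B. Suc ` B) ` Pow {..<n} = {}" by auto
 have inj0: "inj_on (insert 0) ((%B. Suc ` B) ` Pow {..<n})"
  by(rule inj_onI) (metis (no_types, lifting) Zero_neq_Suc imageE insert_ident)
 have "(\<Sum>A\<in>Pow {..<Suc n}. g A) = (\<Sum>B\<in>Pow {..<n}. g (Suc ` B)) + (\<Sum>B\<in>Pow {..<n}. g (insert 0 (Suc ` B)))"
  unfolding e by(subst sum.union_disjoint[OF _ _ d]) (simp_all add: sum.reindex[OF inj0] sum.reindex[OF inj])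
 then show ?thesis by(simp add: sum.distrib add.commute)
qed

lemma Diff_Suc_image:
 "{..<Suc n} - insert 0 (Suc ` B) = Suc ` ({..<n} - B)"
 "{..<Suc n} - Suc ` B = insert 0 (Suc ` ({..<n} - B))" unfolding lessThan_Suc_eq_insert_0 by auto

lemma sorted_map_upt:
 "strict_mono_on {i..<j} sg ==> sorted_wrt (<) (map sg [i..<j])" for sg :: "nat => nat"
 by(simp add: sorted_wrt_iff_nth_less strict_mono_onD)

text \<open>A shuffle is determined by the set of its first \<open>p\<close> values.\<close>

lemma Sh_map:
 assumes sg: "sg : Sh p q"
 shows "map sg [0..<p] = sorted_list_of_set (sg ` {..<p})"
  and "map sg [p..<p + q] = sorted_list_of_set ({..<p + q} - sg ` {..<p})"
  and "sg ` {..<p} \<subseteq> {..<p + q}" "card (sg ` {..<p}) = p"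
proof -
 have perm: "sg permutes {..<p + q}" and mono: "strict_mono_on {..<p} sg" "strict_mono_on {p..<p + q} sg"
  using sg by(auto simp: Sh_def)
 have inj: "inj sg" by(rule permutes_inj[OF perm])
 have "sorted_wrt (<) (map sg [0..<p])"
  by(rule sorted_map_upt) (use mono(1) in \<open>simp only: lessThan_atLeast0\<close>)
 then show "map sg [0..<p] = sorted_list_of_set (sg ` {..<p})"
  by(rule sorted_list_of_set_eqI[symmetric]) (simp only: set_map set_upt lessThan_atLeast0)
 have "{..<p + q} - sg ` {..<p} = sg ` ({..<p + q} - {..<p})"
  using image_set_diff[OF inj, of "{..<p + q}" "{..<p}"] permutes_image[OF perm] by simp
 also have "{..<p + q} - {..<p} = {p..<p + q}" by auto
 finally have c: "{..<p + q} - sg ` {..<p} = sg ` {p..<p + q}" .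
 have "sorted_wrt (<) (map sg [p..<p + q])" by(rule sorted_map_upt[OF mono(2)])
 then show "map sg [p..<p + q] = sorted_list_of_set ({..<p + q} - sg ` {..<p})"
  by(rule sorted_list_of_set_eqI[symmetric]) (simp only: set_map set_upt c)
 have "{..<p} \<subseteq> {..<p + q}" by auto
 from image_mono[OF this, of sg] show "sg ` {..<p} \<subseteq> {..<p + q}" by(simp only: permutes_image[OF perm])
 show "card (sg ` {..<p}) = p" by(subst card_image[OF inj_on_subset[OF inj subset_UNIV]]) simp
qed

lemma bij_betw_Sh: "bij_betw (%sg. sg ` {..<p}) (Sh p q) {A. A \<subseteq> {..<p + q} & card A = p}"
proof (rule bij_betw_imageI)
 show "inj_on (%sg. sg ` {..<p}) (Sh p q)"
 proof (rule inj_onI, rule ext)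
  fix sg ta k assume s: "sg : Sh p q" "ta : Sh p q" and eq: "sg ` {..<p} = ta ` {..<p}"
  have 1: "map sg [0..<p] = map ta [0..<p]" "map sg [p..<p + q] = map ta [p..<p + q]"
   unfolding Sh_map(1,2)[OF s(1)] Sh_map(1,2)[OF s(2)] eq by(rule refl)+
  have "sg k = k" "ta k = k" if "\<not> k < p + q"
   using s that permutes_not_in[of sg "{..<p + q}" k] permutes_not_in[of ta "{..<p + q}" k] by(simp_all add: Sh_def)
  moreover have "sg k = ta k" if "k < p + q"
  proof (cases "k < p")
   case True
   then have "k : set [0..<p]" by simp
   then show ?thesis using 1(1) by(metis map_eq_conv)
  next
   case False
   then have "k : set [p..<p + q]" using that by simp
   then show ?thesis using 1(2) by(metis map_eq_conv)
  qed
  ultimately show "sg k = ta k" by(cases "k < p + q") simp_all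
 qed
 show "(%sg. sg ` {..<p}) ` Sh p q = {A. A \<subseteq> {..<p + q} & card A = p}"
 proof (intro equalityI subsetI)
  fix A assume "A : (%sg. sg ` {..<p}) ` Sh p q"
  then obtain sg where "A = sg ` {..<p}" "sg : Sh p q" by blast
  then show "A : {A. A \<subseteq> {..<p + q} & card A = p}" using Sh_map(3,4)[of sg p q] by blast
 next
  fix A assume "A : {A. A \<subseteq> {..<p + q} & card A = p}"
  then have A: "A \<subseteq> {..<p + q}" "card A = p" by auto
  have fin: "finite A" "finite ({..<p + q} - A)" using A finite_subset by auto
  let ?a = "sorted_list_of_set A" and ?b = "sorted_list_of_set ({..<p + q} - A)"
  have len: "length ?a = p" "length ?b = q" using A card_Diff_subset[OF fin(1) A(1)] by simp_all
  \<comment> \<open>The elements of \<open>A\<close> in increasing order followed by those of the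
    complement. Outside the positions it must be the identity to be a permutation of them.\<close>
  define sg where "sg k = (if k < p + q then (?a @ ?b) ! k else k)" for k
  have "bij_betw (%k. (?a @ ?b) ! k) {..<p + q} {..<p + q}" by(rule bij_betw_nth) (use fin A len in auto)
  then have "bij_betw sg {..<p + q} {..<p + q}" by(rule bij_betw_cong[THEN iffD1, rotated]) (simp add: sg_def)
  then have perm: "sg permutes {..<p + q}" by(rule bij_imp_permutes) (simp add: sg_def)
  have low: "sg k = ?a ! k" if "k < p" for k using that len by(simp add: sg_def nth_append)
  have high: "sg k = ?b ! (k - p)" if "p \<le> k" "k < p + q" for k using that len by(simp add: sg_def nth_append)
  have "strict_mono_on {..<p} sg"
   using sorted_wrt_nth_less[OF strict_sorted_list_of_set[of A]] len by(auto simp: strict_mono_on_def low)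
  moreover have "strict_mono_on {p..<p + q} sg"
   using sorted_wrt_nth_less[OF strict_sorted_list_of_set[of "{..<p + q} - A"]] len by(auto simp: strict_mono_on_def high)
  ultimately have "sg : Sh p q" using perm by(simp add: Sh_def)
  moreover have "sg ` {..<p} = A"
  proof -
   have "sg ` {..<p} = (%k. ?a ! k) ` {..<p}" by(rule image_cong) (simp_all add: low)
   also have "... = set ?a" using len by(metis lessThan_atLeast0 list.set_map map_nth set_upt)
   finally show ?thesis using fin by simp
  qed
  ultimately show "A : (%sg. sg ` {..<p}) ` Sh p q" by blast
 qed
qed

lemma sum_Sh:
 assumes p: "p \<le> length xs"
 shows "(\<Sum>sg\<in>Sh p (length xs - p). g (entries xs sg 0 p) (entries xs sg p (length xs))) =
  (\<Sum>A | A \<subseteq> {..<length xs} & card A = p. g (sub xs A) (sub xs ({..<length xs} - A)))"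
proof -
 have n: "p + (length xs - p) = length xs" using p by simp
 have "(\<Sum>sg\<in>Sh p (length xs - p). g (entries xs sg 0 p) (entries xs sg p (length xs))) =
   (\<Sum>sg\<in>Sh p (length xs - p). g (sub xs (sg ` {..<p})) (sub xs ({..<length xs} - sg ` {..<p})))"
 proof (rule sum.cong[OF refl])
  fix sg assume sg: "sg : Sh p (length xs - p)"
  have "entries xs sg i j = map ((!) xs) (map sg [i..<j])" for i j by(simp add: entries_def)
  then show "g (entries xs sg 0 p) (entries xs sg p (length xs)) =
    g (sub xs (sg ` {..<p})) (sub xs ({..<length xs} - sg ` {..<p}))"
   using Sh_map(1,2)[OF sg] by(simp only: n sub_def)
 qed
 also have "... = (\<Sum>A | A \<subseteq> {..<length xs} & card A = p. g (sub xs A) (sub xs ({..<length xs} - A)))"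
  using sum.reindex_bij_betw[OF bij_betw_Sh[of p "length xs - p"], where g = "%A. g (sub xs A) (sub xs ({..<length xs} - A))"]
  by(simp only: n)
 finally show ?thesis .
qed

text \<open>The bound \<open>p < n\<close> leaves out exactly the full set. Its term is the one with
  \<open>om\<close> in the differential, and it vanishes or cancels in the commutator.\<close>

lemma sum_proper_subsets:
 "(\<Sum>A\<in>Pow {..<n} - {{..<n}}. f A) = (\<Sum>p<n. \<Sum>A | A \<subseteq> {..<n} & card A = p. f A)"
proof -
 have lt: "card A < n" if "A : Pow {..<n} - {{..<n}}" for A using psubset_card_mono[of "{..<n}" A] that by auto
 have "(\<Sum>p<n. \<Sum>A | A \<subseteq> {..<n} & card A = p. f A) = (\<Sum>p<n. \<Sum>A\<in>{A \<in> Pow {..<n} - {{..<n}}. card A = p}. f A)"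
  by(rule sum.cong[OF refl], rule sum.cong) auto
 also have "... = (\<Sum>A\<in>Pow {..<n} - {{..<n}}. f A)" by(rule sum.group) (use lt in auto)
 finally show ?thesis by(rule sym)
qed

lemma sum_proper_Sh:
 "(\<Sum>A\<in>Pow {..<length xs} - {{..<length xs}}. g (sub xs A) (sub xs ({..<length xs} - A))) =
  (\<Sum>p<length xs. \<Sum>sg\<in>Sh p (length xs - p). g (entries xs sg 0 p) (entries xs sg p (length xs)))"
 unfolding sum_proper_subsets by(rule sum.cong[OF refl], rule sum_Sh[symmetric]) simp

section \<open>The differential on monomials\<close>

section \<open>Explicit formulas\<close>

context module_algebra_pair
begin

definition ml where "ml phs = foldr m (butlast phs) (last phs)"

lemma ml_single: "ml [u] = u" by(simp add: ml_def)

lemma ml_Cons: "us ~= [] ==> ml (u # us) = m u (ml us)" by(simp add: ml_def)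

lemma ml_mem: "us : X.L ==> us ~= [] ==> ml us .: U"
proof (induction us)
 case (Cons u us)
 then show ?case by(cases "us = []") (auto simp: ml_single ml_Cons intro: kbilin(1)[OF m])
qed simp

lemma ml_append: "us : X.L ==> vs : X.L ==> us ~= [] ==> vs ~= [] ==> ml (us @ vs) = m (ml us) (ml vs)"
proof (induction us)
 case (Cons u us)
 have u: "u .: U" "us : X.L" using Cons.prems by auto
 show ?case
 proof (cases "us = []")
  case False
  then show ?thesis using Cons.IH[OF u(2)] Cons.prems m_assoc[OF u(1) ml_mem[OF u(2)] ml_mem[of vs]] by(simp add: ml_Cons)
 qed (use Cons.prems in \<open>simp add: ml_Cons ml_single\<close>)
qed simp

text \<open>Each acting letter multiplies by minus itself, which accounts for the sign;
  commutativity puts the factors back into the order of the word.\<close>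

lemma foldl_rD_letter:
 "x .: U ==> us : X.L ==> foldl rD (x, 0) us = smul W ((- 1) ^ length us) (ml (x # us), 0)"
proof (induction us arbitrary: x)
 case Nil
 then show ?case by(simp add: ml_single smul_one[OF kspU] smul_one[OF kspV])
next
 case (Cons u us)
 have u: "u .: U" "us : X.L" using Cons.prems by auto
 note x = Cons.prems(1)
 have mux: "m u x .: U" by(rule kbilin(1)[OF m u(1) x])
 have "ml (- m u x # us) = - ml (x # u # us)"
 proof (cases "us = []")
  case True
  then show ?thesis by(simp add: ml_single ml_Cons m_commute[OF x u(1)])
 next
  case False
  note mus = ml_mem[OF u(2) False]
  have "m (- m u x) (ml us) = - m (m u x) (ml us)" by(rule klin_neg[OF kspU kspU kbilin(3)[OF m mus klin_id] mux])
  also have "m (m u x) (ml us) = m x (m u (ml us))" by(simp only: m_commute[OF u(1) x] m_assoc[OF x u(1) mus])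
  finally show ?thesis using False by(simp add: ml_Cons)
 qed
 moreover have "rD (x, 0 :: 'v) u = (- m u x, 0)" by(simp add: rD_def)
 ultimately have "foldl rD (x, 0) (u # us) = smul W ((- 1) ^ length us) (- ml (x # u # us), 0)"
  using Cons.IH[OF ksp_neg[OF kspU mux] u(2)] by(simp only: foldl.simps)
 then show ?case by(simp add: smul_minus_left[OF kspU] smul_minus_right[OF kspU] smul_zero_right[OF kspV])
qed

lemma n0_ml:
 assumes "us : X.L" "us ~= []"
 shows "n0 us = smul W ((- 1) ^ (length us - 1)) (ml us, 0)"
proof -
 obtain u vs where us: "us = u # vs" using assms(2) by(cases us) auto
 then show ?thesis using assms(1) foldl_rD_letter[of u vs] by simp
qed

lemma n0_append: "us ~= [] ==> foldl rD (n0 us) vs = n0 (us @ vs)" by(cases us) simp_all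

sublocale E: word_bialgebra W True "ext_alg W"
 "stens_mul (word_space (word_forms True W) W) (word_grade (word_forms True W) W) (mul (ext_alg W))"
 by(rule ext_alg_word_bialgebra[OF kspW])

lemma ew: "ext_word W ets = E.gw ets" by(simp add: ext_word_def alternating_word_forms[OF kspW])

lemma ew_Cons: "w .: W ==> ets : E.L ==> ext_word W (w # ets) = mul (ext_alg W) (ext_word W [w]) (ext_word W ets)"
 unfolding ew by(rule E.gw_Cons)

definition wm where "wm phs h ets = tens HT (ext_alg W) (X.gw phs <*> h) (ext_word W ets)"

abbreviation Om where "Om \<equiv> ext_cross_product HT W ra"

lemma wm_klinear:
 assumes us: "us : X.L" and h: "h .: H" and ets: "ets : E.L"
 shows "klinear W Om (%w. wm us h (w # ets))"
proof -
 have xh: "X.gw us <*> h .: HT" by(rule Y.tn_mem[OF X.gw_mem[OF us] h])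
 have "klinear W Om (%w. tens HT (ext_alg W) (X.gw us <*> h) (mul (ext_alg W) (ext_word W [w]) (ext_word W ets)))"
  unfolding ew by(rule Z.tn_right[OF xh mul_left[OF E.algX E.gw_mem[OF ets] E.gw1_lin[OF klin_id]]])
 then show ?thesis by(rule klin_cong[OF kspW]) (simp only: wm_def ew_Cons ets)
qed

lemma sc_one: "x .: X ==> X.sc 1 x = x" by(rule X.X_eqI[OF X.kspX X.sc_klinear klin_id]) (simp_all add: X.sc_gw)

text \<open>Iterated use of the recursion for the coproduct: every letter goes independently to the
  left or to the right leg.\<close>

lemma sw_gw:
 assumes D: "kspace D" and F: "kbilinear X X D F" and ws: "ws : X.L"
 shows "sw X (X.gw ws) F = (\<Sum>A\<in>Pow {..<length ws}. F (X.gw (sub ws A)) (X.gw (sub ws ({..<length ws} - A))))" using F ws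
proof (induction ws arbitrary: F)
 case Nil
 then show ?case using X.sw_one[OF D Nil(1)] by simp
next
 case (Cons w ws)
 note F = Cons.prems(1)
 have w: "w .: U" and ws: "ws : X.L" using Cons.prems(2) by auto
 have gw1: "X.gw [w] .: X" by(rule X.gw1_mem[OF w])
 let ?F = "%a b. F (mul X (X.gw [w]) a) b + F a (mul X (X.gw [w]) b)"
 have F': "kbilinear X X D ?F" by(rule gw1 D X.mulX_lin kbilin[OF F] lin |assumption)+
 have sub_L: "sub ws A : X.L" if "A \<subseteq> {..<length ws}" for A using set_sub[OF that] ws by auto
 have "sw X (X.gw (w # ws)) F = sw X (X.gw ws) ?F" unfolding X.gw_Cons[OF w ws] X.sw_letter[OF D F w X.gw_mem[OF ws]]
  by(rule tsum_eq) (simp only: if_False sc_one)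
 also have "... = (\<Sum>A\<in>Pow {..<length ws}. ?F (X.gw (sub ws A)) (X.gw (sub ws ({..<length ws} - A))))"
  by(rule Cons.IH[OF F' ws])
 also have "... = (\<Sum>A\<in>Pow {..<length ws}. F (X.gw (sub (w # ws) (insert 0 (Suc ` A)))) (X.gw (sub (w # ws) ({..<Suc (length ws)} - insert 0 (Suc ` A)))) +
   F (X.gw (sub (w # ws) (Suc ` A))) (X.gw (sub (w # ws) ({..<Suc (length ws)} - Suc ` A))))"
 proof (rule sum.cong[OF refl])
  fix A assume "A : Pow {..<length ws}"
  then have A: "A \<subseteq> {..<length ws}" and fin: "finite A" "finite ({..<length ws} - A)" using finite_subset by auto
  show "?F (X.gw (sub ws A)) (X.gw (sub ws ({..<length ws} - A))) =
    F (X.gw (sub (w # ws) (insert 0 (Suc ` A)))) (X.gw (sub (w # ws) ({..<Suc (length ws)} - insert 0 (Suc ` A)))) +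
    F (X.gw (sub (w # ws) (Suc ` A))) (X.gw (sub (w # ws) ({..<Suc (length ws)} - Suc ` A)))"
   by(simp only: Diff_Suc_image sub_Cons[OF fin(1)] sub_Cons[OF fin(2)] X.gw_Cons[OF w sub_L[OF A]] X.gw_Cons[OF w sub_L[OF Diff_subset]])
 qed
 finally show ?case by(simp only: length_Cons sum_Pow_Suc)
qed

lemma zeta_mem: "t .: HT ==> ze t .: W" by(rule klin_mem[OF zeta])

lemma zeta_word:
 assumes vs: "vs : X.L" "vs ~= []" and h: "h .: H"
 shows "ze (X.gw vs <*> h) = smul W ((- 1) ^ (length vs - 1)) (la (S h) (ml vs), 0)"
proof -
 note mv = ml_mem[OF vs]
 have "act (S h) 0 = 0" by(rule klin_0[OF kspV kspV kbilin(2)[OF act S_mem[OF h] klin_id]])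
 then have "rH (ml vs, 0) h = (la (S h) (ml vs), 0)" by(simp only: rH_def fst_conv snd_conv)
 moreover have "cou X (X.gw vs) = 0" using X.cou_gw[OF vs(1)] vs(2) by simp
 ultimately show ?thesis
  by(simp only: zeta_tn[OF X.gw_mem[OF vs(1)] h] N_gw[OF vs(1)] n0_ml[OF vs] smul_zero_left[OF kspW] add_0_right
    klin_scale[OF kbilin(3)[OF rH h klin_id] letter_mem[OF mv]])
qed

text \<open>The coproduct in the cross product combines subsets for the word with the Sweedler sum
  for \<open>h\<close>. The right legs are the arguments of the cocycle.\<close>

lemma d_wm:
 assumes phs: "phs : X.L" and h: "h .: H" and ets: "ets : E.L"
 shows "Z.d (wm phs h ets) = (\<Sum>A\<in>Pow {..<length phs}. sw H h (%h1 h2.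
  wm (sub phs A) h1 (ze (X.gw (sub phs ({..<length phs} - A)) <*> h2) # ets)))"
proof -
 have et: "ext_word W ets .: (ext_alg W)" unfolding ew by(rule E.gw_mem[OF ets])
 have gm: "X.gw phs .: X" by(rule X.gw_mem[OF phs])
 let ?F = "%a1 a2. tens HT (ext_alg W) a1 (mul (ext_alg W) (ext_word W [ze a2]) (ext_word W ets))"
 have F: "kbilinear HT HT Om ?F" by(rule et lin |assumption)+
 have G: "kbilinear X X Om (%x1 x2. sw H h (%h1 h2. ?F (x1 <*> h1) (x2 <*> h2)))"
  by(rule h kbilin[OF F] Y.tn_mem Y.tn_left Y.tn_right lin |assumption)+
 have "Z.d (wm phs h ets) = sw HT (X.gw phs <*> h) ?F"
  unfolding wm_def by(rule Z.d_tn[OF Y.tn_mem[OF gm h] et])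
 also have "... = sw X (X.gw phs) (%x1 x2. sw H h (%h1 h2. ?F (x1 <*> h1) (x2 <*> h2)))"
  by(rule Y.sw_tn[OF Z.kspT F gm h])
 also have "... = (\<Sum>A\<in>Pow {..<length phs}. sw H h (%h1 h2.
   ?F (X.gw (sub phs A) <*> h1) (X.gw (sub phs ({..<length phs} - A)) <*> h2)))"
  by(rule sw_gw[OF Z.kspT G phs])
 also have "... = (\<Sum>A\<in>Pow {..<length phs}. sw H h (%h1 h2.
  wm (sub phs A) h1 (ze (X.gw (sub phs ({..<length phs} - A)) <*> h2) # ets)))"
 proof (rule sum.cong[OF refl], rule tsum_eq)
  fix A h1 h2 assume h2: "h2 .: H"
  have "sub phs ({..<length phs} - A) : X.L" using set_sub[OF Diff_subset, of phs A] phs by auto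
  then have "ze (X.gw (sub phs ({..<length phs} - A)) <*> h2) .: W"
   by(rule zeta_mem[OF Y.tn_mem[OF X.gw_mem h2]])
  then show "?F (X.gw (sub phs A) <*> h1) (X.gw (sub phs ({..<length phs} - A)) <*> h2) =
    wm (sub phs A) h1 (ze (X.gw (sub phs ({..<length phs} - A)) <*> h2) # ets)"
   by(simp only: wm_def ew_Cons ets)
 qed
 finally show ?thesis .
qed

lemma sum_Pow_proper: "(\<Sum>A\<in>Pow {..<n::nat}. f A) = f {..<n} + (\<Sum>A\<in>Pow {..<n} - {{..<n}}. f A)"
 by(rule sum.remove) simp_all

lemma length_entries: "length (entries xs sg i j) = j - i" by(simp add: entries_def)

lemma proper_sub:
 assumes A: "A : Pow {..<length phs} - {{..<length phs}}" and phs: "phs : X.L"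
 shows "sub phs A : X.L" "sub phs ({..<length phs} - A) : X.L" "sub phs ({..<length phs} - A) ~= []"
proof -
 show "sub phs A : X.L" using set_sub[of A phs] A phs by auto
 show "sub phs ({..<length phs} - A) : X.L" using set_sub[OF Diff_subset, of phs A] phs by auto
 have "{..<length phs} - A ~= {}" using A by auto
 then have "card ({..<length phs} - A) ~= 0" by simp
 then show "sub phs ({..<length phs} - A) ~= []" by(metis length_sub list.size(3))
qed

text \<open>For the full subset the cocycle is evaluated on \<open>h2\<close> alone and gives
  \<open>om h2\<close>. For a proper subset a nonempty word remains, whose value is the signed
  convolution product moved by S(h2).\<close>

theorem d_formula:
 assumes phs: "phs : X.L" and h: "h .: H" and ets: "ets : E.L"
 shows "Z.d (wm phs h ets) = sw H h (%h1 h2. wm phs h1 ((0, om h2) # ets)) +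
  (\<Sum>p<length phs. \<Sum>sg\<in>Sh p (length phs - p). smul Om ((- 1) ^ (length phs - p - 1)) (sw H h (%h1 h2.
   wm (entries phs sg 0 p) h1 ((la (S h2) (ml (entries phs sg p (length phs))), 0) # ets))))"
proof -
 let ?g = "%us vs. smul Om ((- 1) ^ (length vs - 1)) (sw H h (%h1 h2. wm us h1 ((la (S h2) (ml vs), 0) # ets)))"
 let ?f = "%A. sw H h (%h1 h2. wm (sub phs A) h1 (ze (X.gw (sub phs ({..<length phs} - A)) <*> h2) # ets))"
 have full: "?f {..<length phs} = sw H h (%h1 h2. wm phs h1 ((0, om h2) # ets))"
  by(rule tsum_eq) (simp only: sub_all Diff_cancel sub_empty zeta_H)
 have "(\<Sum>A\<in>Pow {..<length phs} - {{..<length phs}}. ?f A) =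
   (\<Sum>A\<in>Pow {..<length phs} - {{..<length phs}}. ?g (sub phs A) (sub phs ({..<length phs} - A)))"
 proof (rule sum.cong[OF refl])
  fix A assume "A : Pow {..<length phs} - {{..<length phs}}"
  note s = proper_sub[OF this phs]
  show "?f A = ?g (sub phs A) (sub phs ({..<length phs} - A))" unfolding smul_tsum[OF Z.kspT]
  proof (rule tsum_eq)
   fix h1 h2 assume c: "h1 .: H" "h2 .: H"
   have v: "(la (S h2) (ml (sub phs ({..<length phs} - A))), 0) .: W"
    by(rule letter_mem[OF kbilin(1)[OF la S_mem[OF c(2)] ml_mem[OF s(2,3)]]])
   show "wm (sub phs A) h1 (ze (X.gw (sub phs ({..<length phs} - A)) <*> h2) # ets) =
     smul Om ((- 1) ^ (length (sub phs ({..<length phs} - A)) - 1))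
      (wm (sub phs A) h1 ((la (S h2) (ml (sub phs ({..<length phs} - A))), 0) # ets))"
    unfolding zeta_word[OF s(2,3) c(2)] by(rule klin_scale[OF wm_klinear[OF s(1) c(1) ets] v])
  qed
 qed
 also have "... = (\<Sum>p<length phs. \<Sum>sg\<in>Sh p (length phs - p). ?g (entries phs sg 0 p) (entries phs sg p (length phs)))"
  by(rule sum_proper_Sh)
 finally show ?thesis unfolding d_wm[OF assms] sum_Pow_proper[of ?f] full length_entries by(simp only:)
qed

section \<open>Commutators of functions and one-forms\<close>

lemma gw_append_commute: "us : X.L ==> vs : X.L ==> X.gw (us @ vs) = X.gw (vs @ us)"
proof (induction us)
 case (Cons u us)
 have u: "u .: U" "us : X.L" using Cons.prems by auto
 have l: "us @ vs : X.L" "vs @ us : X.L" using u Cons.prems by auto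
 have "X.gw (vs @ u # us) = X.gw (u # vs @ us)" using X.gw_move[of "[]" vs us u] u Cons.prems by simp
 also have "... = X.gw (u # us @ vs)"
  by(simp only: X.gw_Cons[OF u(1) l(1)] X.gw_Cons[OF u(1) l(2)] Cons.IH[OF u(2) Cons.prems(2)])
 finally show ?case by simp
qed simp

lemma mul_HT_words:
 assumes us: "us : X.L" and vs: "vs : X.L"
 shows "mul HT (X.gw us <*> one) (X.gw vs <*> one) = X.gw (us @ vs) <*> one"
proof -
 note m' = X.gw_mem[OF us] unit_mem[OF alg] X.gw_mem[OF vs]
 have "mul HT (X.gw us <*> one) (X.gw vs <*> one) = mul X (X.gw us) (sa one (X.gw vs)) <*> (one \<cdot> one)"
  unfolding Y.mul_tn_sw[OF m' m'(2)]
  by(rule sw_unit[OF Y.kspT bialg]) (rule m' X.mulX_lin Y.tn_left Y.tn_right lin |assumption)+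
 then show ?thesis by(simp only: Y.la_unit[OF m'(3)] X.mul_gw[OF us vs] mul_unit(1)[OF alg m'(2)])
qed

text \<open>A cocycle vanishes at the unit: apply the identity to 1 = 1 1.\<close>

lemma om_one: "om one = 0"
proof -
 have u: "one .: H" by(rule unit_mem[OF alg])
 have "om one = om one + om one" using om_mul[OF u u] klin_mem[OF om u]
  by(simp add: mul_unit[OF alg u] antipode_one act_one bialgebra_cou[OF bialg] smul_one[OF kspV])
 then show ?thesis by simp
qed

lemma zeta_word_one:
 assumes vs: "vs : X.L"
 shows "ze (X.gw vs <*> one) = n0 vs"
proof -
 have "N (X.gw vs) .: W" by(rule N_lin(2)[OF X.gw_mem[OF vs]])
 moreover have "smul W c (0, 0) = 0" for c by(simp add: smul_zero_right[OF kspU] smul_zero_right[OF kspV] zero_prod_def)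
 ultimately show ?thesis by(simp only: zeta_tn[OF X.gw_mem[OF vs] unit_mem[OF alg]] om_one rH_one add_0_right N_gw[OF vs])
qed

lemma n0_mem: "vs : X.L ==> n0 vs .: W" using N_lin(2)[OF X.gw_mem] N_gw by metis

lemma d_wm_one:
 assumes pss: "pss : X.L"
 shows "Z.d (wm pss one []) = (\<Sum>B\<in>Pow {..<length pss}. wm (sub pss B) one [n0 (sub pss ({..<length pss} - B))])"
proof -
 have u: "one .: H" by(rule unit_mem[OF alg])
 show ?thesis unfolding d_wm[OF pss u lists.Nil]
 proof (rule sum.cong[OF refl])
  fix B assume "B : Pow {..<length pss}"
  then have s: "sub pss B : X.L" "sub pss ({..<length pss} - B) : X.L"
   using set_sub[of B pss] set_sub[OF Diff_subset, of pss B] pss by auto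
  let ?v = "sub pss ({..<length pss} - B)"
  have e: "wm (sub pss B) h1 [ze (X.gw ?v <*> h2)] = tens HT (ext_alg W) (X.gw (sub pss B) <*> h1) (ext_word W [ze (X.gw ?v <*> h2)])" for h1 h2
   by(simp only: wm_def)
  have "sw H one (%h1 h2. wm (sub pss B) h1 [ze (X.gw ?v <*> h2)]) = wm (sub pss B) one [ze (X.gw ?v <*> one)]"
   unfolding e
   by(rule sw_unit[OF Z.kspT bialg]) (rule X.gw_mem[OF s(1)] X.gw_mem[OF s(2)] Y.tn_mem Y.tn_left Y.tn_right lin |assumption)+
  then show "sw H one (%h1 h2. wm (sub pss B) h1 [ze (X.gw ?v <*> h2)]) = wm (sub pss B) one [n0 ?v]"
   by(simp only: zeta_word_one[OF s(2)])
 qed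
qed

lemma wm_j: "wm phs one [] = Z.j (X.gw phs <*> one)" unfolding wm_def Z.j_def ext_alg_simps ..

text \<open>Moving the word past the one-form to its right costs the action of the right legs of its
  coproduct. The full subset, where nothing acts, is the product in the other order and cancels; the
  proper subsets remain with a minus sign.\<close>

lemma commutator_one_form:
 assumes phs: "phs : X.L" and us: "us : X.L" and w: "w .: W"
 shows "mul Om (wm phs one []) (wm us one [w]) - mul Om (wm us one [w]) (wm phs one []) =
  - (\<Sum>A\<in>Pow {..<length phs} - {{..<length phs}}. wm (us @ sub phs A) one [foldl rD w (sub phs ({..<length phs} - A))])"
proof -
 have u: "one .: H" by(rule unit_mem[OF alg])
 have gp: "X.gw phs .: X" and gu: "X.gw us .: X" by(rule X.gw_mem phs us)+
 have a: "X.gw phs <*> one .: HT" and b: "X.gw us <*> one .: HT" by(rule Y.tn_mem gp gu u)+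
 have e: "ext_word W [w] .: (ext_alg W)" unfolding ew by(rule E.gw1_mem[OF w])
 have 1: "mul Om (wm phs one []) (wm us one [w]) = wm (us @ phs) one [w]" unfolding wm_j
  unfolding wm_def Z.mul_j_tn[OF a b e] mul_HT_words[OF phs us] gw_append_commute[OF phs us] ..
 let ?F = "%a1 a2. tens HT (ext_alg W) (mul HT (X.gw us <*> one) a1)
   (mul (ext_alg W) (ext_act HT W ra (ext_word W [w]) a2) (unit (ext_alg W)))"
 let ?f = "%A. wm (us @ sub phs A) one [foldl rD w (sub phs ({..<length phs} - A))]"
 have F: "kbilinear HT HT Om ?F" by(rule b e mul_HT_lin lin |assumption)+
 have G: "kbilinear X X Om (%x1 x2. sw H one (%h1 h2. ?F (x1 <*> h1) (x2 <*> h2)))"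
  by(rule kbilin[OF F] Y.tn_mem Y.tn_left Y.tn_right lin |assumption)+
 have "mul Om (wm us one [w]) (wm phs one []) = sw HT (X.gw phs <*> one) ?F" unfolding wm_j
  unfolding Z.j_def wm_def by(rule Z.mul_tn_sw[OF b e a Z.uB])
 also have "... = sw X (X.gw phs) (%x1 x2. sw H one (%h1 h2. ?F (x1 <*> h1) (x2 <*> h2)))"
  by(rule Y.sw_tn[OF Z.kspT F gp u])
 also have "... = (\<Sum>A\<in>Pow {..<length phs}. sw H one (%h1 h2. ?F (X.gw (sub phs A) <*> h1) (X.gw (sub phs ({..<length phs} - A)) <*> h2)))"
  by(rule sw_gw[OF Z.kspT G phs])
 also have "... = (\<Sum>A\<in>Pow {..<length phs}. ?f A)"
 proof (rule sum.cong[OF refl])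
  fix A assume "A : Pow {..<length phs}"
  then have s: "sub phs A : X.L" "sub phs ({..<length phs} - A) : X.L"
   using set_sub[of A phs] set_sub[OF Diff_subset, of phs A] phs by auto
  let ?v = "sub phs ({..<length phs} - A)"
  have v: "X.gw ?v <*> one .: HT" by(rule Y.tn_mem[OF X.gw_mem[OF s(2)] u])
  have 1: "sw H one (%h1 h2. ?F (X.gw (sub phs A) <*> h1) (X.gw ?v <*> h2)) = ?F (X.gw (sub phs A) <*> one) (X.gw ?v <*> one)"
   by(rule sw_unit[OF Z.kspT bialg]) (rule X.gw_mem[OF s(1)] X.gw_mem[OF s(2)] kbilin[OF F] Y.tn_mem Y.tn_left Y.tn_right lin |assumption)+
  have r: "ra w (X.gw ?v <*> one) = foldl rD w ?v"
   by(simp only: ra_tn[OF w X.gw_mem[OF s(2)] u] rH_one[OF foldl_rD_mem[OF s(2) w]] R_gw[OF w s(2)])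
  have act: "ext_act HT W ra (ext_word W [w]) (X.gw ?v <*> one) = ext_word W [ra w (X.gw ?v <*> one)]"
   by(rule right_smash_ext_alg(2)[OF kspW Y.hopf_T cocommutative_HT ra ra_unit ra_mul v w])
  have 3: "mul (ext_alg W) (ext_act HT W ra (ext_word W [w]) (X.gw ?v <*> one)) (unit (ext_alg W)) = ext_word W [foldl rD w ?v]"
   unfolding act r unfolding ew by(rule mul_unit(2)[OF E.algX E.gw1_mem[OF foldl_rD_mem[OF s(2) w]]])
  have "?F (X.gw (sub phs A) <*> one) (X.gw ?v <*> one) = ?f A"
   unfolding wm_def 3 mul_HT_words[OF us s(1)] by(rule refl)
  with 1 show "sw H one (%h1 h2. ?F (X.gw (sub phs A) <*> h1) (X.gw ?v <*> h2)) = ?f A" by(rule trans)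
 qed
 also have "... = wm (us @ phs) one [w] + (\<Sum>A\<in>Pow {..<length phs} - {{..<length phs}}. ?f A)"
  by(simp only: sum_Pow_proper[of ?f] sub_all Diff_cancel sub_empty foldl.simps)
 finally have 2: "mul Om (wm us one [w]) (wm phs one []) = wm (us @ phs) one [w] + (\<Sum>A\<in>Pow {..<length phs} - {{..<length phs}}. ?f A)" .
 show ?thesis unfolding 1 2 by simp
qed

text \<open>Each one-form of the differential is a word value \<open>n0\<close>, on which the
  letters of \<open>phs\<close> continue to act, so the two leftover blocks merge into one
  convolution product. The merged word of length M-p + N-q has sign exponent one less than its
  length, and the minus sign of the commutator makes up for that one.\<close>

theorem commutator_formula:
 assumes phs: "phs : X.L" and pss: "pss : X.L"
 shows "mul Om (wm phs one []) (Z.d (wm pss one [])) - mul Om (Z.d (wm pss one [])) (wm phs one []) =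
  (\<Sum>p<length pss. \<Sum>q<length phs. \<Sum>sg\<in>Sh p (length pss - p). \<Sum>ta\<in>Sh q (length phs - q).
   smul Om ((- 1) ^ (length pss + length phs + p + q)) (wm (entries pss sg 0 p @ entries phs ta 0 q) one
    [(ml (entries phs ta q (length phs) @ entries pss sg p (length pss)), 0)]))"
proof -
 have u: "one .: H" by(rule unit_mem[OF alg])
 let ?M = "length pss" and ?N = "length phs"
 let ?a = "wm phs one []"
 let ?b = "%B. wm (sub pss B) one [n0 (sub pss ({..<?M} - B))]"
 let ?g = "%us vs us' vs'. smul Om ((- 1) ^ (length vs + length vs')) (wm (us @ us') one [(ml (vs' @ vs), 0)])"
 have subL: "sub pss B : X.L" "sub pss ({..<?M} - B) : X.L" if "B : Pow {..<?M}" for B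
  using that set_sub[of B pss] set_sub[OF Diff_subset, of pss B] pss by auto
 have wmem: "wm us one [w] .: Om" if "us : X.L" "w .: W" for us w
  by(rule klin_mem[OF wm_klinear[OF that(1) u lists.Nil] that(2)])
 have bm: "?b B .: Om" if "B : Pow {..<?M}" for B using wmem[OF subL(1)[OF that] n0_mem[OF subL(2)[OF that]]] .
 have am: "?a .: Om" unfolding wm_j by(rule Z.j_mem[OF Y.tn_mem[OF X.gw_mem[OF phs] u]])
 have "mul Om ?a (Z.d (wm pss one [])) - mul Om (Z.d (wm pss one [])) ?a =
   (\<Sum>B\<in>Pow {..<?M}. mul Om ?a (?b B) - mul Om (?b B) ?a)" unfolding d_wm_one[OF pss] sum_subtractf
  using klin_sum[OF Z.kspT Z.kspT mul_right[OF Z.algT am klin_id], of "Pow {..<?M}" ?b]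
   klin_sum[OF Z.kspT Z.kspT mul_left[OF Z.algT am klin_id], of "Pow {..<?M}" ?b] bm by simp
 also have "... = (\<Sum>B\<in>Pow {..<?M} - {{..<?M}}. mul Om ?a (?b B) - mul Om (?b B) ?a)"
 proof -
  \<comment> \<open>The full subset leaves the empty word, where the cocycle is zero; thus the first
    sum, too, runs over proper subsets.\<close>
  have "?b {..<?M} = 0"
   using klin_0[OF kspW Z.kspT wm_klinear[OF pss u lists.Nil]] by(simp only: Diff_cancel sub_empty n0.simps sub_all)
  then have "mul Om ?a (?b {..<?M}) - mul Om (?b {..<?M}) ?a = 0"
   using klin_0[OF Z.kspT Z.kspT mul_right[OF Z.algT am klin_id]]
    klin_0[OF Z.kspT Z.kspT mul_left[OF Z.algT am klin_id]] by(simp only:) simp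
  then show ?thesis by(subst sum_Pow_proper) (simp only: add_0_left)
 qed
 also have "... = (\<Sum>B\<in>Pow {..<?M} - {{..<?M}}. \<Sum>A\<in>Pow {..<?N} - {{..<?N}}.
   ?g (sub pss B) (sub pss ({..<?M} - B)) (sub phs A) (sub phs ({..<?N} - A)))"
 proof (rule sum.cong[OF refl])
  fix B assume "B : Pow {..<?M} - {{..<?M}}"
  note s = proper_sub[OF this pss]
  have "mul Om ?a (?b B) - mul Om (?b B) ?a =
   (\<Sum>A\<in>Pow {..<?N} - {{..<?N}}. - wm (sub pss B @ sub phs A) one [foldl rD (n0 (sub pss ({..<?M} - B))) (sub phs ({..<?N} - A))])"
   unfolding sum_negf by(rule commutator_one_form[OF phs s(1) n0_mem[OF s(2)]])
  also have "... = (\<Sum>A\<in>Pow {..<?N} - {{..<?N}}. ?g (sub pss B) (sub pss ({..<?M} - B)) (sub phs A) (sub phs ({..<?N} - A)))"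
  proof (rule sum.cong[OF refl])
   fix A assume "A : Pow {..<?N} - {{..<?N}}"
   note r = proper_sub[OF this phs]
   let ?v = "sub pss ({..<?M} - B)" and ?w = "sub phs ({..<?N} - A)" and ?x = "sub pss B @ sub phs A"
   have x: "?x : X.L" and vw: "?v @ ?w : X.L" "?v @ ?w ~= []" using s r by auto
   \<comment> \<open>The action appends the letters of \<open>phs\<close> behind those of
     \<open>pss\<close>; the stated formula has them in front.\<close>
   have ml: "ml (?v @ ?w) = ml (?w @ ?v)"
    by(simp only: ml_append[OF s(2) r(2) s(3) r(3)] ml_append[OF r(2) s(2) r(3) s(3)] m_commute[OF ml_mem[OF s(2,3)] ml_mem[OF r(2,3)]])
   have lm: "(ml (?w @ ?v), 0) .: W" using letter_mem[OF ml_mem[OF vw]] by(simp only: ml)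
   note k = wm_klinear[OF x u lists.Nil]
   \<comment> \<open>The truncated subtraction is harmless because the first block is
     nonempty.\<close>
   have l: "Suc (length (?v @ ?w) - 1) = length ?v + length ?w" using s(3) by(cases ?v) auto
   have "wm ?x one [foldl rD (n0 ?v) ?w] = smul Om ((- 1) ^ (length (?v @ ?w) - 1)) (wm ?x one [(ml (?w @ ?v), 0)])"
    unfolding n0_append[OF s(3)] n0_ml[OF vw] ml by(rule klin_scale[OF k lm])
   then have "- wm ?x one [foldl rD (n0 ?v) ?w] = smul Om ((- 1) ^ Suc (length (?v @ ?w) - 1)) (wm ?x one [(ml (?w @ ?v), 0)])"
    by(simp only: power_Suc mult_minus1 smul_minus_left[OF Z.kspT])
   then show "- wm ?x one [foldl rD (n0 ?v) ?w] = ?g (sub pss B) ?v (sub phs A) ?w" by(simp only: l)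
  qed
  finally show "mul Om ?a (?b B) - mul Om (?b B) ?a =
   (\<Sum>A\<in>Pow {..<?N} - {{..<?N}}. ?g (sub pss B) (sub pss ({..<?M} - B)) (sub phs A) (sub phs ({..<?N} - A)))" .
 qed
 also have "... = (\<Sum>p<?M. \<Sum>sg\<in>Sh p (?M - p). \<Sum>q<?N. \<Sum>ta\<in>Sh q (?N - q).
   ?g (entries pss sg 0 p) (entries pss sg p ?M) (entries phs ta 0 q) (entries phs ta q ?N))"
  unfolding sum_proper_Sh[where xs = pss and g = "%us vs. \<Sum>q<?N. \<Sum>ta\<in>Sh q (?N - q).
    ?g us vs (entries phs ta 0 q) (entries phs ta q ?N)", symmetric]
  by(rule sum.cong[OF refl], rule sum_proper_Sh)
 also have "... = (\<Sum>p<?M. \<Sum>q<?N. \<Sum>sg\<in>Sh p (?M - p). \<Sum>ta\<in>Sh q (?N - q).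
   ?g (entries pss sg 0 p) (entries pss sg p ?M) (entries phs ta 0 q) (entries phs ta q ?N))"
  by(rule sum.cong[OF refl], rule sum.swap)
 also have "... = (\<Sum>p<?M. \<Sum>q<?N. \<Sum>sg\<in>Sh p (?M - p). \<Sum>ta\<in>Sh q (?N - q).
   smul Om ((- 1) ^ (?M + ?N + p + q)) (wm (entries pss sg 0 p @ entries phs ta 0 q) one
    [(ml (entries phs ta q ?N @ entries pss sg p ?M), 0)]))"
 proof (rule sum.cong[OF refl], rule sum.cong[OF refl])
  fix p q assume "p : {..<?M}" "q : {..<?N}"
  \<comment> \<open>The two exponents differ by the even number 2 (p + q).\<close>
  then have e: "?M + ?N + p + q = (?M - p + (?N - q)) + 2 * (p + q)" by auto
  have "(- 1 :: 'k) ^ (?M + ?N + p + q) = (- 1) ^ (?M - p + (?N - q))" unfolding e power_add power_mult by simp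
  then show "(\<Sum>sg\<in>Sh p (?M - p). \<Sum>ta\<in>Sh q (?N - q).
    ?g (entries pss sg 0 p) (entries pss sg p ?M) (entries phs ta 0 q) (entries phs ta q ?N)) =
   (\<Sum>sg\<in>Sh p (?M - p). \<Sum>ta\<in>Sh q (?N - q).
    smul Om ((- 1) ^ (?M + ?N + p + q)) (wm (entries pss sg 0 p @ entries phs ta 0 q) one
     [(ml (entries phs ta q ?N @ entries pss sg p ?M), 0)]))" by(simp only: length_entries)
 qed
 finally show ?thesis .
qed

end

section \<open>The dual of a cocommutative coalgebra is a commutative algebra under
  convolution\<close>

section \<open>The dual of a module coalgebra\<close>

lemma dual_smul [lin, simp]: "smul (dual V) = pscale" by(simp add: dual_def)

lemma dualI:
 "klinear V ground ph ==> (!!v. v \<notin> car V ==> ph v = 0) ==> ph .: (dual V)" by(simp add: dual_def)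

lemma dual_klinear: "ph .: (dual V) ==> klinear V ground ph"
 and dual_outside: "ph .: (dual V) ==> v \<notin> car V ==> ph v = 0" by(simp_all add: dual_def)

lemma dual_eqI:
 assumes "ph .: (dual V)" "ps .: (dual V)" "!!v. v .: V ==> ph v = ps v"
 shows "ph = ps" using assms(3) dual_outside[OF assms(1)] dual_outside[OF assms(2)] by(intro ext) metis

lemma kspace_dual [lin]:
 "kspace (dual V)" unfolding kspace_def dual_smul
proof
 show "module.subspace pscale (car (dual V))"
  by(rule module.subspaceI[OF module_pscale]) (auto simp: dual_def klinear_def pscale_def algebra_simps)
qed (rule vector_space_pscale)

lemma klin_eval: "klinear E (dual V) g ==> klinear E ground (%x. g x v)" by(simp add: klinear_def pscale_def)

lemma klin_dual_apply: "ph .: (dual V) ==> klinear E V g ==> klinear E ground (%x. ph (g x))"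
 by(rule klin_comp[OF dual_klinear])

lemma klin_dualI:
 assumes E: "kspace E" and mem: "!!x. x .: E ==> f x .: (dual V)"
  and ev: "!!v. v .: V ==> klinear E ground (%x. f x v)"
 shows "klinear E (dual V) f"
proof (rule klinearI)
 show "f (x + y) = f x + f y" if xy: "x .: E" "y .: E" for x y
 proof (rule dual_eqI[OF mem[OF ksp_add[OF E xy]] ksp_add[OF kspace_dual mem[OF xy(1)] mem[OF xy(2)]]])
  fix v assume "v .: V"
  then show "f (x + y) v = (f x + f y) v" using klin_add[OF ev xy, of v] by simp
 qed
 show "f (smul E c x) = smul (dual V) c (f x)" if x: "x .: E" for c x
 proof (rule dual_eqI[OF mem[OF ksp_scale[OF E x]] ksp_scale[OF kspace_dual mem[OF x]]])
  fix v assume "v .: V"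
  then show "f (smul E c x) v = smul (dual V) c (f x) v" using klin_scale[OF ev x, of v c] by(simp add: pscale_def)
 qed
qed (rule mem)

lemma tsum_dual_apply:
 assumes "!!a b. a .: A ==> b .: B ==> f a b .: (dual V)"
 shows "tsum A B t f v = tsum A B t (%a b. f a b v)"
 by(rule klin_tsum[where g = "%ph. ph v", OF kspace_dual ksp_ground klin_eval[OF klin_id] assms])

lemma conv_apply:
 assumes V: "coalgebra V" and ph: "ph .: (dual V)" and ps: "ps .: (dual V)" and v: "v .: V"
 shows "conv V ph ps v = sw V v (%a b. ph a * ps b)"
proof -
 note [lin] = V coalgebra_kspace[OF V]
 have "kbilinear V V ground (%a b. ph a * ps b)" by(rule klin_dual_apply[OF ph] klin_dual_apply[OF ps] lin |assumption)+
 from tlift_eq_tsum[OF coalgebra_kspace[OF V] ksp_ground this cop_mem[OF V v]] v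
 show ?thesis by(simp add: conv_def)
qed

lemma conv_bilinear:
 assumes V: "coalgebra V"
 shows "kbilinear (dual V) (dual V) (dual V) (conv V)"
proof -
 note V' = coalgebra_kspace[OF V]
 note [lin] = V V'
 have mem: "conv V ph ps .: (dual V)" if m: "ph .: (dual V)" "ps .: (dual V)" for ph ps
 proof (rule dualI)
  have "klinear V ground (%v. sw V v (%a b. ph a * ps b))" by(rule klin_dual_apply[OF m(1)] klin_dual_apply[OF m(2)] lin |assumption)+
  then show "klinear V ground (conv V ph ps)" by(rule klin_cong[OF V']) (rule conv_apply[OF V m])
 qed (simp add: conv_def)
 show ?thesis
 proof (rule kbilinearI)
  fix ph assume ph: "ph .: (dual V)"
  show "klinear (dual V) (dual V) (conv V ph)"
  proof (rule klin_dualI[OF kspace_dual mem[OF ph]])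
   fix v assume v: "v .: V"
   have "klinear (dual V) ground (%ps. sw V v (%a b. ph a * ps b))" by(rule klin_eval[OF klin_id] klin_dual_apply[OF ph] lin |assumption)+
   then show "klinear (dual V) ground (%ps. conv V ph ps v)"
    by(rule klin_cong[OF kspace_dual]) (rule conv_apply[OF V ph _ v])
  qed
 next
  fix ps assume ps: "ps .: (dual V)"
  show "klinear (dual V) (dual V) (%ph. conv V ph ps)"
  proof (rule klin_dualI[OF kspace_dual mem[OF _ ps]])
   fix v assume v: "v .: V"
   have "klinear (dual V) ground (%ph. sw V v (%a b. ph a * ps b))" by(rule klin_eval[OF klin_id] klin_dual_apply[OF ps] lin |assumption)+
   then show "klinear (dual V) ground (%ph. conv V ph ps v)"
    by(rule klin_cong[OF kspace_dual]) (rule conv_apply[OF V _ ps v])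
  qed
 qed
qed

lemma conv_commute:
 assumes V: "coalgebra V" and co: "cocommutative V" and m: "ph .: (dual V)" "ps .: (dual V)"
 shows "conv V ph ps = conv V ps ph"
proof (rule dual_eqI)
 note [lin] = V coalgebra_kspace[OF V]
 show "conv V ph ps .: (dual V)" "conv V ps ph .: (dual V)"
  by(rule kbilin(1)[OF conv_bilinear[OF V]] m)+
 fix v assume v: "v .: V"
 have "sw V v (%a b. ph a * ps b) = sw V v (%a b. ph b * ps a)"
  by(rule sw_cocomm[OF ksp_ground V co v]) (rule klin_dual_apply[OF m(1)] klin_dual_apply[OF m(2)] lin |assumption)+
 then show "conv V ph ps v = conv V ps ph v"
  by(simp only: conv_apply[OF V m v] conv_apply[OF V m(2,1) v] mult.commute)
qed

lemma conv_assoc: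
 assumes V: "coalgebra V" and m: "ph .: (dual V)" "ps .: (dual V)" "\<chi> .: (dual V)"
 shows "conv V (conv V ph ps) \<chi> = conv V ph (conv V ps \<chi>)"
proof (rule dual_eqI)
 note [lin] = V coalgebra_kspace[OF V]
 note c = kbilin(1)[OF conv_bilinear[OF V]]
 note c1 = c[OF m(1,2)] and c2 = c[OF m(2,3)]
 show "conv V (conv V ph ps) \<chi> .: (dual V)" "conv V ph (conv V ps \<chi>) .: (dual V)"
  by(rule c[OF c1 m(3)], rule c[OF m(1) c2])
 fix v assume v: "v .: V"
 have "conv V (conv V ph ps) \<chi> v = sw V v (%r b. sw V r (%p q. ph p * ps q) * \<chi> b)"
  unfolding conv_apply[OF V c1 m(3) v] by(rule tsum_eq) (simp only: conv_apply[OF V m(1,2)])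
 also have "... = sw V v (%r b. sw V r (%p q. ph p * ps q * \<chi> b))" apply(rule tsum_eq)
  apply(rule klin_tsum[where g = "%z. z * \<chi> _", OF ksp_ground ksp_ground]) apply(rule lin | simp)+ done
 also have "... = sw V v (%p r. sw V r (%q b. ph p * ps q * \<chi> b))"
  by(rule sw_coassoc[OF ksp_ground V v]) (rule klin_dual_apply[OF m(1)] klin_dual_apply[OF m(2)] klin_dual_apply[OF m(3)] lin |assumption)+
 also have "... = sw V v (%p r. ph p * sw V r (%q b. ps q * \<chi> b))" unfolding mult.assoc apply(rule tsum_eq)
  apply(rule klin_tsum[where g = "%z. ph _ * z", OF ksp_ground ksp_ground, symmetric])
  apply(rule lin | simp)+ done
 also have "... = conv V ph (conv V ps \<chi>) v"
  unfolding conv_apply[OF V m(1) c2 v] by(rule tsum_eq) (simp only: conv_apply[OF V m(2,3)])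
 finally show "conv V (conv V ph ps) \<chi> v = conv V ph (conv V ps \<chi>) v" .
qed

section \<open>The dual as a module algebra, and the cocycle defined by the module map\<close>

locale hopf_module_coalgebra = cocomm_hopf H
 for H :: "('k::field, 'h::ab_group_add, 'z) kbialg_scheme" +
 fixes V :: "('k, 'v::ab_group_add, 'y) kcoalg_scheme" and act :: "'h => 'v => 'v" and \<omega> :: "'h => 'v"
 assumes module_coalgebra: "left_module_coalgebra H V act" and cocommV: "cocommutative V"
  and module_map: "right_module_map H V act \<omega>"
begin

lemma coalgV [lin]: "coalgebra V" and act: "kbilinear H V V act"
 and act_one: "!!v. v .: V ==> act one v = v"
 and act_mul: "!!g h v. g .: H ==> h .: H ==> v .: V ==> act (g \<cdot> h) v = act g (act h v)"
 using module_coalgebra by(simp_all add: left_module_coalgebra_def)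

lemma kspV [lin]: "kspace V" by(rule coalgebra_kspace[OF coalgV])

lemmas [lin] = kbilin[OF act]

abbreviation da where "da \<equiv> dual_act H V act"

lemma sw_act:
 assumes D: "kspace D" and F: "kbilinear V V D F" and h: "h .: H" and v: "v .: V"
 shows "sw V (act h v) F = sw H h (%h1 h2. sw V v (%a b. F (act h1 a) (act h2 b)))"
proof -
 have inner: "tlift V V (tensor V V) (%v1 v2. tens V V (act h1 v1) (act h2 v2)) (cop V v) = sw V v (%v1 v2. tens V V (act h1 v1) (act h2 v2))"
  if c: "h1 .: H" "h2 .: H" for h1 h2 by(rule tlift_eq_tsum) (rule c v lin |assumption)+
 have "cop V (act h v) = tlift H H (tensor V V) (%h1 h2. tlift V V (tensor V V) (%v1 v2. tens V V (act h1 v1) (act h2 v2)) (cop V v)) (cop H h)"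
  using module_coalgebra h v by(simp add: left_module_coalgebra_def)
 also have "... = sw H h (%h1 h2. sw V v (%v1 v2. tens V V (act h1 v1) (act h2 v2)))"
  by(rule tlift_cong_tsum[OF ksp ksp ksp_tens _ inner cop_mem[OF coalg h]]) (rule v lin |assumption)+
 finally have cop: "cop V (act h v) = sw H h (%h1 h2. sw V v (%v1 v2. tens V V (act h1 v1) (act h2 v2)))" .
 show ?thesis unfolding cop apply(subst tsum_tsum[OF kspV D F]) apply(rule v lin |assumption)+ apply(rule tsum_eq)
  apply(subst tsum_tsum[OF kspV D F]) apply(rule v lin |assumption)+ apply(rule tsum_eq) apply(rule tsum_tens[OF kspV D F])
   apply(rule lin |assumption)+ done
qed

lemma da_apply: "v .: V ==> da h ph v = ph (act (S h) v)" by(simp add: dual_act_def)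

lemma da_bilinear: "kbilinear H (dual V) (dual V) da"
proof -
 have mem: "da h ph .: (dual V)" if m: "h .: H" "ph .: (dual V)" for h ph
 proof (rule dualI)
  have "klinear V ground (%v. ph (act (S h) v))" by(rule klin_dual_apply[OF m(2)] m(1) lin |assumption)+
  then show "klinear V ground (da h ph)" by(rule klin_cong[OF kspV]) (rule da_apply)
 qed (simp add: dual_act_def)
 show ?thesis
 proof (rule kbilinearI)
  fix h assume h: "h .: H"
  show "klinear (dual V) (dual V) (da h)"
  proof (rule klin_dualI[OF kspace_dual mem[OF h]])
   fix v assume v: "v .: V"
   have "klinear (dual V) ground (%ph. ph (act (S h) v))" by(rule klin_eval[OF klin_id])
   then show "klinear (dual V) ground (%ph. da h ph v)" by(simp only: da_apply[OF v])
  qed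
 next
  fix ph assume ph: "ph .: (dual V)"
  show "klinear H (dual V) (%h. da h ph)"
  proof (rule klin_dualI[OF ksp mem[OF _ ph]])
   fix v assume v: "v .: V"
   have "klinear H ground (%h. ph (act (S h) v))" by(rule klin_dual_apply[OF ph] v lin |assumption)+
   then show "klinear H ground (%h. da h ph v)" by(simp only: da_apply[OF v])
  qed
 qed
qed

lemmas da_mem = kbilin(1)[OF da_bilinear]

lemma da_one:
 assumes ph: "ph .: (dual V)"
 shows "da one ph = ph"
 by(rule dual_eqI[OF da_mem[OF unit_mem[OF alg] ph] ph]) (simp only: da_apply antipode_one act_one)

lemma da_mul:
 assumes g: "g .: H" and h: "h .: H" and ph: "ph .: (dual V)"
 shows "da (g \<cdot> h) ph = da g (da h ph)"
proof (rule dual_eqI[OF da_mem[OF mul_mem[OF alg g h] ph] da_mem[OF g da_mem[OF h ph]]])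
 fix v assume v: "v .: V"
 show "da (g \<cdot> h) ph v = da g (da h ph) v"
  by(simp only: da_apply[OF v] da_apply[OF kbilin(1)[OF act S_mem[OF g] v]] antipode_mul[OF g h] act_mul[OF S_mem[OF h] S_mem[OF g] v])
qed

text \<open>The action on the dual goes through the antipode, which for cocommutative
  \<open>H\<close> is a coalgebra map. Hence the module coalgebra property of \<open>V\<close>
  dualises without reversing the Sweedler factors.\<close>

lemma da_conv:
 assumes h: "h .: H" and m: "ph .: (dual V)" "ps .: (dual V)"
 shows "da h (conv V ph ps) = sw H h (%h1 h2. conv V (da h1 ph) (da h2 ps))"
proof (rule dual_eqI)
 note c = kbilin(1)[OF conv_bilinear[OF coalgV]]
 have cm: "conv V (da h1 ph) (da h2 ps) .: (dual V)" if "h1 .: H" "h2 .: H" for h1 h2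
  by(rule c[OF da_mem[OF that(1) m(1)] da_mem[OF that(2) m(2)]])
 show "da h (conv V ph ps) .: (dual V)" by(rule da_mem[OF h c[OF m]])
 show "sw H h (%h1 h2. conv V (da h1 ph) (da h2 ps)) .: (dual V)" by(rule tsum_mem[OF kspace_dual cm])
 fix v assume v: "v .: V"
 have "da h (conv V ph ps) v = sw V (act (S h) v) (%a b. ph a * ps b)"
  by(simp only: da_apply[OF v] conv_apply[OF coalgV m kbilin(1)[OF act S_mem[OF h] v]])
 also have "... = sw H (S h) (%h1 h2. sw V v (%a b. ph (act h1 a) * ps (act h2 b)))"
  by(rule sw_act[OF ksp_ground _ S_mem[OF h] v]) (rule klin_dual_apply[OF m(1)] klin_dual_apply[OF m(2)] lin |assumption)+
 also have "... = sw H h (%h1 h2. sw V v (%a b. ph (act (S h1) a) * ps (act (S h2) b)))"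
  by(rule sw_antipode[OF ksp_ground _ h]) (rule klin_dual_apply[OF m(1)] klin_dual_apply[OF m(2)] v lin |assumption)+
 also have "... = sw H h (%h1 h2. conv V (da h1 ph) (da h2 ps) v)"
 proof (rule tsum_eq)
  fix h1 h2 assume k: "h1 .: H" "h2 .: H"
  show "sw V v (%a b. ph (act (S h1) a) * ps (act (S h2) b)) = conv V (da h1 ph) (da h2 ps) v"
   unfolding conv_apply[OF coalgV da_mem[OF k(1) m(1)] da_mem[OF k(2) m(2)] v] by(rule tsum_eq) (simp only: da_apply)
 qed
 also have "... = sw H h (%h1 h2. conv V (da h1 ph) (da h2 ps)) v" by(rule tsum_dual_apply[OF cm, symmetric])
 finally show "da h (conv V ph ps) v = sw H h (%h1 h2. conv V (da h1 ph) (da h2 ps)) v" .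
qed

lemma aug_proj_mem: "h .: H ==> aug_proj H h .: (aug_ideal H)"
 using klin_minus[OF ksp_ground klin_cou[OF coalg] klin_const_0[OF ksp_ground]]
  klin_diff[OF ksp ksp_ground klin_cou[OF coalg], of h "smul H (eps h) one"]
  klin_scale[OF klin_cou[OF coalg] unit_mem[OF alg], of "eps h"]
 by(simp add: aug_ideal_def aug_proj_def ksp_diff[OF ksp] ksp_scale[OF ksp] unit_mem[OF alg] bialgebra_cou[OF bialg])

lemma aug_simps: "smul (aug_ideal H) = smul H" "x .: (aug_ideal H) ==> x .: H" by(simp_all add: aug_ideal_def)

lemma omega_proj: "klinear H V (%h. \<omega> (aug_proj H h))"
proof -
 have "klinear H H (aug_proj H)" unfolding aug_proj_def by(rule unit_mem[OF alg] cou_lin lin)+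
 then have "klinear H (aug_ideal H) (aug_proj H)" using aug_proj_mem by(simp add: klinear_def aug_simps)
 then show ?thesis using module_map by(auto simp: right_module_map_def intro: klin_comp)
qed

lemma omega_proj_mul:
 assumes g: "g .: H" and h: "h .: H"
 shows "\<omega> (aug_proj H (g \<cdot> h)) = act (S h) (\<omega> (aug_proj H g)) + smul V (eps g) (\<omega> (aug_proj H h))"
proof -
 have \<omega>: "klinear (aug_ideal H) V \<omega>"
  and eq: "!!x. x .: (aug_ideal H) ==> \<omega> (x \<cdot> h) = act (S h) (\<omega> x)"
  using module_map h by(auto simp: right_module_map_def)
 note pg = aug_proj_mem[OF g] and ph = aug_proj_mem[OF h]
 have u: "one .: H" by(rule unit_mem[OF alg])
 have s: "smul H (eps g) (aug_proj H h) .: (aug_ideal H)"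
  using ph klin_scale[OF klin_cou[OF coalg] aug_simps(2)[OF ph], of "eps g"]
  by(simp add: aug_ideal_def ksp_scale[OF ksp])
 have p: "aug_proj H g \<cdot> h .: (aug_ideal H)"
  using pg h by(simp add: aug_ideal_def mul_mem[OF alg] bialgebra_cou[OF bialg])
 have "aug_proj H g \<cdot> h = g \<cdot> h - smul H (eps g) h" unfolding aug_proj_def
  using klin_diff[OF ksp ksp mul_left[OF alg h klin_id] g ksp_scale[OF ksp u]]
   klin_scale[OF mul_left[OF alg h klin_id] u, of "eps g"] by(simp add: mul_unit[OF alg h])
 moreover have "smul H (eps g) (aug_proj H h) = smul H (eps g) h - smul H (eps g * eps h) one" unfolding aug_proj_def
  using module.scale_right_diff_distrib[OF ksp_module[OF ksp]] by(simp add: smul_smul[OF ksp])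
 ultimately have "aug_proj H (g \<cdot> h) = aug_proj H g \<cdot> h + smul H (eps g) (aug_proj H h)"
  by(simp add: aug_proj_def[of H "g \<cdot> h"] bialgebra_cou[OF bialg] g h)
 then show ?thesis
  using klin_add[OF \<omega> p s] klin_scale[OF \<omega> ph, of "eps g"] by(simp add: eq[OF pg] aug_simps)
qed

sublocale M: module_algebra_pair H "dual V" V "conv V" da act "%h. \<omega> (aug_proj H h)" by unfold_locales
  (rule kspace_dual kspV conv_bilinear[OF coalgV] conv_commute[OF coalgV cocommV] conv_assoc[OF coalgV]
   da_bilinear da_one da_mul da_conv act act_one act_mul omega_proj omega_proj_mul; assumption)+

section \<open>The constructions of the theorem are those of the abstract setting\<close>

lemma Htilde_eq: "Htilde H V act = M.HT" by(simp add: Htilde_def)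

lemma ract_eq: "ract H V act = M.ra"
proof -
 have "ract_H H V act = M.rH" by(intro ext) (simp add: ract_H_def M.rH_def)
 moreover have "ract_dual V = M.rD" by(intro ext) (simp add: ract_dual_def M.rD_def)
 ultimately show ?thesis by(intro ext) (simp add: ract_def M.ra_def M.R_def)
qed

lemma Omega_eq: "Omega H V act = M.Om" unfolding Omega_def Htilde_eq ract_eq ..

lemma degree_zero_eq: "degree_zero H V act = M.Z.j" by(intro ext) (simp only: degree_zero_def M.Z.j_def Htilde_eq)

lemma wedge_mono_eq: "wedge_mono H V act = M.wm" by(intro ext) (simp only: wedge_mono_def M.wm_def M.gw Htilde_eq)

lemma conv_list_eq: "conv_list V = M.ml" by(intro ext) (simp only: conv_list_def M.ml_def)

text \<open>The projection is the identity on the augmentation ideal and takes values in it, so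
  composing with it does not change the image.\<close>

lemma omega_surj:
 assumes "\<omega> ` car (aug_ideal H) = car V"
 shows "(%h. \<omega> (aug_proj H h)) ` car H = car V"
proof -
 have "\<omega> ` car (aug_ideal H) \<subseteq> (%h. \<omega> (aug_proj H h)) ` car H"
 proof (rule image_subsetI)
  fix h assume h: "h .: (aug_ideal H)"
  then have "\<omega> h = \<omega> (aug_proj H h)" by(simp add: aug_ideal_def aug_proj_def smul_zero_left[OF ksp])
  then show "\<omega> h : (%h. \<omega> (aug_proj H h)) ` car H" by(rule image_eqI) (rule aug_simps(2)[OF h])
 qed
 moreover have "(%h. \<omega> (aug_proj H h)) ` car H \<subseteq> \<omega> ` car (aug_ideal H)"
  by(rule image_subsetI) (rule imageI[OF aug_proj_mem])
 ultimately show ?thesis unfolding assms by(rule antisym[rotated])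
qed

lemma tlift_wm:
 assumes us: "us : lists (car (dual V))" and ets: "ets : lists (car (one_forms V))" and f: "klinear H (one_forms V) f"
 shows "h .: H ==> tlift H H M.Om (%h1 h2. M.wm us h1 (f h2 # ets)) (cop H h) = sw H h (%h1 h2. M.wm us h1 (f h2 # ets))"
proof (rule tlift_eq_tsum[OF ksp M.Z.kspT _ cop_mem[OF coalg]])
 show "kbilinear H H M.Om (%h1 h2. M.wm us h1 (f h2 # ets))"
 proof (rule kbilinearI)
  show "klinear H M.Om (%h2. M.wm us h1 (f h2 # ets))" if "h1 .: H" for h1
   by(rule klin_comp[OF M.wm_klinear[OF us that ets] f])
  fix h2 assume h2: "h2 .: H"
  have "f h2 # ets : lists (car (one_forms V))" using klin_mem[OF f h2] ets by simp
  then have e: "ext_word (one_forms V) (f h2 # ets) .: (ext_alg (one_forms V))" unfolding M.ew by(rule M.E.gw_mem)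
  show "klinear H M.Om (%h1. M.wm us h1 (f h2 # ets))" unfolding M.wm_def
   by(rule M.Z.tn_left[OF e M.Y.tn_right[OF M.X.gw_mem[OF us] klin_id]])
 qed
qed assumption

lemma d_wedge:
 assumes phs: "phs : lists (car (dual V))" and h: "h .: H" and ets: "ets : lists (car (one_forms V))"
 shows "M.Z.d (M.wm phs h ets) =
  tlift H H M.Om (%h1 h2. M.wm phs h1 ((0, \<omega> (aug_proj H h2)) # ets)) (cop H h) +
  (\<Sum>p<length phs. \<Sum>sg\<in>Sh p (length phs - p). smul M.Om ((- 1) ^ (length phs - p - 1))
   (tlift H H M.Om (%h1 h2. M.wm (entries phs sg 0 p) h1
    ((da (S h2) (M.ml (entries phs sg p (length phs))), 0) # ets)) (cop H h)))"
proof -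
 have "tlift H H M.Om (%h1 h2. M.wm (entries phs sg 0 p) h1
    ((da (S h2) (M.ml (entries phs sg p (length phs))), 0) # ets)) (cop H h) =
   sw H h (%h1 h2. M.wm (entries phs sg 0 p) h1 ((da (S h2) (M.ml (entries phs sg p (length phs))), 0) # ets))"
  if p: "p < length phs" and sg: "sg : Sh p (length phs - p)" for p sg
 proof -
  \<comment> \<open>A shuffle permutes the positions, so the selected entries stay within the word
    and are again elements of the dual.\<close>
  have r: "sg k < length phs" if "k < length phs" for k
   using sg p that permutes_in_image[of sg "{..<length phs}" k] by(simp add: Sh_def)
  have e: "entries phs sg i j : lists (car (dual V))" if "j \<le> length phs" for i j
   using phs r that by(auto simp: entries_def in_lists_conv_set)
  have "entries phs sg p (length phs) ~= []" using p by(auto simp: entries_def)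
  note c = M.ml_mem[OF e[OF order_refl] this]
  have f: "klinear H (one_forms V) (%h2. (da (S h2) (M.ml (entries phs sg p (length phs))), 0))"
   by(rule klin_Pair[OF kbilin(3)[OF da_bilinear c klin_S] klin_const_0[OF kspV]])
  show ?thesis by(rule tlift_wm[OF e[OF less_imp_le[OF p]] ets f h])
 qed
 then have "(\<Sum>p<length phs. \<Sum>sg\<in>Sh p (length phs - p). smul M.Om ((- 1) ^ (length phs - p - 1))
   (tlift H H M.Om (%h1 h2. M.wm (entries phs sg 0 p) h1
    ((da (S h2) (M.ml (entries phs sg p (length phs))), 0) # ets)) (cop H h))) =
  (\<Sum>p<length phs. \<Sum>sg\<in>Sh p (length phs - p). smul M.Om ((- 1) ^ (length phs - p - 1))
   (sw H h (%h1 h2. M.wm (entries phs sg 0 p) h1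
    ((da (S h2) (M.ml (entries phs sg p (length phs))), 0) # ets))))"
  by(intro sum.cong[OF refl]) (simp only: lessThan_iff)
 then show ?thesis unfolding M.d_formula[OF phs h ets] tlift_wm[OF phs ets M.om_lin h] by(simp only:)
qed

lemma Sh_0_1: "Sh 0 (Suc 0) = {id}" by(auto simp: Sh_def strict_mono_on_def lessThan_Suc permutes_sing)

lemma entries_id: "entries [x] id 0 0 = []" "entries [x] id 0 (Suc 0) = [x]" by(simp_all add: entries_def)

lemma sum_Sh_single: "(\<Sum>p<length [x]. \<Sum>sg\<in>Sh p (length [x] - p). f p sg) = f 0 id" by(simp add: Sh_0_1)

text \<open>The general formula for one letter: only \<open>p = 0\<close> with the identity shuffle
  remains, S(1) = 1 acts trivially, and the term with \<omega> vanishes because the cocycle is zero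
  at the unit.\<close>

lemma d_letter:
 assumes ph: "ph .: (dual V)"
 shows "M.Z.d (M.wm [ph] one []) = M.wm [] one [(ph, 0)]"
proof -
 have u: "one .: H" by(rule unit_mem[OF alg])
 have l: "[ph] : lists (car (dual V))" using ph by simp
 have sw1: "sw H one (%h1 h2. M.wm us h1 (f h2 # [])) = M.wm us one [f one]"
  if us: "us : lists (car (dual V))" and f: "klinear H (one_forms V) f" for us f
 proof (rule sw_unit[OF M.Z.kspT bialg], rule kbilinearI)
  show "klinear H M.Om (%h2. M.wm us h1 [f h2])" if "h1 .: H" for h1
   by(rule klin_comp[OF M.wm_klinear[OF us that lists.Nil] f])
  fix h2 assume h2: "h2 .: H"
  have e: "ext_word (one_forms V) [f h2] .: (ext_alg (one_forms V))"
   unfolding M.ew by(rule M.E.gw1_mem[OF klin_mem[OF f h2]])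
  show "klinear H M.Om (%h1. M.wm us h1 [f h2])" unfolding M.wm_def
   by(rule M.Z.tn_left[OF e M.Y.tn_right[OF M.X.gw_mem[OF us] klin_id]])
 qed
 have f: "klinear H (one_forms V) (%h2. (da (S h2) ph, 0))"
  by(rule klin_Pair[OF kbilin(3)[OF da_bilinear ph klin_S] klin_const_0[OF kspV]])
 have "M.wm [ph] one [(0, \<omega> (aug_proj H one))] = 0"
  using klin_0[OF M.kspW M.Z.kspT M.wm_klinear[OF l u lists.Nil]] by(simp only: M.om_one zero_prod_def)
 then show ?thesis unfolding M.d_formula[OF l u lists.Nil] sum_Sh_single
  by(simp only: sw1[OF l M.om_lin] sw1[OF lists.Nil f] entries_id list.size M.ml_single diff_zero One_nat_def
    add_0 add_0_right diff_self_eq_0 power_0 smul_one[OF M.Z.kspT] antipode_one da_one[OF ph] plus_nat.add_Suc)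
qed

end

theorem propositionA3:
  fixes H :: "('k::field, 'h::ab_group_add) kbialg"
    and V :: "('k, 'v::ab_group_add) kcoalg"
    and act :: "'h \<Rightarrow> 'v \<Rightarrow> 'v"
    and \<omega> :: "'h \<Rightarrow> 'v"
  assumes "hopf_algebra H" and "cocommutative H"
    and "left_module_coalgebra H V act" and "cocommutative V"
    and "right_module_map H V act \<omega>"
  shows "\<exists>d.
    strongly_bicovariant_dga (Htilde H V act) (degree_zero H V act) (Omega H V act) d \<and>
    (\<omega> ` car (aug_ideal H) = car V \<longrightarrow>
       standard_dga (Htilde H V act) (degree_zero H V act) (Omega H V act) d) \<and>
    (\<forall>h\<in>car H.
       d (wedge_mono H V act [] h []) =
         tlift H H (Omega H V act)
           (\<lambda>h1 h2. wedge_mono H V act [] h1 [(0, \<omega> (aug_proj H h2))]) (cop H h)) \<and>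
    (\<forall>\<phi>\<in>car (dual V).
       d (wedge_mono H V act [\<phi>] (unit H) []) = wedge_mono H V act [] (unit H) [(\<phi>, 0)]) \<and>
    (\<forall>\<phi>s\<in>lists (car (dual V)). \<forall>h\<in>car H.
       d (wedge_mono H V act \<phi>s h []) =
         (\<Sum>p<length \<phi>s. \<Sum>\<sigma>\<in>Sh p (length \<phi>s - p).
            smul (Omega H V act) ((- 1) ^ (length \<phi>s - p - 1))
              (tlift H H (Omega H V act)
                 (\<lambda>h1 h2. wedge_mono H V act (entries \<phi>s \<sigma> 0 p) h1
                    [(dual_act H V act (antipode H h2)
                        (conv_list V (entries \<phi>s \<sigma> p (length \<phi>s))), 0)])
                 (cop H h)))
         + tlift H H (Omega H V act)
             (\<lambda>h1 h2. wedge_mono H V act \<phi>s h1 [(0, \<omega> (aug_proj H h2))]) (cop H h)) \<and>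
    (\<forall>\<phi>s\<in>lists (car (dual V)). \<forall>h\<in>car H. \<forall>fs\<in>lists (car (dual V)). \<forall>es\<in>lists (car V).
       d (wedge_mono H V act \<phi>s h (map (\<lambda>f. (f, 0)) fs @ map (\<lambda>e. (0, e)) es)) =
         tlift H H (Omega H V act)
           (\<lambda>h1 h2. wedge_mono H V act \<phi>s h1
              ((0, \<omega> (aug_proj H h2)) # map (\<lambda>f. (f, 0)) fs @ map (\<lambda>e. (0, e)) es)) (cop H h)
         + (\<Sum>p<length \<phi>s. \<Sum>\<sigma>\<in>Sh p (length \<phi>s - p).
              smul (Omega H V act) ((- 1) ^ (length \<phi>s - p - 1))
                (tlift H H (Omega H V act)
                   (\<lambda>h1 h2. wedge_mono H V act (entries \<phi>s \<sigma> 0 p) h1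
                      ((dual_act H V act (antipode H h2)
                          (conv_list V (entries \<phi>s \<sigma> p (length \<phi>s))), 0)
                       # map (\<lambda>f. (f, 0)) fs @ map (\<lambda>e. (0, e)) es))
                   (cop H h)))) \<and>
    (\<forall>\<phi>s\<in>lists (car (dual V)). \<forall>\<psi>s\<in>lists (car (dual V)).
       mul (Omega H V act) (wedge_mono H V act \<phi>s (unit H) []) (d (wedge_mono H V act \<psi>s (unit H) []))
       - mul (Omega H V act) (d (wedge_mono H V act \<psi>s (unit H) [])) (wedge_mono H V act \<phi>s (unit H) []) =
         (\<Sum>p<length \<psi>s. \<Sum>q<length \<phi>s.
            \<Sum>\<sigma>\<in>Sh p (length \<psi>s - p). \<Sum>\<tau>\<in>Sh q (length \<phi>s - q).
              smul (Omega H V act) ((- 1) ^ (length \<psi>s + length \<phi>s + p + q))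
                (wedge_mono H V act (entries \<psi>s \<sigma> 0 p @ entries \<phi>s \<tau> 0 q) (unit H)
                   [(conv_list V (entries \<phi>s \<tau> q (length \<phi>s) @ entries \<psi>s \<sigma> p (length \<psi>s)), 0)]))) \<and>
    (\<forall>\<phi>\<in>car (dual V). \<forall>\<psi>\<in>car (dual V).
       mul (Omega H V act) (wedge_mono H V act [\<phi>] (unit H) []) (d (wedge_mono H V act [\<psi>] (unit H) []))
       - mul (Omega H V act) (d (wedge_mono H V act [\<psi>] (unit H) [])) (wedge_mono H V act [\<phi>] (unit H) []) =
         wedge_mono H V act [] (unit H) [(conv V \<phi> \<psi>, 0)])"
proof -
 interpret hopf_module_coalgebra H V act \<omega> using assms by unfold_locales
 have fe: "map (%f. (f, 0)) fs @ map (%e. (0, e)) es : lists (car (one_forms V))"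
  if "fs : lists (car (dual V))" "es : lists (car V)" for fs es
  using that ksp_zero[OF kspV] ksp_zero[OF kspace_dual[of V]] by(auto simp: in_lists_conv_set)
 have H: "M.Z.d (M.wm [] h []) = tlift H H M.Om (%h1 h2. M.wm [] h1 [(0, \<omega> (aug_proj H h2))]) (cop H h)"
  if "h .: H" for h using d_wedge[OF lists.Nil that lists.Nil] by simp
 have comm: "mul M.Om (M.wm [ph] one []) (M.Z.d (M.wm [ps] one []))
   - mul M.Om (M.Z.d (M.wm [ps] one [])) (M.wm [ph] one []) = M.wm [] one [(conv V ph ps, 0)]"
  if "ph .: (dual V)" "ps .: (dual V)" for ph ps
 proof -
  have l: "[ph] : lists (car (dual V))" "[ps] : lists (car (dual V))" using that by auto
  show ?thesis unfolding M.commutator_formula[OF l]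
   by(simp add: Sh_0_1 entries_id M.ml_Cons M.ml_single smul_one[OF M.Z.kspT, simplified])
 qed
 \<comment> \<open>The witness is the differential of the cocycle \<open>M.ze\<close>. The formulas
   without prior forms are the case of the empty list of one-forms.\<close>
 show ?thesis unfolding Htilde_eq Omega_eq degree_zero_eq wedge_mono_eq conv_list_eq
  apply(intro exI[of _ M.Z.d] conjI ballI impI) apply(rule M.Z.strongly_bicovariant)
     apply(rule M.standard[OF omega_surj], assumption) apply(rule H, assumption) apply(rule d_letter, assumption)
    apply(rule trans[OF d_wedge[OF _ _ lists.Nil] add.commute]; assumption) apply(rule d_wedge[OF _ _ fe]; assumption)
   apply(rule M.commutator_formula; assumption) apply(rule comm; assumption) done
qed

end
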